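(* Let $T>0$, let $\alpha \in (0,1]$, and suppose that $\hat X \in C^{2,1}(\mathbb{R}/2\pi \times [0,T],\mathbb{R}^2)$ is a solution of $$\alpha \hat X_t + (1-\alpha)(\nu\cdot \hat X_t)\,\nu = |\hat X_\theta|^{-2}\hat X_{\theta\theta}\quad\text{in } \mathbb{R}/2\pi\times(0,T),\qquad \hat X(\cdot,0)=X_0(\cdot)\quad\text{on }\mathbb{R}/2\pi,$$ where $\nu=\nu(\theta,t)$ is a unit normal field along $\hat X$ (i.e. $|\nu|=1$, $\nu\cdot\hat X_\theta=0$), such that $$\hat X_t\in L^\infty((0,T),H^{1,2}(\mathbb{R}/2\pi,\mathbb{R}^2))\cap L^2((0,T),H^{2,2}(\mathbb{R}/2\pi,\mathbb{R}^2)),\qquad |\hat X_\theta|\ge c_0>0\ \text{ in }\mathbb{R}/2\pi\times[0,T].$$ Then there exist constants $C, M>0$ depending on $\hat X$ and $T$, and a constant $h_0>0$ depending on $\hat X$, $T$ and $\alpha$, such that for every $0<h\le h_0$ there is a unique solution $\hat X_h\in H^{1,2}((0,T),\mathcal{S}_h^2)$ of the nonlinear semi-discrete problem $$\int_0^{2\pi}\Big(\alpha \hat X_{ht}\cdot\varphi_h+(1-\alpha)(\hat X_{ht}\cdot\nu_h)(\nu_h\cdot\varphi_h)\Big)|\hat X_{h\theta}|^2\,d\theta+\int_0^{2\pi}\hat X_{h\theta}\cdot\varphi_{h\theta}\,d\theta=0,\qquad \forall \varphi_h\in\mathcal{S}_h^2,\ 0<t<T,$$ with initial data $\hat X_h(\cdot,0)=(I_hX_0)(\cdot)$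 on $\mathbb{R}/2\pi$, where $\nu_h$ is a (piecewise constant) unit normal vector field to $\hat X_h$; moreover $$\alpha\int_0^T\|(\hat X_t-\hat X_{ht})(t)\|_{L^2(0,2\pi)}^2dt+(1-\alpha)\int_0^T\|\nu_h\cdot(\hat X_t-\hat X_{ht})(t)\|_{L^2(0,2\pi)}^2dt+\max_{t\in[0,T]}\|(\hat X-\hat X_h)(t)\|_{H^{1,2}(0,2\pi)}^2\le C e^{\frac{M}{\alpha}T}h^2 .$$
   Context: Subscripts $t,\theta$ denote partial derivatives. $\mathbb{R}/2\pi$ denotes the circle (functions that are $2\pi$-periodic in $\theta$). $C^{2,1}$ means twice continuously differentiable in $\theta$ and once in $t$. $H^{k,2}$ is the $L^2$-based Sobolev space of order $k$. Finite elements: for $N\in\mathbb{N}$ let $\theta_j\in[0,2\pi)$, $j=1,\dots,N$, be an ordered periodic mesh with $\theta_{N+1}:=2\pi+\theta_1$ and grid size $h=|\theta_{j+1}-\theta_j|$ (the same for all $j$, so $h=2\pi/N$). $\mathcal{S}_h$ is the space of continuous functions $\varphi_h:\mathbb{R}/2\pi\to\mathbb{R}$ that are linear on each $[\theta_j,\theta_{j+1}]$; $\mathcal{S}_h^2$ is the space of $\mathbb{R}^2$-valued functions with components in $\mathcal{S}_h$. The nodal basis $\phi_j\in\mathcal{S}_h$ satisfies $\phi_j(\theta_i)=\delta_{ij}$, and the Lagrange interpolation of a continuous function $f$ on $\mathbb{R}/2\pi$ is $I_hf:=\sum_{j=1}^N f(\theta_j)\phi_j$ (componentwise for vector-valued $f$).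 For $\hat X_h\in\mathcal{S}_h^2$, a unit normal vector field to $\hat X_h$ is a piecewise constant $\nu_h:[0,2\pi]\to\mathbb{R}^2$ with $|\nu_h|=1$ and $\nu_h\cdot(\hat X_h(\theta_{j+1})-\hat X_h(\theta_j))=0$ on $[\theta_j,\theta_{j+1})$ for $j=1,\dots,N$. For time-dependent $\hat X_h$ it is taken at each time $t$. Since $\hat X_h\in H^{1,2}((0,T),\mathcal{S}_h^2)$, the time derivative $\hat X_{ht}$ (and thus the semi-discrete equation) is understood for almost every $t$. The initial datum $X_0:\mathbb{R}/2\pi\to\mathbb{R}^2$ parametrizes the initial closed curve. *)

theory Defs
  imports "HOL-Analysis.Analysis"
begin

text \<open>Functions on the circle are represented by \<open>2 * pi\<close>-periodic functions on \<open>real\<close>. Time-dependent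
  curves take the time first, so that \<open>X t\<close> is the curve at time \<open>t\<close>.\<close>

definition periodic2pi :: "(real \<Rightarrow> 'a) \<Rightarrow> bool" where
  "periodic2pi u \<longleftrightarrow> (\<forall>x. u (x + 2 * pi) = u x)"


subsection \<open>Classical derivatives\<close>

definition dx :: "(real \<Rightarrow> 'a::real_normed_vector) \<Rightarrow> real \<Rightarrow> 'a" where
  "dx u x = vector_derivative u (at x)"

definition dt :: "real \<Rightarrow> (real \<Rightarrow> real \<Rightarrow> 'a::real_normed_vector) \<Rightarrow> real \<Rightarrow> real \<Rightarrow> 'a" where
  "dt T X t x = vector_derivative (\<lambda>s. X s x) (at t within {0..T})"

definition C21 :: "real \<Rightarrow> (real \<Rightarrow> real \<Rightarrow> 'a::real_normed_vector) \<Rightarrow> bool" where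
  "C21 T X \<longleftrightarrow>
     (\<forall>t\<in>{0..T}. periodic2pi (X t)) \<and>
     (\<forall>t\<in>{0..T}. \<forall>x. X t differentiable at x \<and> dx (X t) differentiable at x \<and>
        (\<lambda>s. X s x) differentiable (at t within {0..T})) \<and>
     continuous_on ({0..T} \<times> UNIV) (\<lambda>(t, x). X t x) \<and>
     continuous_on ({0..T} \<times> UNIV) (\<lambda>(t, x). dx (X t) x) \<and>
     continuous_on ({0..T} \<times> UNIV) (\<lambda>(t, x). dx (dx (X t)) x) \<and>
     continuous_on ({0..T} \<times> UNIV) (\<lambda>(t, x). dt T X t x)"


subsection \<open>Weak derivatives and Sobolev spaces\<close>

definition square_integrable :: "real set \<Rightarrow> (real \<Rightarrow> 'a::euclidean_space) \<Rightarrow> bool" where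
  "square_integrable A u \<longleftrightarrow>
     u \<in> borel_measurable (lebesgue_on A) \<and> set_integrable lebesgue A (\<lambda>x. (norm (u x))\<^sup>2)"

definition L2_norm :: "real set \<Rightarrow> (real \<Rightarrow> 'a::euclidean_space) \<Rightarrow> real" where
  "L2_norm A u = sqrt (LINT x:A|lebesgue. (norm (u x))\<^sup>2)"

definition test_functions :: "real set \<Rightarrow> (real \<Rightarrow> real) set" where
  "test_functions \<Omega> = {\<eta>. (\<forall>n x. (deriv ^^ n) \<eta> field_differentiable at x) \<and>
     compact (closure {x. \<eta> x \<noteq> 0}) \<and> closure {x. \<eta> x \<noteq> 0} \<subseteq> \<Omega>}"

definition locally_integrable :: "real set \<Rightarrow> (real \<Rightarrow> 'a::euclidean_space) \<Rightarrow> bool" where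
  "locally_integrable \<Omega> u \<longleftrightarrow> (\<forall>K. compact K \<and> K \<subseteq> \<Omega> \<longrightarrow> set_integrable lebesgue K u)"

definition has_weak_deriv ::
    "real set \<Rightarrow> (real \<Rightarrow> 'a::euclidean_space) \<Rightarrow> (real \<Rightarrow> 'a) \<Rightarrow> bool" where
  "has_weak_deriv \<Omega> u v \<longleftrightarrow> locally_integrable \<Omega> u \<and> locally_integrable \<Omega> v \<and>
     (\<forall>\<eta>\<in>test_functions \<Omega>.
        (LINT x:\<Omega>|lebesgue. deriv \<eta> x *\<^sub>R u x) = - (LINT x:\<Omega>|lebesgue. \<eta> x *\<^sub>R v x))"

definition weak_deriv ::
    "real set \<Rightarrow> (real \<Rightarrow> 'a::euclidean_space) \<Rightarrow> real \<Rightarrow> 'a" where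
  "weak_deriv \<Omega> u = (SOME v. has_weak_deriv \<Omega> u v)"

text \<open>The \<open>H\<^sup>k\<close> norm over \<open>(0, 2 * pi)\<close>. Weak derivatives are unique up to null sets, so the value does
  not depend on the choice made by \<^const>\<open>weak_deriv\<close>.\<close>

definition sobolev_norm :: "nat \<Rightarrow> (real \<Rightarrow> 'a::euclidean_space) \<Rightarrow> real" where
  "sobolev_norm k u =
     sqrt (\<Sum>i\<le>k. (L2_norm {0<..<2*pi} ((weak_deriv {0<..<2*pi} ^^ i) u))\<^sup>2)"

text \<open>On the circle the weak derivatives are those of the periodic function on the whole line;
  over \<open>(0, 2 * pi)\<close> alone, jumps at the end points would go unnoticed.\<close>

definition sobolev_circle :: "nat \<Rightarrow> (real \<Rightarrow> 'a::euclidean_space) set" where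
  "sobolev_circle k = {u. periodic2pi u \<and>
     (\<exists>v. v 0 = u \<and> (\<forall>i<k. has_weak_deriv UNIV (v i) (v (Suc i))) \<and>
        (\<forall>i\<le>k. square_integrable {0<..<2*pi} (v i)))}"


subsection \<open>Bochner spaces of functions from \<open>(0, T)\<close> into a normed function space\<close>

definition bochner_measurable ::
    "real \<Rightarrow> (real \<Rightarrow> 'a::euclidean_space) set \<Rightarrow> ((real \<Rightarrow> 'a) \<Rightarrow> real) \<Rightarrow> (real \<Rightarrow> real \<Rightarrow> 'a) \<Rightarrow> bool"
where
  "bochner_measurable T V nrm u \<longleftrightarrow>
     (AE t in lebesgue_on {0<..<T}. u t \<in> V) \<and>
     (\<exists>s. (\<forall>n. simple_function (lebesgue_on {0<..<T}) (s n) \<and> (\<forall>t\<in>{0<..<T}. s n t \<in> V)) \<and>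
        (AE t in lebesgue_on {0<..<T}. (\<lambda>n. nrm (\<lambda>x. u t x - s n t x)) \<longlonglongrightarrow> 0))"

definition bochner_L2 ::
    "real \<Rightarrow> (real \<Rightarrow> 'a::euclidean_space) set \<Rightarrow> ((real \<Rightarrow> 'a) \<Rightarrow> real) \<Rightarrow> (real \<Rightarrow> real \<Rightarrow> 'a) \<Rightarrow> bool"
where
  "bochner_L2 T V nrm u \<longleftrightarrow> bochner_measurable T V nrm u \<and>
     set_integrable lebesgue {0<..<T} (\<lambda>t. (nrm (u t))\<^sup>2)"

definition bochner_Linf ::
    "real \<Rightarrow> (real \<Rightarrow> 'a::euclidean_space) set \<Rightarrow> ((real \<Rightarrow> 'a) \<Rightarrow> real) \<Rightarrow> (real \<Rightarrow> real \<Rightarrow> 'a) \<Rightarrow> bool"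
where
  "bochner_Linf T V nrm u \<longleftrightarrow> bochner_measurable T V nrm u \<and>
     (\<exists>B. AE t in lebesgue_on {0<..<T}. nrm (u t) \<le> B)"


subsection \<open>Finite elements\<close>

definition periodic_mesh :: "nat \<Rightarrow> (nat \<Rightarrow> real) \<Rightarrow> real \<Rightarrow> bool" where
  "periodic_mesh N \<theta> h \<longleftrightarrow> N \<ge> 1 \<and> (\<forall>j\<in>{1..N}. 0 \<le> \<theta> j \<and> \<theta> j < 2 * pi) \<and>
     \<theta> (N + 1) = 2 * pi + \<theta> 1 \<and>
     (\<forall>j\<in>{1..N}. \<theta> j < \<theta> (j + 1) \<and> \<bar>\<theta> (j + 1) - \<theta> j\<bar> = h)"

definition fe_space :: "nat \<Rightarrow> (nat \<Rightarrow> real) \<Rightarrow> (real \<Rightarrow> real) set" where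
  "fe_space N \<theta> = {\<phi>. periodic2pi \<phi> \<and> continuous_on UNIV \<phi> \<and>
     (\<forall>j\<in>{1..N}. \<exists>a b. \<forall>x\<in>{\<theta> j..\<theta> (j + 1)}. \<phi> x = a + b * x)}"

definition fe_space2 :: "nat \<Rightarrow> (nat \<Rightarrow> real) \<Rightarrow> (real \<Rightarrow> real ^ 2) set" where
  "fe_space2 N \<theta> = {\<phi>. \<forall>i. (\<lambda>x. \<phi> x $ i) \<in> fe_space N \<theta>}"

definition nodal_basis :: "nat \<Rightarrow> (nat \<Rightarrow> real) \<Rightarrow> nat \<Rightarrow> real \<Rightarrow> real" where
  "nodal_basis N \<theta> j =
     (THE \<phi>. \<phi> \<in> fe_space N \<theta> \<and> (\<forall>i\<in>{1..N}. \<phi> (\<theta> i) = (if i = j then 1 else 0)))"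

definition interpolation ::
    "nat \<Rightarrow> (nat \<Rightarrow> real) \<Rightarrow> (real \<Rightarrow> 'a::real_vector) \<Rightarrow> real \<Rightarrow> 'a" where
  "interpolation N \<theta> f x = (\<Sum>j=1..N. nodal_basis N \<theta> j x *\<^sub>R f (\<theta> j))"

text \<open>A normal field is extended periodically: \<open>[\<theta> N, \<theta> (N + 1))\<close> may leave \<open>[0, 2 * pi]\<close>, and its
  excess is the part \<open>[0, \<theta> 1)\<close> of the circle.\<close>

definition unit_normal_fe ::
    "nat \<Rightarrow> (nat \<Rightarrow> real) \<Rightarrow> (real \<Rightarrow> real ^ 2) \<Rightarrow> (real \<Rightarrow> real ^ 2) \<Rightarrow> bool" where
  "unit_normal_fe N \<theta> X \<nu> \<longleftrightarrow> periodic2pi \<nu> \<and>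
     (\<forall>j\<in>{1..N}. \<exists>c. norm c = 1 \<and> c \<bullet> (X (\<theta> (j + 1)) - X (\<theta> j)) = 0 \<and>
        (\<forall>x\<in>{\<theta> j..<\<theta> (j + 1)}. \<nu> x = c))"

text \<open>\<open>X\<close> is the representative in \<open>H\<^sup>1((0, T), S\<^sub>h\<^sup>2)\<close> that is continuous on \<open>[0, T]\<close>, and \<open>X\<^sub>t\<close> is a
  weak time derivative of \<open>X\<close>. Since \<open>S\<^sub>h\<^sup>2\<close> is finite-dimensional, all norms on it are equivalent and
  point evaluations are continuous; therefore Bochner integrals with values in \<open>S\<^sub>h\<^sup>2\<close> and continuity
  in time may be taken pointwise in space.\<close>

definition fe_H1 ::
    "real \<Rightarrow> nat \<Rightarrow> (nat \<Rightarrow> real) \<Rightarrow> (real \<Rightarrow> real \<Rightarrow> real ^ 2) \<Rightarrow> (real \<Rightarrow> real \<Rightarrow> real ^ 2) \<Rightarrow> bool"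
where
  "fe_H1 T N \<theta> X X\<^sub>t \<longleftrightarrow>
     (\<forall>t\<in>{0..T}. X t \<in> fe_space2 N \<theta>) \<and>
     (\<forall>x. continuous_on {0..T} (\<lambda>t. X t x)) \<and>
     bochner_L2 T (fe_space2 N \<theta>) (L2_norm {0<..<2*pi}) X \<and>
     bochner_L2 T (fe_space2 N \<theta>) (L2_norm {0<..<2*pi}) X\<^sub>t \<and>
     (\<forall>x. has_weak_deriv {0<..<T} (\<lambda>t. X t x) (\<lambda>t. X\<^sub>t t x))"

text \<open>The space derivatives below are undefined only at the mesh points, a null set.\<close>

definition semi_discrete_solution ::
    "real \<Rightarrow> real \<Rightarrow> nat \<Rightarrow> (nat \<Rightarrow> real) \<Rightarrow> (real \<Rightarrow> real ^ 2) \<Rightarrow>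
     (real \<Rightarrow> real \<Rightarrow> real ^ 2) \<Rightarrow> (real \<Rightarrow> real \<Rightarrow> real ^ 2) \<Rightarrow> (real \<Rightarrow> real \<Rightarrow> real ^ 2) \<Rightarrow> bool"
where
  "semi_discrete_solution \<alpha> T N \<theta> X\<^sub>0 X X\<^sub>t \<nu> \<longleftrightarrow>
     fe_H1 T N \<theta> X X\<^sub>t \<and>
     (\<forall>t\<in>{0..T}. unit_normal_fe N \<theta> (X t) (\<nu> t)) \<and>
     X 0 = interpolation N \<theta> X\<^sub>0 \<and>
     (AE t in lebesgue_on {0<..<T}. \<forall>\<phi>\<in>fe_space2 N \<theta>.
        (LINT x:{0..2*pi}|lebesgue.
           (\<alpha> * (X\<^sub>t t x \<bullet> \<phi> x) + (1 - \<alpha>) * ((X\<^sub>t t x \<bullet> \<nu> t x) * (\<nu> t x \<bullet> \<phi> x)))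
             * (norm (dx (X t) x))\<^sup>2)
        + (LINT x:{0..2*pi}|lebesgue. dx (X t) x \<bullet> dx \<phi> x) = 0)"

end

theory Submission
  imports Defs
begin

text \<open>In one space dimension the nodal interpolant \<open>I\<^sub>h X\<close> is also the Ritz projection of \<open>X\<close>. Testing the
  difference of the exact and the discrete equation with the time derivative of \<open>E = I\<^sub>h X - X\<^sub>h\<close>
  therefore leaves \<open>1/2 d/dt \<parallel>E\<^sub>\<theta>\<parallel>\<^sup>2\<close> without a consistency term. The tensor
  \<open>\<bar>p\<bar>\<^sup>2 (\<alpha> v + (1 - \<alpha>) (\<nu> \<bullet> v) \<nu>)\<close> with \<open>\<nu> \<bottom> p\<close> equals \<open>\<bar>p\<bar>\<^sup>2 v - (1 - \<alpha>) (p \<bullet> v) p\<close>, a quadratic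
  polynomial in \<open>p\<close> that does not involve the choice of \<open>\<nu>\<close>, so its difference at \<open>X\<^sub>\<theta>\<close> and at \<open>X\<^sub>h\<^sub>\<theta>\<close> is
  controlled by \<open>\<bar>E\<^sub>\<theta>\<bar> + C h\<close>, and Gronwall's inequality gives \<open>\<parallel>E\<^sub>\<theta>\<parallel>\<^sup>2 \<le> Q h\<^sup>2\<close>. By the inverse estimate
  \<open>h \<bar>E\<^sub>\<theta>\<bar>\<^sup>2 \<le> \<parallel>E\<^sub>\<theta>\<parallel>\<^sup>2\<close>, the slopes of \<open>X\<^sub>h\<close> cannot leave a fixed tube around those of \<open>I\<^sub>h X\<close> when \<open>h\<close>
  is small. Inside this tube the scheme is a Lipschitz ODE for the nodal values. Hence truncation to the
  tube yields a global solution, which never meets the truncation, and every other solution stays in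
  the tube as well and coincides with it.\<close>

section \<open>Smooth bumps and weak derivatives\<close>

text \<open>The tensor of the scheme controls tangential velocities only with the factor \<alpha>.
  Absorbing the consistency terms by Young's inequality therefore costs \<open>1 / \<alpha>\<close>,
  which appears in the Gronwall rate and in the source; recovering the L2 part of the H1 norm from
  an energy that contains it with weight \<alpha> costs another \<open>1 / \<alpha>\<close>. Since
  \<open>1 / \<alpha> \<le> exp (1 / \<alpha>)\<close>, both factors are moved into the exponential.
  This is the origin of \<open>2 / T\<close> in \<open>M\<close> and the reason why \<open>C\<close>
  and \<open>M\<close> do not depend on \<alpha>. The mesh bound does: the energy bound
  \<open>Q h^2\<close> must stay below \<open>h (c0 / 4)^2\<close>, the level that confines every
  single slope, and \<open>Q\<close> grows exponentially in \<open>1 / \<alpha>\<close>. A competing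
  solution has only a weak time derivative and satisfies the equation for almost every time. In the
  tube, however, its velocity is almost everywhere a continuous function of its continuous nodal
  values, so these are classically differentiable and can be compared with the ODE solution. Its
  normals are chosen separately at each time; the normal error is therefore expressed through a
  projection that depends only on the slopes.\<close>

definition bump_fun :: "real poly \<Rightarrow> nat \<Rightarrow> real \<Rightarrow> real" where
  "bump_fun P k x =
     (if 0 < x \<and> x < 1 then poly P x * exp (- 1 / (x * (1 - x))) / (x * (1 - x)) ^ k else 0)"

text \<open>A single term of the exponential series,
  \<open>exp (1 / w) \<ge> (1 / w) ^ (k + 2) / fact (k + 2)\<close> with
  \<open>w = x * (1 - x)\<close>, beats the pole of order \<open>k\<close> and leaves
  \<open>w\<^sup>2\<close>. Quadratic decay at both ends forces the derivative there to exist and to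
  vanish.\<close>

lemma bump_fun_bound:
  obtains C where "C \<ge> 0" "\<And>x. \<bar>bump_fun P k x\<bar> \<le> C * x\<^sup>2" "\<And>x. \<bar>bump_fun P k x\<bar> \<le> C * (1 - x)\<^sup>2"
proof -
  have "compact ((\<lambda>x. poly P x) ` {0..1})"
    by (intro compact_continuous_image continuous_intros) auto
  then obtain B where B: "\<And>x. x \<in> {0..1} \<Longrightarrow> \<bar>poly P x\<bar> \<le> B"
    using compact_imp_bounded by (fastforce simp: bounded_iff)
  have B0: "B \<ge> 0" using B[of 0] by auto
  define C where "C = B * fact (k + 2)"
  have main: "\<bar>bump_fun P k x\<bar> \<le> C * (x * (1 - x))\<^sup>2" if "0 < x" "x < 1" for x
  proof -
    define w where "w = x * (1 - x)"
    have w: "w > 0" using that by (auto simp: w_def)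
    have "(1 / w) ^ (k + 2) / fact (k + 2) \<le> exp (1 / w)"
    proof -
      have s: "summable (\<lambda>n. (1 / w) ^ n /\<^sub>R fact n)" "(\<Sum>n. (1 / w) ^ n /\<^sub>R fact n) = exp (1 / w)"
        using exp_converges[of "1 / w"] by (auto simp: sums_iff)
      have "(\<Sum>n\<in>{k+2}. (1 / w) ^ n /\<^sub>R fact n) \<le> (\<Sum>n. (1 / w) ^ n /\<^sub>R fact n)"
        using w by (intro sum_le_suminf s) auto
      then have "(\<Sum>n\<in>{k+2}. (1 / w) ^ n /\<^sub>R fact n) \<le> exp (1 / w)" using s by simp
      then show ?thesis by (simp add: divide_inverse mult.commute)
    qed
    moreover have "(fact (k + 2) :: real) > 0" by (rule fact_gt_zero)
    ultimately have "exp (- 1 / w) \<le> fact (k + 2) * w ^ (k + 2)"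
      using w by (simp add: exp_minus divide_simps mult_ac del: fact_Suc power_Suc)
    then have "exp (- 1 / w) / w ^ k \<le> fact (k + 2) * w\<^sup>2"
      using w by (simp add: field_simps power_add power2_eq_square)
    moreover have "\<bar>poly P x\<bar> \<le> B" using B that by auto
    ultimately have "\<bar>poly P x\<bar> * (exp (- 1 / w) / w ^ k) \<le> B * (fact (k + 2) * w\<^sup>2)"
      using w B0 by (intro mult_mono) auto
    then show ?thesis
      using that w by (simp add: bump_fun_def C_def w_def abs_mult ac_simps)
  qed
  have C0: "C \<ge> 0" using B0 by (simp add: C_def)
  show thesis
  proof
    show "C \<ge> 0" by (rule C0)
    show "\<bar>bump_fun P k x\<bar> \<le> C * x\<^sup>2" for x
    proof (cases "0 < x \<and> x < 1")
      case True
      then have "(x * (1 - x))\<^sup>2 \<le> x\<^sup>2" by (intro power_mono) (auto simp: mult_left_le)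
      then have "C * (x * (1 - x))\<^sup>2 \<le> C * x\<^sup>2" using C0 by (intro mult_left_mono) auto
      then show ?thesis using main[of x] True by simp
    qed (auto simp: bump_fun_def C0)
    show "\<bar>bump_fun P k x\<bar> \<le> C * (1 - x)\<^sup>2" for x
    proof (cases "0 < x \<and> x < 1")
      case True
      then have "(x * (1 - x))\<^sup>2 \<le> (1 - x)\<^sup>2" by (intro power_mono) (auto simp: mult_left_le_one_le)
      then have "C * (x * (1 - x))\<^sup>2 \<le> C * (1 - x)\<^sup>2" using C0 by (intro mult_left_mono) auto
      then show ?thesis using main[of x] True by simp
    qed (auto simp: bump_fun_def C0)
  qed
qed

lemma DERIV_0_quadratic_bound:
  fixes f :: "real \<Rightarrow> real"
  assumes "\<And>y. \<bar>f y\<bar> \<le> C * (y - x)\<^sup>2"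
  shows "(f has_field_derivative 0) (at x)"
proof -
  have fx: "f x = 0" using assms[of x] by simp
  have "((\<lambda>h. (f (x + h) - f x) / h) \<longlongrightarrow> 0) (at 0)"
  proof (rule Lim_null_comparison)
    show "\<forall>\<^sub>F h in at 0. norm ((f (x + h) - f x) / h) \<le> C * \<bar>h\<bar>"
    proof (rule eventually_at_filter[THEN iffD2], rule eventuallyI, intro impI)
      fix h :: real assume "h \<noteq> 0"
      then show "norm ((f (x + h) - f x) / h) \<le> C * \<bar>h\<bar>"
        using assms[of "x + h"] fx by (simp add: abs_divide divide_simps power2_eq_square abs_mult_self_eq flip: abs_mult mult.assoc)
    qed
    show "((\<lambda>h. C * \<bar>h\<bar>) \<longlongrightarrow> 0) (at 0)" by (auto intro!: tendsto_eq_intros)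
  qed
  then show ?thesis by (simp add: DERIV_def)
qed

text \<open>The polynomial \<open>P\<close> and the order \<open>k\<close> of the pole are carried
  along so that the family is closed under differentiation. With \<open>w = x (1 - x)\<close>, the
  polynomial \<open>[:0, 1, -1:]\<close>, and \<open>w' = 1 - 2 x\<close>, the quotient rule inside
  the interval gives \<open>(P' w\<^sup>2 - k P w' w + P w') exp (- 1 / w) / w ^ (k + 2)\<close>;
  elsewhere the quadratic bound gives 0.\<close>

lemma bump_fun_deriv:
  "(bump_fun P k has_field_derivative
     bump_fun (pderiv P * [:0, 1, -1:]\<^sup>2 - smult (of_nat k) (P * [:1, -2:] * [:0, 1, -1:]) + P * [:1, -2:])
       (k + 2) x) (at x)"
proof (cases "0 < x \<and> x < 1")
  case True
  define w where "w = x * (1 - x)"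
  have w: "w \<noteq> 0" using True by (simp add: w_def)
  have dw: "((\<lambda>x. x * (1 - x)) has_field_derivative 1 - 2 * x) (at x)"
    by (auto intro!: derivative_eq_intros)
  have di: "((\<lambda>x. - 1 / (x * (1 - x))) has_field_derivative (1 - 2 * x) / w\<^sup>2) (at x)"
    by (rule DERIV_cong[OF DERIV_divide[OF DERIV_const dw]]) (use w in \<open>simp_all add: w_def power2_eq_square\<close>)
  have de: "((\<lambda>x. exp (- 1 / (x * (1 - x)))) has_field_derivative exp (- 1 / w) * ((1 - 2 * x) / w\<^sup>2)) (at x)"
    by (rule DERIV_cong[OF DERIV_fun_exp[OF di]]) (simp add: w_def)
  have dp: "((\<lambda>x. (x * (1 - x)) ^ k) has_field_derivative of_nat k * w ^ (k - 1) * (1 - 2 * x)) (at x)"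
    by (rule DERIV_cong[OF DERIV_power[OF dw]]) (simp add: w_def ac_simps)
  have d: "((\<lambda>x. poly P x * exp (- 1 / (x * (1 - x))) / (x * (1 - x)) ^ k) has_field_derivative
     ((poly (pderiv P) x * exp (- 1 / w) + poly P x * (exp (- 1 / w) * ((1 - 2 * x) / w\<^sup>2))) * w ^ k
        - poly P x * exp (- 1 / w) * (of_nat k * w ^ (k - 1) * (1 - 2 * x))) / (w ^ k * w ^ k)) (at x)"
    by (rule DERIV_cong[OF DERIV_divide[OF DERIV_mult[OF poly_DERIV de] dp]])
      (use w in \<open>simp_all add: w_def algebra_simps\<close>)
  have eq: "((poly (pderiv P) x * exp (- 1 / w) + poly P x * (exp (- 1 / w) * ((1 - 2 * x) / w\<^sup>2))) * w ^ k
        - poly P x * exp (- 1 / w) * (of_nat k * w ^ (k - 1) * (1 - 2 * x))) / (w ^ k * w ^ k)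
      = (poly (pderiv P) x * w\<^sup>2 - of_nat k * (poly P x * (1 - 2 * x) * w) + poly P x * (1 - 2 * x)) * exp (- 1 / w) / w ^ (k + 2)"
    using w by (cases k) (simp_all add: field_simps power2_eq_square)
  have pw: "poly [:0, 1, -1:] x = w" by (simp add: w_def algebra_simps)
  have d2: "((\<lambda>x. poly P x * exp (- 1 / (x * (1 - x))) / (x * (1 - x)) ^ k) has_field_derivative
    bump_fun (pderiv P * [:0, 1, -1:]\<^sup>2 - smult (of_nat k) (P * [:1, -2:] * [:0, 1, -1:]) + P * [:1, -2:])
       (k + 2) x) (at x)"
    using d[unfolded eq] True unfolding bump_fun_def
    by (simp only: poly_add poly_diff poly_smult poly_mult poly_power pw) (simp add: w_def mult.commute)
  have "\<forall>\<^sub>F y in nhds x. y \<in> {0<..<1}" using True by (intro eventually_nhds_in_open) auto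
  then have ev: "\<forall>\<^sub>F y in nhds x. bump_fun P k y = poly P y * exp (- 1 / (y * (1 - y))) / (y * (1 - y)) ^ k"
    by eventually_elim (auto simp: bump_fun_def)
  show ?thesis using d2 DERIV_cong_ev[OF refl ev refl] by blast
next
  case False
  then have x: "x \<le> 0 \<or> x \<ge> 1" by auto
  obtain C where C: "C \<ge> 0" "\<And>x. \<bar>bump_fun P k x\<bar> \<le> C * x\<^sup>2" "\<And>x. \<bar>bump_fun P k x\<bar> \<le> C * (1 - x)\<^sup>2"
    using bump_fun_bound[of P k] by blast
  have "\<bar>bump_fun P k y\<bar> \<le> C * (y - x)\<^sup>2" for y
  proof (cases "0 < y \<and> y < 1")
    case True
    from x show ?thesis
    proof
      assume "x \<le> 0"
      then have "y\<^sup>2 \<le> (y - x)\<^sup>2" using True by (intro power_mono) auto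
      then have "C * y\<^sup>2 \<le> C * (y - x)\<^sup>2" using C by (intro mult_left_mono) auto
      with C(2)[of y] show ?thesis by linarith
    next
      assume "x \<ge> 1"
      then have "(1 - y)\<^sup>2 \<le> (x - y)\<^sup>2" using True by (intro power_mono) auto
      then have "C * (1 - y)\<^sup>2 \<le> C * (y - x)\<^sup>2" using C by (intro mult_left_mono) (auto simp: power2_commute)
      with C(3)[of y] show ?thesis by linarith
    qed
  qed (auto simp: bump_fun_def C)
  then have "(bump_fun P k has_field_derivative 0) (at x)" by (rule DERIV_0_quadratic_bound)
  moreover have "bump_fun Q m x = 0" for Q m using False by (auto simp: bump_fun_def)
  ultimately show ?thesis by simp
qed

text \<open>Infinite differentiability is reduced to the closure of a set of functions under one
  differentiation, so no formula for higher derivatives is required.\<close>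

lemma field_differentiable_iterated_deriv:
  assumes "f \<in> A" "\<And>f. f \<in> A \<Longrightarrow> \<exists>g\<in>A. \<forall>x. (f has_field_derivative g x) (at x)"
  shows "(deriv ^^ n) f field_differentiable at x"
proof -
  have "(deriv ^^ n) f \<in> A" for n
  proof (induction n)
    case (Suc n)
    then obtain g where g: "g \<in> A" "\<And>x. ((deriv ^^ n) f has_field_derivative g x) (at x)"
      using assms(2) by blast
    then have "deriv ((deriv ^^ n) f) = g" by (auto intro!: ext DERIV_imp_deriv)
    with g show ?case by simp
  qed (use assms in auto)
  then show ?thesis using assms(2) field_differentiable_def by blast
qed

text \<open>\<open>S\<close> is the normalised primitive of the bump. The last clause speaks of
  differences of shifted and rescaled steps because these, unlike \<open>S\<close>, have compact
  support: they are the test functions that imitate the indicator of an interval.\<close>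

lemma smooth_step:
  obtains S \<beta> :: "real \<Rightarrow> real" where
    "\<And>z. (S has_field_derivative \<beta> z) (at z)" "\<And>z. \<beta> z \<ge> 0" "continuous_on UNIV \<beta>"
    "\<And>z. z \<le> 0 \<or> z \<ge> 1 \<Longrightarrow> \<beta> z = 0" "\<And>z. z \<le> 0 \<Longrightarrow> S z = 0" "\<And>z. z \<ge> 1 \<Longrightarrow> S z = 1"
    "\<And>z. 0 \<le> S z" "\<And>z. S z \<le> 1"
    "\<And>a b e n x. e > 0 \<Longrightarrow> (deriv ^^ n) (\<lambda>z. S ((z - a) / e) - S ((z - b) / e)) field_differentiable at x"
proof -
  define \<beta>0 where "\<beta>0 = bump_fun 1 0"
  have cont: "continuous_on UNIV \<beta>0"
    unfolding \<beta>0_def using bump_fun_deriv[of 1 0]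
    by (meson DERIV_isCont continuous_at_imp_continuous_on)
  define S0 where "S0 z = (LBINT y=0..z. \<beta>0 y)" for z :: real
  have dS0: "(S0 has_field_derivative \<beta>0 z) (at z)" for z
  proof -
    have "((\<lambda>u. LBINT y=0..u. \<beta>0 y) has_vector_derivative \<beta>0 z) (at z within {- \<bar>z\<bar> - 1..\<bar>z\<bar> + 1})"
      using interval_integral_FTC2[of "- \<bar>z\<bar> - 1" 0 "\<bar>z\<bar> + 1" \<beta>0 z] continuous_on_subset[OF cont]
      by (auto simp: zero_ereal_def)
    moreover have "at z within {- \<bar>z\<bar> - 1..\<bar>z\<bar> + 1} = at z"
      by (intro at_within_interior) auto
    ultimately show ?thesis
      unfolding S0_def has_real_derivative_iff_has_vector_derivative by simp
  qed
  have \<beta>0: "\<beta>0 z \<ge> 0" "z \<le> 0 \<or> z \<ge> 1 \<Longrightarrow> \<beta>0 z = 0" "0 < z \<Longrightarrow> z < 1 \<Longrightarrow> \<beta>0 z > 0" for z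
    by (auto simp: \<beta>0_def bump_fun_def)
  have mono: "S0 x \<le> S0 y" if "x \<le> y" for x y
    using DERIV_nonneg_imp_nondecreasing[OF that, of S0] dS0 \<beta>0 by blast
  have S00: "S0 0 = 0" by (simp add: S0_def zero_ereal_def)
  have neg: "S0 z = 0" if "z \<le> 0" for z
  proof (cases "z < 0")
    case True
    from MVT2[OF this, of S0 \<beta>0] dS0 obtain y where "z < y" "y < 0" "S0 0 - S0 z = (0 - z) * \<beta>0 y" by auto
    with \<beta>0(2)[of y] S00 show ?thesis by auto
  qed (use that S00 in auto)
  have pos: "S0 z = S0 1" if "z \<ge> 1" for z
  proof (cases "z > 1")
    case True
    from MVT2[OF this, of S0 \<beta>0] dS0 obtain y where "1 < y" "y < z" "S0 z - S0 1 = (z - 1) * \<beta>0 y" by auto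
    with \<beta>0(2)[of y] show ?thesis by auto
  qed (use that in auto)
  have S1: "S0 1 > 0"
  proof -
    have "(0::real) < 1" by simp
    from MVT2[OF this, of S0 \<beta>0] dS0 obtain y where "0 < y" "y < 1" "S0 1 - S0 0 = (1 - 0) * \<beta>0 y" by auto
    with \<beta>0(3)[of y] S00 show ?thesis by auto
  qed
  define S where "S z = S0 z / S0 1" for z
  define \<beta> where "\<beta> z = \<beta>0 z / S0 1" for z
  have dS: "(S has_field_derivative \<beta> z) (at z)" for z
    unfolding S_def \<beta>_def using dS0 by (rule DERIV_cdivide)
  show thesis
  proof
    show "(S has_field_derivative \<beta> z) (at z)" for z by (rule dS)
    show "\<beta> z \<ge> 0" for z using \<beta>0 S1 by (auto simp: \<beta>_def)
    show "continuous_on UNIV \<beta>" unfolding \<beta>_def using S1 by (intro continuous_intros cont) auto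
    show "\<beta> z = 0" if "z \<le> 0 \<or> z \<ge> 1" for z using \<beta>0 that by (auto simp: \<beta>_def)
    show "S z = 0" if "z \<le> 0" for z using neg that by (auto simp: S_def)
    show "S z = 1" if "z \<ge> 1" for z using pos[OF that] S1 by (simp add: S_def)
    show "0 \<le> S z" for z
      using mono[of 0 z] neg[of z] S00 S1 by (cases "z \<le> 0") (auto simp: S_def)
    show "S z \<le> 1" for z
    proof (cases "z \<ge> 1")
      case True
      then show ?thesis using pos[OF True] S1 by (simp add: S_def)
    next
      case False
      then show ?thesis using mono[of z 1] S1 by (simp add: S_def)
    qed
    fix a b e :: real and n and x assume e: "e > 0"
    \<comment> \<open>The step is not a bump, so it is added as a separate member; its derivative is
      a scaled difference of bumps, and all further derivatives stay in the second set. The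
      coefficient \<open>c\<close> collects the normalisation and the factors
      \<open>1 / e\<close>.\<close>
    let ?A = "{\<lambda>z. S ((z - a) / e) - S ((z - b) / e)} \<union>
      {(\<lambda>z. c * bump_fun P k ((z - a) / e) - c * bump_fun P k ((z - b) / e)) | c P k. True}"
    show "(deriv ^^ n) (\<lambda>z. S ((z - a) / e) - S ((z - b) / e)) field_differentiable at x"
    proof (rule field_differentiable_iterated_deriv[of _ ?A])
      fix f assume "f \<in> ?A"
      then consider "f = (\<lambda>z. S ((z - a) / e) - S ((z - b) / e))"
        | c P k where "f = (\<lambda>z. c * bump_fun P k ((z - a) / e) - c * bump_fun P k ((z - b) / e))" by blast
      then show "\<exists>g\<in>?A. \<forall>x. (f has_field_derivative g x) (at x)"
      proof cases
        case 1
        have "(f has_field_derivative ((1 / S0 1 / e) * bump_fun 1 0 ((z - a) / e) - (1 / S0 1 / e) * bump_fun 1 0 ((z - b) / e))) (at z)" for z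
          unfolding 1 using e
          by (auto intro!: derivative_eq_intros DERIV_chain2[OF dS] simp: \<beta>_def \<beta>0_def)
        then show ?thesis
          by (intro bexI[of _ "\<lambda>z. (1 / S0 1 / e) * bump_fun 1 0 ((z - a) / e) - (1 / S0 1 / e) * bump_fun 1 0 ((z - b) / e)"]) blast+
      next
        case 2
        obtain Q where Q: "\<And>x. (bump_fun P k has_field_derivative bump_fun Q (k + 2) x) (at x)"
          using bump_fun_deriv by blast
        have "(f has_field_derivative ((c / e) * bump_fun Q (k + 2) ((z - a) / e) - (c / e) * bump_fun Q (k + 2) ((z - b) / e))) (at z)" for z
          unfolding 2 using e
          by (auto intro!: derivative_eq_intros DERIV_chain2[OF Q] simp: mult_ac)
        then show ?thesis
          by (intro bexI[of _ "\<lambda>z. (c / e) * bump_fun Q (k + 2) ((z - a) / e) - (c / e) * bump_fun Q (k + 2) ((z - b) / e)"]) blast+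
      qed
    qed auto
  qed
qed


text \<open>The defining identity is tested with smooth approximations of the indicator of \<open>(a, b]\<close>.\<close>

lemma weak_deriv_has_integral:
  fixes u v :: "real \<Rightarrow> 'a::euclidean_space"
  assumes wd: "has_weak_deriv \<Omega> u v" and op: "open \<Omega>" and cu: "continuous_on \<Omega> u"
    and ab: "a \<le> b" "{a..b} \<subseteq> \<Omega>"
  shows "(v has_integral (u b - u a)) {a..b}"
proof (cases "a = b")
  case False
  then have ab': "a < b" using ab by simp
  obtain S \<beta> :: "real \<Rightarrow> real" where S:
    "\<And>z. (S has_field_derivative \<beta> z) (at z)" "\<And>z. \<beta> z \<ge> 0" "continuous_on UNIV \<beta>"
    "\<And>z. z \<le> 0 \<or> z \<ge> 1 \<Longrightarrow> \<beta> z = 0" "\<And>z. z \<le> 0 \<Longrightarrow> S z = 0" "\<And>z. z \<ge> 1 \<Longrightarrow> S z = 1"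
    "\<And>z. 0 \<le> S z" "\<And>z. S z \<le> 1"
    "\<And>a b e n x. e > 0 \<Longrightarrow> (deriv ^^ n) (\<lambda>z. S ((z - a) / e) - S ((z - b) / e)) field_differentiable at x"
    by (rule smooth_step) blast
  have cS: "continuous_on A S" for A
    using S(1) by (meson DERIV_isCont continuous_at_imp_continuous_on)
  have "b \<in> \<Omega>" using ab by auto
  \<comment> \<open>The test functions below rise on \<open>{a..a + \<epsilon> n}\<close> and fall
    on \<open>{b..b + \<epsilon> n}\<close>, so their support needs extra room inside \<Omega> only
    to the right of \<open>b\<close>.\<close>
  then obtain e0 where e0: "e0 > 0" "cball b e0 \<subseteq> \<Omega>"
    using op open_contains_cball by blast
  have sub: "{a..b + e0} \<subseteq> \<Omega>"
  proof
    fix x assume x: "x \<in> {a..b + e0}"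
    show "x \<in> \<Omega>"
    proof (cases "x \<le> b")
      case False
      then have "x \<in> cball b e0" using x by (auto simp: dist_real_def)
      with e0 show ?thesis by blast
    qed (use x ab in auto)
  qed
  define \<epsilon> where "\<epsilon> n = e0 / real (Suc n)" for n
  have eps: "\<epsilon> n > 0" "\<epsilon> n \<le> e0" for n
    using e0 by (auto simp: \<epsilon>_def field_simps)
  have epslim: "\<epsilon> \<longlonglongrightarrow> 0" unfolding \<epsilon>_def
    using LIMSEQ_Suc[OF lim_const_over_n[of e0]] by simp
  define w where "w n c z = \<beta> ((z - c) / \<epsilon> n) / \<epsilon> n" for n c z
  define \<eta> where "\<eta> n z = S ((z - a) / \<epsilon> n) - S ((z - b) / \<epsilon> n)" for n z
  have cw: "continuous_on A (w n c)" for A n c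
    unfolding w_def using eps[of n]
    by (intro continuous_intros continuous_on_compose2[OF S(3)]) auto
  have c\<eta>: "continuous_on A (\<eta> n)" for A n
    unfolding \<eta>_def using eps[of n]
    by (intro continuous_intros continuous_on_compose2[OF cS]) auto
  have \<eta>0: "\<eta> n z = 0" if "z \<notin> {a..b + e0}" for n z
  proof (cases "z < a")
    case True
    then have "(z - a) / \<epsilon> n \<le> 0" "(z - b) / \<epsilon> n \<le> 0" using ab' eps[of n] by (auto simp: divide_simps)
    then show ?thesis using S(5) by (simp add: \<eta>_def)
  next
    case False
    then have "(z - a) / \<epsilon> n \<ge> 1" "(z - b) / \<epsilon> n \<ge> 1" using that ab' eps[of n] by (auto simp: divide_simps)
    then show ?thesis using S(6) by (simp add: \<eta>_def)
  qed
  have \<eta>1: "\<bar>\<eta> n z\<bar> \<le> 1" for n z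
    using S(7)[of "(z - a) / \<epsilon> n"] S(8)[of "(z - a) / \<epsilon> n"] S(7)[of "(z - b) / \<epsilon> n"] S(8)[of "(z - b) / \<epsilon> n"]
    by (simp add: \<eta>_def abs_le_iff)
  have supp: "closure {x. \<eta> n x \<noteq> 0} \<subseteq> {a..b + e0}" for n
    by (rule closure_minimal) (use \<eta>0 in \<open>auto, meson atLeastAtMost_iff, meson atLeastAtMost_iff\<close>)
  have test: "\<eta> n \<in> test_functions \<Omega>" for n
  proof -
    have "compact (closure {x. \<eta> n x \<noteq> 0})"
      using supp[of n] by (meson closed_closure bounded_closed_interval bounded_subset compact_eq_bounded_closed)
    moreover have "\<eta> n = (\<lambda>z. S ((z - a) / \<epsilon> n) - S ((z - b) / \<epsilon> n))" by (simp add: \<eta>_def fun_eq_iff)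
    ultimately show ?thesis
      using S(9)[OF eps(1)[of n]] supp[of n] sub unfolding test_functions_def by auto
  qed
  have d\<eta>: "deriv (\<eta> n) z = w n a z - w n b z" for n z
  proof -
    have "(\<eta> n has_field_derivative w n a z - w n b z) (at z)"
      unfolding \<eta>_def w_def using eps[of n]
      by (auto intro!: derivative_eq_intros DERIV_chain2[OF S(1)])
    then show ?thesis by (rule DERIV_imp_deriv)
  qed
  have w0: "w n c z = 0" if "z \<notin> {c..c + \<epsilon> n}" for n c z
  proof -
    have "(z - c) / \<epsilon> n \<le> 0 \<or> (z - c) / \<epsilon> n \<ge> 1" using that eps[of n] by (auto simp: divide_simps)
    then show ?thesis using S(4) by (simp add: w_def)
  qed
  have w1: "(w n c has_integral 1) {c..c + \<epsilon> n}" for n c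
  proof -
    have "(w n c has_integral S ((c + \<epsilon> n - c) / \<epsilon> n) - S ((c - c) / \<epsilon> n)) {c..c + \<epsilon> n}"
    proof (rule fundamental_theorem_of_calculus)
      show "((\<lambda>z. S ((z - c) / \<epsilon> n)) has_vector_derivative w n c x) (at x within {c..c + \<epsilon> n})" for x
      proof -
        have "((\<lambda>z. S ((z - c) / \<epsilon> n)) has_field_derivative w n c x) (at x)"
          unfolding w_def
          by (rule DERIV_cong[OF DERIV_chain2[OF S(1)]]) (use eps[of n] in \<open>auto intro!: derivative_eq_intros\<close>)
        then show ?thesis
          by (simp add: has_field_derivative_at_within flip: has_real_derivative_iff_has_vector_derivative)
      qed
    qed (use eps[of n] in auto)
    then show ?thesis using S(5)[of 0] S(6)[of 1] eps[of n] by simp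
  qed
  have lhs: "set_integrable lebesgue \<Omega> (\<lambda>z. w n c z *\<^sub>R u z)"
      "(LINT z:\<Omega>|lebesgue. w n c z *\<^sub>R u z) = integral {c..c + \<epsilon> n} (\<lambda>z. w n c z *\<^sub>R u z)"
    if c: "{c..c + e0} \<subseteq> \<Omega>" for n c
  proof -
    have sub': "{c..c + \<epsilon> n} \<subseteq> \<Omega>" using c eps[of n] by (force simp: subset_eq)
    have ai: "(\<lambda>z. w n c z *\<^sub>R u z) absolutely_integrable_on {c..c + \<epsilon> n}"
      by (intro absolutely_integrable_continuous_real continuous_intros cw continuous_on_subset[OF cu sub'])
    have eq: "(\<lambda>z. indicat_real \<Omega> z *\<^sub>R w n c z *\<^sub>R u z) = (\<lambda>z. indicat_real {c..c + \<epsilon> n} z *\<^sub>R w n c z *\<^sub>R u z)"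
    proof
      fix z show "indicat_real \<Omega> z *\<^sub>R w n c z *\<^sub>R u z = indicat_real {c..c + \<epsilon> n} z *\<^sub>R w n c z *\<^sub>R u z"
        using w0[of z c n] sub' by (cases "z \<in> {c..c + \<epsilon> n}") auto
    qed
    show "set_integrable lebesgue \<Omega> (\<lambda>z. w n c z *\<^sub>R u z)"
      using ai unfolding set_integrable_def eq .
    show "(LINT z:\<Omega>|lebesgue. w n c z *\<^sub>R u z) = integral {c..c + \<epsilon> n} (\<lambda>z. w n c z *\<^sub>R u z)"
      using set_lebesgue_integral_eq_integral(2)[OF ai] unfolding set_lebesgue_integral_def eq .
  qed
  \<comment> \<open>\<open>w n c\<close> is a nonnegative kernel of mass one on
    \<open>{c..c + \<epsilon> n}\<close>, so averages of the continuous \<open>u\<close> converge to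
    its value at \<open>c\<close>.\<close>
  have mol: "(\<lambda>n. integral {c..c + \<epsilon> n} (\<lambda>z. w n c z *\<^sub>R u z)) \<longlonglongrightarrow> u c" if c: "{c..c + e0} \<subseteq> \<Omega>" for c
  proof (rule LIMSEQ_I)
    fix r :: real assume r: "r > 0"
    have "c \<in> \<Omega>" using c e0 by auto
    then obtain d where d: "d > 0" "\<And>z. z \<in> \<Omega> \<Longrightarrow> dist z c < d \<Longrightarrow> dist (u z) (u c) < r / 2"
      using cu r unfolding continuous_on_iff by (meson half_gt_zero)
    obtain n0 where n0: "\<And>n. n \<ge> n0 \<Longrightarrow> \<epsilon> n < d"
      using LIMSEQ_D[OF epslim d(1)] eps by fastforce
    have "norm (integral {c..c + \<epsilon> n} (\<lambda>z. w n c z *\<^sub>R u z) - u c) < r" if n: "n \<ge> n0" for n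
    proof -
      have sub': "{c..c + \<epsilon> n} \<subseteq> \<Omega>" using c eps[of n] by (force simp: subset_eq)
      have i1: "(\<lambda>z. w n c z *\<^sub>R u z) integrable_on {c..c + \<epsilon> n}"
        by (intro integrable_continuous_real continuous_intros cw continuous_on_subset[OF cu sub'])
      have i2: "((\<lambda>z. w n c z *\<^sub>R u c) has_integral 1 *\<^sub>R u c) {c..c + \<epsilon> n}"
        by (rule has_integral_scaleR_left[OF w1])
      have "integral {c..c + \<epsilon> n} (\<lambda>z. w n c z *\<^sub>R u z) - u c = integral {c..c + \<epsilon> n} (\<lambda>z. w n c z *\<^sub>R u z - w n c z *\<^sub>R u c)"
        using i1 i2 by (simp add: integral_diff has_integral_iff)
      also have "norm \<dots> \<le> integral {c..c + \<epsilon> n} (\<lambda>z. w n c z * (r / 2))"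
      proof (rule integral_norm_bound_integral)
        show "(\<lambda>z. w n c z *\<^sub>R u z - w n c z *\<^sub>R u c) integrable_on {c..c + \<epsilon> n}"
          using i1 i2 by (intro integrable_diff) auto
        show "(\<lambda>z. w n c z * (r / 2)) integrable_on {c..c + \<epsilon> n}"
          by (intro integrable_continuous_real continuous_intros cw)
        fix z assume z: "z \<in> {c..c + \<epsilon> n}"
        then have "dist z c < d" using n0[OF n] by (auto simp: dist_real_def)
        then have "norm (u z - u c) \<le> r / 2" using d(2)[of z] z sub' by (auto simp: dist_norm)
        moreover have "w n c z \<ge> 0" using S(2) eps[of n] by (simp add: w_def)
        ultimately have "w n c z * norm (u z - u c) \<le> w n c z * (r / 2)" by (rule mult_left_mono)
        with \<open>w n c z \<ge> 0\<close> show "norm (w n c z *\<^sub>R u z - w n c z *\<^sub>R u c) \<le> w n c z * (r / 2)"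
          by (simp flip: scaleR_diff_right)
      qed
      also have "\<dots> = r / 2" using has_integral_mult_left[OF w1[of n c], of "r / 2"] by (simp add: has_integral_iff)
      finally show ?thesis using r by simp
    qed
    then show "\<exists>n0. \<forall>n\<ge>n0. norm (integral {c..c + \<epsilon> n} (\<lambda>z. w n c z *\<^sub>R u z) - u c) < r" by blast
  qed
  have suba: "{a..a + e0} \<subseteq> \<Omega>" and subb: "{b..b + e0} \<subseteq> \<Omega>" using sub ab' by (force simp: subset_eq)+
  have vI: "set_integrable lebesgue {a..b + e0} v"
    using wd sub unfolding has_weak_deriv_def locally_integrable_def by auto
  have conv1: "(\<lambda>n. LINT z:\<Omega>|lebesgue. deriv (\<eta> n) z *\<^sub>R u z) \<longlonglongrightarrow> u a - u b"
  proof -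
    have "(LINT z:\<Omega>|lebesgue. deriv (\<eta> n) z *\<^sub>R u z) =
       integral {a..a + \<epsilon> n} (\<lambda>z. w n a z *\<^sub>R u z) - integral {b..b + \<epsilon> n} (\<lambda>z. w n b z *\<^sub>R u z)" for n
      using set_integral_diff(2)[OF lhs(1)[OF suba, of n] lhs(1)[OF subb, of n]] lhs(2)[OF suba, of n] lhs(2)[OF subb, of n]
      by (simp add: d\<eta> scaleR_diff_left)
    then show ?thesis using tendsto_diff[OF mol[OF suba] mol[OF subb]] by simp
  qed
  have conv2: "(\<lambda>n. LINT z:\<Omega>|lebesgue. \<eta> n z *\<^sub>R v z) \<longlonglongrightarrow> integral {a..b} v"
  proof -
    have vI': "set_integrable lebesgue {a..b} v"
      by (rule set_integrable_subset[OF vI]) (use e0 in auto)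
    have eq: "indicat_real \<Omega> z *\<^sub>R \<eta> n z *\<^sub>R v z = \<eta> n z *\<^sub>R (indicat_real {a..b + e0} z *\<^sub>R v z)" for n z
      using \<eta>0[of z n] sub by (cases "z \<in> {a..b + e0}") auto
    have "(\<lambda>n. LINT z|lebesgue. indicat_real \<Omega> z *\<^sub>R \<eta> n z *\<^sub>R v z) \<longlonglongrightarrow> (LINT z|lebesgue. indicat_real {a..b} z *\<^sub>R v z)"
    proof (rule integral_dominated_convergence[where w = "\<lambda>z. norm (indicat_real {a..b + e0} z *\<^sub>R v z)"])
      show "(\<lambda>z. indicat_real {a..b} z *\<^sub>R v z) \<in> borel_measurable lebesgue"
        using vI' unfolding set_integrable_def by auto
      have "\<eta> n \<in> borel_measurable lebesgue" for n
        by (intro measurable_completion) (simp add: borel_measurable_continuous_onI c\<eta>)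
      then show "(\<lambda>z. indicat_real \<Omega> z *\<^sub>R \<eta> n z *\<^sub>R v z) \<in> borel_measurable lebesgue" for n
        unfolding eq by (rule borel_measurable_scaleR) (use vI in \<open>simp add: set_integrable_def borel_measurable_integrable del: borel_measurable_scaleR\<close>)
      show "integrable lebesgue (\<lambda>z. norm (indicat_real {a..b + e0} z *\<^sub>R v z))"
        using vI unfolding set_integrable_def by (rule integrable_norm)
      show "AE z in lebesgue. norm (indicat_real \<Omega> z *\<^sub>R \<eta> n z *\<^sub>R v z) \<le> norm (indicat_real {a..b + e0} z *\<^sub>R v z)" for n
        unfolding eq using \<eta>1[of n] by (intro AE_I2) (auto intro: mult_left_le_one_le simp: indicator_def)
      \<comment> \<open>Pointwise convergence can fail only at \<open>a\<close>, where every
        \<open>\<eta> n\<close> is 0 but the indicator is 1; at \<open>b\<close> the limit is 1, in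
        agreement with the indicator.\<close>
      have "AE z in lebesgue. z \<noteq> a" by (rule AE_completion) (rule AE_lborel_singleton)
      then show "AE z in lebesgue. (\<lambda>n. indicat_real \<Omega> z *\<^sub>R \<eta> n z *\<^sub>R v z) \<longlonglongrightarrow> indicat_real {a..b} z *\<^sub>R v z"
      proof eventually_elim
        case (elim z)
        have "(\<lambda>n. \<eta> n z *\<^sub>R (indicat_real {a..b + e0} z *\<^sub>R v z)) \<longlonglongrightarrow> indicat_real {a..b} z *\<^sub>R v z"
        proof (cases "z \<in> {a..b + e0}")
          case True
          define d where "d = (if z \<le> b then z - a else min (z - a) (z - b))"
          have "d > 0" using True elim ab' by (auto simp: d_def)
          then have "\<forall>\<^sub>F n in sequentially. \<epsilon> n < d" by (rule order_tendstoD(2)[OF epslim])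
          then have "\<forall>\<^sub>F n in sequentially. \<eta> n z *\<^sub>R (indicat_real {a..b + e0} z *\<^sub>R v z) = indicat_real {a..b} z *\<^sub>R v z"
          proof eventually_elim
            case (elim n)
            have A: "(z - a) / \<epsilon> n \<ge> 1" using elim eps[of n] by (auto simp: d_def divide_simps split: if_splits)
            show ?case
            proof (cases "z \<le> b")
              case True
              then have "(z - b) / \<epsilon> n \<le> 0" using eps[of n] by (auto simp: divide_simps)
              then show ?thesis using A S(5,6) True \<open>z \<in> {a..b + e0}\<close> by (simp add: \<eta>_def)
            next
              case False
              then have "(z - b) / \<epsilon> n \<ge> 1" using elim eps[of n] by (auto simp: d_def divide_simps)
              then show ?thesis using A S(6) False by (simp add: \<eta>_def)
            qed
          qed
          then show ?thesis by (rule tendsto_eventually)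
        next
          case False
          then have "z \<notin> {a..b}" using e0 by auto
          with False show ?thesis by simp
        qed
        then show ?case unfolding eq .
      qed
    qed
    then show ?thesis
      using set_lebesgue_integral_eq_integral(2)[OF vI'] unfolding set_lebesgue_integral_def by simp
  qed
  have "(LINT z:\<Omega>|lebesgue. deriv (\<eta> n) z *\<^sub>R u z) = - (LINT z:\<Omega>|lebesgue. \<eta> n z *\<^sub>R v z)" for n
    using wd test unfolding has_weak_deriv_def by blast
  then have "u a - u b = - integral {a..b} v"
    using LIMSEQ_unique[OF conv1] tendsto_minus[OF conv2] by simp
  then have "integral {a..b} v = u b - u a" by (simp add: algebra_simps minus_equation_iff)
  moreover have "v integrable_on {a..b}"
    by (rule set_lebesgue_integral_eq_integral(1), rule set_integrable_subset[OF vI]) (use e0 in auto)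
  ultimately show ?thesis by (simp add: has_integral_iff)
qed (use has_integral_refl in simp)

section \<open>Uniqueness of weak derivatives and the H1 norm\<close>

text \<open>After extension by zero the integrals over all half-lines \<open>{..c}\<close> vanish.
  Half-lines are an intersection-stable generator, so by Dynkin's theorem the integrals over Borel
  sets vanish, then over Lebesgue sets, and componentwise uniqueness of densities finishes the
  argument.\<close>

lemma negligible_if_interval_integrals_zero:
  fixes f :: "real \<Rightarrow> 'a::euclidean_space"
  assumes f: "f absolutely_integrable_on {a..b}" and z: "\<And>c. c \<in> {a..b} \<Longrightarrow> integral {a..c} f = 0"
  shows "negligible {x\<in>{a..b}. f x \<noteq> 0}"
proof -
  define g where "g x = indicat_real {a..b} x *\<^sub>R f x" for x
  have g: "integrable lebesgue g" using f unfolding set_integrable_def g_def[abs_def] .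
  have gA: "set_integrable lebesgue A g" if "A \<in> sets lebesgue" for A
    unfolding set_integrable_def using g that by (rule integrable_mult_indicator[rotated])
  have half: "set_lebesgue_integral lebesgue {..c} g = 0" for c
  proof (cases "c < a")
    case True
    then have "(\<lambda>x. indicat_real {..c} x *\<^sub>R g x) = (\<lambda>x. 0)" by (auto simp: g_def fun_eq_iff indicator_def)
    then show ?thesis by (simp add: set_lebesgue_integral_def)
  next
    case False
    define d where "d = min b c"
    have "(\<lambda>x. indicat_real {..c} x *\<^sub>R g x) = (\<lambda>x. indicat_real {a..d} x *\<^sub>R f x)"
      using False by (auto simp: g_def fun_eq_iff indicator_def d_def)
    then have "set_lebesgue_integral lebesgue {..c} g = set_lebesgue_integral lebesgue {a..d} f"
      by (simp add: set_lebesgue_integral_def)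
    also have "\<dots> = integral {a..d} f"
      by (rule set_lebesgue_integral_eq_integral(2)[OF set_integrable_subset[OF f]]) (auto simp: d_def)
    also have "\<dots> = 0" using z[of d] False by (cases "d \<ge> a") (auto simp: d_def)
    finally show ?thesis .
  qed
  have UN: "set_lebesgue_integral lebesgue UNIV g = 0"
  proof -
    have "set_lebesgue_integral lebesgue UNIV g = set_lebesgue_integral lebesgue {..b} g"
      unfolding set_lebesgue_integral_def
      by (rule Bochner_Integration.integral_cong) (auto simp: g_def indicator_def)
    then show ?thesis using half[of b] by simp
  qed
  have sb: "A \<in> sets lebesgue" if "A \<in> sigma_sets UNIV (range (\<lambda>a::real. {..a}))" for A
  proof -
    have "A \<in> sets borel" using that by (simp add: borel_eq_atMost)
    then show ?thesis by auto
  qed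
  have bor: "set_lebesgue_integral lebesgue A g = 0" if "A \<in> sets borel" for A
  proof -
    have "A \<in> sigma_sets UNIV (range (\<lambda>a::real. {..a}))"
      using that by (simp add: borel_eq_atMost)
    have st: "Int_stable (range (\<lambda>a::real. {..a}))"
      by (auto simp: Int_stable_def)
    have pw: "range (\<lambda>a::real. {..a}) \<subseteq> Pow UNIV" by simp
    from st pw \<open>A \<in> sigma_sets UNIV _\<close> show ?thesis
    proof (induction rule: sigma_sets_induct_disjoint)
      case (basic A)
      then show ?case using half by auto
    next
      case (compl A)
      then have A: "A \<in> sets lebesgue" by (intro sb)
      have "set_lebesgue_integral lebesgue (A \<union> (UNIV - A)) g = set_lebesgue_integral lebesgue A g + set_lebesgue_integral lebesgue (UNIV - A) g"
        using A by (intro set_integral_Un gA) auto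
      then show ?case using compl UN by simp
    next
      case (union A)
      have A: "A i \<in> sets lebesgue" for i
        using union(2) by (intro sb) auto
      have "set_lebesgue_integral lebesgue (\<Union>i. A i) g = (\<Sum>i. set_lebesgue_integral lebesgue (A i) g)"
        using union(1) A by (intro lebesgue_integral_countable_add gA) (auto simp: disjoint_family_on_def)
      then show ?case using union by simp
    qed (auto simp: set_lebesgue_integral_def)
  qed
  have "set_lebesgue_integral lebesgue A g = 0" if A: "A \<in> sets lebesgue" for A
  proof -
    \<comment> \<open>The main part of \<open>A\<close> is a Borel set that differs from
      \<open>A\<close> by a null set only.\<close>
    have "set_lebesgue_integral lebesgue A g = set_lebesgue_integral lebesgue (main_part lborel A) g"
    proof (rule set_integral_cong_set)
      show ae: "AE x in lebesgue. (x \<in> main_part lborel A) = (x \<in> A)"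
        using AE_in_main_part[OF A] by (auto simp: AE_completion)
      have "main_part lborel A \<in> sets lebesgue" using main_part_sets[OF A] by simp
      with gA A show "set_borel_measurable lebesgue A g" "set_borel_measurable lebesgue (main_part lborel A) g"
        unfolding set_borel_measurable_def set_integrable_def by (blast intro: borel_measurable_integrable)+
    qed
    also have "\<dots> = 0" using main_part_sets[OF A] by (intro bor) simp
    finally show ?thesis .
  qed
  note gA0 = this
  have "AE x in lebesgue. g x \<bullet> i = 0" for i
  proof (rule density_unique_real[where f' = "\<lambda>_. 0"])
    fix A :: "real set" assume A: "A \<in> sets lebesgue"
    have "set_lebesgue_integral lebesgue A (\<lambda>x. g x \<bullet> i) = (LINT x|lebesgue. (indicat_real A x *\<^sub>R g x) \<bullet> i)"
      by (simp add: set_lebesgue_integral_def)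
    also have "\<dots> = set_lebesgue_integral lebesgue A g \<bullet> i"
      unfolding set_lebesgue_integral_def using gA[OF A] unfolding set_integrable_def by (intro integral_inner_left)
    finally show "set_lebesgue_integral lebesgue A (\<lambda>x. g x \<bullet> i) = set_lebesgue_integral lebesgue A (\<lambda>_. 0)"
      using gA0[OF A] by simp
  qed (use g in auto)
  then have "AE x in lebesgue. \<forall>i\<in>Basis. g x \<bullet> i = 0"
    by (intro AE_finite_allI) auto
  then have "AE x in lebesgue. g x = 0" by (simp add: euclidean_all_zero_iff)
  then obtain N where "N \<in> null_sets lebesgue" "{x. g x \<noteq> 0} \<subseteq> N" by (auto simp: eventually_ae_filter)
  then show ?thesis
    unfolding negligible_iff_null_sets[symmetric]
    by (elim negligible_subset) (auto simp: g_def)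
qed

lemma absolutely_integrable_continuous_scaleR:
  fixes \<eta> :: "real \<Rightarrow> real" and v :: "real \<Rightarrow> 'a::euclidean_space"
  assumes v: "v absolutely_integrable_on {a..b}" and c: "continuous_on UNIV \<eta>"
  shows "(\<lambda>x. \<eta> x *\<^sub>R v x) absolutely_integrable_on {a..b}"
proof -
  have "compact (\<eta> ` {a..b})" by (intro compact_continuous_image continuous_on_subset[OF c]) auto
  then obtain B where B: "\<And>x. x \<in> {a..b} \<Longrightarrow> \<bar>\<eta> x\<bar> \<le> B"
    using compact_imp_bounded by (fastforce simp: bounded_iff)
  show ?thesis
    unfolding set_integrable_def
  proof (rule Bochner_Integration.integrable_bound)
    show "integrable lebesgue (\<lambda>x. B * norm (indicat_real {a..b} x *\<^sub>R v x))"
      using v unfolding set_integrable_def by (intro integrable_mult_right integrable_norm)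
    have eq: "(\<lambda>x. indicat_real {a..b} x *\<^sub>R \<eta> x *\<^sub>R v x) = (\<lambda>x. \<eta> x *\<^sub>R (indicat_real {a..b} x *\<^sub>R v x))"
      by (simp add: mult.commute)
    have "\<eta> \<in> borel_measurable lebesgue"
      by (intro measurable_completion) (simp add: borel_measurable_continuous_onI c)
    then show "(\<lambda>x. indicat_real {a..b} x *\<^sub>R \<eta> x *\<^sub>R v x) \<in> borel_measurable lebesgue"
      unfolding eq by (rule borel_measurable_scaleR) (use v in \<open>simp add: set_integrable_def borel_measurable_integrable del: borel_measurable_scaleR\<close>)
    show "AE x in lebesgue. norm (indicat_real {a..b} x *\<^sub>R \<eta> x *\<^sub>R v x) \<le> norm (B * norm (indicat_real {a..b} x *\<^sub>R v x))"
    proof (rule AE_I2)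
      fix x
      show "norm (indicat_real {a..b} x *\<^sub>R \<eta> x *\<^sub>R v x) \<le> norm (B * norm (indicat_real {a..b} x *\<^sub>R v x))"
      proof (cases "x \<in> {a..b}")
        case True
        then have "\<bar>\<eta> x\<bar> * norm (v x) \<le> \<bar>B\<bar> * norm (v x)" using B[OF True] by (intro mult_right_mono) auto
        with True show ?thesis by (simp add: abs_mult)
      qed auto
    qed
  qed
qed

lemma set_integral_open_closed:
  fixes f :: "real \<Rightarrow> 'a::euclidean_space"
  shows "f absolutely_integrable_on {a<..<b} \<longleftrightarrow> f absolutely_integrable_on {a..b}"
    and "(LINT x:{a<..<b}|lebesgue. f x) = (LINT x:{a..b}|lebesgue. f x)"
proof -
  have ae: "AE x in lebesgue. x \<noteq> a" "AE x in lebesgue. x \<noteq> b"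
    by (rule AE_completion, rule AE_lborel_singleton)+
  show 1: "f absolutely_integrable_on {a<..<b} \<longleftrightarrow> f absolutely_integrable_on {a..b}"
    by (rule absolutely_integrable_spike_set_eq; rule negligible_subset[of "{a, b}"]) auto
  show "(LINT x:{a<..<b}|lebesgue. f x) = (LINT x:{a..b}|lebesgue. f x)"
  proof (cases "f absolutely_integrable_on {a..b}")
    case True
    then show ?thesis
      using 1 set_lebesgue_integral_eq_integral(2)[of "{a..b}" f] set_lebesgue_integral_eq_integral(2)[of "{a<..<b}" f]
        integral_open_interval_real[of a b f] by simp
  next
    \<comment> \<open>Without integrability both integrals are the default value 0.\<close>
    case False
    then show ?thesis using 1 by (simp add: set_lebesgue_integral_def set_integrable_def not_integrable_integral_eq)
  qed
qed

text \<open>Integration by parts: the closed support of a test function avoids the end points of the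
  open interval, so no boundary terms arise. The finite set \<open>S\<close> is there for the kinks
  of piecewise linear functions.\<close>

lemma has_weak_deriv_classical:
  fixes u v :: "real \<Rightarrow> 'a::euclidean_space"
  assumes cu: "continuous_on {a..b} u" and S: "finite S"
    and du: "\<And>x. x \<in> {a<..<b} - S \<Longrightarrow> (u has_vector_derivative v x) (at x)"
    and v: "v absolutely_integrable_on {a..b}" and ab: "a < b"
  shows "has_weak_deriv {a<..<b} u v"
  unfolding has_weak_deriv_def
proof (intro conjI ballI)
  have u: "u absolutely_integrable_on {a..b}" by (intro absolutely_integrable_continuous_real cu)
  show "locally_integrable {a<..<b} u" "locally_integrable {a<..<b} v"
    unfolding locally_integrable_def using u v
    by (auto intro!: set_integrable_subset[of lebesgue "{a..b}"] lmeasurable_compact[THEN fmeasurableD] simp: subset_eq)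
  fix \<eta> assume \<eta>: "\<eta> \<in> test_functions {a<..<b}"
  have df: "(deriv ^^ n) \<eta> field_differentiable at x" for n x
    using \<eta> unfolding test_functions_def by blast
  have d\<eta>: "(\<eta> has_field_derivative deriv \<eta> x) (at x)" for x
    using df[of 0 x] by (simp add: DERIV_deriv_iff_field_differentiable)
  have d2\<eta>: "(deriv \<eta> has_field_derivative deriv (deriv \<eta>) x) (at x)" for x
    using df[of "Suc 0" x] by (simp add: DERIV_deriv_iff_field_differentiable)
  have c\<eta>: "continuous_on A \<eta>" and cd\<eta>: "continuous_on A (deriv \<eta>)" for A
    using d\<eta> d2\<eta> by (meson DERIV_isCont continuous_at_imp_continuous_on)+
  have "a \<notin> closure {x. \<eta> x \<noteq> 0}" "b \<notin> closure {x. \<eta> x \<noteq> 0}"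
    using \<eta> unfolding test_functions_def by auto
  then have ab0: "\<eta> a = 0" "\<eta> b = 0" using closure_subset[of "{x. \<eta> x \<noteq> 0}"] by auto
  have i1: "(\<lambda>x. \<eta> x *\<^sub>R v x) absolutely_integrable_on {a..b}" 
    by (rule absolutely_integrable_continuous_scaleR[OF v c\<eta>])
  have i2: "(\<lambda>x. deriv \<eta> x *\<^sub>R u x) absolutely_integrable_on {a..b}"
    by (rule absolutely_integrable_continuous_scaleR[OF u cd\<eta>])
  have "((\<lambda>x. deriv \<eta> x *\<^sub>R u x) has_integral (- integral {a..b} (\<lambda>x. \<eta> x *\<^sub>R v x))) {a..b}"
  proof (rule integration_by_parts_interior_strong[OF bounded_bilinear_scaleR S, of a b \<eta> u "deriv \<eta>" v])
    show "(\<eta> has_vector_derivative deriv \<eta> x) (at x)" for x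
      using d\<eta> by (simp add: has_real_derivative_iff_has_vector_derivative)
    show "((\<lambda>x. \<eta> x *\<^sub>R v x) has_integral
      \<eta> b *\<^sub>R u b - \<eta> a *\<^sub>R u a - - integral {a..b} (\<lambda>x. \<eta> x *\<^sub>R v x)) {a..b}"
      using set_lebesgue_integral_eq_integral(1)[OF i1] ab0 by (simp add: integrable_integral)
  qed (use ab c\<eta> cu du in auto)
  then show "(LINT x:{a<..<b}|lebesgue. deriv \<eta> x *\<^sub>R u x) = - (LINT x:{a<..<b}|lebesgue. \<eta> x *\<^sub>R v x)"
    unfolding set_integral_open_closed(2)
      set_lebesgue_integral_eq_integral(2)[OF i1] set_lebesgue_integral_eq_integral(2)[OF i2]
    by (rule integral_unique)
qed

text \<open>On every compact subinterval both candidates integrate to the same increments of the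
  continuous \<open>u\<close>, and an open set is a countable union of such intervals.\<close>

lemma has_weak_deriv_unique:
  fixes u v w :: "real \<Rightarrow> 'a::euclidean_space"
  assumes v: "has_weak_deriv \<Omega> u v" and w: "has_weak_deriv \<Omega> u w"
    and op: "open \<Omega>" and cu: "continuous_on \<Omega> u"
  shows "negligible {x\<in>\<Omega>. v x \<noteq> w x}"
proof -
  obtain D :: "real set set" where D: "countable D" "D \<subseteq> Pow \<Omega>" "\<And>I. I \<in> D \<Longrightarrow> \<exists>a b. I = cbox a b" "\<Union>D = \<Omega>"
    by (rule open_countable_Union_open_cbox[OF op]) presburger
  have "negligible {x\<in>I. v x \<noteq> w x}" if I: "I \<in> D" for I
  proof -
    from D(3)[OF I] obtain a b where "I = cbox a b" by blast
    moreover have "I \<subseteq> \<Omega>" using D(2) I by blast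
    ultimately have I': "I = {a..b}" "{a..b} \<subseteq> \<Omega>" by simp_all
    have ai: "v absolutely_integrable_on {a..b}" "w absolutely_integrable_on {a..b}"
      using v w I' unfolding has_weak_deriv_def locally_integrable_def by auto
    have "negligible {x\<in>{a..b}. v x - w x \<noteq> 0}"
    proof (rule negligible_if_interval_integrals_zero)
      show "(\<lambda>x. v x - w x) absolutely_integrable_on {a..b}" using ai by (rule set_integral_diff)
      fix c assume c: "c \<in> {a..b}"
      then have "{a..c} \<subseteq> \<Omega>" "a \<le> c" using I' by (auto simp: subset_eq)
      then have "((\<lambda>x. v x - w x) has_integral ((u c - u a) - (u c - u a))) {a..c}"
        by (intro has_integral_diff weak_deriv_has_integral[OF v op cu] weak_deriv_has_integral[OF w op cu])
      then show "integral {a..c} (\<lambda>x. v x - w x) = 0" by (simp add: integral_unique)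
    qed
    then show ?thesis by (simp add: I')
  qed
  then have "negligible (\<Union>I\<in>D. {x\<in>I. v x \<noteq> w x})"
    using D(1) by (intro negligible_countable_Union) blast+
  moreover have "{x\<in>\<Omega>. v x \<noteq> w x} \<subseteq> (\<Union>I\<in>D. {x\<in>I. v x \<noteq> w x})" using D(4) by blast
  ultimately show ?thesis by (rule negligible_subset)
qed

text \<open>\<open>weak_deriv\<close> is an unspecified choice; uniqueness up to null sets permits
  replacing it by whichever weak derivative is at hand.\<close>

lemma sobolev_norm_1_eq:
  fixes u v :: "real \<Rightarrow> 'a::euclidean_space"
  assumes v: "has_weak_deriv {0<..<2*pi} u v" and cu: "continuous_on {0<..<2*pi} u"
    and sq: "(\<lambda>x. (norm (v x))\<^sup>2) absolutely_integrable_on {0..2*pi}"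
  shows "(sobolev_norm 1 u)\<^sup>2 = (LINT x:{0..2*pi}|lebesgue. (norm (u x))\<^sup>2) + (LINT x:{0..2*pi}|lebesgue. (norm (v x))\<^sup>2)"
proof -
  let ?I = "{0<..<2*pi} :: real set"
  define w where "w = weak_deriv ?I u"
  have w: "has_weak_deriv ?I u w" unfolding w_def weak_deriv_def by (rule someI[where P = "has_weak_deriv ?I u", OF v])
  have neg: "negligible {x\<in>?I. v x \<noteq> w x}" by (rule has_weak_deriv_unique[OF v w _ cu]) auto
  have sq': "(\<lambda>x. (norm (v x))\<^sup>2) absolutely_integrable_on ?I" using sq by (simp add: set_integral_open_closed)
  have sqw: "(\<lambda>x. (norm (w x))\<^sup>2) absolutely_integrable_on ?I"
    by (rule absolutely_integrable_spike[OF sq' neg]) auto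
  have "(LINT x:?I|lebesgue. (norm (w x))\<^sup>2) = (LINT x:?I|lebesgue. (norm (v x))\<^sup>2)"
    unfolding set_lebesgue_integral_eq_integral(2)[OF sqw] set_lebesgue_integral_eq_integral(2)[OF sq']
    by (rule integral_spike[OF neg]) auto
  moreover have nn: "(LINT x:?I|lebesgue. (norm (f x))\<^sup>2) \<ge> 0" for f :: "real \<Rightarrow> 'a"
    unfolding set_lebesgue_integral_def by (rule Bochner_Integration.integral_nonneg) auto
  ultimately show ?thesis
    unfolding sobolev_norm_def L2_norm_def set_integral_open_closed(2)[symmetric]
    by (simp add: atMost_Suc w_def[symmetric])
qed

section \<open>Ordinary differential equations and finite-dimensional linear problems\<close>

text \<open>The Picard operator is a contraction for the norm weighted by \<open>exp (- K t)\<close>; the weight is built into the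
  unknown \<open>y t = exp (- K t) *\<^sub>R x t\<close>, so that the plain supremum norm can be used.\<close>

lemma picard_lindelof:
  fixes F :: "real \<Rightarrow> 'a::banach \<Rightarrow> 'a"
  assumes T: "T \<ge> 0" and L: "L \<ge> 0"
    and lip: "\<And>t x y. t \<in> {0..T} \<Longrightarrow> norm (F t x - F t y) \<le> L * norm (x - y)"
    and cont: "\<And>x. continuous_on {0..T} x \<Longrightarrow> continuous_on {0..T} (\<lambda>t. F t (x t))"
  obtains x where "x 0 = x0" "\<And>t. t \<in> {0..T} \<Longrightarrow> (x has_vector_derivative F t (x t)) (at t within {0..T})"
proof -
  \<comment> \<open>The integral of \<open>L * exp (K * s)\<close> up to \<open>t\<close> is at most
    \<open>L / K * exp (K * t)\<close>; \<open>L \<le> K / 2\<close> makes the contraction factor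
    \<open>1 / 2\<close>, and the summand 1 keeps \<open>K\<close> positive when
    \<open>L = 0\<close>.\<close>
  define K where "K = 2 * L + 1"
  have K: "K > 0" "L \<le> K / 2" using L by (auto simp: K_def)
  \<comment> \<open>Time is clamped to \<open>{0..T}\<close> so that the iterates become bounded
    continuous functions on the whole line, a complete space on which the fixed point theorem
    applies.\<close>
  define cl where "cl t = max 0 (min t T)" for t
  have cl: "cl t \<in> {0..T}" for t using T by (auto simp: cl_def)
  have cl_id: "cl t = t" if "t \<in> {0..T}" for t using that by (auto simp: cl_def)
  have ccl: "continuous_on UNIV cl" unfolding cl_def by (intro continuous_intros)
  define G where "G y s = F s (exp (K * s) *\<^sub>R apply_bcontfun y s)" for y :: "real \<Rightarrow>\<^sub>C 'a" and s
  have cG: "continuous_on {0..T} (G y)" for y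
    unfolding G_def by (intro cont continuous_intros) auto
  have iG: "G y integrable_on {0..t}" if "t \<in> {0..T}" for y t
    using that by (intro integrable_continuous_real continuous_on_subset[OF cG]) auto
  define g where "g y t = exp (- K * t) *\<^sub>R (x0 + integral {0..t} (G y))" for y t
  have cg: "continuous_on {0..T} (g y)" for y
    unfolding g_def using iG[of T y] T by (intro continuous_intros indefinite_integral_continuous_1) auto
  define \<Phi> where "\<Phi> y = Bcontfun (\<lambda>t. g y (cl t))" for y
  have bc: "(\<lambda>t. g y (cl t)) \<in> bcontfun" for y
  proof -
    have "compact (g y ` {0..T})" by (intro compact_continuous_image cg) auto
    then obtain B where "\<And>t. t \<in> {0..T} \<Longrightarrow> norm (g y t) \<le> B"
      using compact_imp_bounded by (fastforce simp: bounded_iff)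
    then show ?thesis
      using cl by (intro bcontfun_normI[of _ B] continuous_on_compose2[OF cg ccl]) auto
  qed
  have app: "apply_bcontfun (\<Phi> y) t = g y (cl t)" for y t
    using bc[of y] by (simp add: \<Phi>_def Bcontfun_inverse)
  have contr: "dist (\<Phi> y) (\<Phi> z) \<le> 1 / 2 * dist y z" for y z
  proof (rule dist_bound)
    fix t0
    define t where "t = cl t0"
    have t: "t \<in> {0..T}" using cl by (simp add: t_def)
    have sub: "{0..t} \<subseteq> {0..T}" using t by auto
    have eint: "((\<lambda>s. L * dist y z * exp (K * s)) has_integral L * dist y z / K * exp (K * t) - L * dist y z / K * exp (K * 0)) {0..t}"
      using t K by (intro fundamental_theorem_of_calculus)
        (auto intro!: derivative_eq_intros simp flip: has_real_derivative_iff_has_vector_derivative)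
    have "norm (integral {0..t} (\<lambda>s. G y s - G z s)) \<le> integral {0..t} (\<lambda>s. L * dist y z * exp (K * s))"
    proof (rule integral_norm_bound_integral)
      show "(\<lambda>s. G y s - G z s) integrable_on {0..t}" using iG[OF t] by (intro integrable_diff)
      show "(\<lambda>s. L * dist y z * exp (K * s)) integrable_on {0..t}" using eint by auto
      fix s assume "s \<in> {0..t}"
      then have s: "s \<in> {0..T}" using sub by auto
      have "norm (G y s - G z s) \<le> L * norm (exp (K * s) *\<^sub>R apply_bcontfun y s - exp (K * s) *\<^sub>R apply_bcontfun z s)"
        unfolding G_def by (rule lip[OF s])
      also have "\<dots> = L * (exp (K * s) * dist (apply_bcontfun y s) (apply_bcontfun z s))"
        by (simp add: dist_norm flip: scaleR_diff_right)
      also have "\<dots> \<le> L * (exp (K * s) * dist y z)"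
        using L dist_bounded[of y s z] by (intro mult_left_mono) auto
      finally show "norm (G y s - G z s) \<le> L * dist y z * exp (K * s)" by (simp add: ac_simps)
    qed
    also have "\<dots> = L * dist y z / K * exp (K * t) - L * dist y z / K" using integral_unique[OF eint] by simp
    also have "\<dots> \<le> L / K * dist y z * exp (K * t)" using L K by simp
    also have "\<dots> \<le> 1 / 2 * dist y z * exp (K * t)"
      using K by (intro mult_right_mono) (auto simp: divide_simps)
    finally have *: "norm (integral {0..t} (\<lambda>s. G y s - G z s)) \<le> 1 / 2 * dist y z * exp (K * t)" .
    have "dist (g y t) (g z t) = exp (- K * t) * norm (integral {0..t} (G y) - integral {0..t} (G z))"
      unfolding g_def dist_norm by (simp flip: scaleR_diff_right)
    also have "integral {0..t} (G y) - integral {0..t} (G z) = integral {0..t} (\<lambda>s. G y s - G z s)"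
      using iG[OF t] by (simp add: integral_diff)
    also have "exp (- K * t) * norm (integral {0..t} (\<lambda>s. G y s - G z s)) \<le> exp (- K * t) * (1 / 2 * dist y z * exp (K * t))"
      using * by (intro mult_left_mono) auto
    also have "\<dots> = 1 / 2 * dist y z" by (simp add: exp_minus)
    finally show "dist (apply_bcontfun (\<Phi> y) t0) (apply_bcontfun (\<Phi> z) t0) \<le> 1 / 2 * dist y z"
      by (simp add: app t_def)
  qed
  obtain y where y: "\<Phi> y = y"
    using banach_fix_type[of "1/2" \<Phi>] contr by auto
  define x where "x t = exp (K * t) *\<^sub>R apply_bcontfun y t" for t
  have G: "G y = (\<lambda>t. F t (x t))" by (simp add: G_def x_def fun_eq_iff)
  have x: "x t = x0 + integral {0..t} (G y)" if "t \<in> {0..T}" for t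
  proof -
    have "apply_bcontfun y t = g y t" using app[of y t] y cl_id[OF that] by simp
    then show ?thesis by (simp add: x_def g_def exp_minus)
  qed
  show thesis
  proof
    show "x 0 = x0" using x[of 0] T by simp
    fix t assume t: "t \<in> {0..T}"
    have "((\<lambda>t. x0 + integral {0..t} (G y)) has_vector_derivative 0 + G y t) (at t within {0..T})"
      by (intro has_vector_derivative_add has_vector_derivative_const integral_has_vector_derivative[OF cG t])
    then have "(x has_vector_derivative G y t) (at t within {0..T})"
      using t by (auto intro: has_vector_derivative_transform[where f = "\<lambda>t. x0 + integral {0..t} (G y)"] simp: x)
    then show "(x has_vector_derivative F t (x t)) (at t within {0..T})" by (simp add: G)
  qed
qed

section \<open>Gronwall inequalities and continuation in time\<close>

text \<open>The dissipation \<open>g\<close> has to survive on the left, because its time integral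
  will bound the velocity error. The function \<open>H\<close> below is nonincreasing; bounding
  \<open>exp (- K * s)\<close> from below by \<open>exp (- K * \<tau>)\<close> then releases
  \<open>g\<close> from the weight.\<close>

lemma gronwall_energy:
  fixes f f' g :: "real \<Rightarrow> real"
  assumes \<tau>: "\<tau> \<ge> 0" and K: "K \<ge> 0" and R: "R \<ge> 0" and f0: "f 0 = 0"
    and df: "\<And>t. t \<in> {0..\<tau>} \<Longrightarrow> (f has_real_derivative f' t) (at t within {0..\<tau>})"
    and cg: "continuous_on {0..\<tau>} g" and g: "\<And>t. t \<in> {0..\<tau>} \<Longrightarrow> g t \<ge> 0"
    and ineq: "\<And>t. 0 < t \<Longrightarrow> t < \<tau> \<Longrightarrow> f' t + g t \<le> K * f t + R"
  shows "f \<tau> + integral {0..\<tau>} g \<le> R * \<tau> * exp (K * \<tau>)"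
proof (cases "\<tau> = 0")
  case False
  then have \<tau>: "\<tau> > 0" using \<tau> by simp
  define H where "H t = exp (- K * t) * f t + integral {0..t} (\<lambda>s. exp (- K * s) * g s) - R * t" for t
  have cG: "continuous_on {0..\<tau>} (\<lambda>s. exp (- K * s) * g s)" by (intro continuous_intros cg)
  have dH: "(H has_real_derivative (exp (- K * t) * f' t - K * exp (- K * t) * f t + exp (- K * t) * g t - R)) (at t within {0..\<tau>})"
    if t: "t \<in> {0..\<tau>}" for t
  proof -
    have "((\<lambda>t. integral {0..t} (\<lambda>s. exp (- K * s) * g s)) has_real_derivative exp (- K * t) * g t) (at t within {0..\<tau>})"
      using integral_has_vector_derivative[OF cG t] by (simp only: has_real_derivative_iff_has_vector_derivative)
    then show ?thesis
      unfolding H_def by (auto intro!: derivative_eq_intros df[OF t])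
  qed
  have "H \<tau> \<le> H 0"
  proof (rule DERIV_nonpos_imp_decreasing_open[of 0 \<tau> H])
    show "continuous_on {0..\<tau>} H"
      using dH by (meson DERIV_continuous continuous_on_eq_continuous_within)
    fix t assume t: "0 < t" "t < \<tau>"
    then have "(H has_real_derivative (exp (- K * t) * f' t - K * exp (- K * t) * f t + exp (- K * t) * g t - R)) (at t)"
      using dH[of t] by (simp add: at_within_Icc_at)
    moreover have "exp (- K * t) * (f' t + g t - K * f t) \<le> exp (- K * t) * R"
      using ineq[of t] t by (intro mult_left_mono) auto
    moreover have "exp (- K * t) * R \<le> 1 * R" using K t R by (intro mult_right_mono) auto
    ultimately show "\<exists>y. (H has_real_derivative y) (at t) \<and> y \<le> 0"
      by (intro exI[of _ "exp (- K * t) * f' t - K * exp (- K * t) * f t + exp (- K * t) * g t - R"])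
        (simp add: algebra_simps)
  qed (use \<tau> in auto)
  then have H: "exp (- K * \<tau>) * f \<tau> + integral {0..\<tau>} (\<lambda>s. exp (- K * s) * g s) \<le> R * \<tau>"
    by (simp add: H_def f0)
  have "exp (- K * \<tau>) * integral {0..\<tau>} g = integral {0..\<tau>} (\<lambda>s. exp (- K * \<tau>) * g s)" by simp
  also have "\<dots> \<le> integral {0..\<tau>} (\<lambda>s. exp (- K * s) * g s)"
    using K g by (intro integral_le integrable_continuous_real cG continuous_intros cg mult_right_mono) (auto intro: mult_left_mono)
  finally have "exp (- K * \<tau>) * (f \<tau> + integral {0..\<tau>} g) \<le> R * \<tau>" using H by (simp add: algebra_simps)
  then have "exp (K * \<tau>) * (exp (- K * \<tau>) * (f \<tau> + integral {0..\<tau>} g)) \<le> exp (K * \<tau>) * (R * \<tau>)"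
    by (intro mult_left_mono) auto
  moreover have "exp (K * \<tau>) * (exp (- K * \<tau>) * (f \<tau> + integral {0..\<tau>} g)) = f \<tau> + integral {0..\<tau>} g"
    by (simp add: exp_minus)
  ultimately have "f \<tau> + integral {0..\<tau>} g \<le> exp (K * \<tau>) * (R * \<tau>)" by linarith
  then show ?thesis by (simp only: mult.commute)
qed (use f0 in simp)

text \<open>\<open>exp (- K * t) * z t\<close> is nonincreasing. The derivative is requested only in
  the open interval, since that is where the nodal values of a weak solution are shown to be
  differentiable.\<close>

lemma gronwall_zero:
  fixes z :: "real \<Rightarrow> real"
  assumes \<tau>: "\<tau> \<ge> 0" and z0: "z 0 \<le> 0" and cz: "continuous_on {0..\<tau>} z"
    and dz: "\<And>t. 0 < t \<Longrightarrow> t < \<tau> \<Longrightarrow> \<exists>y. (z has_real_derivative y) (at t) \<and> y \<le> K * z t"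
  shows "z \<tau> \<le> 0"
proof (cases "\<tau> = 0")
  case False
  define H where "H t = exp (- K * t) * z t" for t
  have "H \<tau> \<le> H 0"
  proof (rule DERIV_nonpos_imp_decreasing_open[of 0 \<tau> H])
    show "continuous_on {0..\<tau>} H" unfolding H_def by (intro continuous_intros cz)
    fix t assume t: "0 < t" "t < \<tau>"
    then obtain y where y: "(z has_real_derivative y) (at t)" "y \<le> K * z t" using dz by blast
    have "(H has_real_derivative exp (- K * t) * (y - K * z t)) (at t)"
      unfolding H_def by (auto intro!: derivative_eq_intros y(1) simp: algebra_simps)
    moreover have "exp (- K * t) * (y - K * z t) \<le> 0" using y by (intro mult_nonneg_nonpos) auto
    ultimately show "\<exists>y. (H has_real_derivative y) (at t) \<and> y \<le> 0" by blast
  qed (use False \<tau> in auto)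
  also have "H 0 \<le> 0" using z0 by (simp add: H_def)
  finally show ?thesis by (simp add: H_def mult_le_0_iff)
qed (use z0 in simp)

text \<open>At the first time at which \<open>g\<close> reaches \<delta> the weak inequality still
  holds up to and including that time, and \<open>step\<close> turns it into a strict one there, a
  contradiction.\<close>

lemma continuous_bootstrap:
  fixes g :: "real \<Rightarrow> real"
  assumes cg: "continuous_on {0..T} g" and g0: "g 0 < \<delta>"
    and step: "\<And>\<tau>. \<tau> \<in> {0..T} \<Longrightarrow> (\<And>t. t \<in> {0..\<tau>} \<Longrightarrow> g t \<le> \<delta>) \<Longrightarrow> g \<tau> < \<delta>"
    and t: "t \<in> {0..T}"
  shows "g t < \<delta>"
proof (rule ccontr)
  assume "\<not> g t < \<delta>"
  define S where "S = {0..T} \<inter> g -` {\<delta>..}"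
  have "closed S" unfolding S_def by (intro continuous_closed_preimage cg) auto
  moreover have "bounded S" unfolding S_def by (rule bounded_subset[of "{0..T}"]) auto
  ultimately have S: "compact S" by (simp add: compact_eq_bounded_closed)
  moreover have "S \<noteq> {}" using \<open>\<not> g t < \<delta>\<close> t by (auto simp: S_def)
  ultimately obtain t0 where t0: "t0 \<in> S" "\<And>s. s \<in> S \<Longrightarrow> t0 \<le> s" using compact_attains_inf by metis
  have t0': "t0 \<in> {0..T}" "g t0 \<ge> \<delta>" using t0 by (auto simp: S_def)
  \<comment> \<open>At the first point of the closed set \<open>S\<close> the value is exactly
    \<delta>: a larger value would be preceded by a crossing of the level \<delta>.\<close>
  have "\<exists>x\<ge>0. x \<le> t0 \<and> g x = \<delta>"
    by (rule IVT') (use g0 t0' in \<open>auto intro: continuous_on_subset[OF cg]\<close>)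
  then obtain x where x: "0 \<le> x" "x \<le> t0" "g x = \<delta>" by blast
  then have "x \<in> S" using t0' by (auto simp: S_def)
  then have "g t0 = \<delta>" using t0(2) x by force
  moreover have "g s \<le> \<delta>" if "s \<in> {0..t0}" for s
  proof (cases "s = t0")
    case False
    then have "s \<notin> S" using t0(2) that by force
    then show ?thesis using that t0' by (auto simp: S_def)
  qed (use \<open>g t0 = \<delta>\<close> in simp)
  ultimately show False using step[OF t0'(1)] by simp
qed

text \<open>Inside the open interval the violation set is open and negligible, hence empty; the end
  points follow by closure.\<close>

lemma AE_le_imp_le_continuous:
  fixes f :: "real \<Rightarrow> real"
  assumes T: "T > 0" and cf: "continuous_on {0..T} f" and ae: "AE t in lebesgue_on {0<..<T}. f t \<le> B"
    and t: "t \<in> {0..T}"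
  shows "f t \<le> B"
proof -
  define S where "S = {0<..<T} \<inter> f -` {B<..}"
  have "open S" unfolding S_def
    by (intro continuous_open_preimage continuous_on_subset[OF cf]) auto
  moreover have "negligible S"
  proof -
    have "AE t in lebesgue. t \<in> {0<..<T} \<longrightarrow> f t \<le> B" using ae by (subst (asm) AE_restrict_space_iff) auto
    then obtain N where "N \<in> null_sets lebesgue" "{t. \<not> (t \<in> {0<..<T} \<longrightarrow> f t \<le> B)} \<subseteq> N"
      by (auto simp: eventually_ae_filter)
    then show ?thesis
      unfolding negligible_iff_null_sets[symmetric] by (elim negligible_subset) (auto simp: S_def)
  qed
  ultimately have "S = {}" using open_not_negligible by blast
  then have *: "f s \<le> B" if "s \<in> {0<..<T}" for s using that by (force simp: S_def)
  have "closure {0<..<T} = {0..T}" using T by (simp add: closure_greaterThanLessThan)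
  then show ?thesis
    using continuous_le_on_closure[of "{0<..<T}" f t B] cf t * by simp
qed

section \<open>Linear problems on a finite-dimensional span\<close>

text \<open>A dimension count: a vector outside the image could be added to the image of a basis and
  would make an independent set that is too large. It is carried out within the span because the
  ambient space may be infinite-dimensional.\<close>

lemma linear_inj_span_surj:
  fixes f :: "'a::real_vector \<Rightarrow> 'a"
  assumes f: "linear f" and B: "finite B" and sub: "f ` span B \<subseteq> span B"
    and inj: "\<And>u. u \<in> span B \<Longrightarrow> f u = 0 \<Longrightarrow> u = 0"
  shows "f ` span B = span B"
proof -
  obtain C where C: "C \<subseteq> B" "independent C" "B \<subseteq> span C"
    using maximal_independent_subset[of B] by blast
  have fC: "finite C" using C B finite_subset by auto
  have sp: "span C = span B"
    using C by (metis span_mono span_span subset_antisym)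
  have inj': "inj_on f (span C)"
    using inj f by (subst linear_inj_on_iff_eq_0) (auto simp: sp subspace_span)
  have ind: "independent (f ` C)" by (rule linear_independent_injective_image[OF f C(2) inj'])
  have cC: "card (f ` C) = card C" by (rule card_image) (rule inj_on_subset[OF inj' span_superset])
  have "y \<in> f ` span B" if y: "y \<in> span B" for y
  proof (rule ccontr)
    assume "y \<notin> f ` span B"
    then have n: "y \<notin> span (f ` C)" using linear_span_image[OF f, of C] sp by simp
    then have "independent (insert y (f ` C))" using ind by (simp add: independent_insert)
    moreover have "insert y (f ` C) \<subseteq> span C" using y sub sp span_superset[of C] by auto
    ultimately have "card (insert y (f ` C)) \<le> card C"
      by (rule independent_span_bound[OF fC, THEN conjunct2])
    moreover have "y \<notin> f ` C" using n span_base[of y "f ` C"] by argo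
    ultimately show False using fC cC by simp
  qed
  with sub show ?thesis by blast
qed

text \<open>In finite dimensions definiteness replaces a coercivity constant. The map
  \<open>g\<close> encodes the functional \<open>m u\<close> by its values on a basis
  \<open>C\<close>; definiteness makes it injective, hence onto, and a preimage of the vector that
  encodes \<open>l\<close> is the solution.\<close>

lemma lax_milgram_finite:
  fixes m :: "'a::real_vector \<Rightarrow> 'a \<Rightarrow> real"
  assumes B: "finite B" and m1: "\<And>f. linear (\<lambda>u. m u f)" and m2: "\<And>u. linear (m u)" and l: "linear l"
    and coer: "\<And>u. u \<in> span B \<Longrightarrow> m u u = 0 \<Longrightarrow> u = 0"
  shows "\<exists>!u. u \<in> span B \<and> (\<forall>f\<in>span B. m u f = l f)"
proof -
  obtain C where C: "C \<subseteq> B" "independent C" "B \<subseteq> span C"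
    using maximal_independent_subset[of B] by blast
  have fC: "finite C" using C B finite_subset by auto
  have sp: "span C = span B"
    using C by (metis span_mono span_span subset_antisym)
  define g where "g u = (\<Sum>b\<in>C. m u b *\<^sub>R b)" for u
  have lg: "linear g"
    unfolding g_def
    by (intro linearI) (simp_all add: linear_add[OF m1] linear_scale[OF m1] scaleR_add_left sum.distrib scaleR_sum_right)
  have eqC: "\<forall>f\<in>span B. m u f = k f" if "\<And>b. b \<in> C \<Longrightarrow> m u b = k b" "linear k" for u and k :: "'a \<Rightarrow> real"
    unfolding sp[symmetric] using linear_eq_on_span[OF m2 that(2), of C u] that(1) by blast
  have co: "\<And>b. b \<in> C \<Longrightarrow> p b = q b" if "(\<Sum>b\<in>C. p b *\<^sub>R b) = (\<Sum>b\<in>C. q b *\<^sub>R b)" for p q :: "'a \<Rightarrow> real"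
  proof -
    have "(\<Sum>b\<in>C. (p b - q b) *\<^sub>R b) = 0" using that by (simp add: scaleR_diff_left sum_subtractf)
    then have "\<And>b. b \<in> C \<Longrightarrow> p b - q b = 0" using C(2) fC independentD[OF C(2) fC subset_refl, of "\<lambda>b. p b - q b"] by blast
    then show "\<And>b. b \<in> C \<Longrightarrow> p b = q b" by simp
  qed
  have l0: "linear (\<lambda>_::'a. 0::real)" by (rule linear_zero)
  have "g ` span B = span B"
  proof (rule linear_inj_span_surj[OF lg B])
    show "g ` span B \<subseteq> span B" unfolding g_def sp[symmetric] by (blast intro: span_sum span_scale span_base)
    fix u assume u: "u \<in> span B" "g u = 0"
    then have "m u b = 0" if "b \<in> C" for b using co[of "m u" "\<lambda>_. 0"] that by (simp add: g_def)
    then have "m u u = 0" using eqC[OF _ l0, of u] u by blast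
    then show "u = 0" using coer u by blast
  qed
  moreover have "(\<Sum>b\<in>C. l b *\<^sub>R b) \<in> span B"
    unfolding sp[symmetric] by (blast intro: span_sum span_scale span_base)
  ultimately obtain u where u: "u \<in> span B" "g u = (\<Sum>b\<in>C. l b *\<^sub>R b)" by (metis imageE)
  then have "m u b = l b" if "b \<in> C" for b using co[of "m u" l] that by (simp add: g_def)
  then have "\<forall>f\<in>span B. m u f = l f" using eqC l by blast
  moreover have "v = u" if v: "v \<in> span B" "\<forall>f\<in>span B. m v f = l f" for v
  proof -
    have "v - u \<in> span B" using v u by (simp add: span_diff)
    then have "m v (v - u) = l (v - u)" "m u (v - u) = l (v - u)" 
      using v u \<open>\<forall>f\<in>span B. m u f = l f\<close> by auto
    then have "m (v - u) (v - u) = 0" using linear_diff[OF m1, of v u "v - u"] by simp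
    then show ?thesis using coer[OF \<open>v - u \<in> span B\<close>] by simp
  qed
  ultimately show ?thesis using u(1) by blast
qed

section \<open>Finite elements on a periodic mesh\<close>

lemma periodic2pi_int:
  assumes "periodic2pi u"
  shows "u (x + 2 * pi * of_int k) = u x"
proof -
  have nat: "u (x + 2 * pi * real n) = u x" for n x
  proof (induction n)
    case (Suc n)
    have "u (x + 2 * pi * real (Suc n)) = u ((x + 2 * pi * real n) + 2 * pi)" by (simp add: algebra_simps)
    also have "\<dots> = u (x + 2 * pi * real n)" using assms unfolding periodic2pi_def by blast
    finally show ?case using Suc by simp
  qed simp
  show ?thesis
  proof (cases "k \<ge> 0")
    case True
    then show ?thesis using nat[of x "nat k"] by simp
  next
    case False
    then show ?thesis using nat[of "x + 2 * pi * of_int k" "nat (- k)"] by simp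
  qed
qed

lemma periodic2pi_dx:
  fixes u :: "real \<Rightarrow> 'a::real_normed_vector"
  assumes "periodic2pi u"
  shows "periodic2pi (dx u)"
proof -
  have shift: "((\<lambda>y. u (y + c)) has_vector_derivative d) (at x)" if "(u has_vector_derivative d) (at (x + c))" for u :: "real \<Rightarrow> 'a" and c d x
  proof -
    have "((\<lambda>y. y + c) has_vector_derivative 1) (at x)"
      by (auto intro!: derivative_eq_intros simp flip: has_real_derivative_iff_has_vector_derivative)
    from vector_diff_chain_at[OF this that] show ?thesis by (simp add: o_def)
  qed
  have u: "u (y + 2 * pi) = u y" for y using assms by (simp add: periodic2pi_def)
  have "(u has_vector_derivative d) (at (x + 2 * pi)) \<longleftrightarrow> (u has_vector_derivative d) (at x)" for x d
  proof
    show "(u has_vector_derivative d) (at x)" if "(u has_vector_derivative d) (at (x + 2 * pi))"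
      using shift[OF that] by (simp add: u)
    show "(u has_vector_derivative d) (at (x + 2 * pi))" if d: "(u has_vector_derivative d) (at x)"
    proof -
      have "((\<lambda>y. u (y + (- (2 * pi)))) has_vector_derivative d) (at (x + 2 * pi))"
        by (rule shift) (simp add: d)
      moreover have "u (y + (- (2 * pi))) = u y" for y using u[of "y - 2 * pi"] by simp
      ultimately show ?thesis by simp
    qed
  qed
  then show ?thesis by (simp add: periodic2pi_def dx_def vector_derivative_def)
qed

text \<open>This connects a period that starts at the first mesh point with the fixed interval of
  the norms: the part beyond \<open>2 * pi\<close> is shifted to the front.\<close>

lemma has_integral_periodic:
  fixes f :: "real \<Rightarrow> 'a::banach"
  assumes f: "periodic2pi f" and a: "0 \<le> a" "a \<le> 2 * pi" and int: "(f has_integral I) {a..a + 2 * pi}"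
  shows "(f has_integral I) {0..2 * pi}"
proof -
  obtain I1 where I1: "(f has_integral I1) {a..2*pi}"
    using integrable_on_subinterval[of f "{a..a + 2 * pi}" a "2 * pi"] int a by (auto simp: integrable_on_def)
  obtain I2 where I2: "(f has_integral I2) {2*pi..a + 2*pi}"
    using integrable_on_subinterval[of f "{a..a + 2 * pi}" "2 * pi" "a + 2*pi"] int a by (auto simp: integrable_on_def)
  have "(f has_integral (I1 + I2)) {a..a + 2 * pi}"
    by (rule has_integral_combine[OF _ _ I1 I2]) (use a in auto)
  then have I: "I = I1 + I2" using int has_integral_unique by blast
  have I0: "(f has_integral I2) {0..a}"
    using has_integral_shift_real_ivl[OF I2, of "2 * pi"] f by (simp add: periodic2pi_def)
  have "(f has_integral (I2 + I1)) {0..2*pi}"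
    by (rule has_integral_combine[OF _ _ I0 I1]) (use a in auto)
  then show ?thesis using I by (simp add: add.commute)
qed

text \<open>Three nodes ensure \<open>h < pi\<close>, on which the distance formula for the hat
  functions relies, and distinct neighbours of every node. Since \<open>N * h = 2 * pi\<close>, this
  is automatic for \<open>h \<le> 1\<close>.\<close>

locale fe_mesh =
  fixes N :: nat and \<theta> :: "nat \<Rightarrow> real" and h :: real
  assumes mesh: "periodic_mesh N \<theta> h" and N3: "N \<ge> 3"
begin

text \<open>Cyclic successor: nodal values are indexed by \<open>{1..N}\<close>, and the right end
  of the last element is the first node moved by one period.\<close>

definition nx :: "nat \<Rightarrow> nat" where "nx j = (if j = N then 1 else j + 1)"

lemma nx_in: "j \<in> {1..N} \<Longrightarrow> nx j \<in> {1..N}"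
  using N3 by (auto simp: nx_def)

lemma nx_bij: "bij_betw nx {1..N} {1..N}"
proof -
  have "inj_on nx {1..N}" by (auto simp: inj_on_def nx_def split: if_splits)
  moreover have "nx ` {1..N} \<subseteq> {1..N}" using nx_in by auto
  ultimately show ?thesis by (simp add: bij_betw_def endo_inj_surj)
qed

lemma sum_nx: "(\<Sum>j=1..N. f (nx j)) = (\<Sum>j=1..N. f j)"
  by (rule sum.reindex_bij_betw[OF nx_bij])

lemma mesh_step: "j \<in> {1..N} \<Longrightarrow> \<theta> (j + 1) = \<theta> j + h"
proof -
  assume "j \<in> {1..N}"
  then have "\<theta> j < \<theta> (j + 1)" "\<bar>\<theta> (j + 1) - \<theta> j\<bar> = h" using mesh by (auto simp: periodic_mesh_def)
  then show ?thesis by linarith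
qed

lemma h_pos: "h > 0"
  using mesh mesh_step[of 1] N3 by (force simp: periodic_mesh_def)

lemma node_eq: "j \<le> N \<Longrightarrow> \<theta> (Suc j) = \<theta> 1 + real j * h"
proof (induction j)
  case (Suc j)
  then show ?case using mesh_step[of "Suc j"] by (simp add: algebra_simps)
qed simp

lemma node_eq': "j \<in> {1..N + 1} \<Longrightarrow> \<theta> j = \<theta> 1 + (real j - 1) * h"
  using node_eq[of "j - 1"] by (cases j) auto

lemma node_last: "\<theta> (N + 1) = \<theta> 1 + 2 * pi"
  using mesh by (simp add: periodic_mesh_def)

lemma Nh: "real N * h = 2 * pi"
  using node_eq[of N] node_last by simp

lemma h_le: "h \<le> 2 * pi / 3" 
proof -
  have "3 * h \<le> real N * h" using N3 h_pos by (intro mult_right_mono) auto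
  then show ?thesis using Nh by simp
qed

lemma h_lt_pi: "h < pi" using h_le pi_gt_zero by linarith

lemma theta1: "0 \<le> \<theta> 1" "\<theta> 1 < 2 * pi"
  using mesh by (auto simp: periodic_mesh_def)

lemma node_nx: "periodic2pi u \<Longrightarrow> j \<in> {1..N} \<Longrightarrow> u (\<theta> (j + 1)) = u (\<theta> (nx j))"
  using node_last by (auto simp: nx_def periodic2pi_def)

text \<open>\<open>rep x\<close> is the representative of \<open>x\<close> modulo \<open>2\<pi>\<close> in \<open>[\<theta> 1, \<theta> 1 + 2\<pi>)\<close>, and \<open>idx x\<close> the element that contains it.\<close>

definition rep :: "real \<Rightarrow> real" where "rep x = x - 2 * pi * of_int \<lfloor>(x - \<theta> 1) / (2 * pi)\<rfloor>"

definition idx :: "real \<Rightarrow> nat" where "idx x = nat \<lfloor>(rep x - \<theta> 1) / h\<rfloor> + 1"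

lemma rep_bounds: "\<theta> 1 \<le> rep x" "rep x < \<theta> 1 + 2 * pi"
proof -
  let ?k = "of_int \<lfloor>(x - \<theta> 1) / (2 * pi)\<rfloor> :: real"
  have "?k \<le> (x - \<theta> 1) / (2 * pi)" "(x - \<theta> 1) / (2 * pi) < ?k + 1" by linarith+
  then have "?k * (2 * pi) \<le> x - \<theta> 1" "x - \<theta> 1 < (?k + 1) * (2 * pi)"
    by (simp_all only: pos_le_divide_eq pos_divide_less_eq pi_gt_zero zero_less_mult_iff zero_less_numeral simp_thms)
  then show "\<theta> 1 \<le> rep x" "rep x < \<theta> 1 + 2 * pi" unfolding rep_def by (simp_all add: algebra_simps)
qed

lemma rep_id: "\<theta> 1 \<le> x \<Longrightarrow> x < \<theta> 1 + 2 * pi \<Longrightarrow> rep x = x"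
proof -
  assume "\<theta> 1 \<le> x" "x < \<theta> 1 + 2 * pi"
  then have "\<lfloor>(x - \<theta> 1) / (2 * pi)\<rfloor> = 0" by (intro floor_unique) (auto simp: field_simps)
  then show ?thesis by (simp add: rep_def)
qed

lemma rep_periodic: "rep (x + 2 * pi) = rep x"
proof -
  have "(x + 2 * pi - \<theta> 1) / (2 * pi) = (x - \<theta> 1) / (2 * pi) + 1" by (simp add: field_simps)
  then show ?thesis by (simp add: rep_def algebra_simps)
qed

lemma idx_rep: "idx x \<in> {1..N}" "rep x \<in> {\<theta> (idx x)..<\<theta> (idx x + 1)}"
proof -
  let ?q = "(rep x - \<theta> 1) / h"
  have q: "0 \<le> ?q" "?q < real N" using rep_bounds[of x] h_pos Nh by (auto simp: field_simps)
  then have f: "0 \<le> \<lfloor>?q\<rfloor>" "\<lfloor>?q\<rfloor> < int N" by (auto simp: floor_less_iff)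
  then show i: "idx x \<in> {1..N}" by (simp add: idx_def Suc_le_eq nat_less_iff)
  have "of_int \<lfloor>?q\<rfloor> \<le> ?q" "?q < of_int \<lfloor>?q\<rfloor> + 1" by linarith+
  moreover have "real (idx x) = of_int \<lfloor>?q\<rfloor> + 1" using f by (simp add: idx_def)
  ultimately have "real (idx x) - 1 \<le> ?q" "?q < real (idx x)" by auto
  then show "rep x \<in> {\<theta> (idx x)..<\<theta> (idx x + 1)}"
    using node_eq'[of "idx x"] mesh_step[OF i] i h_pos by (auto simp: field_simps)
qed

lemma element_subset: "j \<in> {1..N} \<Longrightarrow> {\<theta> j..\<theta> (j + 1)} \<subseteq> {\<theta> 1..\<theta> 1 + 2 * pi}"
proof
  fix x assume j: "j \<in> {1..N}" and x: "x \<in> {\<theta> j..\<theta> (j + 1)}"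
  have "0 \<le> (real j - 1) * h" "real j * h \<le> real N * h" using j h_pos by (auto intro: mult_right_mono)
  then show "x \<in> {\<theta> 1..\<theta> 1 + 2 * pi}"
    using x node_eq'[of j] mesh_step[OF j] Nh j by (auto simp: algebra_simps)
qed

lemma idx_unique: "j \<in> {1..N} \<Longrightarrow> x \<in> {\<theta> j..<\<theta> (j + 1)} \<Longrightarrow> idx x = j"
proof -
  assume j: "j \<in> {1..N}" and x: "x \<in> {\<theta> j..<\<theta> (j + 1)}"
  have "\<theta> j \<in> {\<theta> 1..\<theta> 1 + 2 * pi}" "\<theta> (j + 1) \<in> {\<theta> 1..\<theta> 1 + 2 * pi}"
    using element_subset[OF j] mesh_step[OF j] h_pos by (auto intro!: subsetD[OF element_subset[OF j]])
  then have x': "\<theta> 1 \<le> x" "x < \<theta> 1 + 2 * pi" using x by auto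
  have "\<lfloor>(x - \<theta> 1) / h\<rfloor> = int j - 1"
    using x node_eq'[of j] mesh_step[OF j] j h_pos by (intro floor_unique) (auto simp: field_simps)
  moreover have "nat (int j - 1) + 1 = j" using j by (cases j) auto
  ultimately show ?thesis using rep_id[OF x'] by (simp add: idx_def)
qed

text \<open>\<open>arccos (cos d)\<close> is the distance from \<open>d\<close> to \<open>2\<pi>\<int>\<close>; this makes the hat functions visibly
  continuous and periodic.\<close>

definition hat :: "nat \<Rightarrow> real \<Rightarrow> real" where
  "hat j x = max 0 (1 - arccos (cos (x - \<theta> j)) / h)"

definition fe :: "(nat \<Rightarrow> 'a::real_vector) \<Rightarrow> real \<Rightarrow> 'a" where
  "fe c x = (\<Sum>j=1..N. hat j x *\<^sub>R c j)"

lemma hat_far: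
  assumes "h \<le> \<bar>y\<bar>" "\<bar>y\<bar> \<le> 2 * pi - h"
  shows "1 - arccos (cos y) / h \<le> 0"
proof -
  have "cos \<bar>y\<bar> \<le> cos h"
  proof (cases "\<bar>y\<bar> \<le> pi")
    case True
    then show ?thesis using assms h_pos by (intro cos_monotone_0_pi_le) auto
  next
    case False
    have "cos (2 * pi - \<bar>y\<bar>) \<le> cos h" using assms h_pos False by (intro cos_monotone_0_pi_le) auto
    then show ?thesis by (simp add: cos_diff)
  qed
  then have "cos y \<le> cos h" by (simp add: cos_abs_real)
  then have "arccos (cos h) \<le> arccos (cos y)" by (intro arccos_le_arccos) auto
  moreover have "arccos (cos h) = h" using h_pos h_lt_pi by (intro arccos_cos) auto
  ultimately show ?thesis using h_pos by (simp add: field_simps)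
qed

lemma hat_on_element:
  assumes i: "i \<in> {1..N}" and j: "j \<in> {1..N}" and x: "x \<in> {\<theta> i..\<theta> (i + 1)}"
  shows "hat j x = (if j = i then 1 - (x - \<theta> i) / h else if j = nx i then (x - \<theta> i) / h else 0)"
proof -
  define r where "r = x - \<theta> i"
  have r: "0 \<le> r" "r \<le> h" using x mesh_step[OF i] by (auto simp: r_def)
  have xj: "x - \<theta> j = (real i - real j) * h + r"
    using node_eq'[of i] node_eq'[of j] i j by (simp add: r_def algebra_simps)
  consider "j = i" | "j \<noteq> i" "j = nx i" "i \<noteq> N" | "j \<noteq> i" "j = nx i" "i = N" | "j \<noteq> i" "j \<noteq> nx i" by blast
  then show ?thesis
  proof cases
    case 1
    have "arccos (cos r) = r" using r h_lt_pi by (intro arccos_cos) auto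
    then show ?thesis using 1 r h_pos by (simp add: hat_def r_def field_simps)
  next
    case 2
    then have "x - \<theta> j = r - h" using xj by (simp add: nx_def algebra_simps)
    moreover have "arccos (cos (r - h)) = - (r - h)" using r h_lt_pi by (intro arccos_cos2) auto
    ultimately show ?thesis using 2 r h_pos by (simp add: hat_def r_def field_simps)
  next
    \<comment> \<open>The element that closes the circle: its right end carries the hat of the first
      node, seen after a shift by \<open>2 * pi\<close>.\<close>
    case 3
    then have "x - \<theta> j = (r - h) + 2 * pi" using xj Nh by (simp add: nx_def algebra_simps)
    then have "cos (x - \<theta> j) = cos (r - h)" by (simp only: cos_periodic)
    moreover have "arccos (cos (r - h)) = - (r - h)" using r h_lt_pi by (intro arccos_cos2) auto
    ultimately show ?thesis using 3 r h_pos by (simp add: hat_def r_def field_simps)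
  next
    case 4
    have "h \<le> \<bar>x - \<theta> j\<bar> \<and> \<bar>x - \<theta> j\<bar> \<le> 2 * pi - h"
    proof (cases "i > j")
      case True
      have "1 * h \<le> (real i - real j) * h" using True h_pos by (intro mult_right_mono) auto
      moreover have "real i - real j \<le> real N - 2"
        using 4 True i j by (cases "i = N") (auto simp: nx_def)
      then have "(real i - real j) * h \<le> (real N - 2) * h" using h_pos by (intro mult_right_mono) auto
      ultimately show ?thesis using xj r Nh by (simp add: algebra_simps)
    next
      case False
      then have ji: "real j - real i \<ge> 2" using 4 i j by (auto simp: nx_def split: if_splits)
      then have "2 * h \<le> (real j - real i) * h" using h_pos by (intro mult_right_mono) auto
      moreover have "(real j - real i) * h \<le> (real N - 1) * h" using i j h_pos by (intro mult_right_mono) auto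
      ultimately show ?thesis using xj r Nh by (simp add: algebra_simps)
    qed
    then show ?thesis using 4 hat_far[of "x - \<theta> j"] by (simp add: hat_def)
  qed
qed

lemma fe_on_element:
  assumes i: "i \<in> {1..N}" and x: "x \<in> {\<theta> i..\<theta> (i + 1)}"
  shows "fe c x = (1 - (x - \<theta> i) / h) *\<^sub>R c i + ((x - \<theta> i) / h) *\<^sub>R c (nx i)"
proof -
  have ne: "nx i \<noteq> i" using N3 i by (auto simp: nx_def)
  have "fe c x = (\<Sum>j=1..N. (if j = i then (1 - (x - \<theta> i) / h) *\<^sub>R c i else 0) + (if j = nx i then ((x - \<theta> i) / h) *\<^sub>R c (nx i) else 0))"
    unfolding fe_def
    by (rule sum.cong[OF refl]) (use hat_on_element[OF i _ x] ne in auto)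
  then show ?thesis using i nx_in[OF i] by (simp add: sum.distrib)
qed

lemma continuous_hat: "continuous_on A (hat j)"
  unfolding hat_def using h_pos by (intro continuous_intros) auto

lemma continuous_fe: "continuous_on A (fe (c :: nat \<Rightarrow> 'a::real_normed_vector))"
  unfolding fe_def by (intro continuous_intros continuous_hat)

lemma periodic_fe: "periodic2pi (fe c)"
proof -
  have "hat j (x + 2 * pi) = hat j x" for j x
    unfolding hat_def using cos_periodic[of "x - \<theta> j"] by (simp add: algebra_simps)
  then show ?thesis by (simp add: periodic2pi_def fe_def)
qed

lemma fe_at_node:
  assumes "i \<in> {1..N}"
  shows "fe c (\<theta> i) = c i"
  using fe_on_element[OF assms, of "\<theta> i"] mesh_step[OF assms] h_pos by simp

lemma fe_component: "fe c x $ k = fe (\<lambda>j. c j $ k) x"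
  by (simp add: fe_def sum_component)

lemma fe_in_fe_space: "fe c \<in> fe_space N \<theta>"
  unfolding fe_space_def
proof (intro CollectI conjI ballI)
  show "periodic2pi (fe c)" "continuous_on UNIV (fe c)" by (rule periodic_fe continuous_fe)+
  fix i assume i: "i \<in> {1..N}"
  show "\<exists>a b. \<forall>x\<in>{\<theta> i..\<theta> (i + 1)}. fe c x = a + b * x"
    by (intro exI[of _ "c i + (\<theta> i / h) * (c i - c (nx i))"] exI[of _ "(c (nx i) - c i) / h"] ballI)
      (simp add: fe_on_element[OF i] algebra_simps diff_divide_distrib add_divide_distrib)
qed

lemma fe_space_eq_fe:
  assumes "\<phi> \<in> fe_space N \<theta>"
  shows "\<phi> = fe (\<lambda>j. \<phi> (\<theta> j))"
proof
  fix x
  have per: "periodic2pi \<phi>" using assms by (simp add: fe_space_def)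
  let ?i = "idx x" let ?y = "rep x"
  have i: "?i \<in> {1..N}" and y: "?y \<in> {\<theta> ?i..\<theta> (?i + 1)}" using idx_rep[of x] by auto
  obtain a b where ab: "\<And>x. x \<in> {\<theta> ?i..\<theta> (?i + 1)} \<Longrightarrow> \<phi> x = a + b * x"
    using assms i unfolding fe_space_def by blast
  have e: "\<phi> (\<theta> ?i) = a + b * \<theta> ?i" "\<phi> (\<theta> (nx ?i)) = a + b * (\<theta> ?i + h)"
    using ab[of "\<theta> ?i"] ab[of "\<theta> (?i + 1)"] node_nx[OF per i] mesh_step[OF i] h_pos by auto
  have "\<phi> ?y = fe (\<lambda>j. \<phi> (\<theta> j)) ?y"
    unfolding fe_on_element[OF i y] e ab[OF y] using h_pos by (simp add: field_simps)
  moreover have "\<phi> ?y = \<phi> x"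
    using periodic2pi_int[OF per, of ?y "\<lfloor>(x - \<theta> 1) / (2 * pi)\<rfloor>"] by (simp add: rep_def)
  moreover have "fe (\<lambda>j. \<phi> (\<theta> j)) ?y = fe (\<lambda>j. \<phi> (\<theta> j)) x"
    using periodic2pi_int[OF periodic_fe, of "\<lambda>j. \<phi> (\<theta> j)" ?y "\<lfloor>(x - \<theta> 1) / (2 * pi)\<rfloor>"] by (simp add: rep_def)
  ultimately show "\<phi> x = fe (\<lambda>j. \<phi> (\<theta> j)) x" by simp
qed

lemma fe_in_fe_space2: "fe c \<in> fe_space2 N \<theta>"
  unfolding fe_space2_def using fe_in_fe_space by (simp add: fe_component)

lemma fe_space2_eq_fe:
  assumes "\<phi> \<in> fe_space2 N \<theta>"
  shows "\<phi> = fe (\<lambda>j. \<phi> (\<theta> j))"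
proof
  fix x
  have "\<phi> x $ k = fe (\<lambda>j. \<phi> (\<theta> j)) x $ k" for k
  proof -
    have "(\<lambda>x. \<phi> x $ k) \<in> fe_space N \<theta>" using assms by (simp add: fe_space2_def)
    from fun_cong[OF fe_space_eq_fe[OF this], of x] show ?thesis by (simp only: fe_component)
  qed
  then show "\<phi> x = fe (\<lambda>j. \<phi> (\<theta> j)) x" by (simp add: vec_eq_iff)
qed

lemma fe_cong: "(\<And>j. j \<in> {1..N} \<Longrightarrow> c j = d j) \<Longrightarrow> fe c = fe d"
  by (auto simp: fe_def fun_eq_iff intro!: sum.cong)

lemma nodal_basis_eq:
  assumes j: "j \<in> {1..N}"
  shows "nodal_basis N \<theta> j = hat j"
proof -
  have hat: "hat j = fe (\<lambda>i. if i = j then 1 else 0 :: real)"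
  proof
    fix x
    have "fe (\<lambda>i. if i = j then 1 else 0 :: real) x = (\<Sum>i=1..N. if i = j then hat i x else 0)"
      unfolding fe_def by (rule sum.cong) auto
    then show "hat j x = fe (\<lambda>i. if i = j then 1 else 0 :: real) x" using j by simp
  qed
  show ?thesis
    unfolding nodal_basis_def
  proof (rule the_equality)
    show "hat j \<in> fe_space N \<theta> \<and> (\<forall>i\<in>{1..N}. hat j (\<theta> i) = (if i = j then 1 else 0))"
      unfolding hat by (simp add: fe_in_fe_space fe_at_node)
    fix \<phi> assume \<phi>: "\<phi> \<in> fe_space N \<theta> \<and> (\<forall>i\<in>{1..N}. \<phi> (\<theta> i) = (if i = j then 1 else 0))"
    then have "\<phi> = fe (\<lambda>i. \<phi> (\<theta> i))" by (blast intro: fe_space_eq_fe)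
    also have "\<dots> = hat j" unfolding hat using \<phi> by (intro fe_cong) auto
    finally show "\<phi> = hat j" .
  qed
qed

lemma interpolation_eq_fe: "interpolation N \<theta> f = fe (\<lambda>j. f (\<theta> j))"
  by (auto simp: interpolation_def fe_def fun_eq_iff nodal_basis_eq intro!: sum.cong)

definition slope :: "(nat \<Rightarrow> real ^ 2) \<Rightarrow> nat \<Rightarrow> real ^ 2" where
  "slope c i = (1 / h) *\<^sub>R (c (nx i) - c i)"

lemma fe_has_derivative:
  assumes i: "i \<in> {1..N}" and x: "x \<in> {\<theta> i<..<\<theta> (i + 1)}"
  shows "(fe c has_vector_derivative slope c i) (at x)"
proof -
  have "((\<lambda>x. (1 - (x - \<theta> i) / h) *\<^sub>R c i + ((x - \<theta> i) / h) *\<^sub>R c (nx i)) has_vector_derivative slope c i) (at x)"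
    unfolding slope_def using h_pos
    by (auto intro!: derivative_eq_intros simp: scaleR_diff_right simp flip: has_real_derivative_iff_has_vector_derivative)
  then show ?thesis
  proof (rule has_vector_derivative_transform_within_open)
    show "open {\<theta> i<..<\<theta> (i + 1)}" by simp
    show "x \<in> {\<theta> i<..<\<theta> (i + 1)}" by (rule x)
    show "(1 - (y - \<theta> i) / h) *\<^sub>R c i + ((y - \<theta> i) / h) *\<^sub>R c (nx i) = fe c y" if "y \<in> {\<theta> i<..<\<theta> (i + 1)}" for y
      using that by (intro fe_on_element[OF i, symmetric]) simp
  qed
qed

lemma dx_fe: "i \<in> {1..N} \<Longrightarrow> x \<in> {\<theta> i<..<\<theta> (i + 1)} \<Longrightarrow> dx (fe c) x = slope c i"
  unfolding dx_def by (intro vector_derivative_at fe_has_derivative)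

section \<open>Exact integration over the circle\<close>

text \<open>Derivatives and normals of finite element functions are only piecewise continuous. Here
  \<open>g i\<close> is the continuous extension to the closed element, whose two end points form a
  null set.\<close>

lemma circle_integral:
  fixes f :: "real \<Rightarrow> 'a::euclidean_space"
  assumes f: "periodic2pi f" and g: "\<And>i. i \<in> {1..N} \<Longrightarrow> continuous_on {\<theta> i..\<theta> (i + 1)} (g i)"
    and eq: "\<And>i x. i \<in> {1..N} \<Longrightarrow> x \<in> {\<theta> i<..<\<theta> (i + 1)} \<Longrightarrow> f x = g i x"
  shows "f absolutely_integrable_on {0..2*pi}"
    and "(LINT x:{0..2*pi}|lebesgue. f x) = (\<Sum>i=1..N. integral {\<theta> i..\<theta> (i + 1)} (g i))"
proof -
  \<comment> \<open>Proved for a generic \<open>F\<close>, since it is applied to \<open>f\<close>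
    and to its norm; both together give absolute integrability.\<close>
  have gen: "(F has_integral (\<Sum>i=1..N. integral {\<theta> i..\<theta> (i + 1)} (G i))) {0..2*pi}"
    if F: "periodic2pi F" and G: "\<And>i. i \<in> {1..N} \<Longrightarrow> continuous_on {\<theta> i..\<theta> (i + 1)} (G i)"
      and FG: "\<And>i x. i \<in> {1..N} \<Longrightarrow> x \<in> {\<theta> i<..<\<theta> (i + 1)} \<Longrightarrow> F x = G i x"
    for F :: "real \<Rightarrow> 'b::euclidean_space" and G
  proof -
    have piece: "(F has_integral integral {\<theta> i..\<theta> (i + 1)} (G i)) {\<theta> i..\<theta> (i + 1)}" if i: "i \<in> {1..N}" for i
    proof (rule has_integral_spike_finite[of "{\<theta> i, \<theta> (i + 1)}"])
      show "(G i has_integral integral {\<theta> i..\<theta> (i + 1)} (G i)) {\<theta> i..\<theta> (i + 1)}"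
        by (intro integrable_integral integrable_continuous_real G i)
    qed (use FG[OF i] in auto)
    have "(F has_integral (\<Sum>i=1..k. integral {\<theta> i..\<theta> (i + 1)} (G i))) {\<theta> 1..\<theta> (k + 1)}" if "k \<le> N" for k
      using that
    proof (induction k)
      case 0
      then show ?case using has_integral_refl(2)[of F "\<theta> 1"] by simp
    next
      case (Suc k)
      have "(F has_integral ((\<Sum>i=1..k. integral {\<theta> i..\<theta> (i + 1)} (G i)) + integral {\<theta> (k + 1)..\<theta> (Suc k + 1)} (G (Suc k)))) {\<theta> 1..\<theta> (Suc k + 1)}"
      proof (rule has_integral_combine)
        show "(F has_integral (\<Sum>i=1..k. integral {\<theta> i..\<theta> (i + 1)} (G i))) {\<theta> 1..\<theta> (k + 1)}" using Suc by simp
        show "(F has_integral integral {\<theta> (k + 1)..\<theta> (Suc k + 1)} (G (Suc k))) {\<theta> (k + 1)..\<theta> (Suc k + 1)}"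
          using piece[of "Suc k"] Suc by simp
      qed (use node_eq[of k] node_eq[of "Suc k"] h_pos Suc in \<open>auto simp: algebra_simps\<close>)
      then show ?case by simp
    qed
    from this[of N] have "(F has_integral (\<Sum>i=1..N. integral {\<theta> i..\<theta> (i + 1)} (G i))) {\<theta> 1..\<theta> 1 + 2 * pi}"
      using node_last by simp
    then show ?thesis using theta1 by (intro has_integral_periodic[OF F]) auto
  qed
  have I1: "(f has_integral (\<Sum>i=1..N. integral {\<theta> i..\<theta> (i + 1)} (g i))) {0..2*pi}" by (rule gen[OF f g eq])
  have "((\<lambda>x. norm (f x)) has_integral (\<Sum>i=1..N. integral {\<theta> i..\<theta> (i + 1)} (\<lambda>x. norm (g i x)))) {0..2*pi}"
    by (rule gen) (use f g eq in \<open>auto simp: periodic2pi_def intro: continuous_on_norm\<close>)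
  with I1 show ai: "f absolutely_integrable_on {0..2*pi}" unfolding absolutely_integrable_on_def by blast
  show "(LINT x:{0..2*pi}|lebesgue. f x) = (\<Sum>i=1..N. integral {\<theta> i..\<theta> (i + 1)} (g i))"
    using set_lebesgue_integral_eq_integral(2)[OF ai] I1 by (simp add: integral_unique)
qed

text \<open>The exact value of \<open>\<integral> f \<bullet> A u\<close> for piecewise linear \<open>u\<close> and \<open>f\<close> with nodal values \<open>u i\<close> and \<open>f i\<close>,
  where \<open>A\<close> is constant on each element.\<close>

definition mass :: "(nat \<Rightarrow> real ^ 2 \<Rightarrow> real ^ 2) \<Rightarrow> (nat \<Rightarrow> real ^ 2) \<Rightarrow> (nat \<Rightarrow> real ^ 2) \<Rightarrow> real" where
  "mass A u f = (\<Sum>i=1..N. h * (f i \<bullet> A i (u i) / 3 + (f i \<bullet> A i (u (nx i)) + f (nx i) \<bullet> A i (u i)) / 6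
     + f (nx i) \<bullet> A i (u (nx i)) / 3))"

text \<open>The integral of a piecewise constant \<open>p\<close> against the derivative of
  \<open>fe f\<close>: the element length cancels the denominator of the difference
  quotient.\<close>

definition stiff :: "(nat \<Rightarrow> real ^ 2) \<Rightarrow> (nat \<Rightarrow> real ^ 2) \<Rightarrow> real" where
  "stiff p f = (\<Sum>i=1..N. p i \<bullet> (f (nx i) - f i))"

lemma element_integral:
  assumes i: "i \<in> {1..N}" and A: "linear A"
  shows "((\<lambda>x. fe f x \<bullet> A (fe u x)) has_integral
    h * (f i \<bullet> A (u i) / 3 + (f i \<bullet> A (u (nx i)) + f (nx i) \<bullet> A (u i)) / 6 + f (nx i) \<bullet> A (u (nx i)) / 3))
    {\<theta> i..\<theta> (i + 1)}"
proof -
  define s where "s x = (x - \<theta> i) / h" for x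
  \<comment> \<open>A primitive in the local coordinate \<open>s\<close>. The weights
    \<open>1 / 3\<close>, \<open>1 / 6\<close> and \<open>1 / 3\<close> are the integrals of
    \<open>(1 - s)^2\<close>, \<open>s (1 - s)\<close> and \<open>s^2\<close> over the unit
    interval.\<close>
  define P where "P x = h * ((f i \<bullet> A (u i)) * (s x - (s x)^2 + (s x)^3 / 3)
     + (f i \<bullet> A (u (nx i)) + f (nx i) \<bullet> A (u i)) * ((s x)^2 / 2 - (s x)^3 / 3) + (f (nx i) \<bullet> A (u (nx i))) * (s x)^3 / 3)" for x
  have ds: "(s has_real_derivative 1 / h) (at x within S)" for x S
    unfolding s_def using h_pos by (auto intro!: derivative_eq_intros)
  have "((\<lambda>x. fe f x \<bullet> A (fe u x)) has_integral P (\<theta> (i + 1)) - P (\<theta> i)) {\<theta> i..\<theta> (i + 1)}"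
  proof (rule fundamental_theorem_of_calculus)
    show "\<theta> i \<le> \<theta> (i + 1)" using mesh_step[OF i] h_pos by simp
    fix x assume x: "x \<in> {\<theta> i..\<theta> (i + 1)}"
    have e: "fe f x \<bullet> A (fe u x) = (f i \<bullet> A (u i)) * (1 - 2 * s x + (s x)^2)
      + (f i \<bullet> A (u (nx i)) + f (nx i) \<bullet> A (u i)) * (s x - (s x)^2) + (f (nx i) \<bullet> A (u (nx i))) * (s x)^2"
    proof -
      have "A ((1 - s x) *\<^sub>R u i + s x *\<^sub>R u (nx i)) = (1 - s x) *\<^sub>R A (u i) + s x *\<^sub>R A (u (nx i))"
        by (simp only: linear_add[OF A] linear_scale[OF A])
      then have "fe f x \<bullet> A (fe u x) = ((1 - s x) *\<^sub>R f i + s x *\<^sub>R f (nx i)) \<bullet> ((1 - s x) *\<^sub>R A (u i) + s x *\<^sub>R A (u (nx i)))"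
        unfolding fe_on_element[OF i x] s_def by simp
      also have "\<dots> = (1 - s x) * ((1 - s x) * (f i \<bullet> A (u i))) + (1 - s x) * (s x * (f (nx i) \<bullet> A (u i)))
          + (s x * ((1 - s x) * (f i \<bullet> A (u (nx i)))) + s x * (s x * (f (nx i) \<bullet> A (u (nx i)))))"
        by (simp only: inner_add_left inner_add_right inner_scaleR_left inner_scaleR_right distrib_left)
      finally show ?thesis by (simp add: algebra_simps power2_eq_square)
    qed
    have "(P has_real_derivative fe f x \<bullet> A (fe u x)) (at x within {\<theta> i..\<theta> (i + 1)})"
      unfolding P_def e
      by (rule derivative_eq_intros ds refl | simp)+ (use h_pos in \<open>simp add: field_simps power2_eq_square\<close>)
    then show "(P has_vector_derivative fe f x \<bullet> A (fe u x)) (at x within {\<theta> i..\<theta> (i + 1)})"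
      by (simp add: has_real_derivative_iff_has_vector_derivative)
  qed
  moreover have "s (\<theta> (i + 1)) = 1" "s (\<theta> i) = 0" using mesh_step[OF i] h_pos by (auto simp: s_def)
  then have "P (\<theta> (i + 1)) - P (\<theta> i) = h * (f i \<bullet> A (u i) / 3 + (f i \<bullet> A (u (nx i)) + f (nx i) \<bullet> A (u i)) / 6 + f (nx i) \<bullet> A (u (nx i)) / 3)"
    by (simp add: P_def algebra_simps)
  ultimately show ?thesis by simp
qed

lemma mass_eq_integral:
  assumes "\<And>i. i \<in> {1..N} \<Longrightarrow> linear (A i)"
  shows "mass A u f = (\<Sum>i=1..N. integral {\<theta> i..\<theta> (i + 1)} (\<lambda>x. fe f x \<bullet> A i (fe u x)))"
  unfolding mass_def
proof (rule sum.cong[OF refl])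
  fix i assume i: "i \<in> {1..N}"
  show "h * (f i \<bullet> A i (u i) / 3 + (f i \<bullet> A i (u (nx i)) + f (nx i) \<bullet> A i (u i)) / 6 + f (nx i) \<bullet> A i (u (nx i)) / 3)
    = integral {\<theta> i..\<theta> (i + 1)} (\<lambda>x. fe f x \<bullet> A i (fe u x))"
    by (rule integral_unique[symmetric]) (rule element_integral[OF i assms[OF i]])
qed

lemma LINT_mass:
  assumes A: "\<And>i. i \<in> {1..N} \<Longrightarrow> linear (A i)" and F: "periodic2pi F"
    and eq: "\<And>i x. i \<in> {1..N} \<Longrightarrow> x \<in> {\<theta> i<..<\<theta> (i + 1)} \<Longrightarrow> F x = fe f x \<bullet> A i (fe u x)"
  shows "F absolutely_integrable_on {0..2*pi}" "(LINT x:{0..2*pi}|lebesgue. F x) = mass A u f"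
proof -
  have c: "continuous_on {\<theta> i..\<theta> (i + 1)} (\<lambda>x. fe f x \<bullet> A i (fe u x))" if "i \<in> {1..N}" for i
    using A[OF that] by (intro continuous_intros continuous_fe linear_continuous_on_compose[OF continuous_fe])
  show "F absolutely_integrable_on {0..2*pi}" by (rule circle_integral(1)[OF F c eq])
  show "(LINT x:{0..2*pi}|lebesgue. F x) = mass A u f"
  proof -
    have "mass A u f = (\<Sum>i=1..N. integral {\<theta> i..\<theta> (i + 1)} (\<lambda>x. fe f x \<bullet> A i (fe u x)))"
      by (rule mass_eq_integral) (rule A)
    also have "\<dots> = (LINT x:{0..2*pi}|lebesgue. F x)"
      by (rule circle_integral(2)[OF F c eq, symmetric])
    finally show ?thesis by simp
  qed
qed

lemma LINT_stiff:
  assumes F: "periodic2pi F" and eq: "\<And>i x. i \<in> {1..N} \<Longrightarrow> x \<in> {\<theta> i<..<\<theta> (i + 1)} \<Longrightarrow> F x = p i \<bullet> slope f i"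
  shows "(LINT x:{0..2*pi}|lebesgue. F x) = stiff p f"
proof -
  have "(LINT x:{0..2*pi}|lebesgue. F x) = (\<Sum>i=1..N. integral {\<theta> i..\<theta> (i + 1)} (\<lambda>x. p i \<bullet> slope f i))"
    by (rule circle_integral(2)[OF F _ eq]) auto
  also have "\<dots> = stiff p f"
    unfolding stiff_def
  proof (rule sum.cong[OF refl])
    fix i assume "i \<in> {1..N}"
    then show "integral {\<theta> i..\<theta> (i + 1)} (\<lambda>x. p i \<bullet> slope f i) = p i \<bullet> (f (nx i) - f i)"
      using mesh_step[of i] h_pos by (simp add: slope_def)
  qed
  finally show ?thesis .
qed

end

text \<open>For a unit vector \<open>\<nu>\<close> orthogonal to \<open>p\<close> this is \<open>\<bar>p\<bar>\<^sup>2 (\<alpha> v + (1 - \<alpha>) (\<nu> \<bullet> v) \<nu>)\<close>.\<close>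

definition scheme_op :: "real \<Rightarrow> real ^ 2 \<Rightarrow> real ^ 2 \<Rightarrow> real ^ 2" where
  "scheme_op \<alpha> p v = (norm p)\<^sup>2 *\<^sub>R v - ((1 - \<alpha>) * (p \<bullet> v)) *\<^sub>R p"

lemma linear_scheme_op: "linear (scheme_op \<alpha> p)"
  by (rule linearI) (simp_all add: scheme_op_def algebra_simps inner_add_right)

text \<open>In the plane \<open>p\<close> is \<open>l\<close> times the rotated normal, with
  \<open>l\<^sup>2 = (norm p)\<^sup>2\<close>, and the identity splits into the normal and the
  tangential projection. Both sides vanish for \<open>p = 0\<close>, so degenerate elements cause no
  exception.\<close>

lemma unit_normal_tensor:
  fixes n p u v :: "real ^ 2"
  assumes n: "norm n = 1" and np: "n \<bullet> p = 0"
  shows "(norm p)\<^sup>2 * ((u \<bullet> n) * (n \<bullet> v)) = (norm p)\<^sup>2 * (u \<bullet> v) - (u \<bullet> p) * (p \<bullet> v)"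
proof -
  define a b c d where "a = n $ 1" "b = n $ 2" "c = p $ 1" "d = p $ 2"
  note defs = this
  have 1: "a * a + b * b = 1" "a * c + b * d = 0"
    using n np by (auto simp: defs norm_eq_1 inner_vec_def sum_2)
  define l where "l = a * d - b * c"
  have c: "c = - (l * b)" and d: "d = l * a"
    using 1 unfolding l_def by algebra+
  have "(norm p)\<^sup>2 = c * c + d * d" by (simp add: power2_norm_eq_inner inner_vec_def sum_2 defs)
  also have "\<dots> = l * l" unfolding c d using 1 by algebra
  finally have np2: "(norm p)\<^sup>2 = l * l" .
  have alg: "l * l * ((u1 * a + u2 * b) * (a * v1 + b * v2))
      = l * l * (u1 * v1 + u2 * v2) - (u1 * (- (l * b)) + u2 * (l * a)) * ((- (l * b)) * v1 + (l * a) * v2)"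
    for u1 u2 v1 v2 using 1(1) by algebra
  show ?thesis
    unfolding np2 using alg[of "u $ 1" "u $ 2" "v $ 1" "v $ 2"] c d
    by (simp add: inner_vec_def sum_2 flip: defs)
qed

lemma scheme_op_normal_form:
  fixes n p u v :: "real ^ 2"
  assumes "norm n = 1" "n \<bullet> p = 0"
  shows "(\<alpha> * (u \<bullet> v) + (1 - \<alpha>) * ((u \<bullet> n) * (n \<bullet> v))) * (norm p)\<^sup>2 = v \<bullet> scheme_op \<alpha> p u"
proof -
  have "(\<alpha> * (u \<bullet> v) + (1 - \<alpha>) * ((u \<bullet> n) * (n \<bullet> v))) * (norm p)\<^sup>2
    = \<alpha> * ((norm p)\<^sup>2 * (u \<bullet> v)) + (1 - \<alpha>) * ((norm p)\<^sup>2 * ((u \<bullet> n) * (n \<bullet> v)))"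
    by (simp add: algebra_simps)
  also have "\<dots> = (norm p)\<^sup>2 * (u \<bullet> v) - (1 - \<alpha>) * ((u \<bullet> p) * (p \<bullet> v))"
    unfolding unit_normal_tensor[OF assms, of u v] by (simp add: algebra_simps)
  also have "\<dots> = v \<bullet> scheme_op \<alpha> p u"
    by (simp add: scheme_op_def inner_diff_right inner_commute ac_simps)
  finally show ?thesis .
qed

section \<open>The velocity of the semi-discrete scheme\<close>

text \<open>Cauchy-Schwarz, with equality when \<open>v\<close> is parallel to \<open>p\<close>: the
  factor \<alpha> is the price of tangential motion.\<close>

lemma scheme_op_coercive:
  assumes "0 < \<alpha>" "\<alpha> \<le> 1"
  shows "\<alpha> * (norm p)\<^sup>2 * (norm v)\<^sup>2 \<le> v \<bullet> scheme_op \<alpha> p v"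
proof -
  have "(p \<bullet> v)\<^sup>2 \<le> (norm p)\<^sup>2 * (norm v)\<^sup>2"
    using Cauchy_Schwarz_ineq[of p v] by (simp add: power2_norm_eq_inner)
  then have "(1 - \<alpha>) * (p \<bullet> v)\<^sup>2 \<le> (1 - \<alpha>) * ((norm p)\<^sup>2 * (norm v)\<^sup>2)"
    using assms by (intro mult_left_mono) auto
  then show ?thesis
    by (simp add: scheme_op_def inner_diff_right inner_commute power2_norm_eq_inner[symmetric] algebra_simps power2_eq_square)
qed

lemma scheme_op_bound:
  assumes "0 < \<alpha>" "\<alpha> \<le> 1"
  shows "norm (scheme_op \<alpha> p v) \<le> 2 * (norm p)\<^sup>2 * norm v"
proof -
  have "\<bar>(1 - \<alpha>) * (p \<bullet> v)\<bar> \<le> 1 * (norm p * norm v)"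
    unfolding abs_mult using assms Cauchy_Schwarz_ineq2[of p v] by (intro mult_mono) auto
  then have "\<bar>(1 - \<alpha>) * (p \<bullet> v)\<bar> * norm p \<le> norm p * norm v * norm p"
    by (intro mult_right_mono) auto
  moreover have "norm (scheme_op \<alpha> p v) \<le> norm ((norm p)\<^sup>2 *\<^sub>R v) + norm (((1 - \<alpha>) * (p \<bullet> v)) *\<^sub>R p)"
    unfolding scheme_op_def by (rule norm_triangle_ineq4)
  then have "norm (scheme_op \<alpha> p v) \<le> (norm p)\<^sup>2 * norm v + \<bar>(1 - \<alpha>) * (p \<bullet> v)\<bar> * norm p"
    by (simp only: norm_scaleR abs_power2)
  moreover have "norm p * norm v * norm p = (norm p)\<^sup>2 * norm v" by (simp add: power2_eq_square)
  ultimately show ?thesis by linarith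
qed

lemma scheme_op_diff:
  assumes "0 < \<alpha>" "\<alpha> \<le> 1"
  shows "norm (scheme_op \<alpha> p v - scheme_op \<alpha> q v) \<le> 2 * (norm p + norm q) * norm (p - q) * norm v"
proof -
  \<comment> \<open>The quadratic terms are polarised: \<open>p\<close> is exchanged for
    \<open>q\<close> one factor at a time.\<close>
  have e: "scheme_op \<alpha> p v - scheme_op \<alpha> q v = ((norm p)\<^sup>2 - (norm q)\<^sup>2) *\<^sub>R v
     - ((1 - \<alpha>) * ((p - q) \<bullet> v)) *\<^sub>R p - ((1 - \<alpha>) * (q \<bullet> v)) *\<^sub>R (p - q)"
    by (simp add: scheme_op_def algebra_simps inner_diff_left)
  have 1: "\<bar>(norm p)\<^sup>2 - (norm q)\<^sup>2\<bar> \<le> (norm p + norm q) * norm (p - q)"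
  proof -
    have "(norm p)\<^sup>2 - (norm q)\<^sup>2 = (norm p + norm q) * (norm p - norm q)" by (simp add: power2_eq_square algebra_simps)
    also have "\<bar>\<dots>\<bar> = (norm p + norm q) * \<bar>norm p - norm q\<bar>" by (simp add: abs_mult)
    also have "\<dots> \<le> (norm p + norm q) * norm (p - q)" using norm_triangle_ineq3[of p q] by (intro mult_left_mono) auto
    finally show ?thesis .
  qed
  have 2: "\<bar>(1 - \<alpha>) * ((p - q) \<bullet> v)\<bar> \<le> 1 * (norm (p - q) * norm v)"
    unfolding abs_mult using assms Cauchy_Schwarz_ineq2[of "p - q" v] by (intro mult_mono) auto
  have 3: "\<bar>(1 - \<alpha>) * (q \<bullet> v)\<bar> \<le> 1 * (norm q * norm v)"
    unfolding abs_mult using assms Cauchy_Schwarz_ineq2[of q v] by (intro mult_mono) auto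
  have "norm (scheme_op \<alpha> p v - scheme_op \<alpha> q v) \<le> \<bar>(norm p)\<^sup>2 - (norm q)\<^sup>2\<bar> * norm v
     + \<bar>(1 - \<alpha>) * ((p - q) \<bullet> v)\<bar> * norm p + \<bar>(1 - \<alpha>) * (q \<bullet> v)\<bar> * norm (p - q)"
    unfolding e by (rule order_trans[OF norm_triangle_ineq4 add_mono[OF order_trans[OF norm_triangle_ineq4]]]) auto
  also have "\<dots> \<le> (norm p + norm q) * norm (p - q) * norm v + norm (p - q) * norm v * norm p + norm q * norm v * norm (p - q)"
    using 1 2 3 by (intro add_mono mult_right_mono) auto
  also have "\<dots> = 2 * (norm p + norm q) * norm (p - q) * norm v" by (simp add: algebra_simps)
  finally show ?thesis .
qed

lemma le_of_mult_power2:
  fixes x :: real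
  assumes "k * x\<^sup>2 \<le> B * x" "k > 0" "x \<ge> 0" "B \<ge> 0"
  shows "x \<le> B / k"
proof (cases "x = 0")
  case False
  then have "k * x \<le> B" using assms by (simp add: power2_eq_square flip: mult.assoc)
  then show ?thesis using assms by (simp add: field_simps)
qed (use assms in simp)

lemma bounded_linear_apply_bcontfun: "bounded_linear (\<lambda>c. apply_bcontfun c x)"
  by (rule bounded_linear_intro[where K = 1]) (auto simp: norm_bounded)

context fe_mesh
begin

text \<open>Since \<open>N\<close> is a variable, nodal vectors live in the Banach space of bounded functions on \<open>nat\<close>.\<close>

definition node_vec :: "(nat \<Rightarrow> real ^ 2) \<Rightarrow> nat \<Rightarrow>\<^sub>C (real ^ 2)" where
  "node_vec f = Bcontfun (\<lambda>j. if j \<in> {1..N} then f j else 0)"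

lemma apply_node_vec: "apply_bcontfun (node_vec f) j = (if j \<in> {1..N} then f j else 0)"
proof -
  have "(\<lambda>j. if j \<in> {1..N} then f j else 0) \<in> bcontfun"
  proof (rule bcontfun_normI[where b = "\<Sum>j=1..N. norm (f j)"])
    show "norm (if j \<in> {1..N} then f j else 0) \<le> (\<Sum>j=1..N. norm (f j))" for j
      using member_le_sum[of j "{1..N}" "\<lambda>j. norm (f j)"] by (auto intro: sum_nonneg)
  qed (simp add: continuous_on_def at_discrete)
  then show ?thesis by (simp add: node_vec_def Bcontfun_inverse)
qed

definition node_basis :: "(nat \<Rightarrow>\<^sub>C (real ^ 2)) set" where
  "node_basis = (\<lambda>(i, k). node_vec (\<lambda>j. if j = i then axis k 1 else 0)) ` ({1..N} \<times> UNIV)"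

lemma finite_node_basis: "finite node_basis"
  by (simp add: node_basis_def)

lemma node_vec_in_span: "node_vec f \<in> span node_basis"
proof -
  have "node_vec f = (\<Sum>i=1..N. \<Sum>k\<in>UNIV. (f i $ k) *\<^sub>R node_vec (\<lambda>j. if j = i then axis k 1 else 0))"
  proof (rule bcontfun_eqI)
    fix j
    have app: "apply_bcontfun (\<Sum>i\<in>I. g i) j = (\<Sum>i\<in>I. apply_bcontfun (g i) j)" for I and g :: "'b \<Rightarrow> nat \<Rightarrow>\<^sub>C (real ^ 2)"
      by (rule bounded_linear.linear[OF bounded_linear_apply_bcontfun, THEN linear_sum])
    have "apply_bcontfun (\<Sum>i=1..N. \<Sum>k\<in>UNIV. (f i $ k) *\<^sub>R node_vec (\<lambda>j. if j = i then axis k 1 else 0)) j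
      = (\<Sum>i=1..N. if i = j then f j else 0)"
      unfolding app
    proof (rule sum.cong[OF refl])
      fix i assume i: "i \<in> {1..N}"
      show "(\<Sum>k\<in>UNIV. apply_bcontfun ((f i $ k) *\<^sub>R node_vec (\<lambda>j. if j = i then axis k 1 else 0)) j) = (if i = j then f j else 0)"
      proof (cases "i = j")
        case True
        then show ?thesis using i by (simp add: apply_node_vec basis_expansion[of "f j", unfolded scalar_mult_eq_scaleR])
      next
        case False
        then have "j \<noteq> i" by simp
        with False show ?thesis by (simp add: apply_node_vec cong: if_cong)
      qed
    qed
    also have "\<dots> = apply_bcontfun (node_vec f) j" by (simp add: apply_node_vec)
    finally show "apply_bcontfun (node_vec f) j
      = apply_bcontfun (\<Sum>i=1..N. \<Sum>k\<in>UNIV. (f i $ k) *\<^sub>R node_vec (\<lambda>j. if j = i then axis k 1 else 0)) j" by simp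
  qed
  moreover have "node_vec (\<lambda>j. if j = i then axis k 1 else 0) \<in> node_basis" if "i \<in> {1..N}" for i k
    using that by (force simp: node_basis_def)
  ultimately show ?thesis by (simp only:) (blast intro: span_sum span_scale span_base)
qed

lemma span_node_basis_0: 
  assumes "u \<in> span node_basis" "j \<notin> {1..N}"
  shows "apply_bcontfun u j = 0"
  using assms(1)
proof (induction rule: span_induct)
  case base
  show ?case by (auto simp: subspace_def)
next
  case (step x)
  then show ?case using assms(2) by (auto simp: node_basis_def apply_node_vec)
qed

lemma mass_cong:
  "(\<And>j. j \<in> {1..N} \<Longrightarrow> u j = u' j) \<Longrightarrow> (\<And>j. j \<in> {1..N} \<Longrightarrow> f j = f' j) \<Longrightarrow>
    (\<And>j v. j \<in> {1..N} \<Longrightarrow> A j v = A' j v) \<Longrightarrow> mass A u f = mass A' u' f'"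
  unfolding mass_def using nx_in by (intro sum.cong) auto

lemma stiff_cong:
  "(\<And>j. j \<in> {1..N} \<Longrightarrow> p j = p' j) \<Longrightarrow> (\<And>j. j \<in> {1..N} \<Longrightarrow> f j = f' j) \<Longrightarrow> stiff p f = stiff p' f'"
  unfolding stiff_def using nx_in by (intro sum.cong) auto

section \<open>Bounds for the mass and stiffness forms\<close>

lemma mass_coercive:
  assumes A: "\<And>i. i \<in> {1..N} \<Longrightarrow> linear (A i)"
    and co: "\<And>i v. i \<in> {1..N} \<Longrightarrow> l * (norm v)\<^sup>2 \<le> v \<bullet> A i v"
    and l: "l \<ge> 0"
  shows "l * h / 3 * (\<Sum>i=1..N. (norm (u i))\<^sup>2) \<le> mass A u u"
proof -
  have el: "l * h / 6 * ((norm (u i))\<^sup>2 + (norm (u (nx i)))\<^sup>2) \<le>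
     h * (u i \<bullet> A i (u i) / 3 + (u i \<bullet> A i (u (nx i)) + u (nx i) \<bullet> A i (u i)) / 6 + u (nx i) \<bullet> A i (u (nx i)) / 3)"
    if i: "i \<in> {1..N}" for i
  proof -
    \<comment> \<open>This is Simpson's rule, exact for the quadratic integrand: four times its
      value at the midpoint is the form at the sum of the two nodal values. That term is nonnegative
      and is dropped in the lower bound.\<close>
    have q: "u i \<bullet> A i (u i) / 3 + (u i \<bullet> A i (u (nx i)) + u (nx i) \<bullet> A i (u i)) / 6 + u (nx i) \<bullet> A i (u (nx i)) / 3
      = (u i \<bullet> A i (u i) + u (nx i) \<bullet> A i (u (nx i)) + (u i + u (nx i)) \<bullet> A i (u i + u (nx i))) / 6"
      by (simp add: linear_add[OF A[OF i]] inner_add_left inner_add_right field_simps)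
    have "0 \<le> l * (norm (u i + u (nx i)))\<^sup>2" using l by simp
    then have "l * ((norm (u i))\<^sup>2 + (norm (u (nx i)))\<^sup>2) / 6 \<le> (u i \<bullet> A i (u i) + u (nx i) \<bullet> A i (u (nx i)) + (u i + u (nx i)) \<bullet> A i (u i + u (nx i))) / 6"
      using co[OF i, of "u i"] co[OF i, of "u (nx i)"] co[OF i, of "u i + u (nx i)"] by (simp add: distrib_left)
    then have "h * (l * ((norm (u i))\<^sup>2 + (norm (u (nx i)))\<^sup>2) / 6) \<le> h * ((u i \<bullet> A i (u i) + u (nx i) \<bullet> A i (u (nx i)) + (u i + u (nx i)) \<bullet> A i (u i + u (nx i))) / 6)"
      using h_pos by (intro mult_left_mono) auto
    then show ?thesis unfolding q by (simp add: ac_simps)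
  qed
  have "l * h / 3 * (\<Sum>i=1..N. (norm (u i))\<^sup>2) = l * h / 6 * ((\<Sum>i=1..N. (norm (u i))\<^sup>2) + (\<Sum>i=1..N. (norm (u (nx i)))\<^sup>2))"
    unfolding sum_nx[of "\<lambda>i. (norm (u i))\<^sup>2"] by simp
  also have "\<dots> = (\<Sum>i=1..N. l * h / 6 * ((norm (u i))\<^sup>2 + (norm (u (nx i)))\<^sup>2))"
    unfolding sum.distrib[symmetric] sum_distrib_left ..
  also have "\<dots> \<le> mass A u u" unfolding mass_def by (rule sum_mono) (rule el)
  finally show ?thesis .
qed

lemma mass_bound:
  assumes A: "\<And>i v. i \<in> {1..N} \<Longrightarrow> norm (A i v) \<le> C * norm v" and C: "C \<ge> 0"
    and u: "\<And>i. i \<in> {1..N} \<Longrightarrow> norm (u i) \<le> U" and f: "\<And>i. i \<in> {1..N} \<Longrightarrow> norm (f i) \<le> F"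
  shows "\<bar>mass A u f\<bar> \<le> 2 * pi * C * U * F"
proof -
  have b: "\<bar>f j \<bullet> A i (u k)\<bar> \<le> C * U * F" if "i \<in> {1..N}" "j \<in> {1..N}" "k \<in> {1..N}" for i j k
  proof -
    have "norm (A i (u k)) \<le> C * U" using A[OF that(1), of "u k"] u[OF that(3)] C
      by (meson mult_left_mono order_trans)
    then have "norm (f j) * norm (A i (u k)) \<le> F * (C * U)"
      using f[OF that(2)] by (intro mult_mono) (auto intro: order_trans[OF norm_ge_zero])
    then show ?thesis using Cauchy_Schwarz_ineq2[of "f j" "A i (u k)"] by (simp add: ac_simps)
  qed
  have avg: "\<bar>p\<bar> \<le> M \<Longrightarrow> \<bar>q\<bar> \<le> M \<Longrightarrow> \<bar>r\<bar> \<le> M \<Longrightarrow> \<bar>s\<bar> \<le> M \<Longrightarrow> \<bar>p / 3 + (q + r) / 6 + s / 3\<bar> \<le> M"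
    for p q r s M :: real
  proof -
    assume a: "\<bar>p\<bar> \<le> M" "\<bar>q\<bar> \<le> M" "\<bar>r\<bar> \<le> M" "\<bar>s\<bar> \<le> M"
    have "p / 3 \<le> M / 3" "q / 6 \<le> M / 6" "r / 6 \<le> M / 6" "s / 3 \<le> M / 3"
      "- M / 3 \<le> p / 3" "- M / 6 \<le> q / 6" "- M / 6 \<le> r / 6" "- M / 3 \<le> s / 3"
      using a by auto
    then show ?thesis unfolding add_divide_distrib by (intro abs_leI) linarith+
  qed
  have "\<bar>mass A u f\<bar> \<le> (\<Sum>i=1..N. h * (C * U * F))"
    unfolding mass_def
  proof (rule order_trans[OF sum_abs sum_mono])
    fix i assume i: "i \<in> {1..N}"
    note bs = b[OF i i i] b[OF i i nx_in[OF i]] b[OF i nx_in[OF i] i] b[OF i nx_in[OF i] nx_in[OF i]]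
    have "\<bar>f i \<bullet> A i (u i) / 3 + (f i \<bullet> A i (u (nx i)) + f (nx i) \<bullet> A i (u i)) / 6 + f (nx i) \<bullet> A i (u (nx i)) / 3\<bar> \<le> C * U * F"
      by (rule avg[OF bs])
    then show "\<bar>h * (f i \<bullet> A i (u i) / 3 + (f i \<bullet> A i (u (nx i)) + f (nx i) \<bullet> A i (u i)) / 6 + f (nx i) \<bullet> A i (u (nx i)) / 3)\<bar> \<le> h * (C * U * F)"
      using h_pos by (simp only: abs_mult) (simp add: mult_left_mono)
  qed
  also have "\<dots> = (real N * h) * (C * U * F)" by simp
  finally show ?thesis unfolding Nh by (simp add: ac_simps)
qed

lemma stiff_bound:
  assumes p: "\<And>i. i \<in> {1..N} \<Longrightarrow> norm (p i) \<le> P" and f: "\<And>i. i \<in> {1..N} \<Longrightarrow> norm (f i) \<le> F"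
  shows "\<bar>stiff p f\<bar> \<le> 2 * real N * P * F"
proof -
  have "\<bar>stiff p f\<bar> \<le> (\<Sum>i=1..N. P * (F + F))"
    unfolding stiff_def
  proof (rule order_trans[OF sum_abs sum_mono])
    fix i assume i: "i \<in> {1..N}"
    have "norm (f (nx i) - f i) \<le> F + F"
      using norm_triangle_ineq4[of "f (nx i)" "f i"] f[OF i] f[OF nx_in[OF i]] by simp
    then have "norm (p i) * norm (f (nx i) - f i) \<le> P * (F + F)"
      using p[OF i] by (intro mult_mono) (auto intro: order_trans[OF norm_ge_zero])
    then show "\<bar>p i \<bullet> (f (nx i) - f i)\<bar> \<le> P * (F + F)" using Cauchy_Schwarz_ineq2[of "p i"] order_trans by blast
  qed
  then show ?thesis by (simp add: algebra_simps)
qed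

lemma mass_linear_left: "(\<And>i. linear (A i)) \<Longrightarrow> linear (\<lambda>u. mass A (apply_bcontfun u) f)"
  by (rule linearI)
    (simp_all add: mass_def linear_add linear_scale inner_add_right sum.distrib[symmetric] sum_distrib_left algebra_simps add_divide_distrib)

lemma mass_linear_right: "linear (\<lambda>f. mass A u (apply_bcontfun f))"
  by (rule linearI)
    (simp_all add: mass_def inner_add_left sum.distrib[symmetric] sum_distrib_left algebra_simps add_divide_distrib)

lemma mass_diff_op: "mass (\<lambda>i v. A i v - B i v) u f = mass A u f - mass B u f"
  by (simp add: mass_def inner_diff_right sum_subtractf[symmetric] algebra_simps diff_divide_distrib add_divide_distrib)

lemma mass_diff_left: "(\<And>i. linear (A i)) \<Longrightarrow> mass A (\<lambda>j. u j - v j) f = mass A u f - mass A v f"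
  by (simp add: mass_def linear_diff inner_diff_right sum_subtractf[symmetric] algebra_simps diff_divide_distrib add_divide_distrib)

lemma stiff_linear_right: "linear (\<lambda>f. stiff p (apply_bcontfun f))"
  by (rule linearI)
    (simp_all add: stiff_def inner_add_right inner_diff_right sum.distrib[symmetric] sum_distrib_left algebra_simps)

lemma stiff_diff_left: "stiff (\<lambda>i. p i - q i) f = stiff p f - stiff q f"
  by (simp add: stiff_def inner_diff_left sum_subtractf)

section \<open>The nodal velocity as a function of the slopes\<close>

text \<open>The argument is the family of slopes and not the nodal values, so that the slopes can be
  truncated first.\<close>

definition velocity :: "real \<Rightarrow> (nat \<Rightarrow> real ^ 2) \<Rightarrow> nat \<Rightarrow>\<^sub>C (real ^ 2)" where
  "velocity \<alpha> p = (THE u. u \<in> span node_basis \<and> (\<forall>f\<in>span node_basis.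
     mass (\<lambda>i. scheme_op \<alpha> (p i)) (apply_bcontfun u) (apply_bcontfun f) = - stiff p (apply_bcontfun f)))"

text \<open>Slopes bounded away from zero make the mass form definite on the nodes. Vectors in the
  span vanish off \<open>{1..N}\<close>, while \<open>mass\<close> and \<open>stiff\<close> read
  only these indices; hence the equation tested in the span extends to every
  \<open>f\<close>.\<close>

lemma velocity_properties:
  assumes \<alpha>: "0 < \<alpha>" "\<alpha> \<le> 1" and a: "a > 0" and p: "\<forall>i\<in>{1..N}. a \<le> norm (p i)"
  shows mass_scheme_op_coercive: "\<And>u. \<alpha> * a\<^sup>2 * h / 3 * (\<Sum>i=1..N. (norm (u i))\<^sup>2) \<le> mass (\<lambda>i. scheme_op \<alpha> (p i)) u u"
    and velocity_in_span: "velocity \<alpha> p \<in> span node_basis"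
    and velocity_eq: "\<And>f. mass (\<lambda>i. scheme_op \<alpha> (p i)) (apply_bcontfun (velocity \<alpha> p)) f = - stiff p f"
    and velocity_unique: "\<And>u j. (\<And>f. mass (\<lambda>i. scheme_op \<alpha> (p i)) u f = - stiff p f) \<Longrightarrow> j \<in> {1..N} \<Longrightarrow>
      u j = apply_bcontfun (velocity \<alpha> p) j"
proof -
  show co: "\<alpha> * a\<^sup>2 * h / 3 * (\<Sum>i=1..N. (norm (u i))\<^sup>2) \<le> mass (\<lambda>i. scheme_op \<alpha> (p i)) u u" for u
  proof (rule mass_coercive)
    fix i and v :: "real ^ 2" assume i: "i \<in> {1..N}"
    have "a\<^sup>2 \<le> (norm (p i))\<^sup>2" using a bspec[OF p i] by (intro power_mono) auto
    then have "\<alpha> * a\<^sup>2 * (norm v)\<^sup>2 \<le> \<alpha> * (norm (p i))\<^sup>2 * (norm v)\<^sup>2"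
      using \<alpha> by (intro mult_right_mono mult_left_mono) auto
    also have "\<dots> \<le> v \<bullet> scheme_op \<alpha> (p i) v" by (rule scheme_op_coercive[OF \<alpha>])
    finally show "\<alpha> * a\<^sup>2 * (norm v)\<^sup>2 \<le> v \<bullet> scheme_op \<alpha> (p i) v" .
  qed (use \<alpha> a linear_scheme_op in auto)
  have z: "u j = 0" if "mass (\<lambda>i. scheme_op \<alpha> (p i)) u u = 0" "j \<in> {1..N}" for u j
  proof -
    have "0 < \<alpha> * a\<^sup>2 * h / 3" using \<alpha> a h_pos by simp
    moreover have "\<alpha> * a\<^sup>2 * h / 3 * (\<Sum>i=1..N. (norm (u i))\<^sup>2) \<le> \<alpha> * a\<^sup>2 * h / 3 * 0"
      using co[of u] that(1) by simp
    ultimately have "(\<Sum>i=1..N. (norm (u i))\<^sup>2) \<le> 0" by (metis mult_le_cancel_left_pos)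
    then have "(\<Sum>i=1..N. (norm (u i))\<^sup>2) = 0" by (simp add: order_antisym sum_nonneg)
    then show ?thesis using that(2) by (simp add: sum_nonneg_eq_0_iff)
  qed
  have ex1: "\<exists>!u. u \<in> span node_basis \<and> (\<forall>f\<in>span node_basis.
     mass (\<lambda>i. scheme_op \<alpha> (p i)) (apply_bcontfun u) (apply_bcontfun f) = - stiff p (apply_bcontfun f))"
  proof (rule lax_milgram_finite[OF finite_node_basis])
    show "linear (\<lambda>u. mass (\<lambda>i. scheme_op \<alpha> (p i)) (apply_bcontfun u) (apply_bcontfun f))" for f
      by (rule mass_linear_left) (rule linear_scheme_op)
    show "linear (\<lambda>f. mass (\<lambda>i. scheme_op \<alpha> (p i)) (apply_bcontfun u) (apply_bcontfun f))" for u
      by (rule mass_linear_right)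
    show "linear (\<lambda>f. - stiff p (apply_bcontfun f))"
      by (rule linear_compose_neg[OF stiff_linear_right])
    fix u assume u: "u \<in> span node_basis" "mass (\<lambda>i. scheme_op \<alpha> (p i)) (apply_bcontfun u) (apply_bcontfun u) = 0"
    show "u = 0"
    proof (rule bcontfun_eqI)
      show "apply_bcontfun u j = apply_bcontfun 0 j" for j
        using z[OF u(2)] span_node_basis_0[OF u(1)] by (cases "j \<in> {1..N}") auto
    qed
  qed
  note V = theI'[OF ex1, folded velocity_def]
  then show "velocity \<alpha> p \<in> span node_basis" by simp
  show eq: "mass (\<lambda>i. scheme_op \<alpha> (p i)) (apply_bcontfun (velocity \<alpha> p)) f = - stiff p f" for f
  proof -
    have "mass (\<lambda>i. scheme_op \<alpha> (p i)) (apply_bcontfun (velocity \<alpha> p)) f = mass (\<lambda>i. scheme_op \<alpha> (p i)) (apply_bcontfun (velocity \<alpha> p)) (apply_bcontfun (node_vec f))"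
      by (rule mass_cong) (auto simp: apply_node_vec)
    also have "\<dots> = - stiff p (apply_bcontfun (node_vec f))" using V node_vec_in_span by blast
    also have "\<dots> = - stiff p f" by (simp, rule stiff_cong) (auto simp: apply_node_vec)
    finally show ?thesis .
  qed
  fix u j assume u: "\<And>f. mass (\<lambda>i. scheme_op \<alpha> (p i)) u f = - stiff p f" and j: "j \<in> {1..N}"
  have "mass (\<lambda>i. scheme_op \<alpha> (p i)) (\<lambda>j. u j - apply_bcontfun (velocity \<alpha> p) j) f = 0" for f
    by (subst mass_diff_left) (auto simp: linear_scheme_op u eq)
  from z[OF this j] show "u j = apply_bcontfun (velocity \<alpha> p) j" by simp
qed

text \<open>The supremum norm is at most the Euclidean norm of the nodal values, and one factor
  \<open>norm u\<close> cancels.\<close>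

lemma norm_le_of_sum:
  assumes "u \<in> span node_basis" "k > 0" "k * (\<Sum>i=1..N. (norm (apply_bcontfun u i))\<^sup>2) \<le> B * norm u" "B \<ge> 0"
  shows "norm u \<le> B / k"
proof (rule le_of_mult_power2[OF _ assms(2) norm_ge_zero assms(4)])
  define S where "S = (\<Sum>i=1..N. (norm (apply_bcontfun u i))\<^sup>2)"
  have S0: "S \<ge> 0" by (simp add: S_def sum_nonneg)
  have "norm u \<le> sqrt S"
  proof (rule norm_bound)
    fix j show "norm (apply_bcontfun u j) \<le> sqrt S"
    proof (cases "j \<in> {1..N}")
      case True
      then have "(norm (apply_bcontfun u j))\<^sup>2 \<le> S"
        unfolding S_def by (intro member_le_sum[of j "{1..N}" "\<lambda>i. (norm (apply_bcontfun u i))\<^sup>2"]) auto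
      then show ?thesis by (rule real_le_rsqrt)
    qed (use span_node_basis_0[OF assms(1)] S0 in simp)
  qed
  then have "(norm u)\<^sup>2 \<le> (sqrt S)\<^sup>2" by (intro power_mono) auto
  then have "(norm u)\<^sup>2 \<le> S" using S0 by simp
  then have "k * (norm u)\<^sup>2 \<le> k * S" using assms by (intro mult_left_mono) auto
  then show "k * (norm u)\<^sup>2 \<le> B * norm u" using assms(3) unfolding S_def by linarith
qed

text \<open>The difference of the two equations is tested with the difference \<open>w\<close> of
  the velocities: coercivity for \<open>p\<close> bounds \<open>w\<close> by the change of the
  stiffness term and by the change of the operator acting on the second velocity. The constant
  depends on the mesh and on \<alpha>; it serves existence and uniqueness, not the error
  bound.\<close>

lemma velocity_lipschitz:
  assumes \<alpha>: "0 < \<alpha>" "\<alpha> \<le> 1" and a: "a > 0"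
  obtains L where "L \<ge> 0"
    "\<And>p q d. (\<And>i. i \<in> {1..N} \<Longrightarrow> a \<le> norm (p i) \<and> norm (p i) \<le> b) \<Longrightarrow>
      (\<And>i. i \<in> {1..N} \<Longrightarrow> a \<le> norm (q i) \<and> norm (q i) \<le> b) \<Longrightarrow>
      (\<And>i. i \<in> {1..N} \<Longrightarrow> norm (p i - q i) \<le> d) \<Longrightarrow> norm (velocity \<alpha> p - velocity \<alpha> q) \<le> L * d"
proof -
  define k where "k = \<alpha> * a\<^sup>2 * h / 3"
  have k: "k > 0" using \<alpha> a h_pos by (simp add: k_def)
  \<comment> \<open>An a priori bound for a single velocity, from testing its own equation with
    itself; it is used for the velocity on which the operator difference acts.\<close>
  define U where "U = 2 * real N * \<bar>b\<bar> / k"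
  have U0: "U \<ge> 0" using k by (simp add: U_def)
  define L where "L = (2 * real N + 2 * pi * (4 * \<bar>b\<bar>) * U) / k"
  show thesis
  proof
    show "L \<ge> 0" using k U0 by (simp add: L_def)
    fix p q :: "nat \<Rightarrow> real ^ 2" and d :: real
    assume p: "\<And>i. i \<in> {1..N} \<Longrightarrow> a \<le> norm (p i) \<and> norm (p i) \<le> b"
      and q: "\<And>i. i \<in> {1..N} \<Longrightarrow> a \<le> norm (q i) \<and> norm (q i) \<le> b"
      and d: "\<And>i. i \<in> {1..N} \<Longrightarrow> norm (p i - q i) \<le> d"
    have d0: "d \<ge> 0" using order_trans[OF norm_ge_zero d[of 1]] N3 by simp
    have b0: "b \<ge> 0" using p[of 1] N3 a by auto
    have p': "\<forall>i\<in>{1..N}. a \<le> norm (p i)" and q': "\<forall>i\<in>{1..N}. a \<le> norm (q i)"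
      using p q by auto
    let ?u = "velocity \<alpha> p" and ?v = "velocity \<alpha> q"
    note up = velocity_properties[of \<alpha> a p, OF \<alpha> a p'] and uq = velocity_properties[of \<alpha> a q, OF \<alpha> a q']
    have vU: "norm ?v \<le> U"
      unfolding U_def
    proof (rule norm_le_of_sum[OF uq(2) k])
      have "k * (\<Sum>i=1..N. (norm (apply_bcontfun ?v i))\<^sup>2) \<le> mass (\<lambda>i. scheme_op \<alpha> (q i)) (apply_bcontfun ?v) (apply_bcontfun ?v)"
        unfolding k_def by (rule uq(1))
      also have "\<dots> = - stiff q (apply_bcontfun ?v)" by (rule uq(3))
      also have "\<dots> \<le> 2 * real N * b * norm ?v"
        using stiff_bound[of q b "apply_bcontfun ?v" "norm ?v"] q norm_bounded[of ?v] by (simp add: abs_le_iff)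
      finally show "k * (\<Sum>i=1..N. (norm (apply_bcontfun ?v i))\<^sup>2) \<le> 2 * real N * \<bar>b\<bar> * norm ?v" using b0 by simp
    qed auto
    have w: "?u - ?v \<in> span node_basis" using up(2) uq(2) by (rule span_diff)
    let ?w = "apply_bcontfun (?u - ?v)"
    have "norm (?u - ?v) \<le> ((2 * real N + 2 * pi * (4 * \<bar>b\<bar>) * U) * d) / k"
    proof (rule norm_le_of_sum[OF w k])
      have "k * (\<Sum>i=1..N. (norm (?w i))\<^sup>2) \<le> mass (\<lambda>i. scheme_op \<alpha> (p i)) ?w ?w"
        unfolding k_def by (rule up(1))
      also have "\<dots> = mass (\<lambda>i. scheme_op \<alpha> (p i)) (apply_bcontfun ?u) ?w - mass (\<lambda>i. scheme_op \<alpha> (p i)) (apply_bcontfun ?v) ?w"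
        by (simp only: minus_bcontfun.rep_eq) (rule mass_diff_left, rule linear_scheme_op)
      also have "\<dots> = - stiff (\<lambda>i. p i - q i) ?w - mass (\<lambda>i v. scheme_op \<alpha> (p i) v - scheme_op \<alpha> (q i) v) (apply_bcontfun ?v) ?w"
        unfolding mass_diff_op stiff_diff_left up(3) uq(3) by simp
      also have "\<dots> \<le> 2 * real N * d * norm (?u - ?v) + 2 * pi * (4 * b * d) * norm ?v * norm (?u - ?v)"
      proof -
        have "\<bar>stiff (\<lambda>i. p i - q i) ?w\<bar> \<le> 2 * real N * d * norm (?u - ?v)"
          by (rule stiff_bound) (rule d, assumption, rule norm_bounded)
        moreover have "\<bar>mass (\<lambda>i v. scheme_op \<alpha> (p i) v - scheme_op \<alpha> (q i) v) (apply_bcontfun ?v) ?w\<bar>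
          \<le> 2 * pi * (4 * b * d) * norm ?v * norm (?u - ?v)"
        proof (rule mass_bound)
          fix i and v :: "real ^ 2" assume i: "i \<in> {1..N}"
          have "2 * (norm (p i) + norm (q i)) * norm (p i - q i) * norm v \<le> 2 * (b + b) * d * norm v"
            using p[OF i] q[OF i] d[OF i] b0 by (intro mult_right_mono mult_mono) auto
          then show "norm (scheme_op \<alpha> (p i) v - scheme_op \<alpha> (q i) v) \<le> 4 * b * d * norm v"
            using scheme_op_diff[OF \<alpha>, of "p i" v "q i"] by simp
        next
          show "0 \<le> 4 * b * d" using b0 d0 by simp
        qed (rule norm_bounded)+
        ultimately show ?thesis by linarith
      qed
      also have "\<dots> \<le> 2 * real N * d * norm (?u - ?v) + 2 * pi * (4 * b * d) * U * norm (?u - ?v)"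
        using vU b0 d0 by (intro add_mono mult_right_mono mult_left_mono order_refl) auto
      also have "\<dots> = (2 * real N + 2 * pi * (4 * \<bar>b\<bar>) * U) * d * norm (?u - ?v)"
        using b0 by (simp add: algebra_simps)
      finally show "k * (\<Sum>i=1..N. (norm (?w i))\<^sup>2) \<le> (2 * real N + 2 * pi * (4 * \<bar>b\<bar>) * U) * d * norm (?u - ?v)" .
    qed (use U0 d0 in simp)
    then show "norm (?u - ?v) \<le> L * d" by (simp add: L_def)
  qed
qed

lemma slope_diff: "slope c i - slope d i = slope (\<lambda>j. c j - d j) i"
  by (simp add: slope_def scaleR_diff_right)

lemma slope_bound:
  assumes "\<And>j. j \<in> {1..N} \<Longrightarrow> norm (c j) \<le> S" "i \<in> {1..N}"
  shows "norm (slope c i) \<le> 2 / h * S"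
proof -
  have "norm (c (nx i) - c i) \<le> S + S"
    using norm_triangle_ineq4[of "c (nx i)" "c i"] assms(1)[OF assms(2)] assms(1)[OF nx_in[OF assms(2)]] by simp
  moreover have "norm (slope c i) = norm (c (nx i) - c i) / h"
    unfolding slope_def norm_scaleR using h_pos by simp
  ultimately show ?thesis using h_pos by (simp add: divide_right_mono)
qed

end

section \<open>The semi-discrete scheme as an ordinary differential equation\<close>

text \<open>The distance of integers induces the discrete topology, for which every function on
  \<open>nat\<close> is continuous. With it the nodal vectors form a Banach space, as the Picard
  argument requires.\<close>

instantiation nat :: metric_space
begin

definition dist_nat :: "nat \<Rightarrow> nat \<Rightarrow> real" where "dist_nat m n = \<bar>real m - real n\<bar>"

definition uniformity_nat :: "(nat \<times> nat) filter" where
  "uniformity_nat = (INF e\<in>{0 <..}. principal {(x, y). dist x y < e})"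

instance
proof
  fix m n k :: nat and U :: "nat set"
  show "dist m n = 0 \<longleftrightarrow> m = n" by (simp add: dist_nat_def)
  show "dist m n \<le> dist m k + dist n k" unfolding dist_nat_def by linarith
  show "uniformity = (INF e\<in>{0 <..}. principal {(x, y :: nat). dist x y < e})" by (rule uniformity_nat_def)
  have "eventually (\<lambda>(x', y). x' = x \<longrightarrow> y \<in> U) uniformity" if "x \<in> U" for x
  proof (rule filter_leD)
    show "uniformity \<le> principal {(x, y :: nat). dist x y < 1}"
      unfolding uniformity_nat_def by (rule INF_lower) simp
    show "eventually (\<lambda>(x', y). x' = x \<longrightarrow> y \<in> U) (principal {(x, y :: nat). dist x y < 1})"
      unfolding eventually_principal
    proof (clarify)
      fix y assume "dist x y < 1"
      then have "x = y" unfolding dist_nat_def by linarith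
      with that show "y \<in> U" by simp
    qed
  qed
  then show "open U \<longleftrightarrow> (\<forall>x\<in>U. eventually (\<lambda>(x', y). x' = x \<longrightarrow> y \<in> U) uniformity)"
    using open_discrete[of U] by blast
qed

end

instance bcontfun :: (metric_space, banach) banach ..

lemma AE_lebesgue_on_iff: 
  "S \<in> sets lebesgue \<Longrightarrow> (AE t in lebesgue_on S. P t) \<longleftrightarrow> (AE t in lebesgue. t \<in> S \<longrightarrow> P t)"
  by (rule AE_restrict_space_iff) auto

lemma continuous_on_dominated_dist:
  fixes f :: "real \<Rightarrow> 'a::real_normed_vector"
  assumes "\<And>s t. s \<in> S \<Longrightarrow> t \<in> S \<Longrightarrow> norm (f t - f s) \<le> e t s"
    and "\<And>s. s \<in> S \<Longrightarrow> ((\<lambda>t. e t s) \<longlongrightarrow> 0) (at s within S)"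
  shows "continuous_on S f"
  unfolding continuous_on_def
proof
  fix s assume s: "s \<in> S"
  have "((\<lambda>t. f t - f s) \<longlongrightarrow> 0) (at s within S)"
  proof (rule Lim_null_comparison)
    show "\<forall>\<^sub>F t in at s within S. norm (f t - f s) \<le> e t s"
      using assms(1)[OF s] by (auto simp: eventually_at_filter)
  qed (rule assms(2)[OF s])
  then show "(f \<longlongrightarrow> f s) (at s within S)" by (simp add: LIM_zero_iff)
qed

context fe_mesh
begin

section \<open>Norms, weak form and normals in terms of nodal values\<close>

lemma fe_diff: "fe u x - fe v x = fe (\<lambda>j. u j - v j) x"
  by (simp add: fe_def scaleR_diff_right sum_subtractf)

lemma LINT_norm_fe: "(LINT x:{0..2*pi}|lebesgue. (norm (fe v x))\<^sup>2) = mass (\<lambda>_ x. x) v v"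
proof -
  have p: "periodic2pi (\<lambda>x. (norm (fe v x))\<^sup>2)" using periodic_fe[of v] by (simp add: periodic2pi_def)
  show ?thesis
    by (rule LINT_mass(2)[OF _ p]) (simp_all add: power2_norm_eq_inner linear_id[unfolded id_def])
qed

lemma L2_norm_fe: "L2_norm {0<..<2*pi} (fe v) = sqrt (mass (\<lambda>_ x. x) v v)"
  unfolding L2_norm_def set_integral_open_closed(2) LINT_norm_fe ..

lemma mass_nonneg: "mass (\<lambda>_ x. x) v v \<ge> 0"
proof -
  have "1 * h / 3 * (\<Sum>i=1..N. (norm (v i))\<^sup>2) \<le> mass (\<lambda>_ x. x) v v"
    by (rule mass_coercive) (auto simp: power2_norm_eq_inner linear_id[unfolded id_def])
  moreover have "0 \<le> 1 * h / 3 * (\<Sum>i=1..N. (norm (v i))\<^sup>2)"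
    using h_pos by (intro mult_nonneg_nonneg sum_nonneg) auto
  ultimately show ?thesis by linarith
qed

lemma continuous_mass_id:
  assumes u: "\<And>j. j \<in> {1..N} \<Longrightarrow> continuous_on S (\<lambda>t. u t j)" and v: "\<And>j. j \<in> {1..N} \<Longrightarrow> continuous_on S (\<lambda>t. v t j)"
  shows "continuous_on S (\<lambda>t. mass (\<lambda>_ x. x) (u t) (v t))"
  unfolding mass_def by (intro continuous_intros u v nx_in) auto

lemma continuous_fe_time:
  fixes u :: "real \<Rightarrow> nat \<Rightarrow> 'a::real_normed_vector"
  assumes u: "\<And>j. j \<in> {1..N} \<Longrightarrow> continuous_on S (\<lambda>t. u t j)"
  shows "continuous_on S (\<lambda>t. fe (u t) x)"
  unfolding fe_def by (intro continuous_intros u)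

text \<open>Strong measurability by rounding: evaluating \<open>u\<close> at the largest multiple of
  \<open>T / (n + 1)\<close> below \<open>t\<close> gives a simple function, and continuity of the
  nodal values gives convergence at every time.\<close>

lemma bochner_L2_fe:
  assumes T: "T > 0" and u: "\<And>j. j \<in> {1..N} \<Longrightarrow> continuous_on {0..T} (\<lambda>t. u t j)"
  shows "bochner_L2 T (fe_space2 N \<theta>) (L2_norm {0<..<2*pi}) (\<lambda>t. fe (u t))"
  unfolding bochner_L2_def bochner_measurable_def
proof (intro conjI exI[of _ "\<lambda>n t. fe (u (T * of_int \<lfloor>real (Suc n) * t / T\<rfloor> / real (Suc n)))"] allI ballI)
  show "AE t in lebesgue_on {0<..<T}. fe (u t) \<in> fe_space2 N \<theta>" by (simp add: fe_in_fe_space2)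
  show "fe (u (T * of_int \<lfloor>real (Suc n) * t / T\<rfloor> / real (Suc n))) \<in> fe_space2 N \<theta>" for n t by (rule fe_in_fe_space2)
  show "simple_function (lebesgue_on {0<..<T}) (\<lambda>t. fe (u (T * of_int \<lfloor>real (Suc n) * t / T\<rfloor> / real (Suc n))))" for n
  proof -
    have "simple_function (lebesgue_on {0<..<T}) (\<lambda>t. \<lfloor>real (Suc n) * t / T\<rfloor>)"
      unfolding simple_function_def
    proof (intro conjI ballI)
      have "(\<lambda>t. \<lfloor>real (Suc n) * t / T\<rfloor>) ` space (lebesgue_on {0<..<T}) \<subseteq> {0..int (Suc n)}"
      proof (rule image_subsetI)
        fix t assume "t \<in> space (lebesgue_on {0<..<T})"
        then have t: "0 < t" "t < T" by auto
        then have "real (Suc n) * t \<le> real (Suc n) * T" by (intro mult_left_mono) auto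
        then have "real (Suc n) * t / T \<le> real (Suc n)" "0 \<le> real (Suc n) * t / T" using t T by (auto simp: divide_le_eq)
        then have "0 \<le> \<lfloor>real (Suc n) * t / T\<rfloor>" "\<lfloor>real (Suc n) * t / T\<rfloor> \<le> int (Suc n)" by linarith+
        then show "\<lfloor>real (Suc n) * t / T\<rfloor> \<in> {0..int (Suc n)}" by simp
      qed
      then show "finite ((\<lambda>t. \<lfloor>real (Suc n) * t / T\<rfloor>) ` space (lebesgue_on {0<..<T}))" by (rule finite_subset) simp
      fix k
      have "(\<lambda>t. \<lfloor>real (Suc n) * t / T\<rfloor>) -` {k} \<inter> space (lebesgue_on {0<..<T}) = {0<..<T} \<inter> {of_int k * T / real (Suc n)..<(of_int k + 1) * T / real (Suc n)}"
      proof -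
        have fl: "\<lfloor>real (Suc n) * t / T\<rfloor> = k \<longleftrightarrow> of_int k * T / real (Suc n) \<le> t \<and> t < (of_int k + 1) * T / real (Suc n)" for t
        proof -
          have m: "0 < real (Suc n)" by simp
          show ?thesis
            unfolding floor_eq_iff pos_le_divide_eq[OF T] pos_divide_less_eq[OF T] pos_divide_le_eq[OF m] pos_less_divide_eq[OF m]
            by (simp only: mult.commute)
        qed
        show ?thesis
          by (rule set_eqI) (auto simp only: Int_iff vimage_singleton_eq fl atLeastLessThan_iff space_lebesgue_on)
      qed
      also have "\<dots> \<in> sets (lebesgue_on {0<..<T})" by (subst sets_restrict_space_iff) auto
      finally show "(\<lambda>t. \<lfloor>real (Suc n) * t / T\<rfloor>) -` {k} \<inter> space (lebesgue_on {0<..<T}) \<in> sets (lebesgue_on {0<..<T})" .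
    qed
    from simple_function_compose1[OF this, of "\<lambda>k. fe (u (T * of_int k / real (Suc n)))"] show ?thesis by simp
  qed
  show "AE t in lebesgue_on {0<..<T}.
     (\<lambda>n. L2_norm {0<..<2 * pi} (\<lambda>x. fe (u t) x - fe (u (T * of_int \<lfloor>real (Suc n) * t / T\<rfloor> / real (Suc n))) x)) \<longlonglongrightarrow> 0"
  proof (rule AE_I2)
    fix t assume "t \<in> space (lebesgue_on {0<..<T})"
    then have t: "0 < t" "t < T" by auto
    define g where "g n = T * of_int \<lfloor>real (Suc n) * t / T\<rfloor> / real (Suc n)" for n
    have gb: "t - T / real (Suc n) \<le> g n" "g n \<le> t" "0 \<le> g n" for n
    proof -
      let ?m = "real (Suc n)"
      have m: "?m > 0" by simp
      have f: "of_int \<lfloor>?m * t / T\<rfloor> \<le> ?m * t / T" "?m * t / T \<le> of_int \<lfloor>?m * t / T\<rfloor> + 1"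
        by linarith+
      have f0: "(0::real) \<le> of_int \<lfloor>?m * t / T\<rfloor>" using t T by (simp del: of_nat_Suc)
      have "T * of_int \<lfloor>?m * t / T\<rfloor> \<le> T * (?m * t / T)" using f T by (intro mult_left_mono) auto
      then show "g n \<le> t" using T m unfolding g_def by (simp add: divide_le_eq mult.commute del: of_nat_Suc)
      have "T * (?m * t / T) \<le> T * (of_int \<lfloor>?m * t / T\<rfloor> + 1)" using f T by (intro mult_left_mono) auto
      then have "?m * t - T \<le> T * of_int \<lfloor>?m * t / T\<rfloor>" using T by (simp add: algebra_simps del: of_nat_Suc)
      then have "(?m * t - T) / ?m \<le> g n" unfolding g_def using m by (intro divide_right_mono) auto
      then show "t - T / ?m \<le> g n" using m by (simp add: diff_divide_distrib del: of_nat_Suc)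
      show "0 \<le> g n" using f0 T unfolding g_def by simp
    qed
    have gl: "g \<longlonglongrightarrow> t"
    proof (rule tendsto_sandwich)
      show "\<forall>\<^sub>F n in sequentially. t - T / real (Suc n) \<le> g n" "\<forall>\<^sub>F n in sequentially. g n \<le> t" using gb by auto
      show "(\<lambda>n. t - T / real (Suc n)) \<longlonglongrightarrow> t"
        using tendsto_diff[OF tendsto_const LIMSEQ_Suc[OF lim_const_over_n[of T]], of t] by simp
    qed simp
    have uj: "(\<lambda>n. u (g n) j) \<longlonglongrightarrow> u t j" if "j \<in> {1..N}" for j
    proof (rule continuous_on_tendsto_compose[OF u[OF that] gl])
      have "g n \<in> {0..T}" for n using gb(2,3)[of n] t by auto
      then show "\<forall>\<^sub>F n in sequentially. g n \<in> {0..T}" by simp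
    qed (use t in auto)
    have "(\<lambda>n. mass (\<lambda>_ x. x) (\<lambda>j. u t j - u (g n) j) (\<lambda>j. u t j - u (g n) j)) \<longlonglongrightarrow>
      mass (\<lambda>_ x. x) (\<lambda>j. u t j - u t j) (\<lambda>j. u t j - u t j)"
      unfolding mass_def by (intro tendsto_intros uj nx_in) auto
    then have "(\<lambda>n. sqrt (mass (\<lambda>_ x. x) (\<lambda>j. u t j - u (g n) j) (\<lambda>j. u t j - u (g n) j))) \<longlonglongrightarrow> sqrt 0"
      by (intro tendsto_real_sqrt) (simp add: mass_def)
    then show "(\<lambda>n. L2_norm {0<..<2 * pi} (\<lambda>x. fe (u t) x - fe (u (T * of_int \<lfloor>real (Suc n) * t / T\<rfloor> / real (Suc n))) x)) \<longlonglongrightarrow> 0"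
      unfolding fe_diff L2_norm_fe g_def by simp
  qed
  have "set_integrable lebesgue {0..T} (\<lambda>t. (L2_norm {0<..<2 * pi} (fe (u t)))\<^sup>2)"
    unfolding L2_norm_fe
  proof (rule absolutely_integrable_continuous_real)
    have "continuous_on {0..T} (\<lambda>t. mass (\<lambda>_ x. x) (u t) (u t))"
      by (rule continuous_mass_id) (rule u, assumption)+
    then show "continuous_on {0..T} (\<lambda>t. (sqrt (mass (\<lambda>_ x. x) (u t) (u t)))\<^sup>2)"
      by (simp add: mass_nonneg)
  qed
  then show "set_integrable lebesgue {0<..<T} (\<lambda>t. (L2_norm {0<..<2 * pi} (fe (u t)))\<^sup>2)"
    by (rule set_integrable_subset) auto
qed

text \<open>Both integrals are evaluated exactly and test functions are replaced by their nodal
  values. The normal field disappears through \<open>scheme_op_normal_form\<close>, so every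
  admissible choice of it yields the same condition.\<close>

lemma weak_form_iff:
  assumes \<nu>: "unit_normal_fe N \<theta> (fe c) \<nu>"
  shows "(\<forall>\<phi>\<in>fe_space2 N \<theta>.
        (LINT x:{0..2*pi}|lebesgue.
           (\<alpha> * (fe u x \<bullet> \<phi> x) + (1 - \<alpha>) * ((fe u x \<bullet> \<nu> x) * (\<nu> x \<bullet> \<phi> x))) * (norm (dx (fe c) x))\<^sup>2)
        + (LINT x:{0..2*pi}|lebesgue. dx (fe c) x \<bullet> dx \<phi> x) = 0)
    \<longleftrightarrow> (\<forall>f. mass (\<lambda>i. scheme_op \<alpha> (slope c i)) u f = - stiff (slope c) f)"
proof -
  have 1: "(LINT x:{0..2*pi}|lebesgue.
           (\<alpha> * (fe u x \<bullet> fe f x) + (1 - \<alpha>) * ((fe u x \<bullet> \<nu> x) * (\<nu> x \<bullet> fe f x))) * (norm (dx (fe c) x))\<^sup>2)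
     = mass (\<lambda>i. scheme_op \<alpha> (slope c i)) u f" for f
  proof (rule LINT_mass(2))
    show "periodic2pi (\<lambda>x. (\<alpha> * (fe u x \<bullet> fe f x) + (1 - \<alpha>) * ((fe u x \<bullet> \<nu> x) * (\<nu> x \<bullet> fe f x))) * (norm (dx (fe c) x))\<^sup>2)"
      using \<nu> periodic_fe[of u] periodic_fe[of f] periodic2pi_dx[OF periodic_fe[of c]]
      by (simp add: periodic2pi_def unit_normal_fe_def)
    fix i x assume i: "i \<in> {1..N}" and x: "x \<in> {\<theta> i<..<\<theta> (i + 1)}"
    obtain n where n: "norm n = 1" "n \<bullet> (fe c (\<theta> (i + 1)) - fe c (\<theta> i)) = 0" "\<And>x. x \<in> {\<theta> i..<\<theta> (i + 1)} \<Longrightarrow> \<nu> x = n"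
      using \<nu> i unfolding unit_normal_fe_def by blast
    have "n \<bullet> slope c i = 0"
      using n(2) node_nx[OF periodic_fe i, of c] fe_at_node[OF i, of c] fe_at_node[OF nx_in[OF i], of c] by (simp add: slope_def)
    moreover have "\<nu> x = n" using n(3) x by auto
    ultimately show "(\<alpha> * (fe u x \<bullet> fe f x) + (1 - \<alpha>) * ((fe u x \<bullet> \<nu> x) * (\<nu> x \<bullet> fe f x))) * (norm (dx (fe c) x))\<^sup>2
      = fe f x \<bullet> scheme_op \<alpha> (slope c i) (fe u x)"
      unfolding dx_fe[OF i x] using scheme_op_normal_form[OF n(1)] by simp
  qed (rule linear_scheme_op)
  have 2: "(LINT x:{0..2*pi}|lebesgue. dx (fe c) x \<bullet> dx (fe f) x) = stiff (slope c) f" for f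
    by (rule LINT_stiff)
      (use periodic2pi_dx[OF periodic_fe[of c]] periodic2pi_dx[OF periodic_fe[of f]] in \<open>auto simp: periodic2pi_def dx_fe\<close>)
  show ?thesis
  proof
    assume L: "\<forall>\<phi>\<in>fe_space2 N \<theta>.
        (LINT x:{0..2*pi}|lebesgue.
           (\<alpha> * (fe u x \<bullet> \<phi> x) + (1 - \<alpha>) * ((fe u x \<bullet> \<nu> x) * (\<nu> x \<bullet> \<phi> x))) * (norm (dx (fe c) x))\<^sup>2)
        + (LINT x:{0..2*pi}|lebesgue. dx (fe c) x \<bullet> dx \<phi> x) = 0"
    show "\<forall>f. mass (\<lambda>i. scheme_op \<alpha> (slope c i)) u f = - stiff (slope c) f"
    proof
      fix f show "mass (\<lambda>i. scheme_op \<alpha> (slope c i)) u f = - stiff (slope c) f"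
        using bspec[OF L fe_in_fe_space2[of f]] unfolding 1 2 by linarith
    qed
  next
    assume R: "\<forall>f. mass (\<lambda>i. scheme_op \<alpha> (slope c i)) u f = - stiff (slope c) f"
    show "\<forall>\<phi>\<in>fe_space2 N \<theta>.
        (LINT x:{0..2*pi}|lebesgue.
           (\<alpha> * (fe u x \<bullet> \<phi> x) + (1 - \<alpha>) * ((fe u x \<bullet> \<nu> x) * (\<nu> x \<bullet> \<phi> x))) * (norm (dx (fe c) x))\<^sup>2)
        + (LINT x:{0..2*pi}|lebesgue. dx (fe c) x \<bullet> dx \<phi> x) = 0"
    proof
      fix \<phi> assume "\<phi> \<in> fe_space2 N \<theta>"
      then obtain f where f: "\<phi> = fe f" using fe_space2_eq_fe by blast
      show "(LINT x:{0..2*pi}|lebesgue.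
           (\<alpha> * (fe u x \<bullet> \<phi> x) + (1 - \<alpha>) * ((fe u x \<bullet> \<nu> x) * (\<nu> x \<bullet> \<phi> x))) * (norm (dx (fe c) x))\<^sup>2)
        + (LINT x:{0..2*pi}|lebesgue. dx (fe c) x \<bullet> dx \<phi> x) = 0"
        unfolding f 1 2 using R by simp
    qed
  qed
qed

text \<open>The default at \<open>p = 0\<close> keeps unit length, so that a normal field exists on
  degenerate elements too.\<close>

definition normal_vec :: "real ^ 2 \<Rightarrow> real ^ 2" where
  "normal_vec p = (if p = 0 then axis 1 1 else (1 / norm p) *\<^sub>R vector [- p $ 2, p $ 1])"

lemma normal_vec: "norm (normal_vec p) = 1" "normal_vec p \<bullet> p = 0"
proof -
  have "norm (vector [- p $ 2, p $ 1] :: real ^ 2) = norm p"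
    by (simp add: norm_eq_sqrt_inner inner_vec_def sum_2 add.commute)
  then show "norm (normal_vec p) = 1" by (auto simp: normal_vec_def)
  show "normal_vec p \<bullet> p = 0" by (simp add: normal_vec_def inner_vec_def sum_2)
qed

lemma unit_normal_fe_exists: "unit_normal_fe N \<theta> (fe c) (\<lambda>x. normal_vec (slope c (idx x)))"
  unfolding unit_normal_fe_def
proof (intro conjI ballI)
  show "periodic2pi (\<lambda>x. normal_vec (slope c (idx x)))"
    by (simp add: periodic2pi_def idx_def rep_periodic)
  fix j assume j: "j \<in> {1..N}"
  have "fe c (\<theta> (j + 1)) - fe c (\<theta> j) = h *\<^sub>R slope c j"
    using node_nx[OF periodic_fe j, of c] fe_at_node[OF j, of c] fe_at_node[OF nx_in[OF j], of c] h_pos by (simp add: slope_def)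
  then show "\<exists>n. norm n = 1 \<and> n \<bullet> (fe c (\<theta> (j + 1)) - fe c (\<theta> j)) = 0 \<and>
      (\<forall>x\<in>{\<theta> j..<\<theta> (j + 1)}. normal_vec (slope c (idx x)) = n)"
    by (intro exI[of _ "normal_vec (slope c j)"]) (auto simp: normal_vec idx_unique[OF j])
qed

lemma velocity_cong:
  assumes "\<And>i. i \<in> {1..N} \<Longrightarrow> p i = q i"
  shows "velocity \<alpha> p = velocity \<alpha> q"
proof -
  have "mass (\<lambda>i. scheme_op \<alpha> (p i)) u f = mass (\<lambda>i. scheme_op \<alpha> (q i)) u f" "stiff p f = stiff q f" for u f
    by (rule mass_cong stiff_cong; simp add: assms)+
  then show ?thesis by (simp add: velocity_def)
qed

end

text \<open>The mesh together with reference slopes \<open>ps\<close>. Slopes are truncated to the \<open>\<delta>\<close>-balls around the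
  reference, which makes the semi-discrete system a globally Lipschitz ODE.\<close>

locale fe_flow = fe_mesh +
  fixes \<alpha> a b \<delta> T :: real and ps :: "real \<Rightarrow> nat \<Rightarrow> real ^ 2"
  assumes \<alpha>: "0 < \<alpha>" "\<alpha> \<le> 1" and a: "a > 0" and \<delta>: "\<delta> > 0" and T: "T > 0"
    and ps: "\<And>t i. t \<in> {0..T} \<Longrightarrow> i \<in> {1..N} \<Longrightarrow> a + \<delta> \<le> norm (ps t i) \<and> norm (ps t i) + \<delta> \<le> b"
    and cps: "\<And>i. i \<in> {1..N} \<Longrightarrow> continuous_on {0..T} (\<lambda>t. ps t i)"
begin

text \<open>The metric projection onto a ball is nonexpansive, so the truncation preserves Lipschitz
  bounds, and it is the identity inside the tube.\<close>

definition trunc :: "real \<Rightarrow> (nat \<Rightarrow> real ^ 2) \<Rightarrow> nat \<Rightarrow> real ^ 2" where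
  "trunc t c i = ps t i + closest_point (cball 0 \<delta>) (slope c i - ps t i)"

definition field :: "real \<Rightarrow> (nat \<Rightarrow> real ^ 2) \<Rightarrow> nat \<Rightarrow>\<^sub>C (real ^ 2)" where
  "field t c = velocity \<alpha> (trunc t c)"

definition tube :: "real \<Rightarrow> (nat \<Rightarrow> real ^ 2) \<Rightarrow> bool" where
  "tube t c \<longleftrightarrow> (\<forall>i\<in>{1..N}. norm (slope c i - ps t i) \<le> \<delta>)"

lemma trunc_bounds:
  assumes "t \<in> {0..T}" "i \<in> {1..N}"
  shows "a \<le> norm (trunc t c i)" "norm (trunc t c i) \<le> b"
proof -
  define d where "d = closest_point (cball 0 \<delta>) (slope c i - ps t i)"
  have "d \<in> cball 0 \<delta>" unfolding d_def using \<delta> by (intro closest_point_in_set) auto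
  then have "norm d \<le> \<delta>" by simp
  moreover have "trunc t c i = ps t i + d" by (simp add: trunc_def d_def)
  moreover have "norm (ps t i) - norm d \<le> norm (ps t i + d)" "norm (ps t i + d) \<le> norm (ps t i) + norm d"
    by (rule norm_diff_ineq norm_triangle_ineq)+
  ultimately show "a \<le> norm (trunc t c i)" "norm (trunc t c i) \<le> b" using ps[OF assms] by auto
qed

lemma trunc_tube: "tube t c \<Longrightarrow> i \<in> {1..N} \<Longrightarrow> trunc t c i = slope c i"
  by (simp add: trunc_def tube_def closest_point_self)

lemma tube_bounds: "t \<in> {0..T} \<Longrightarrow> tube t c \<Longrightarrow> i \<in> {1..N} \<Longrightarrow> a \<le> norm (slope c i) \<and> norm (slope c i) \<le> b"
  using trunc_bounds[of t i c] trunc_tube[of t c i] by simp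

lemma field_tube: "tube t c \<Longrightarrow> field t c = velocity \<alpha> (slope c)"
  unfolding field_def by (rule velocity_cong) (rule trunc_tube)

text \<open>The moving reference slopes enter twice, as the centre of the ball and inside the
  projection, hence the factor 2; \<open>2 / h\<close> is the cost of a difference quotient. Keeping
  two times \<open>t\<close> and \<open>s\<close> yields continuity in time from the same
  inequality.\<close>

lemma field_lipschitz:
  obtains L where "L \<ge> 0" "\<And>t s c d S. t \<in> {0..T} \<Longrightarrow> s \<in> {0..T} \<Longrightarrow> (\<And>j. j \<in> {1..N} \<Longrightarrow> norm (c j - d j) \<le> S) \<Longrightarrow>
    norm (field t c - field s d) \<le> L * (2 / h * S + 2 * (\<Sum>i=1..N. norm (ps t i - ps s i)))"
proof -
  obtain L where L: "L \<ge> 0"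
    "\<And>p q d. (\<And>i. i \<in> {1..N} \<Longrightarrow> a \<le> norm (p i) \<and> norm (p i) \<le> b) \<Longrightarrow>
      (\<And>i. i \<in> {1..N} \<Longrightarrow> a \<le> norm (q i) \<and> norm (q i) \<le> b) \<Longrightarrow>
      (\<And>i. i \<in> {1..N} \<Longrightarrow> norm (p i - q i) \<le> d) \<Longrightarrow> norm (velocity \<alpha> p - velocity \<alpha> q) \<le> L * d"
    using velocity_lipschitz[OF \<alpha> a, of b] by metis
  show thesis
  proof (rule that[OF L(1)])
    fix t s :: real and c d :: "nat \<Rightarrow> real ^ 2" and S :: real
    assume t: "t \<in> {0..T}" and s: "s \<in> {0..T}" and S: "\<And>j. j \<in> {1..N} \<Longrightarrow> norm (c j - d j) \<le> S"
    show "norm (field t c - field s d) \<le> L * (2 / h * S + 2 * (\<Sum>i=1..N. norm (ps t i - ps s i)))"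
      unfolding field_def
    proof (rule L(2))
      fix i assume i: "i \<in> {1..N}"
      show "a \<le> norm (trunc t c i) \<and> norm (trunc t c i) \<le> b" "a \<le> norm (trunc s d i) \<and> norm (trunc s d i) \<le> b"
        using trunc_bounds[OF t i] trunc_bounds[OF s i] by auto
      define x y where "x = slope c i - ps t i" "y = slope d i - ps s i"
      have "norm (closest_point (cball 0 \<delta>) x - closest_point (cball 0 \<delta>) y) \<le> norm (x - y)"
        using closest_point_lipschitz[of "cball 0 \<delta>" x y] \<delta> by (simp add: dist_norm)
      moreover have "x - y = slope (\<lambda>j. c j - d j) i - (ps t i - ps s i)"
        unfolding x_y_def slope_diff[symmetric] by simp
      moreover have "norm (slope (\<lambda>j. c j - d j) i) \<le> 2 / h * S" using S i by (rule slope_bound)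
      moreover have "trunc t c i - trunc s d i = (ps t i - ps s i) + (closest_point (cball 0 \<delta>) x - closest_point (cball 0 \<delta>) y)"
        by (simp add: trunc_def x_y_def)
      moreover have "norm (ps t i - ps s i) \<le> (\<Sum>i=1..N. norm (ps t i - ps s i))"
        using i by (intro member_le_sum[of i "{1..N}" "\<lambda>i. norm (ps t i - ps s i)"]) auto
      ultimately show "norm (trunc t c i - trunc s d i) \<le> 2 / h * S + 2 * (\<Sum>i=1..N. norm (ps t i - ps s i))"
        using norm_triangle_ineq[of "ps t i - ps s i" "closest_point (cball 0 \<delta>) x - closest_point (cball 0 \<delta>) y"]
          norm_triangle_ineq4[of "slope (\<lambda>j. c j - d j) i" "ps t i - ps s i"] by simp
    qed
  qed
qed

lemma continuous_field:
  assumes c: "\<And>j. j \<in> {1..N} \<Longrightarrow> continuous_on {0..T} (\<lambda>t. c t j)"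
  shows "continuous_on {0..T} (\<lambda>t. field t (c t))"
proof -
  obtain L where L: "L \<ge> 0" "\<And>t s c d S. t \<in> {0..T} \<Longrightarrow> s \<in> {0..T} \<Longrightarrow> (\<And>j. j \<in> {1..N} \<Longrightarrow> norm (c j - d j) \<le> S) \<Longrightarrow>
    norm (field t c - field s d) \<le> L * (2 / h * S + 2 * (\<Sum>i=1..N. norm (ps t i - ps s i)))"
    by (rule field_lipschitz) blast
  show ?thesis
  proof (rule continuous_on_dominated_dist)
    fix s t assume "s \<in> {0..T}" "t \<in> {0..T}"
    then show "norm (field t (c t) - field s (c s)) \<le>
      L * (2 / h * (\<Sum>j=1..N. norm (c t j - c s j)) + 2 * (\<Sum>i=1..N. norm (ps t i - ps s i)))"
      by (intro L(2) member_le_sum[of _ "{1..N}" "\<lambda>j. norm (c t j - c s j)"]) auto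
  next
    fix s assume s: "s \<in> {0..T}"
    have "((\<lambda>t. L * (2 / h * (\<Sum>j=1..N. norm (c t j - c s j)) + 2 * (\<Sum>i=1..N. norm (ps t i - ps s i)))) \<longlongrightarrow>
      L * (2 / h * (\<Sum>j=1..N. norm (c s j - c s j)) + 2 * (\<Sum>i=1..N. norm (ps s i - ps s i)))) (at s within {0..T})"
      using c cps s unfolding continuous_on_def by (intro tendsto_intros) auto
    then show "((\<lambda>t. L * (2 / h * (\<Sum>j=1..N. norm (c t j - c s j)) + 2 * (\<Sum>i=1..N. norm (ps t i - ps s i)))) \<longlongrightarrow> 0) (at s within {0..T})"
      by simp
  qed
qed

lemma truncated_flow:
  obtains c :: "real \<Rightarrow> nat \<Rightarrow> real ^ 2" where "\<And>j. j \<in> {1..N} \<Longrightarrow> c 0 j = f j"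
    "\<And>t j. t \<in> {0..T} \<Longrightarrow> ((\<lambda>t. c t j) has_vector_derivative apply_bcontfun (field t (c t)) j) (at t within {0..T})"
proof -
  obtain L where L: "L \<ge> 0" "\<And>t s c d S. t \<in> {0..T} \<Longrightarrow> s \<in> {0..T} \<Longrightarrow> (\<And>j. j \<in> {1..N} \<Longrightarrow> norm (c j - d j) \<le> S) \<Longrightarrow>
    norm (field t c - field s d) \<le> L * (2 / h * S + 2 * (\<Sum>i=1..N. norm (ps t i - ps s i)))"
    by (rule field_lipschitz) blast
  obtain x where x: "x 0 = node_vec f" "\<And>t. t \<in> {0..T} \<Longrightarrow> (x has_vector_derivative field t (apply_bcontfun (x t))) (at t within {0..T})"
  proof (rule picard_lindelof[of T "L * (2 / h)" "\<lambda>t x. field t (apply_bcontfun x)" "node_vec f"])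
    show "0 \<le> T" "0 \<le> L * (2 / h)" using T L(1) h_pos by auto
    show "norm (field t (apply_bcontfun x) - field t (apply_bcontfun y)) \<le> L * (2 / h) * norm (x - y)" if "t \<in> {0..T}" for t x y
      using L(2)[OF that that, of "apply_bcontfun x" "apply_bcontfun y" "norm (x - y)"] norm_bounded[of "x - y"] by simp
    show "continuous_on {0..T} (\<lambda>t. field t (apply_bcontfun (x t)))" if "continuous_on {0..T} x" for x
      by (intro continuous_field bounded_linear.continuous_on[OF bounded_linear_apply_bcontfun that])
  qed blast
  show thesis
  proof (rule that[of "\<lambda>t. apply_bcontfun (x t)"])
    show "apply_bcontfun (x 0) j = f j" if "j \<in> {1..N}" for j using that by (simp add: x(1) apply_node_vec)
    show "((\<lambda>t. apply_bcontfun (x t) j) has_vector_derivative apply_bcontfun (field t (apply_bcontfun (x t))) j) (at t within {0..T})"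
      if "t \<in> {0..T}" for t j
      by (rule bounded_linear.has_vector_derivative[OF bounded_linear_apply_bcontfun x(2)[OF that]])
  qed
qed

lemma tube_semi_discrete_solution:
  assumes c0: "\<And>j. j \<in> {1..N} \<Longrightarrow> c 0 j = X\<^sub>0 (\<theta> j)"
    and dc: "\<And>t j. t \<in> {0..T} \<Longrightarrow> ((\<lambda>t. c t j) has_vector_derivative apply_bcontfun (field t (c t)) j) (at t within {0..T})"
    and tb: "\<And>t. t \<in> {0..T} \<Longrightarrow> tube t (c t)"
  shows "semi_discrete_solution \<alpha> T N \<theta> X\<^sub>0 (\<lambda>t. fe (c t)) (\<lambda>t. fe (apply_bcontfun (field t (c t))))
    (\<lambda>t x. normal_vec (slope (c t) (idx x)))"
  unfolding semi_discrete_solution_def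
proof (intro conjI ballI)
  have cc: "continuous_on {0..T} (\<lambda>t. c t j)" for j
    using dc by (meson continuous_on_eq_continuous_within has_vector_derivative_continuous)
  have cF: "continuous_on {0..T} (\<lambda>t. apply_bcontfun (field t (c t)) j)" for j
    by (intro bounded_linear.continuous_on[OF bounded_linear_apply_bcontfun] continuous_field cc)
  have wd: "has_weak_deriv {0<..<T} (\<lambda>t. fe (c t) x) (\<lambda>t. fe (apply_bcontfun (field t (c t))) x)" for x
  proof (rule has_weak_deriv_classical[of 0 T _ "{}"])
    show "continuous_on {0..T} (\<lambda>t. fe (c t) x)" by (intro continuous_fe_time cc)
    show "(\<lambda>t. fe (apply_bcontfun (field t (c t))) x) absolutely_integrable_on {0..T}"
      by (intro absolutely_integrable_continuous_real continuous_fe_time cF)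
    fix t assume t: "t \<in> {0<..<T} - {}"
    have "((\<lambda>t. c t j) has_vector_derivative apply_bcontfun (field t (c t)) j) (at t)" for j
      using dc[of t j] t by (simp add: at_within_Icc_at)
    then show "((\<lambda>t. fe (c t) x) has_vector_derivative fe (apply_bcontfun (field t (c t))) x) (at t)"
      unfolding fe_def by (auto intro!: derivative_eq_intros bounded_linear.has_vector_derivative[OF bounded_linear_scaleR_right])
  qed (use T in auto)
  show "fe_H1 T N \<theta> (\<lambda>t. fe (c t)) (\<lambda>t. fe (apply_bcontfun (field t (c t))))"
    unfolding fe_H1_def using wd
    by (auto intro!: fe_in_fe_space2 continuous_fe_time cc bochner_L2_fe[OF T] cF)
  show "unit_normal_fe N \<theta> (fe (c t)) (\<lambda>x. normal_vec (slope (c t) (idx x)))" for t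
    by (rule unit_normal_fe_exists)
  show "fe (c 0) = interpolation N \<theta> X\<^sub>0"
    unfolding interpolation_eq_fe by (rule fe_cong) (rule c0)
  have wf: "\<forall>\<phi>\<in>fe_space2 N \<theta>.
        (LINT x:{0..2*pi}|lebesgue.
           (\<alpha> * (fe (apply_bcontfun (field t (c t))) x \<bullet> \<phi> x) + (1 - \<alpha>) * ((fe (apply_bcontfun (field t (c t))) x \<bullet> normal_vec (slope (c t) (idx x))) * (normal_vec (slope (c t) (idx x)) \<bullet> \<phi> x))) * (norm (dx (fe (c t)) x))\<^sup>2)
        + (LINT x:{0..2*pi}|lebesgue. dx (fe (c t)) x \<bullet> dx \<phi> x) = 0" if "t \<in> {0..T}" for t
    unfolding weak_form_iff[OF unit_normal_fe_exists] field_tube[OF tb[OF that]]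
    using velocity_eq[OF \<alpha> a] tube_bounds[OF that tb[OF that]] by blast
  show "AE t in lebesgue_on {0<..<T}. \<forall>\<phi>\<in>fe_space2 N \<theta>.
        (LINT x:{0..2*pi}|lebesgue.
           (\<alpha> * (fe (apply_bcontfun (field t (c t))) x \<bullet> \<phi> x) + (1 - \<alpha>) * ((fe (apply_bcontfun (field t (c t))) x \<bullet> normal_vec (slope (c t) (idx x))) * (normal_vec (slope (c t) (idx x)) \<bullet> \<phi> x))) * (norm (dx (fe (c t)) x))\<^sup>2)
        + (LINT x:{0..2*pi}|lebesgue. dx (fe (c t)) x \<bullet> dx \<phi> x) = 0"
    by (rule AE_I2) (rule wf, auto)
qed

section \<open>Arbitrary semi-discrete solutions inside the tube\<close>

text \<open>In the tube the mass form is definite, so at each time at which the weak equation holds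
  and the derivative lies in the finite element space, that derivative is determined by the nodal
  values.\<close>

lemma semi_discrete_velocity:
  assumes Y: "semi_discrete_solution \<alpha> T N \<theta> X\<^sub>0 Y Y\<^sub>t \<mu>" and \<tau>: "\<tau> \<le> T"
    and tb: "\<And>t. t \<in> {0..\<tau>} \<Longrightarrow> tube t (\<lambda>j. Y t (\<theta> j))"
  shows "AE t in lebesgue. t \<in> {0<..<T} \<longrightarrow> t \<le> \<tau> \<longrightarrow> Y\<^sub>t t = fe (apply_bcontfun (field t (\<lambda>j. Y t (\<theta> j))))"
proof -
  have 1: "AE t in lebesgue. t \<in> {0<..<T} \<longrightarrow> Y\<^sub>t t \<in> fe_space2 N \<theta>"
    using Y unfolding semi_discrete_solution_def fe_H1_def bochner_L2_def bochner_measurable_def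
    by (simp add: AE_lebesgue_on_iff)
  have 2: "AE t in lebesgue. t \<in> {0<..<T} \<longrightarrow> (\<forall>\<phi>\<in>fe_space2 N \<theta>.
        (LINT x:{0..2*pi}|lebesgue.
           (\<alpha> * (Y\<^sub>t t x \<bullet> \<phi> x) + (1 - \<alpha>) * ((Y\<^sub>t t x \<bullet> \<mu> t x) * (\<mu> t x \<bullet> \<phi> x))) * (norm (dx (Y t) x))\<^sup>2)
        + (LINT x:{0..2*pi}|lebesgue. dx (Y t) x \<bullet> dx \<phi> x) = 0)"
    using Y unfolding semi_discrete_solution_def by (simp add: AE_lebesgue_on_iff)
  show ?thesis
    using 1 2
  proof eventually_elim
    case (elim t)
    show ?case
    proof (intro impI)
      assume t: "t \<in> {0<..<T}" "t \<le> \<tau>"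
      define c u where "c j = Y t (\<theta> j)" and "u j = Y\<^sub>t t (\<theta> j)" for j
      have t': "t \<in> {0..T}" "t \<in> {0..\<tau>}" using t by auto
      have Yt: "Y\<^sub>t t = fe u" using elim(1) t fe_space2_eq_fe unfolding u_def by blast
      have "Y t \<in> fe_space2 N \<theta>" using Y t' unfolding semi_discrete_solution_def fe_H1_def by blast
      then have Yc: "Y t = fe c" unfolding c_def by (rule fe_space2_eq_fe)
      have "unit_normal_fe N \<theta> (fe c) (\<mu> t)"
        using Y t' unfolding semi_discrete_solution_def Yc[symmetric] by blast
      from weak_form_iff[OF this, of \<alpha> u] elim(2) t have wf: "\<forall>f. mass (\<lambda>i. scheme_op \<alpha> (slope c i)) u f = - stiff (slope c) f"
        unfolding Yt Yc by blast
      have tbc: "tube t c" using tb[OF t'(2)] by (simp add: c_def[abs_def])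
      have "fe u = fe (apply_bcontfun (velocity \<alpha> (slope c)))"
      proof (rule fe_cong)
        fix j assume j: "j \<in> {1..N}"
        show "u j = apply_bcontfun (velocity \<alpha> (slope c)) j"
          by (rule velocity_unique[OF \<alpha> a _ _ j]) (use wf tube_bounds[OF t'(1) tbc] in auto)
      qed
      then show "Y\<^sub>t t = fe (apply_bcontfun (field t (\<lambda>j. Y t (\<theta> j))))"
        using field_tube[OF tbc] by (simp add: Yt c_def[abs_def])
    qed
  qed
qed

text \<open>The weak velocity agrees almost everywhere with the continuous \<open>G\<close>.
  Integration over compact time intervals shows that the nodal values are classically differentiable
  inside \<open>(0, \<tau>)\<close>, and Gronwall applies to the sum of squared nodal
  differences.\<close>

lemma semi_discrete_unique:
  assumes Y: "semi_discrete_solution \<alpha> T N \<theta> X\<^sub>0 Y Y\<^sub>t \<mu>" and \<tau>: "\<tau> \<in> {0..T}"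
    and tb: "\<And>t. t \<in> {0..\<tau>} \<Longrightarrow> tube t (\<lambda>j. Y t (\<theta> j))"
    and c0: "\<And>j. j \<in> {1..N} \<Longrightarrow> c 0 j = X\<^sub>0 (\<theta> j)"
    and dc: "\<And>t j. t \<in> {0..T} \<Longrightarrow> ((\<lambda>t. c t j) has_vector_derivative apply_bcontfun (field t (c t)) j) (at t within {0..T})"
  shows "Y \<tau> = fe (c \<tau>)"
proof -
  define y where "y t j = Y t (\<theta> j)" for t j
  define G where "G t = field t (y t)" for t
  obtain L where L: "L \<ge> 0" "\<And>t s c d S. t \<in> {0..T} \<Longrightarrow> s \<in> {0..T} \<Longrightarrow> (\<And>j. j \<in> {1..N} \<Longrightarrow> norm (c j - d j) \<le> S) \<Longrightarrow>
    norm (field t c - field s d) \<le> L * (2 / h * S + 2 * (\<Sum>i=1..N. norm (ps t i - ps s i)))"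
    by (rule field_lipschitz) blast
  have H1: "fe_H1 T N \<theta> Y Y\<^sub>t" using Y by (simp add: semi_discrete_solution_def)
  have cy: "continuous_on {0..T} (\<lambda>t. y t j)" for j using H1 by (simp add: fe_H1_def y_def)
  have cc: "continuous_on {0..T} (\<lambda>t. c t j)" for j
    using dc by (meson continuous_on_eq_continuous_within has_vector_derivative_continuous)
  have cG: "continuous_on {0..T} (\<lambda>t. apply_bcontfun (G t) j)" for j
    unfolding G_def by (intro bounded_linear.continuous_on[OF bounded_linear_apply_bcontfun] continuous_field cy)
  have "AE t in lebesgue. t \<in> {0<..<T} \<longrightarrow> t \<le> \<tau> \<longrightarrow> Y\<^sub>t t = fe (apply_bcontfun (G t))"
    using semi_discrete_velocity[OF Y _ tb] \<tau> by (simp add: G_def y_def[abs_def])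
  then obtain Z where Z: "negligible Z" "\<And>t. t \<in> {0<..<T} \<Longrightarrow> t \<le> \<tau> \<Longrightarrow> t \<notin> Z \<Longrightarrow> Y\<^sub>t t = fe (apply_bcontfun (G t))"
    unfolding eventually_ae_filter negligible_iff_null_sets by auto
  have dy: "((\<lambda>t. y t j) has_vector_derivative apply_bcontfun (G t) j) (at t)" if t: "0 < t" "t < \<tau>" and j: "j \<in> {1..N}" for t j
  proof -
    \<comment> \<open>A compact window around \<open>t\<close> inside \<open>(0, \<tau>)\<close>:
      the integral formula for weak derivatives is available on closed intervals contained in the
      open time interval.\<close>
    define s m where "s = t / 2" and "m = (t + \<tau>) / 2"
    have sm: "0 < s" "s < t" "t < m" "m < \<tau>" using t by (auto simp: s_def m_def)
    have int: "((\<lambda>r. apply_bcontfun (G r) j) has_integral (y r j - y s j)) {s..r}" if r: "r \<in> {s..m}" for r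
    proof (rule has_integral_spike[OF Z(1)])
      show "((\<lambda>r. Y\<^sub>t r (\<theta> j)) has_integral (y r j - y s j)) {s..r}"
        unfolding y_def
      proof (rule weak_deriv_has_integral)
        show "has_weak_deriv {0<..<T} (\<lambda>t. Y t (\<theta> j)) (\<lambda>t. Y\<^sub>t t (\<theta> j))" using H1 by (simp add: fe_H1_def)
        show "continuous_on {0<..<T} (\<lambda>t. Y t (\<theta> j))" using cy[of j] unfolding y_def by (rule continuous_on_subset) auto
      qed (use r sm \<tau> in auto)
      fix q assume "q \<in> {s..r} - Z"
      then have "Y\<^sub>t q = fe (apply_bcontfun (G q))" using r sm \<tau> by (intro Z(2)) auto
      then show "apply_bcontfun (G q) j = Y\<^sub>t q (\<theta> j)" by (simp only: fe_at_node[OF j])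
    qed
    have sub: "{s..m} \<subseteq> {0..T}" using sm \<tau> by auto
    have "((\<lambda>r. y s j + integral {s..r} (\<lambda>r. apply_bcontfun (G r) j)) has_vector_derivative 0 + apply_bcontfun (G t) j) (at t within {s..m})"
      by (intro has_vector_derivative_add has_vector_derivative_const integral_has_vector_derivative continuous_on_subset[OF cG sub]) (use sm in auto)
    then have "((\<lambda>r. y s j + integral {s..r} (\<lambda>r. apply_bcontfun (G r) j)) has_vector_derivative apply_bcontfun (G t) j) (at t)"
      using sm by (simp add: at_within_Icc_at)
    then show ?thesis
    proof (rule has_vector_derivative_transform_within_open[of _ _ _ "{s<..<m}"])
      fix r assume "r \<in> {s<..<m}"
      then show "y s j + integral {s..r} (\<lambda>r. apply_bcontfun (G r) j) = y r j"
        using int[of r] by (simp add: integral_unique)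
    qed (use sm in auto)
  qed
  define z where "z t = (\<Sum>j=1..N. (y t j - c t j) \<bullet> (y t j - c t j))" for t
  have z0: "z t \<ge> 0" for t by (simp add: z_def sum_nonneg)
  have wz: "norm (y t j - c t j) \<le> sqrt (z t)" if "j \<in> {1..N}" for t j
  proof -
    have "(norm (y t j - c t j))\<^sup>2 \<le> z t"
      unfolding z_def power2_norm_eq_inner using that by (intro member_le_sum[of j "{1..N}" "\<lambda>j. (y t j - c t j) \<bullet> (y t j - c t j)"]) auto
    then show ?thesis by (rule real_le_rsqrt)
  qed
  define K where "K = 2 * real N * (L * (2 / h))"
  have "z \<tau> \<le> 0"
  proof (rule gronwall_zero[of \<tau> z K])
    show "0 \<le> \<tau>" using \<tau> by simp
    have y0: "y 0 j = X\<^sub>0 (\<theta> j)" if "j \<in> {1..N}" for j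
      using Y fe_at_node[OF that] by (simp add: semi_discrete_solution_def y_def interpolation_eq_fe)
    then show "z 0 \<le> 0" using c0 by (simp add: z_def)
    have sub: "{0..\<tau>} \<subseteq> {0..T}" using \<tau> by auto
    show "continuous_on {0..\<tau>} z"
      unfolding z_def by (intro continuous_intros continuous_on_subset[OF cy sub] continuous_on_subset[OF cc sub])
    fix t assume t: "0 < t" "t < \<tau>"
    then have tT: "t \<in> {0..T}" using \<tau> by auto
    let ?F = "field t (c t)"
    have dct: "((\<lambda>t. c t j) has_vector_derivative apply_bcontfun ?F j) (at t)" for j
      using dc[OF tT, of j] t \<tau> by (simp add: at_within_Icc_at)
    have "(z has_real_derivative (\<Sum>j=1..N. 2 * ((y t j - c t j) \<bullet> (apply_bcontfun (G t) j - apply_bcontfun ?F j)))) (at t)"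
      unfolding z_def
    proof (rule DERIV_sum)
      fix j assume j: "j \<in> {1..N}"
      have d: "((\<lambda>t. y t j - c t j) has_vector_derivative apply_bcontfun (G t) j - apply_bcontfun ?F j) (at t)"
        by (intro has_vector_derivative_diff dy t j dct)
      show "((\<lambda>t. (y t j - c t j) \<bullet> (y t j - c t j)) has_real_derivative 2 * ((y t j - c t j) \<bullet> (apply_bcontfun (G t) j - apply_bcontfun ?F j))) (at t)"
        using bounded_bilinear.has_vector_derivative[OF bounded_bilinear_inner d d]
        by (simp add: has_real_derivative_iff_has_vector_derivative inner_commute)
    qed
    moreover have "(\<Sum>j=1..N. 2 * ((y t j - c t j) \<bullet> (apply_bcontfun (G t) j - apply_bcontfun ?F j))) \<le> K * z t"
    proof -
      have GF: "norm (G t - ?F) \<le> L * (2 / h) * sqrt (z t)"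
        using L(2)[OF tT tT, of "y t" "c t" "sqrt (z t)"] wz by (simp add: G_def)
      have "(\<Sum>j=1..N. 2 * ((y t j - c t j) \<bullet> (apply_bcontfun (G t) j - apply_bcontfun ?F j))) \<le> (\<Sum>j=1..N. 2 * (sqrt (z t) * (L * (2 / h) * sqrt (z t))))"
      proof (rule sum_mono)
        fix j assume j: "j \<in> {1..N}"
        have "norm (apply_bcontfun (G t) j - apply_bcontfun ?F j) \<le> L * (2 / h) * sqrt (z t)"
          using norm_bounded[of "G t - ?F" j] GF by simp
        then have "norm (y t j - c t j) * norm (apply_bcontfun (G t) j - apply_bcontfun ?F j) \<le> sqrt (z t) * (L * (2 / h) * sqrt (z t))"
          using wz[OF j] z0 by (intro mult_mono) auto
        then show "2 * ((y t j - c t j) \<bullet> (apply_bcontfun (G t) j - apply_bcontfun ?F j)) \<le> 2 * (sqrt (z t) * (L * (2 / h) * sqrt (z t)))"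
          using norm_cauchy_schwarz[of "y t j - c t j" "apply_bcontfun (G t) j - apply_bcontfun ?F j"] by linarith
      qed
      also have "\<dots> = K * (sqrt (z t) * sqrt (z t))" by (simp add: K_def)
      also have "\<dots> = K * z t" using z0 by simp
      finally show ?thesis .
    qed
    ultimately show "\<exists>d. (z has_real_derivative d) (at t) \<and> d \<le> K * z t" by blast
  qed
  then have "z \<tau> = 0" using z0[of \<tau>] by simp
  then have "y \<tau> j = c \<tau> j" if "j \<in> {1..N}" for j using wz[OF that, of \<tau>] by simp
  then have "fe (y \<tau>) = fe (c \<tau>)" by (intro fe_cong)
  moreover have "Y \<tau> = fe (y \<tau>)"
    unfolding y_def by (rule fe_space2_eq_fe) (use H1 \<tau> in \<open>simp add: fe_H1_def\<close>)
  ultimately show ?thesis by simp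
qed

end

section \<open>Interpolation of the exact solution\<close>

text \<open>Test functions live on the whole line, so those of \<Omega> are also test functions of
  \<open>UNIV\<close>; they and their derivatives vanish off \<Omega>, which makes the integrals
  agree.\<close>

lemma has_weak_deriv_restrict:
  fixes u v :: "real \<Rightarrow> 'a::euclidean_space"
  assumes "has_weak_deriv UNIV u v"
  shows "has_weak_deriv \<Omega> u v"
  unfolding has_weak_deriv_def
proof (intro conjI ballI)
  show "locally_integrable \<Omega> u" "locally_integrable \<Omega> v"
    using assms by (auto simp: has_weak_deriv_def locally_integrable_def)
  fix \<eta> assume \<eta>: "\<eta> \<in> test_functions \<Omega>"
  have z: "\<eta> x = 0" "deriv \<eta> x = 0" if "x \<notin> \<Omega>" for x
  proof -
    let ?C = "closure {x. \<eta> x \<noteq> 0}"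
    have x: "x \<in> - ?C" using \<eta> that by (auto simp: test_functions_def)
    have y0: "\<eta> y = 0" if "y \<in> - ?C" for y using that closure_subset[of "{x. \<eta> x \<noteq> 0}"] by blast
    then show "\<eta> x = 0" using x by blast
    have "((\<lambda>_. 0 :: real) has_field_derivative 0) (at x)" by (rule DERIV_const)
    then have "(\<eta> has_field_derivative 0) (at x)"
    proof (rule has_field_derivative_transform_within_open)
      show "open (- ?C)" by (simp add: open_Compl)
      show "0 = \<eta> y" if "y \<in> - ?C" for y using y0[OF that] by simp
    qed (rule x)
    then show "deriv \<eta> x = 0" by (rule DERIV_imp_deriv)
  qed
  have "\<eta> \<in> test_functions UNIV" using \<eta> by (simp add: test_functions_def)
  then have E: "(LINT x:UNIV|lebesgue. deriv \<eta> x *\<^sub>R u x) = - (LINT x:UNIV|lebesgue. \<eta> x *\<^sub>R v x)"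
    using assms by (simp add: has_weak_deriv_def)
  have L: "(LINT x:UNIV|lebesgue. f x *\<^sub>R w x) = (LINT x:\<Omega>|lebesgue. f x *\<^sub>R w x)"
    if "\<And>x. x \<notin> \<Omega> \<Longrightarrow> f x = 0" for f and w :: "real \<Rightarrow> 'a"
    unfolding set_lebesgue_integral_def
    by (rule Bochner_Integration.integral_cong[OF refl]) (auto simp: indicator_def intro: that)
  show "(LINT x:\<Omega>|lebesgue. deriv \<eta> x *\<^sub>R u x) = - (LINT x:\<Omega>|lebesgue. \<eta> x *\<^sub>R v x)"
    using E L[OF z(2), where w = u] L[OF z(1), where w = v] by simp
qed

lemma vector_derivative_lipschitz:
  fixes f :: "real \<Rightarrow> 'a::real_normed_vector"
  assumes "convex S" and df: "\<And>x. x \<in> S \<Longrightarrow> (f has_vector_derivative f' x) (at x within S)"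
    and b: "\<And>x. x \<in> S \<Longrightarrow> norm (f' x) \<le> B" and "x \<in> S" "y \<in> S"
  shows "norm (f y - f x) \<le> B * \<bar>y - x\<bar>"
proof -
  have "norm (f y - f x) \<le> B * norm (y - x)"
  proof (rule differentiable_bound[OF \<open>convex S\<close>])
    fix z assume z: "z \<in> S"
    show "(f has_derivative (\<lambda>d. d *\<^sub>R f' z)) (at z within S)"
      using df[OF z] by (simp add: has_vector_derivative_def)
    show "onorm (\<lambda>d. d *\<^sub>R f' z) \<le> B"
    proof (rule onorm_le)
      fix d :: real
      have "\<bar>d\<bar> * norm (f' z) \<le> \<bar>d\<bar> * B" using b[OF z] by (rule mult_left_mono) simp
      then show "norm (d *\<^sub>R f' z) \<le> B * norm d" by (simp add: mult.commute)
    qed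
  qed (use assms in auto)
  then show ?thesis by simp
qed

text \<open>Cauchy-Schwarz against the constant 1, obtained by expanding the integral of
  \<open>(f - m)^2\<close> around the mean value \<open>m\<close>.\<close>

lemma integral_power2_le:
  fixes f :: "real \<Rightarrow> real"
  assumes ab: "a < b" and f: "f integrable_on {a..b}" and f2: "(\<lambda>x. (f x)\<^sup>2) integrable_on {a..b}"
  shows "(integral {a..b} f)\<^sup>2 \<le> (b - a) * integral {a..b} (\<lambda>x. (f x)\<^sup>2)"
proof -
  define A where "A = integral {a..b} f"
  define m where "m = A / (b - a)"
  have "((\<lambda>x. (f x)\<^sup>2 - 2 * m * f x + m\<^sup>2) has_integral (integral {a..b} (\<lambda>x. (f x)\<^sup>2) - 2 * m * A + m\<^sup>2 * (b - a))) {a..b}"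
    unfolding A_def using ab
    by (intro has_integral_add has_integral_diff has_integral_mult_right integrable_integral f f2)
      (use has_integral_const_real[of "m\<^sup>2" a b] in \<open>simp add: mult.commute\<close>)
  moreover have "(f x)\<^sup>2 - 2 * m * f x + m\<^sup>2 = (f x - m)\<^sup>2" for x by (simp add: power2_eq_square algebra_simps)
  ultimately have "((\<lambda>x. (f x - m)\<^sup>2) has_integral (integral {a..b} (\<lambda>x. (f x)\<^sup>2) - 2 * m * A + m\<^sup>2 * (b - a))) {a..b}" by simp
  then have "0 \<le> integral {a..b} (\<lambda>x. (f x)\<^sup>2) - 2 * m * A + m\<^sup>2 * (b - a)"
    by (rule has_integral_nonneg) simp
  also have "m\<^sup>2 * (b - a) = m * A" using ab by (simp add: m_def power2_eq_square)
  finally have "m * A \<le> integral {a..b} (\<lambda>x. (f x)\<^sup>2)" by linarith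
  then have "(b - a) * (m * A) \<le> (b - a) * integral {a..b} (\<lambda>x. (f x)\<^sup>2)" using ab by (intro mult_left_mono) auto
  moreover have "(b - a) * (m * A) = A\<^sup>2" using ab by (simp add: m_def power2_eq_square)
  ultimately show ?thesis by (simp add: A_def)
qed

context fe_mesh
begin

lemma sum_element_integrals:
  fixes f :: "real \<Rightarrow> real"
  assumes "f integrable_on {\<theta> 1..\<theta> 1 + 2 * pi}"
  shows "(\<Sum>i=1..N. integral {\<theta> i..\<theta> (i + 1)} f) = integral {\<theta> 1..\<theta> 1 + 2 * pi} f"
proof -
  have mono: "\<theta> 1 \<le> \<theta> (Suc k)" "\<theta> (Suc k) \<le> \<theta> 1 + 2 * pi" if "k \<le> N" for k
  proof -
    have "real k * h \<le> real N * h" using that h_pos by (intro mult_right_mono) auto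
    then show "\<theta> 1 \<le> \<theta> (Suc k)" "\<theta> (Suc k) \<le> \<theta> 1 + 2 * pi" using node_eq[OF that] h_pos Nh by auto
  qed
  have "(\<Sum>i=1..k. integral {\<theta> i..\<theta> (i + 1)} f) = integral {\<theta> 1..\<theta> (Suc k)} f" if "k \<le> N" for k
    using that
  proof (induction k)
    case (Suc k)
    have "integral {\<theta> 1..\<theta> (Suc k)} f + integral {\<theta> (Suc k)..\<theta> (Suc (Suc k))} f = integral {\<theta> 1..\<theta> (Suc (Suc k))} f"
    proof (rule Henstock_Kurzweil_Integration.integral_combine)
      show "\<theta> 1 \<le> \<theta> (Suc k)" using mono[of k] Suc by simp
      show "\<theta> (Suc k) \<le> \<theta> (Suc (Suc k))" using mesh_step[of "Suc k"] Suc h_pos by simp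
      show "f integrable_on {\<theta> 1..\<theta> (Suc (Suc k))}"
        by (rule integrable_subinterval_real[OF assms]) (use mono[of "Suc k"] Suc in auto)
    qed
    then show ?case using Suc by simp
  qed simp
  from this[of N] show ?thesis using node_last by simp
qed

section \<open>Interpolation error in L2\<close>

text \<open>On an element the pointwise error is at most the integral \<open>A\<close> of the norm
  of the weak derivative, and \<open>A\<^sup>2\<close> is at most \<open>h\<close> times the
  integral of the square. Integrating over the element supplies the second factor
  \<open>h\<close>.\<close>

lemma interpolation_L2_bound:
  fixes u :: "real \<Rightarrow> real ^ 2"
  assumes u: "u \<in> sobolev_circle 1" and cu: "continuous_on UNIV u" and B: "sobolev_norm 1 u \<le> B"
  shows "(\<Sum>i=1..N. integral {\<theta> i..\<theta> (i + 1)} (\<lambda>x. (norm (u x - fe (\<lambda>j. u (\<theta> j)) x))\<^sup>2)) \<le> B\<^sup>2 * h\<^sup>2"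
proof -
  obtain w where w: "w 0 = u" "\<forall>i<1. has_weak_deriv UNIV (w i) (w (Suc i))"
      "\<forall>i\<le>1. square_integrable {0<..<2*pi} (w i)" and per: "periodic2pi u"
    using u unfolding sobolev_circle_def by blast
  define v where "v = w 1"
  have wd: "has_weak_deriv UNIV u v" using w by (simp add: v_def)
  have sqv: "(\<lambda>x. (norm (v x))\<^sup>2) absolutely_integrable_on {0..2*pi}"
    using w(3) by (simp add: square_integrable_def v_def flip: set_integral_open_closed(1))
  have vai: "v absolutely_integrable_on {x..y}" for x y
    using wd by (simp add: has_weak_deriv_def locally_integrable_def)
  have vint: "(v has_integral (u y - u x)) {x..y}" if "x \<le> y" for x y
    by (rule weak_deriv_has_integral[OF wd _ cu that]) auto
  define J where "J = integral {0..2*pi} (\<lambda>x. (norm (v x))\<^sup>2)"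
  have JB: "J \<le> B\<^sup>2"
  proof -
    have "(sobolev_norm 1 u)\<^sup>2 = (LINT x:{0..2*pi}|lebesgue. (norm (u x))\<^sup>2) + (LINT x:{0..2*pi}|lebesgue. (norm (v x))\<^sup>2)"
      by (rule sobolev_norm_1_eq[OF has_weak_deriv_restrict[OF wd] continuous_on_subset[OF cu] sqv]) simp
    moreover have "(LINT x:{0..2*pi}|lebesgue. (norm (u x))\<^sup>2) \<ge> 0"
      unfolding set_lebesgue_integral_def by (rule Bochner_Integration.integral_nonneg) auto
    moreover have "(LINT x:{0..2*pi}|lebesgue. (norm (v x))\<^sup>2) = J"
      unfolding J_def by (rule set_lebesgue_integral_eq_integral(2)[OF sqv])
    moreover have "sobolev_norm 1 u \<ge> 0" unfolding sobolev_norm_def by (simp add: sum_nonneg)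
    then have "(sobolev_norm 1 u)\<^sup>2 \<le> B\<^sup>2" using B by (intro power_mono)
    ultimately show ?thesis by linarith
  qed
  have v2: "((\<lambda>x. (norm (v x))\<^sup>2) has_integral J) {\<theta> 1..\<theta> 1 + 2 * pi}"
  proof -
    have i: "(\<lambda>x. (norm (v x))\<^sup>2) integrable_on {0..2*pi}" using sqv by (rule set_lebesgue_integral_eq_integral(1))
    obtain J1 where J1: "((\<lambda>x. (norm (v x))\<^sup>2) has_integral J1) {0..\<theta> 1}"
      using integrable_subinterval_real[OF i, of 0 "\<theta> 1"] theta1 by (auto simp: integrable_on_def)
    obtain J2 where J2: "((\<lambda>x. (norm (v x))\<^sup>2) has_integral J2) {\<theta> 1..2*pi}"
      using integrable_subinterval_real[OF i, of "\<theta> 1" "2*pi"] theta1 by (auto simp: integrable_on_def)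
    have J: "J = J1 + J2"
      unfolding J_def using has_integral_combine[OF _ _ J1 J2] theta1 by (auto intro: integral_unique)
    \<comment> \<open>The norm refers to \<open>(0, 2 * pi)\<close> and the mesh to a period from
      \<open>\<theta> 1\<close>. Periodicity of \<open>u\<close> passes to its weak derivative only
      up to a null set, which is enough for shifting the integral.\<close>
    have "negligible {x\<in>{0..\<theta> 1}. v (x + 2 * pi) - v x \<noteq> 0}"
    proof (rule negligible_if_interval_integrals_zero)
      have "(\<lambda>x. v (x + 2 * pi)) absolutely_integrable_on {0..\<theta> 1}"
      proof -
        have "v absolutely_integrable_on {2*pi..\<theta> 1 + 2*pi}" by (rule vai)
        then have "v integrable_on {2*pi..\<theta> 1 + 2*pi}" "(\<lambda>x. norm (v x)) integrable_on {2*pi..\<theta> 1 + 2*pi}"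
          by (auto simp: absolutely_integrable_on_def)
        then have "(\<lambda>x. v (x + 2*pi)) integrable_on {0..\<theta> 1}" "(\<lambda>x. norm (v (x + 2*pi))) integrable_on {0..\<theta> 1}"
          using has_integral_shift_real_ivl[of v _ "2*pi" "\<theta> 1 + 2*pi" "2*pi"]
            has_integral_shift_real_ivl[of "\<lambda>x. norm (v x)" _ "2*pi" "\<theta> 1 + 2*pi" "2*pi"]
          by (auto simp: integrable_on_def)
        then show ?thesis by (simp add: absolutely_integrable_on_def)
      qed
      then show "(\<lambda>x. v (x + 2 * pi) - v x) absolutely_integrable_on {0..\<theta> 1}"
        by (intro set_integral_diff(1) vai)
      fix c assume c: "c \<in> {0..\<theta> 1}"
      have "(v has_integral (u (c + 2*pi) - u (2*pi))) {2*pi..c + 2*pi}" using c by (intro vint) auto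
      then have "((\<lambda>x. v (x + 2*pi)) has_integral (u (c + 2*pi) - u (2*pi))) {0..c}"
        using has_integral_shift_real_ivl[of v _ "2*pi" "c + 2*pi" "2*pi"] by simp
      then have "((\<lambda>x. v (x + 2 * pi) - v x) has_integral ((u (c + 2*pi) - u (2*pi)) - (u c - u 0))) {0..c}"
        using c by (intro has_integral_diff vint) auto
      moreover have "u (c + 2*pi) = u c" "u (2*pi) = u 0"
        using per[unfolded periodic2pi_def, rule_format, of c] per[unfolded periodic2pi_def, rule_format, of 0] by auto
      ultimately show "integral {0..c} (\<lambda>x. v (x + 2 * pi) - v x) = 0" by (simp add: integral_unique)
    qed
    then have "((\<lambda>x. (norm (v (x + 2*pi)))\<^sup>2) has_integral J1) {0..\<theta> 1}"
      by (rule has_integral_spike[OF _ _ J1]) auto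
    then have J1': "((\<lambda>x. (norm (v x))\<^sup>2) has_integral J1) {2*pi..\<theta> 1 + 2*pi}"
      using has_integral_shift_real_ivl_iff[of "\<lambda>x. (norm (v x))\<^sup>2" J1 "2*pi" "\<theta> 1 + 2*pi" "2*pi"] by simp
    show ?thesis using has_integral_combine[OF _ _ J2 J1'] theta1 by (simp add: J add.commute)
  qed
  have el: "integral {\<theta> i..\<theta> (i + 1)} (\<lambda>x. (norm (u x - fe (\<lambda>j. u (\<theta> j)) x))\<^sup>2)
    \<le> h\<^sup>2 * integral {\<theta> i..\<theta> (i + 1)} (\<lambda>x. (norm (v x))\<^sup>2)" if i: "i \<in> {1..N}" for i
  proof -
    let ?I = "{\<theta> i..\<theta> (i + 1)}"
    have st: "\<theta> (i + 1) = \<theta> i + h" by (rule mesh_step[OF i])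
    have ni: "(\<lambda>x. norm (v x)) integrable_on ?I" using vai[of "\<theta> i" "\<theta> (i + 1)"] by (simp add: absolutely_integrable_on_def)
    have n2: "(\<lambda>x. (norm (v x))\<^sup>2) integrable_on ?I"
      using v2 element_subset[OF i] by (meson has_integral_integrable integrable_subinterval_real)
    define A where "A = integral ?I (\<lambda>x. norm (v x))"
    have diff: "norm (u y - u x) \<le> A" if "x \<in> ?I" "y \<in> ?I" "x \<le> y" for x y
    proof -
      have sub: "{x..y} \<subseteq> ?I" using that by auto
      have "norm (u y - u x) = norm (integral {x..y} v)" using vint[OF that(3)] by (simp add: integral_unique)
      also have "\<dots> \<le> integral {x..y} (\<lambda>x. norm (v x))"
        using vai[of x y] by (intro integral_norm_bound_integral) (auto simp: absolutely_integrable_on_def)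
      also have "\<dots> \<le> A" unfolding A_def
        using vai[of x y] ni sub by (intro integral_subset_le) (auto simp: absolutely_integrable_on_def)
      finally show ?thesis .
    qed
    have A2: "A\<^sup>2 \<le> h * integral ?I (\<lambda>x. (norm (v x))\<^sup>2)"
      using integral_power2_le[OF _ ni n2] st h_pos by (simp add: A_def)
    have pt: "(norm (u x - fe (\<lambda>j. u (\<theta> j)) x))\<^sup>2 \<le> A\<^sup>2" if x: "x \<in> ?I" for x
    proof -
      define s where "s = (x - \<theta> i) / h"
      have s: "0 \<le> s" "s \<le> 1" using x st h_pos by (auto simp: s_def field_simps)
      have nxe: "u (\<theta> (nx i)) = u (\<theta> (i + 1))" using node_nx[OF per i] by simp
      \<comment> \<open>The interpolation error is a combination of two increments of
        \<open>u\<close> within the element whose coefficients have absolute values adding up to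
        1.\<close>
      have "u x - fe (\<lambda>j. u (\<theta> j)) x = (1 - s) *\<^sub>R (u x - u (\<theta> i)) - s *\<^sub>R (u (\<theta> (i + 1)) - u x)"
        unfolding fe_on_element[OF i x] s_def[symmetric] nxe by (simp add: algebra_simps)
      then have "norm (u x - fe (\<lambda>j. u (\<theta> j)) x) \<le> (1 - s) * norm (u x - u (\<theta> i)) + s * norm (u (\<theta> (i + 1)) - u x)"
        using norm_triangle_ineq4[of "(1 - s) *\<^sub>R (u x - u (\<theta> i))" "s *\<^sub>R (u (\<theta> (i + 1)) - u x)"] s by simp
      also have "\<dots> \<le> (1 - s) * A + s * A"
        using s diff[of "\<theta> i" x] diff[of x "\<theta> (i + 1)"] x st h_pos by (intro add_mono mult_left_mono) auto
      also have "\<dots> = A" by (simp add: algebra_simps)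
      finally show ?thesis by (intro power_mono) auto
    qed
    have "integral ?I (\<lambda>x. (norm (u x - fe (\<lambda>j. u (\<theta> j)) x))\<^sup>2) \<le> integral ?I (\<lambda>x. A\<^sup>2)"
      by (intro integral_le pt integrable_continuous_real continuous_intros continuous_on_subset[OF cu] continuous_fe) auto
    also have "\<dots> = h * A\<^sup>2" using st h_pos by simp
    also have "\<dots> \<le> h * (h * integral ?I (\<lambda>x. (norm (v x))\<^sup>2))" using A2 h_pos by (intro mult_left_mono) auto
    finally show ?thesis by (simp add: power2_eq_square mult.assoc)
  qed
  have "(\<Sum>i=1..N. integral {\<theta> i..\<theta> (i + 1)} (\<lambda>x. (norm (u x - fe (\<lambda>j. u (\<theta> j)) x))\<^sup>2))
    \<le> h\<^sup>2 * (\<Sum>i=1..N. integral {\<theta> i..\<theta> (i + 1)} (\<lambda>x. (norm (v x))\<^sup>2))"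
    unfolding sum_distrib_left by (rule sum_mono) (rule el)
  also have "\<dots> = h\<^sup>2 * J"
    using sum_element_integrals[of "\<lambda>x. (norm (v x))\<^sup>2"] v2 by (auto simp: has_integral_iff)
  also have "\<dots> \<le> h\<^sup>2 * B\<^sup>2" using JB by (intro mult_left_mono) auto
  finally show ?thesis by (simp add: mult.commute)
qed

end

section \<open>The exact curve and its nodal interpolant\<close>

locale exact_curve =
  fixes T c\<^sub>0 K :: real and X :: "real \<Rightarrow> real \<Rightarrow> real ^ 2"
  assumes T: "T > 0" and C21: "C21 T X" and c0: "c\<^sub>0 > 0"
    and lower: "\<And>t x. t \<in> {0..T} \<Longrightarrow> c\<^sub>0 \<le> norm (dx (X t) x)"
    and K1: "\<And>t x. t \<in> {0..T} \<Longrightarrow> norm (dx (X t) x) \<le> K"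
    and K2: "\<And>t x. t \<in> {0..T} \<Longrightarrow> norm (dx (dx (X t)) x) \<le> K"
    and K3: "\<And>t x. t \<in> {0..T} \<Longrightarrow> norm (dt T X t x) \<le> K"

context
  fixes T :: real and X :: "real \<Rightarrow> real \<Rightarrow> real ^ 2"
  assumes T: "T > 0" and C21: "C21 T X"
begin

lemma C21_derivs:
  assumes "t \<in> {0..T}"
  shows C21_dx: "(X t has_vector_derivative dx (X t) x) (at x)"
    and C21_dxx: "(dx (X t) has_vector_derivative dx (dx (X t)) x) (at x)"
    and C21_dt: "((\<lambda>s. X s x) has_vector_derivative dt T X t x) (at t within {0..T})"
proof -
  have "X t differentiable at x" "dx (X t) differentiable at x" "(\<lambda>s. X s x) differentiable (at t within {0..T})"
    using C21 assms by (auto simp: C21_def)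
  then show "(X t has_vector_derivative dx (X t) x) (at x)" "(dx (X t) has_vector_derivative dx (dx (X t)) x) (at x)"
    "((\<lambda>s. X s x) has_vector_derivative dt T X t x) (at t within {0..T})"
    by (simp_all add: vector_derivative_works dx_def dt_def)
qed

lemma C21_periodic:
  assumes t: "t \<in> {0..T}"
  shows per_X: "periodic2pi (X t)" and per_dx: "periodic2pi (dx (X t))" and per_dxx: "periodic2pi (dx (dx (X t)))"
    and per_dt: "periodic2pi (dt T X t)"
proof -
  have p: "periodic2pi (X t)" if "t \<in> {0..T}" for t using C21 that by (simp add: C21_def)
  show "periodic2pi (X t)" by (rule p[OF t])
  show "periodic2pi (dx (X t))" "periodic2pi (dx (dx (X t)))" by (intro periodic2pi_dx p t)+
  show "periodic2pi (dt T X t)"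
    unfolding periodic2pi_def
  proof
    fix x
    have "((\<lambda>s. X s (x + 2 * pi)) has_vector_derivative dt T X t x) (at t within {0..T})"
      by (rule has_vector_derivative_transform[OF t _ C21_dt[OF t]]) (use p in \<open>simp add: periodic2pi_def\<close>)
    then show "dt T X t (x + 2 * pi) = dt T X t x"
      unfolding dt_def[of T X t "x + 2 * pi"] using T t
      using vector_derivative_within_cbox[of 0 T t "\<lambda>s. X s (x + 2 * pi)" "dt T X t x"] by simp
  qed
qed

text \<open>Continuity on the compact product of \<open>{0..T}\<close> with one period gives the
  bounds and periodicity extends them. This is the origin of the constant \<open>K\<close> in
  \<open>exact_curve\<close>.\<close>

lemma C21_bound:
  obtains K where "\<And>t x. t \<in> {0..T} \<Longrightarrow> norm (dx (X t) x) \<le> K" "\<And>t x. t \<in> {0..T} \<Longrightarrow> norm (dx (dx (X t)) x) \<le> K"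
    "\<And>t x. t \<in> {0..T} \<Longrightarrow> norm (dt T X t x) \<le> K"
proof -
  have b: "\<exists>K. \<forall>t\<in>{0..T}. \<forall>x. norm (G t x) \<le> K"
    if c: "continuous_on ({0..T} \<times> UNIV) (\<lambda>(t, x). G t x)" and p: "\<And>t. t \<in> {0..T} \<Longrightarrow> periodic2pi (G t)" for G :: "real \<Rightarrow> real \<Rightarrow> real ^ 2"
  proof -
    have "compact ((\<lambda>(t, x). G t x) ` ({0..T} \<times> {0..2*pi}))"
      by (intro compact_continuous_image continuous_on_subset[OF c] compact_Times) auto
    then obtain K where K: "\<forall>y\<in>(\<lambda>(t, x). G t x) ` ({0..T} \<times> {0..2*pi}). norm y \<le> K"
      using compact_imp_bounded bounded_iff by metis
    have "norm (G t x) \<le> K" if t: "t \<in> {0..T}" for t x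
    proof -
      define y where "y = x - 2 * pi * of_int \<lfloor>x / (2 * pi)\<rfloor>"
      have "of_int \<lfloor>x / (2 * pi)\<rfloor> \<le> x / (2 * pi)" "x / (2 * pi) \<le> of_int \<lfloor>x / (2 * pi)\<rfloor> + 1" by linarith+
      then have "of_int \<lfloor>x / (2 * pi)\<rfloor> * (2 * pi) \<le> x" "x \<le> (of_int \<lfloor>x / (2 * pi)\<rfloor> + 1) * (2 * pi)"
        by (simp_all only: pos_le_divide_eq pos_divide_le_eq pi_gt_zero zero_less_mult_iff zero_less_numeral simp_thms)
      then have "y \<in> {0..2*pi}" by (simp add: y_def algebra_simps)
      moreover have "G t x = G t y" using periodic2pi_int[OF p[OF t], of y "\<lfloor>x / (2 * pi)\<rfloor>"] by (simp add: y_def)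
      ultimately show ?thesis using K t by force
    qed
    then show ?thesis by blast
  qed
  have c: "continuous_on ({0..T} \<times> UNIV) (\<lambda>(t, x). dx (X t) x)" "continuous_on ({0..T} \<times> UNIV) (\<lambda>(t, x). dx (dx (X t)) x)"
    "continuous_on ({0..T} \<times> UNIV) (\<lambda>(t, x). dt T X t x)"
    using C21 unfolding C21_def by blast+
  obtain k1 k2 k3 where k: "\<forall>t\<in>{0..T}. \<forall>x. norm (dx (X t) x) \<le> k1" "\<forall>t\<in>{0..T}. \<forall>x. norm (dx (dx (X t)) x) \<le> k2"
      "\<forall>t\<in>{0..T}. \<forall>x. norm (dt T X t x) \<le> k3"
    using b[OF c(1) per_dx] b[OF c(2) per_dxx] b[OF c(3) per_dt] by blast
  show thesis
    by (rule that[of "max k1 (max k2 k3)"]) (use k in \<open>auto simp: le_max_iff_disj\<close>)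
qed

end

context exact_curve
begin

lemmas deriv_X = C21_dx[OF T C21] C21_dxx[OF T C21] C21_dt[OF T C21]
lemmas per = per_X[OF T C21] per_dx[OF T C21] per_dxx[OF T C21] per_dt[OF T C21]

lemma K_pos: "c\<^sub>0 \<le> K" "K > 0"
  using lower[of 0 0] K1[of 0 0] T c0 by auto

lemma cont2:
  "continuous_on ({0..T} \<times> A) (\<lambda>(t, x). X t x)" "continuous_on ({0..T} \<times> A) (\<lambda>(t, x). dx (X t) x)"
  "continuous_on ({0..T} \<times> A) (\<lambda>(t, x). dx (dx (X t)) x)" "continuous_on ({0..T} \<times> A) (\<lambda>(t, x). dt T X t x)"
  using C21 unfolding C21_def by (auto elim!: continuous_on_subset)

lemma cont_x:
  assumes t: "t \<in> {0..T}"
  shows "continuous_on A (X t)" "continuous_on A (dx (X t))" "continuous_on A (dx (dx (X t)))" "continuous_on A (dt T X t)"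
proof -
  have p: "continuous_on A (\<lambda>x. (t, x))" by (intro continuous_intros)
  have s: "(\<lambda>x. (t, x)) ` A \<subseteq> {0..T} \<times> A" using t by auto
  show "continuous_on A (X t)" "continuous_on A (dx (X t))" "continuous_on A (dx (dx (X t)))" "continuous_on A (dt T X t)"
    using continuous_on_compose2[OF cont2(1) p s] continuous_on_compose2[OF cont2(2) p s]
      continuous_on_compose2[OF cont2(3) p s] continuous_on_compose2[OF cont2(4) p s] by simp_all
qed

lemma cont_t:
  shows "continuous_on {0..T} (\<lambda>t. X t x)" "continuous_on {0..T} (\<lambda>t. dx (X t) x)" "continuous_on {0..T} (\<lambda>t. dt T X t x)"
proof -
  have p: "continuous_on {0..T} (\<lambda>t. (t, x))" by (intro continuous_intros)
  have s: "(\<lambda>t. (t, x)) ` {0..T} \<subseteq> {0..T} \<times> UNIV" by auto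
  show "continuous_on {0..T} (\<lambda>t. X t x)" "continuous_on {0..T} (\<lambda>t. dx (X t) x)" "continuous_on {0..T} (\<lambda>t. dt T X t x)"
    using continuous_on_compose2[OF cont2(1) p s] continuous_on_compose2[OF cont2(2) p s]
      continuous_on_compose2[OF cont2(4) p s] by simp_all
qed

lemma dx_lipschitz:
  assumes "t \<in> {0..T}"
  shows "norm (dx (X t) y - dx (X t) x) \<le> K * \<bar>y - x\<bar>"
  by (rule vector_derivative_lipschitz[of UNIV, OF _ deriv_X(2)[OF assms] K2[OF assms]]) auto

lemma X_lipschitz:
  assumes "t \<in> {0..T}"
  shows "norm (X t y - X t x) \<le> K * \<bar>y - x\<bar>"
  by (rule vector_derivative_lipschitz[of UNIV, OF _ deriv_X(1)[OF assms] K1[OF assms]]) auto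

end

locale exact_mesh = exact_curve T c\<^sub>0 K X + fe_mesh N \<theta> h
  for T c\<^sub>0 K :: real and X :: "real \<Rightarrow> real \<Rightarrow> real ^ 2" and N \<theta> h
begin

definition nodal :: "real \<Rightarrow> nat \<Rightarrow> real ^ 2" where "nodal t j = X t (\<theta> j)"

definition nodal_dt :: "real \<Rightarrow> nat \<Rightarrow> real ^ 2" where "nodal_dt t j = dt T X t (\<theta> j)"

text \<open>The mean value inequality for \<open>X t y - y *\<^sub>R dx (X t) x\<close> as a
  function of \<open>y\<close>, whose derivative is at most \<open>K * h\<close> on the
  element.\<close>

lemma nodal_slope:
  assumes t: "t \<in> {0..T}" and i: "i \<in> {1..N}" and x: "x \<in> {\<theta> i..\<theta> (i + 1)}"
  shows "norm (slope (nodal t) i - dx (X t) x) \<le> K * h"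
proof -
  have st: "\<theta> (i + 1) = \<theta> i + h" by (rule mesh_step[OF i])
  have "norm ((X t (\<theta> (i + 1)) - \<theta> (i + 1) *\<^sub>R dx (X t) x) - (X t (\<theta> i) - \<theta> i *\<^sub>R dx (X t) x)) \<le> (K * h) * norm (\<theta> (i + 1) - \<theta> i)"
    unfolding real_norm_def
  proof (rule vector_derivative_lipschitz[of "{\<theta> i..\<theta> (i + 1)}" "\<lambda>y. X t y - y *\<^sub>R dx (X t) x" "\<lambda>y. dx (X t) y - dx (X t) x"])
    fix y assume y: "y \<in> {\<theta> i..\<theta> (i + 1)}"
    show "((\<lambda>y. X t y - y *\<^sub>R dx (X t) x) has_vector_derivative dx (X t) y - dx (X t) x) (at y within {\<theta> i..\<theta> (i + 1)})"
      by (auto intro!: derivative_eq_intros has_vector_derivative_at_within[OF deriv_X(1)[OF t]])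
    have "norm (dx (X t) y - dx (X t) x) \<le> K * \<bar>y - x\<bar>" by (rule dx_lipschitz[OF t])
    also have "\<dots> \<le> K * h" using x y st K_pos by (intro mult_left_mono) auto
    finally show "norm (dx (X t) y - dx (X t) x) \<le> K * h" .
  qed (use st h_pos in auto)
  moreover have "(X t (\<theta> (i + 1)) - \<theta> (i + 1) *\<^sub>R dx (X t) x) - (X t (\<theta> i) - \<theta> i *\<^sub>R dx (X t) x)
     = h *\<^sub>R (slope (nodal t) i - dx (X t) x)"
    using h_pos node_nx[OF per(1)[OF t] i] st by (simp add: slope_def nodal_def algebra_simps)
  ultimately have "h * norm (slope (nodal t) i - dx (X t) x) \<le> (K * h) * h"
    using st h_pos by simp
  then show ?thesis using h_pos by simp
qed

text \<open>A Lipschitz bound of order \<open>h\<close> suffices, since the error of the slopes is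
  of this order as well.\<close>

lemma nodal_fe:
  assumes t: "t \<in> {0..T}" and i: "i \<in> {1..N}" and x: "x \<in> {\<theta> i..\<theta> (i + 1)}"
  shows "norm (X t x - fe (nodal t) x) \<le> K * h"
proof -
  have st: "\<theta> (i + 1) = \<theta> i + h" by (rule mesh_step[OF i])
  define s where "s = (x - \<theta> i) / h"
  have s: "0 \<le> s" "s \<le> 1" using x st h_pos by (auto simp: s_def field_simps)
  have nxe: "X t (\<theta> (nx i)) = X t (\<theta> (i + 1))" using node_nx[OF per(1)[OF t] i] by simp
  have "X t x - fe (nodal t) x = (1 - s) *\<^sub>R (X t x - X t (\<theta> i)) - s *\<^sub>R (X t (\<theta> (i + 1)) - X t x)"
    unfolding fe_on_element[OF i x] s_def[symmetric] nodal_def nxe by (simp add: algebra_simps)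
  then have "norm (X t x - fe (nodal t) x) \<le> (1 - s) * norm (X t x - X t (\<theta> i)) + s * norm (X t (\<theta> (i + 1)) - X t x)"
    using norm_triangle_ineq4[of "(1 - s) *\<^sub>R (X t x - X t (\<theta> i))" "s *\<^sub>R (X t (\<theta> (i + 1)) - X t x)"] s by simp
  also have "\<dots> \<le> (1 - s) * (K * h) + s * (K * h)"
  proof (intro add_mono mult_left_mono)
    have "K * \<bar>x - \<theta> i\<bar> \<le> K * h" "K * \<bar>\<theta> (i + 1) - x\<bar> \<le> K * h" using x st K_pos by (auto intro!: mult_left_mono)
    then show "norm (X t x - X t (\<theta> i)) \<le> K * h" "norm (X t (\<theta> (i + 1)) - X t x) \<le> K * h"
      using X_lipschitz[OF t, of x "\<theta> i"] X_lipschitz[OF t, of "\<theta> (i + 1)" x] by auto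
  qed (use s in auto)
  finally show ?thesis by (simp add: algebra_simps)
qed

text \<open>Interpolation uses up \<open>c\<^sub>0 / 4\<close> of the lower bound
  \<open>c\<^sub>0\<close>. Another \<open>c\<^sub>0 / 4\<close> is reserved as radius of the tube,
  so all slopes in the tube have length between \<open>c\<^sub>0 / 2\<close> and
  \<open>2 * K\<close>.\<close>

lemma nodal_slope_bounds:
  assumes t: "t \<in> {0..T}" and i: "i \<in> {1..N}" and h: "K * h \<le> c\<^sub>0 / 4"
  shows "c\<^sub>0 / 2 + c\<^sub>0 / 4 \<le> norm (slope (nodal t) i)" "norm (slope (nodal t) i) + c\<^sub>0 / 4 \<le> 2 * K"
proof -
  have "\<theta> i \<in> {\<theta> i..\<theta> (i + 1)}" using mesh_step[OF i] h_pos by auto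
  from nodal_slope[OF t i this] have "norm (slope (nodal t) i - dx (X t) (\<theta> i)) \<le> c\<^sub>0 / 4" using h by simp
  then show "c\<^sub>0 / 2 + c\<^sub>0 / 4 \<le> norm (slope (nodal t) i)" "norm (slope (nodal t) i) + c\<^sub>0 / 4 \<le> 2 * K"
    using norm_triangle_ineq3[of "slope (nodal t) i" "dx (X t) (\<theta> i)"] lower[OF t, of "\<theta> i"] K1[OF t, of "\<theta> i"] K_pos c0
    by auto
qed

lemma continuous_nodal: "continuous_on {0..T} (\<lambda>t. nodal t j)" "continuous_on {0..T} (\<lambda>t. nodal_dt t j)"
  unfolding nodal_def nodal_dt_def by (rule cont_t)+

lemma nodal_deriv: "t \<in> {0..T} \<Longrightarrow> ((\<lambda>t. nodal t j) has_vector_derivative nodal_dt t j) (at t within {0..T})"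
  unfolding nodal_def nodal_dt_def by (rule deriv_X(3))

text \<open>The nodal interpolant is the Ritz projection: its stiffness form coincides with that of the
  interpolated curve, which is why no error term appears here.\<close>

lemma stiff_nodal:
  assumes t: "t \<in> {0..T}"
  shows "(\<Sum>i=1..N. integral {\<theta> i..\<theta> (i + 1)} (\<lambda>x. fe f x \<bullet> dx (dx (X t)) x)) = - stiff (slope (nodal t)) f"
proof -
  define g where "g j = f j \<bullet> dx (X t) (\<theta> j)" for j
  have el: "integral {\<theta> i..\<theta> (i + 1)} (\<lambda>x. fe f x \<bullet> dx (dx (X t)) x) = g (nx i) - g i - slope (nodal t) i \<bullet> (f (nx i) - f i)"
    if i: "i \<in> {1..N}" for i
  proof -
    let ?I = "{\<theta> i..\<theta> (i + 1)}"
    have st: "\<theta> (i + 1) = \<theta> i + h" by (rule mesh_step[OF i])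
    have nxe: "X t (\<theta> (nx i)) = X t (\<theta> (i + 1))" "dx (X t) (\<theta> (nx i)) = dx (X t) (\<theta> (i + 1))"
      using node_nx[OF per(1)[OF t] i] node_nx[OF per(2)[OF t] i] by simp_all
    define l where "l x = (1 - (x - \<theta> i) / h) *\<^sub>R f i + ((x - \<theta> i) / h) *\<^sub>R f (nx i)" for x
    have dl: "(l has_vector_derivative slope f i) (at x within ?I)" for x
      unfolding l_def slope_def using h_pos
      by (auto intro!: derivative_eq_intros simp: scaleR_diff_right simp flip: has_real_derivative_iff_has_vector_derivative)
    \<comment> \<open>Integration by parts on one element: \<open>l\<close> has constant derivative
      \<open>slope f i\<close>, so the remaining integral is an increment of \<open>X\<close> and no
      second integral is left.\<close>
    have "((\<lambda>x. (l x \<bullet> dx (dx (X t)) x + slope f i \<bullet> dx (X t) x) - slope f i \<bullet> dx (X t) x) has_integral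
      ((l (\<theta> (i + 1)) \<bullet> dx (X t) (\<theta> (i + 1)) - l (\<theta> i) \<bullet> dx (X t) (\<theta> i)) - (slope f i \<bullet> X t (\<theta> (i + 1)) - slope f i \<bullet> X t (\<theta> i)))) ?I"
    proof (rule has_integral_diff)
      show "((\<lambda>x. l x \<bullet> dx (dx (X t)) x + slope f i \<bullet> dx (X t) x) has_integral
         (l (\<theta> (i + 1)) \<bullet> dx (X t) (\<theta> (i + 1)) - l (\<theta> i) \<bullet> dx (X t) (\<theta> i))) ?I"
        using st h_pos
        by (intro fundamental_theorem_of_calculus bounded_bilinear.has_vector_derivative[OF bounded_bilinear_inner dl
              has_vector_derivative_at_within[OF deriv_X(2)[OF t]]]) auto
      show "((\<lambda>x. slope f i \<bullet> dx (X t) x) has_integral (slope f i \<bullet> X t (\<theta> (i + 1)) - slope f i \<bullet> X t (\<theta> i))) ?I"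
        using st h_pos
        by (intro fundamental_theorem_of_calculus bounded_linear.has_vector_derivative[OF bounded_linear_inner_right]
              has_vector_derivative_at_within[OF deriv_X(1)[OF t]]) auto
    qed
    then have "((\<lambda>x. l x \<bullet> dx (dx (X t)) x) has_integral
      (g (nx i) - g i - slope f i \<bullet> (X t (\<theta> (i + 1)) - X t (\<theta> i)))) ?I"
      using st h_pos nxe by (simp add: l_def g_def inner_diff_right algebra_simps)
    then have "((\<lambda>x. fe f x \<bullet> dx (dx (X t)) x) has_integral
      (g (nx i) - g i - slope f i \<bullet> (X t (\<theta> (i + 1)) - X t (\<theta> i)))) ?I"
      by (rule has_integral_eq[rotated]) (simp add: fe_on_element[OF i] l_def)
    moreover have "slope f i \<bullet> (X t (\<theta> (i + 1)) - X t (\<theta> i)) = slope (nodal t) i \<bullet> (f (nx i) - f i)"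
      by (simp add: slope_def nodal_def nxe inner_commute)
    ultimately show ?thesis by (simp add: integral_unique)
  qed
  have "(\<Sum>i=1..N. integral {\<theta> i..\<theta> (i + 1)} (\<lambda>x. fe f x \<bullet> dx (dx (X t)) x))
    = (\<Sum>i=1..N. g (nx i) - g i - slope (nodal t) i \<bullet> (f (nx i) - f i))"
    by (rule sum.cong[OF refl]) (rule el)
  \<comment> \<open>The boundary terms \<open>g\<close> cancel around the circle.\<close>
  also have "\<dots> = - stiff (slope (nodal t)) f"
    using sum_nx[of g] by (simp add: sum_subtractf stiff_def)
  finally show ?thesis .
qed

end

section \<open>The energy estimate\<close>

text \<open>For \<open>p \<noteq> 0\<close> the projection onto the normal direction, written
  without a choice of sign; for \<open>p = 0\<close> division by zero makes it the identity. It
  describes squared normal components by a function of the slope alone.\<close>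

definition normal_proj :: "real ^ 2 \<Rightarrow> real ^ 2 \<Rightarrow> real ^ 2" where
  "normal_proj p v = v - ((p \<bullet> v) / (norm p)\<^sup>2) *\<^sub>R p"

lemma linear_normal_proj: "linear (normal_proj p)"
  by (rule linearI) (simp_all add: normal_proj_def algebra_simps inner_add_right add_divide_distrib)

lemma normal_proj_inner: "v \<bullet> normal_proj p v = (norm v)\<^sup>2 - (p \<bullet> v)\<^sup>2 / (norm p)\<^sup>2"
  by (simp add: normal_proj_def inner_diff_right inner_commute power2_norm_eq_inner[of v] power2_eq_square[of "p \<bullet> v"])

lemma normal_proj_nonneg: "0 \<le> v \<bullet> normal_proj p v"
proof (cases "p = 0")
  case False
  have "(p \<bullet> v)\<^sup>2 \<le> (norm p)\<^sup>2 * (norm v)\<^sup>2"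
    using Cauchy_Schwarz_ineq[of p v] by (simp add: power2_norm_eq_inner)
  then show ?thesis using False by (simp add: normal_proj_inner divide_le_eq mult.commute)
qed (simp add: normal_proj_inner)

lemma normal_proj_le: "v \<bullet> normal_proj p v \<le> (norm v)\<^sup>2"
  by (simp add: normal_proj_inner)

lemma normal_proj_unit_normal:
  assumes "norm n = 1" "n \<bullet> p = 0" "p \<noteq> 0"
  shows "(n \<bullet> v)\<^sup>2 = v \<bullet> normal_proj p v"
proof -
  have "(norm p)\<^sup>2 * (n \<bullet> v)\<^sup>2 = (norm p)\<^sup>2 * (norm v)\<^sup>2 - (p \<bullet> v)\<^sup>2"
    using unit_normal_tensor[OF assms(1,2), of v v] by (simp add: inner_commute power2_eq_square power2_norm_eq_inner[unfolded power2_eq_square, symmetric])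
  then show ?thesis using assms(3) by (simp add: normal_proj_inner field_simps)
qed

text \<open>For \<open>p \<noteq> 0\<close> the tensor equals \<open>(norm p)\<^sup>2\<close> times
  the sum of \<alpha> times the identity and \<open>1 - \<alpha>\<close> times
  \<open>normal_proj\<close>. Keeping both parts retains the two velocity terms of the error bound
  with their weights.\<close>

lemma scheme_op_ge_normal_proj:
  assumes "0 < \<alpha>" "\<alpha> \<le> 1" "0 < a" "a \<le> norm p"
  shows "\<alpha> * a\<^sup>2 * (norm v)\<^sup>2 + (1 - \<alpha>) * a\<^sup>2 * (v \<bullet> normal_proj p v) \<le> v \<bullet> scheme_op \<alpha> p v"
proof -
  have p: "norm p \<noteq> 0" using assms by auto
  have a2: "a\<^sup>2 \<le> (norm p)\<^sup>2" using assms by (intro power_mono) auto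
  have "v \<bullet> scheme_op \<alpha> p v = (norm p)\<^sup>2 * (norm v)\<^sup>2 - (1 - \<alpha>) * (p \<bullet> v)\<^sup>2"
    by (simp add: scheme_op_def inner_diff_right inner_commute power2_norm_eq_inner[symmetric] power2_eq_square[of "p \<bullet> v"])
  also have "\<dots> = \<alpha> * (norm p)\<^sup>2 * (norm v)\<^sup>2 + (1 - \<alpha>) * (norm p)\<^sup>2 * (v \<bullet> normal_proj p v)"
    using p by (simp add: normal_proj_inner algebra_simps)
  also have "\<dots> \<ge> \<alpha> * a\<^sup>2 * (norm v)\<^sup>2 + (1 - \<alpha>) * a\<^sup>2 * (v \<bullet> normal_proj p v)"
    using assms a2 normal_proj_nonneg[of v p] by (intro add_mono mult_right_mono mult_left_mono) auto
  finally show ?thesis .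
qed

lemma young_quarter:
  fixes y z l :: real
  assumes "l > 0"
  shows "y * z \<le> l / 4 * y\<^sup>2 + z\<^sup>2 / l"
proof -
  have "0 \<le> (l * y / 2 - z)\<^sup>2 / l" using assms by simp
  also have "\<dots> = l / 4 * y\<^sup>2 + z\<^sup>2 / l - y * z" using assms by (simp add: power2_eq_square field_simps)
  finally show ?thesis by simp
qed

lemma power2_sum3_le: "(x + y + z)\<^sup>2 \<le> 3 * (x\<^sup>2 + y\<^sup>2 + (z::real)\<^sup>2)"
proof -
  have "0 \<le> (x - y)\<^sup>2 + (y - z)\<^sup>2 + (x - z)\<^sup>2" by simp
  then show ?thesis by (simp add: power2_eq_square algebra_simps)
qed

text \<open>Here \<open>p\<close> and \<open>q\<close> are the discrete and the exact slope,
  \<open>v\<close> is the exact velocity, \<open>r\<close> its interpolation error and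
  \<open>E\<close> the velocity of the nodal error, so \<open>v - r - E\<close> is the discrete
  velocity. The factors are \<open>192 = 3 * 8 * 8\<close> from the operator at
  \<open>norm p \<le> 2 * K\<close> and \<open>108 = 3 * 6 * 6\<close> from the operator difference;
  the 3 comes from squaring a sum of three terms.\<close>

lemma pointwise_estimate:
  fixes p q v r E :: "real ^ 2"
  assumes \<alpha>: "0 < \<alpha>" "\<alpha> \<le> 1" and a: "a > 0" and p: "norm p \<le> 2 * K" and q: "norm q \<le> K" and v: "norm v \<le> K"
    and pq: "norm (p - q) \<le> e + K * h" and e: "e \<ge> 0" and h: "h \<ge> 0"
  shows "E \<bullet> scheme_op \<alpha> p (v - r - E) - E \<bullet> scheme_op \<alpha> q v
    \<le> - (E \<bullet> scheme_op \<alpha> p E) + \<alpha> * a\<^sup>2 / 4 * (norm E)\<^sup>2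
      + (192 * K ^ 4 * (norm r)\<^sup>2 + 108 * K ^ 4 * e\<^sup>2 + 108 * K ^ 6 * h\<^sup>2) / (\<alpha> * a\<^sup>2)"
proof -
  have K: "K \<ge> 0" using q norm_ge_zero order_trans by blast
  define z where "z = 8 * K\<^sup>2 * norm r + 6 * K\<^sup>2 * e + 6 * K ^ 3 * h"
  have eq: "E \<bullet> scheme_op \<alpha> p (v - r - E) - E \<bullet> scheme_op \<alpha> q v = - (E \<bullet> scheme_op \<alpha> p E) + E \<bullet> ((scheme_op \<alpha> p v - scheme_op \<alpha> q v) - scheme_op \<alpha> p r)"
    by (simp add: linear_diff[OF linear_scheme_op] inner_diff_right)
  have 1: "norm (scheme_op \<alpha> p r) \<le> 8 * K\<^sup>2 * norm r"
  proof -
    have "norm (scheme_op \<alpha> p r) \<le> 2 * (norm p)\<^sup>2 * norm r" by (rule scheme_op_bound[OF \<alpha>])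
    also have "\<dots> \<le> 2 * (2 * K)\<^sup>2 * norm r" using p by (intro mult_right_mono mult_left_mono power_mono) auto
    finally show ?thesis by (simp add: power2_eq_square)
  qed
  have 2: "norm (scheme_op \<alpha> p v - scheme_op \<alpha> q v) \<le> 6 * K\<^sup>2 * e + 6 * K ^ 3 * h"
  proof -
    have "norm (scheme_op \<alpha> p v - scheme_op \<alpha> q v) \<le> 2 * (norm p + norm q) * norm (p - q) * norm v" by (rule scheme_op_diff[OF \<alpha>])
    also have "\<dots> \<le> 2 * (2 * K + K) * (e + K * h) * K"
      using p q v pq K e h by (intro mult_mono add_mono) auto
    also have "\<dots> = 6 * K\<^sup>2 * e + 6 * K ^ 3 * h" by (simp add: algebra_simps power2_eq_square power3_eq_cube)
    finally show ?thesis .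
  qed
  have "E \<bullet> ((scheme_op \<alpha> p v - scheme_op \<alpha> q v) - scheme_op \<alpha> p r) \<le> norm E * z"
  proof -
    have "norm ((scheme_op \<alpha> p v - scheme_op \<alpha> q v) - scheme_op \<alpha> p r) \<le> z"
      using norm_triangle_ineq4[of "scheme_op \<alpha> p v - scheme_op \<alpha> q v" "scheme_op \<alpha> p r"] 1 2 by (simp add: z_def)
    then have "norm E * norm ((scheme_op \<alpha> p v - scheme_op \<alpha> q v) - scheme_op \<alpha> p r) \<le> norm E * z" by (rule mult_left_mono) simp
    then show ?thesis using norm_cauchy_schwarz order_trans by blast
  qed
  also have "\<dots> \<le> \<alpha> * a\<^sup>2 / 4 * (norm E)\<^sup>2 + z\<^sup>2 / (\<alpha> * a\<^sup>2)"
    by (rule young_quarter) (use \<alpha> a in simp)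
  also have "z\<^sup>2 / (\<alpha> * a\<^sup>2) \<le> (192 * K ^ 4 * (norm r)\<^sup>2 + 108 * K ^ 4 * e\<^sup>2 + 108 * K ^ 6 * h\<^sup>2) / (\<alpha> * a\<^sup>2)"
  proof (rule divide_right_mono)
    have "z\<^sup>2 \<le> 3 * ((8 * K\<^sup>2 * norm r)\<^sup>2 + (6 * K\<^sup>2 * e)\<^sup>2 + (6 * K ^ 3 * h)\<^sup>2)"
      unfolding z_def by (rule power2_sum3_le)
    also have "\<dots> = 192 * K ^ 4 * (norm r)\<^sup>2 + 108 * K ^ 4 * e\<^sup>2 + 108 * K ^ 6 * h\<^sup>2"
      by (simp add: power_mult_distrib flip: power_mult)
    finally show "z\<^sup>2 \<le> 192 * K ^ 4 * (norm r)\<^sup>2 + 108 * K ^ 4 * e\<^sup>2 + 108 * K ^ 6 * h\<^sup>2" .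
  qed (use \<alpha> in simp)
  finally show ?thesis unfolding eq by simp
qed

context fe_mesh
begin

lemma mass_id_deriv:
  assumes "\<And>j. j \<in> {1..N} \<Longrightarrow> ((\<lambda>t. u t j) has_vector_derivative u' j) (at t within S)"
  shows "((\<lambda>t. mass (\<lambda>_ x. x) (u t) (u t)) has_real_derivative 2 * mass (\<lambda>_ x. x) (u t) u') (at t within S)"
proof -
  have d: "((\<lambda>t. u t i \<bullet> u t j) has_real_derivative (u t i \<bullet> u' j + u' i \<bullet> u t j)) (at t within S)"
    if "i \<in> {1..N}" "j \<in> {1..N}" for i j
    using bounded_bilinear.has_vector_derivative[OF bounded_bilinear_inner assms[OF that(1)] assms[OF that(2)]]
    by (simp add: has_real_derivative_iff_has_vector_derivative)
  have "((\<lambda>t. mass (\<lambda>_ x. x) (u t) (u t)) has_real_derivative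
     (\<Sum>i=1..N. h * ((u t i \<bullet> u' i + u' i \<bullet> u t i) / 3 + ((u t i \<bullet> u' (nx i) + u' i \<bullet> u t (nx i))
       + (u t (nx i) \<bullet> u' i + u' (nx i) \<bullet> u t i)) / 6 + (u t (nx i) \<bullet> u' (nx i) + u' (nx i) \<bullet> u t (nx i)) / 3))) (at t within S)"
    unfolding mass_def
    by (intro DERIV_sum DERIV_cmult DERIV_add DERIV_cdivide d nx_in)
  also have "(\<Sum>i=1..N. h * ((u t i \<bullet> u' i + u' i \<bullet> u t i) / 3 + ((u t i \<bullet> u' (nx i) + u' i \<bullet> u t (nx i))
       + (u t (nx i) \<bullet> u' i + u' (nx i) \<bullet> u t i)) / 6 + (u t (nx i) \<bullet> u' (nx i) + u' (nx i) \<bullet> u t (nx i)) / 3))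
    = 2 * mass (\<lambda>_ x. x) (u t) u'"
    unfolding mass_def sum_distrib_left by (rule sum.cong[OF refl]) (simp add: inner_commute algebra_simps)
  finally show ?thesis .
qed

lemma mass_id_young: "2 * mass (\<lambda>_ x. x) u v \<le> mass (\<lambda>_ x. x) u u + mass (\<lambda>_ x. x) v v"
proof -
  have "mass (\<lambda>_ x. x) (\<lambda>j. u j - v j) (\<lambda>j. u j - v j) = mass (\<lambda>_ x. x) u u + mass (\<lambda>_ x. x) v v - 2 * mass (\<lambda>_ x. x) u v"
    unfolding mass_def sum_distrib_left sum.distrib[symmetric] sum_subtractf[symmetric]
    by (rule sum.cong[OF refl])
      (simp add: inner_commute inner_diff_left inner_diff_right algebra_simps add_divide_distrib diff_divide_distrib)
  then show ?thesis using mass_nonneg[of "\<lambda>j. u j - v j"] by simp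
qed

lemma mass_scale_op: "mass (\<lambda>i v. r *\<^sub>R A i v) u f = r * mass A u f"
  unfolding mass_def sum_distrib_left by (rule sum.cong[OF refl]) (simp add: algebra_simps)

text \<open>The pointwise inequality passes to \<open>mass\<close> by applying coercivity with
  constant 0 to the difference of the operators.\<close>

lemma mass_scheme_op_ge:
  assumes \<alpha>: "0 < \<alpha>" "\<alpha> \<le> 1" and a: "0 < a" and p: "\<And>i. i \<in> {1..N} \<Longrightarrow> a \<le> norm (p i)"
  shows "\<alpha> * a\<^sup>2 * mass (\<lambda>_ x. x) u u + (1 - \<alpha>) * a\<^sup>2 * mass (\<lambda>i. normal_proj (p i)) u u \<le> mass (\<lambda>i. scheme_op \<alpha> (p i)) u u"
proof -
  let ?A = "\<lambda>i v. scheme_op \<alpha> (p i) v - (\<alpha> * a\<^sup>2) *\<^sub>R v - ((1 - \<alpha>) * a\<^sup>2) *\<^sub>R normal_proj (p i) v"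
  have "0 * h / 3 * (\<Sum>i=1..N. (norm (u i))\<^sup>2) \<le> mass ?A u u"
  proof (rule mass_coercive)
    show "linear (?A i)" for i
      by (intro linear_compose_sub linear_compose_scale_right linear_scheme_op linear_normal_proj linear_id[unfolded id_def])
    show "0 * (norm v)\<^sup>2 \<le> v \<bullet> ?A i v" if "i \<in> {1..N}" for i v
      using scheme_op_ge_normal_proj[OF \<alpha> a p[OF that], of v] by (simp add: inner_diff_right power2_norm_eq_inner)
  qed simp
  also have "mass ?A u u = mass (\<lambda>i. scheme_op \<alpha> (p i)) u u - \<alpha> * a\<^sup>2 * mass (\<lambda>_ x. x) u u - (1 - \<alpha>) * a\<^sup>2 * mass (\<lambda>i. normal_proj (p i)) u u"
    unfolding mass_diff_op[of "\<lambda>i v. scheme_op \<alpha> (p i) v - (\<alpha> * a\<^sup>2) *\<^sub>R v"] mass_diff_op[of "\<lambda>i. scheme_op \<alpha> (p i)"] mass_scale_op ..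
  finally show ?thesis by simp
qed

lemma mass_normal_proj_nonneg: "0 \<le> mass (\<lambda>i. normal_proj (p i)) u u"
proof -
  have "0 * h / 3 * (\<Sum>i=1..N. (norm (u i))\<^sup>2) \<le> mass (\<lambda>i. normal_proj (p i)) u u"
    by (rule mass_coercive) (auto simp: linear_normal_proj normal_proj_nonneg)
  then show ?thesis by simp
qed

lemma continuous_element:
  fixes A :: "real ^ 2 \<Rightarrow> real ^ 2"
  shows "linear A \<Longrightarrow> continuous_on S (\<lambda>x. fe f x \<bullet> A (fe u x))"
  by (intro continuous_intros continuous_fe linear_continuous_on_compose[OF continuous_fe])

end

section \<open>Gronwall estimate for the nodal error\<close>

text \<open>The Gronwall rate before division by \<alpha>, stated outside the locales because the
  constants must be fixed before the mesh. Here \<open>c\<^sub>0 / 2\<close> is the lower bound for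
  slopes in the tube and \<open>216 = 2 * 108\<close> comes from \<open>pointwise_estimate\<close>;
  the summand 1 absorbs the L2 part of the energy, since \<open>\<alpha> \<le> 1\<close>.\<close>

definition energy_rate :: "real \<Rightarrow> real \<Rightarrow> real" where
  "energy_rate c\<^sub>0 K = 1 + 216 * K ^ 4 / (c\<^sub>0 / 2)\<^sup>2"

text \<open>The coefficient of \<open>h\<^sup>2 / \<alpha>\<close>: \<open>B\<close> bounds the H1
  norm of the velocity, and \<open>216 * pi\<close> is 108 times the length of the circle.\<close>

definition energy_source :: "real \<Rightarrow> real \<Rightarrow> real \<Rightarrow> real" where
  "energy_source c\<^sub>0 K B = 2 / (c\<^sub>0 / 2)\<^sup>2 * (192 * K ^ 4 * B\<^sup>2 + 216 * pi * K ^ 6)"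

definition energy_const :: "real \<Rightarrow> real \<Rightarrow> real \<Rightarrow> real \<Rightarrow> real \<Rightarrow> real" where
  "energy_const T c\<^sub>0 K B \<alpha> = energy_source c\<^sub>0 K B / \<alpha> * T * exp (energy_rate c\<^sub>0 K / \<alpha> * T)"

text \<open>The scheme is not assumed for \<open>c\<close>: for the truncated flow it holds only
  while the slopes lie in the tube, so it appears as a premise of the individual estimates.\<close>

locale approx = exact_mesh T c\<^sub>0 K X N \<theta> h
  for T c\<^sub>0 K :: real and X :: "real \<Rightarrow> real \<Rightarrow> real ^ 2" and N \<theta> h +
  fixes \<alpha> B :: real and c c' :: "real \<Rightarrow> nat \<Rightarrow> real ^ 2"
  assumes \<alpha>: "0 < \<alpha>" "\<alpha> \<le> 1" and Kh: "K * h \<le> c\<^sub>0 / 4"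
    and pde: "\<And>t x. 0 < t \<Longrightarrow> t < T \<Longrightarrow> scheme_op \<alpha> (dx (X t) x) (dt T X t x) = dx (dx (X t)) x"
    and rho: "\<And>t. t \<in> {0..T} \<Longrightarrow>
      (\<Sum>i=1..N. integral {\<theta> i..\<theta> (i + 1)} (\<lambda>x. (norm (dt T X t x - fe (nodal_dt t) x))\<^sup>2)) \<le> B\<^sup>2 * h\<^sup>2"
    and dc: "\<And>t j. t \<in> {0..T} \<Longrightarrow> ((\<lambda>t. c t j) has_vector_derivative c' t j) (at t within {0..T})"
    and cc': "\<And>j. continuous_on {0..T} (\<lambda>t. c' t j)"
    and cinit: "\<And>j. j \<in> {1..N} \<Longrightarrow> c 0 j = nodal 0 j"
begin

definition a where "a = c\<^sub>0 / 2"

definition err where "err t j = nodal t j - c t j"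

definition err' where "err' t j = nodal_dt t j - c' t j"

definition slope_energy where "slope_energy t = (\<Sum>i=1..N. h * (norm (slope (err t) i))\<^sup>2)"

abbreviation "mass_id \<equiv> mass (\<lambda>_ x. x)"

definition dissipation where "dissipation t = \<alpha> * mass_id (err' t) (err' t)
  + (1 - \<alpha>) * mass (\<lambda>i. normal_proj (slope (c t) i)) (err' t) (err' t)"

abbreviation "K0 \<equiv> energy_rate c\<^sub>0 K"

abbreviation "R0 \<equiv> energy_source c\<^sub>0 K B"

abbreviation "Q \<equiv> energy_const T c\<^sub>0 K B \<alpha>"

lemma K0_eq: "K0 = 1 + 216 * K ^ 4 / a\<^sup>2" 
  and R0_eq: "R0 = 2 / a\<^sup>2 * (192 * K ^ 4 * B\<^sup>2 + 216 * pi * K ^ 6)"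
  and Q_eq: "Q = R0 / \<alpha> * T * exp (K0 / \<alpha> * T)"
  by (simp_all only: energy_rate_def energy_source_def energy_const_def a_def)

lemma a_pos: "a > 0" using c0 by (simp add: a_def)

lemma cc: "continuous_on {0..T} (\<lambda>t. c t j)"
  using dc by (meson continuous_on_eq_continuous_within has_vector_derivative_continuous)

lemma slope_err: "slope (err t) i = slope (nodal t) i - slope (c t) i"
  unfolding slope_diff by (simp add: err_def[abs_def])

lemma err_deriv: "t \<in> {0..T} \<Longrightarrow> ((\<lambda>t. err t j) has_vector_derivative err' t j) (at t within {0..T})"
  unfolding err_def err'_def by (intro has_vector_derivative_diff nodal_deriv dc)

lemma continuous_err: "continuous_on {0..T} (\<lambda>t. err t j)" "continuous_on {0..T} (\<lambda>t. err' t j)"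
  unfolding err_def err'_def by (intro continuous_intros continuous_nodal cc cc')+

lemma slope_energy_nonneg: "slope_energy t \<ge> 0" using h_pos by (simp add: slope_energy_def sum_nonneg)

lemma slope_energy_deriv:
  assumes t: "t \<in> {0..T}"
  shows "(slope_energy has_real_derivative 2 * stiff (slope (err t)) (err' t)) (at t within {0..T})"
proof -
  have d: "((\<lambda>t. slope (err t) i) has_vector_derivative slope (err' t) i) (at t within {0..T})" for i
    unfolding slope_def
    by (intro bounded_linear.has_vector_derivative[OF bounded_linear_scaleR_right] has_vector_derivative_diff err_deriv t)
  have "((\<lambda>t. \<Sum>i=1..N. h * (slope (err t) i \<bullet> slope (err t) i)) has_real_derivative
      (\<Sum>i=1..N. h * (slope (err t) i \<bullet> slope (err' t) i + slope (err' t) i \<bullet> slope (err t) i))) (at t within {0..T})"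
    using bounded_bilinear.has_vector_derivative[OF bounded_bilinear_inner d d]
    by (intro DERIV_sum DERIV_cmult) (simp add: has_real_derivative_iff_has_vector_derivative)
  moreover have "(\<Sum>i=1..N. h * (slope (err t) i \<bullet> slope (err' t) i + slope (err' t) i \<bullet> slope (err t) i)) = 2 * stiff (slope (err t)) (err' t)"
    unfolding stiff_def sum_distrib_left
  proof (rule sum.cong[OF refl])
    fix i
    have "err' t (nx i) - err' t i = h *\<^sub>R slope (err' t) i" using h_pos by (simp add: slope_def)
    then show "h * (slope (err t) i \<bullet> slope (err' t) i + slope (err' t) i \<bullet> slope (err t) i) = 2 * (slope (err t) i \<bullet> (err' t (nx i) - err' t i))"
      by (simp add: inner_commute)
  qed
  ultimately show ?thesis by (simp add: slope_energy_def[abs_def] power2_norm_eq_inner)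
qed

lemma continuous_slope_energy: "continuous_on {0..T} slope_energy"
  using slope_energy_deriv by (meson DERIV_continuous continuous_on_eq_continuous_within)

lemma tube_slope_bounds:
  assumes t: "t \<in> {0..T}" and i: "i \<in> {1..N}" and tb: "norm (slope (err t) i) \<le> c\<^sub>0 / 4"
  shows "a \<le> norm (slope (c t) i)" "norm (slope (c t) i) \<le> 2 * K"
  using nodal_slope_bounds[OF t i Kh] norm_triangle_ineq3[of "slope (nodal t) i" "slope (c t) i"] tb
  unfolding slope_err a_def by auto

text \<open>The stiffness of the nodal interpolant is replaced by the integral of the second space
  derivative, that of \<open>c\<close> by the scheme. The differential equation turns the second
  derivative into the tensor at the exact slope, and \<open>pointwise_estimate\<close> is integrated
  over the elements.\<close>

lemma stiff_err_bound:
  assumes t: "0 < t" "t < T" and tb: "\<And>i. i \<in> {1..N} \<Longrightarrow> norm (slope (err t) i) \<le> c\<^sub>0 / 4"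
    and eq: "\<And>f. mass (\<lambda>i. scheme_op \<alpha> (slope (c t) i)) (c' t) f = - stiff (slope (c t)) f"
  shows "stiff (slope (err t)) (err' t) \<le> - mass (\<lambda>i. scheme_op \<alpha> (slope (c t) i)) (err' t) (err' t)
    + \<alpha> * a\<^sup>2 / 4 * mass_id (err' t) (err' t)
    + (192 * K ^ 4 * (B\<^sup>2 * h\<^sup>2) + 108 * K ^ 4 * slope_energy t + 108 * K ^ 6 * h\<^sup>2 * (2 * pi)) / (\<alpha> * a\<^sup>2)"
proof -
  have t': "t \<in> {0..T}" using t by auto
  define p where "p i = slope (c t) i" for i
  let ?f = "err' t"
  let ?I = "\<lambda>i. {\<theta> i..\<theta> (i + 1)}"
  let ?l = "\<alpha> * a\<^sup>2"
  have l: "?l > 0" using \<alpha> a_pos by simp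
  have cA: "continuous_on (?I i) (\<lambda>x. fe ?f x \<bullet> scheme_op \<alpha> (p i) (fe (c' t) x))" for i by (intro continuous_element linear_scheme_op)
  have cB: "continuous_on (?I i) (\<lambda>x. fe ?f x \<bullet> dx (dx (X t)) x)" for i by (intro continuous_intros continuous_fe cont_x[OF t'])
  have "stiff (slope (err t)) ?f = stiff (\<lambda>i. slope (nodal t) i - slope (c t) i) ?f"
    by (rule stiff_cong) (auto simp: slope_err)
  also have "\<dots> = stiff (slope (nodal t)) ?f - stiff (slope (c t)) ?f" by (rule stiff_diff_left)
  also have "\<dots> = mass (\<lambda>i. scheme_op \<alpha> (p i)) (c' t) ?f - (\<Sum>i=1..N. integral (?I i) (\<lambda>x. fe ?f x \<bullet> dx (dx (X t)) x))"
    unfolding stiff_nodal[OF t'] p_def eq by simp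
  also have "\<dots> = (\<Sum>i=1..N. integral (?I i) (\<lambda>x. fe ?f x \<bullet> scheme_op \<alpha> (p i) (fe (c' t) x) - fe ?f x \<bullet> dx (dx (X t)) x))"
    unfolding mass_eq_integral[of "\<lambda>i. scheme_op \<alpha> (p i)", OF linear_scheme_op] sum_subtractf[symmetric]
    by (intro sum.cong refl Henstock_Kurzweil_Integration.integral_diff[symmetric] integrable_continuous_real cA cB)
  also have "\<dots> \<le> (\<Sum>i=1..N. integral (?I i) (\<lambda>x. - (fe ?f x \<bullet> scheme_op \<alpha> (p i) (fe ?f x)) + ?l / 4 * (fe ?f x \<bullet> fe ?f x)
      + (192 * K ^ 4 * (norm (dt T X t x - fe (nodal_dt t) x))\<^sup>2 + 108 * K ^ 4 * (norm (slope (err t) i))\<^sup>2 + 108 * K ^ 6 * h\<^sup>2) / ?l))"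
  proof (rule sum_mono, rule integral_le)
    fix i assume i: "i \<in> {1..N}"
    show "(\<lambda>x. fe ?f x \<bullet> scheme_op \<alpha> (p i) (fe (c' t) x) - fe ?f x \<bullet> dx (dx (X t)) x) integrable_on ?I i"
      by (intro integrable_continuous_real continuous_intros cA cB)
    show "(\<lambda>x. - (fe ?f x \<bullet> scheme_op \<alpha> (p i) (fe ?f x)) + ?l / 4 * (fe ?f x \<bullet> fe ?f x)
      + (192 * K ^ 4 * (norm (dt T X t x - fe (nodal_dt t) x))\<^sup>2 + 108 * K ^ 4 * (norm (slope (err t) i))\<^sup>2 + 108 * K ^ 6 * h\<^sup>2) / ?l) integrable_on ?I i"
      using l by (intro integrable_continuous_real continuous_intros continuous_element linear_scheme_op continuous_fe cont_x[OF t']) auto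
    fix x assume x: "x \<in> ?I i"
    define v r E where "v = dt T X t x" and "r = dt T X t x - fe (nodal_dt t) x" and "E = fe ?f x"
    have "fe (c' t) x = fe (nodal_dt t) x - E"
      unfolding E_def fe_diff by (simp add: err'_def)
    then have u: "fe (c' t) x = v - r - E" by (simp add: v_def r_def)
    have pq: "norm (p i - dx (X t) x) \<le> norm (slope (err t) i) + K * h"
    proof -
      have e: "p i - dx (X t) x = (slope (nodal t) i - dx (X t) x) - slope (err t) i" by (simp add: p_def slope_err)
      show ?thesis
        unfolding e using norm_triangle_ineq4[of "slope (nodal t) i - dx (X t) x" "slope (err t) i"] nodal_slope[OF t' i x] by linarith
    qed
    show "fe ?f x \<bullet> scheme_op \<alpha> (p i) (fe (c' t) x) - fe ?f x \<bullet> dx (dx (X t)) x \<le> - (fe ?f x \<bullet> scheme_op \<alpha> (p i) (fe ?f x)) + ?l / 4 * (fe ?f x \<bullet> fe ?f x)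
      + (192 * K ^ 4 * (norm (dt T X t x - fe (nodal_dt t) x))\<^sup>2 + 108 * K ^ 4 * (norm (slope (err t) i))\<^sup>2 + 108 * K ^ 6 * h\<^sup>2) / ?l"
      unfolding r_def[symmetric] unfolding u pde[OF t, symmetric] v_def[symmetric] E_def[symmetric] power2_norm_eq_inner[of E, symmetric]
      using tube_slope_bounds[OF t' i tb[OF i]] h_pos
      by (intro pointwise_estimate \<alpha> a_pos K1[OF t'] pq) (auto simp: p_def v_def K3[OF t'])
  qed
  also have "\<dots> = - mass (\<lambda>i. scheme_op \<alpha> (p i)) ?f ?f + ?l / 4 * mass_id ?f ?f
      + (192 * K ^ 4 * (\<Sum>i=1..N. integral (?I i) (\<lambda>x. (norm (dt T X t x - fe (nodal_dt t) x))\<^sup>2))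
        + 108 * K ^ 4 * slope_energy t + 108 * K ^ 6 * h\<^sup>2 * (2 * pi)) / ?l"
  proof -
    have 1: "integral (?I i) (\<lambda>x. - (fe ?f x \<bullet> scheme_op \<alpha> (p i) (fe ?f x)) + ?l / 4 * (fe ?f x \<bullet> fe ?f x)
      + (192 * K ^ 4 * (norm (dt T X t x - fe (nodal_dt t) x))\<^sup>2 + 108 * K ^ 4 * (norm (slope (err t) i))\<^sup>2 + 108 * K ^ 6 * h\<^sup>2) / ?l)
      = - integral (?I i) (\<lambda>x. fe ?f x \<bullet> scheme_op \<alpha> (p i) (fe ?f x)) + ?l / 4 * integral (?I i) (\<lambda>x. fe ?f x \<bullet> fe ?f x)
        + (192 * K ^ 4 * integral (?I i) (\<lambda>x. (norm (dt T X t x - fe (nodal_dt t) x))\<^sup>2)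
          + 108 * K ^ 4 * (h * (norm (slope (err t) i))\<^sup>2) + 108 * K ^ 6 * h\<^sup>2 * h) / ?l" if i: "i \<in> {1..N}" for i
    proof (rule integral_unique)
      have a1: "((\<lambda>x. fe ?f x \<bullet> scheme_op \<alpha> (p i) (fe ?f x)) has_integral integral (?I i) (\<lambda>x. fe ?f x \<bullet> scheme_op \<alpha> (p i) (fe ?f x))) (?I i)"
        by (intro integrable_integral integrable_continuous_real continuous_element linear_scheme_op)
      have a2: "((\<lambda>x. fe ?f x \<bullet> fe ?f x) has_integral integral (?I i) (\<lambda>x. fe ?f x \<bullet> fe ?f x)) (?I i)"
        by (intro integrable_integral integrable_continuous_real continuous_intros continuous_fe)
      have a3: "((\<lambda>x. (norm (dt T X t x - fe (nodal_dt t) x))\<^sup>2) has_integral integral (?I i) (\<lambda>x. (norm (dt T X t x - fe (nodal_dt t) x))\<^sup>2)) (?I i)"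
        by (intro integrable_integral integrable_continuous_real continuous_intros continuous_fe cont_x[OF t'])
      have k: "((\<lambda>x. k) has_integral k * h) (?I i)" for k :: real
        using has_integral_const_real[of k "\<theta> i" "\<theta> (i + 1)"] mesh_step[OF i] h_pos by (simp add: mult.commute)
      have k1: "((\<lambda>x. 108 * K ^ 4 * (norm (slope (err t) i))\<^sup>2) has_integral 108 * K ^ 4 * (h * (norm (slope (err t) i))\<^sup>2)) (?I i)"
        using k[of "108 * K ^ 4 * (norm (slope (err t) i))\<^sup>2"] by (simp add: ac_simps)
      show "((\<lambda>x. - (fe ?f x \<bullet> scheme_op \<alpha> (p i) (fe ?f x)) + ?l / 4 * (fe ?f x \<bullet> fe ?f x)
      + (192 * K ^ 4 * (norm (dt T X t x - fe (nodal_dt t) x))\<^sup>2 + 108 * K ^ 4 * (norm (slope (err t) i))\<^sup>2 + 108 * K ^ 6 * h\<^sup>2) / ?l) has_integral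
        - integral (?I i) (\<lambda>x. fe ?f x \<bullet> scheme_op \<alpha> (p i) (fe ?f x)) + ?l / 4 * integral (?I i) (\<lambda>x. fe ?f x \<bullet> fe ?f x)
        + (192 * K ^ 4 * integral (?I i) (\<lambda>x. (norm (dt T X t x - fe (nodal_dt t) x))\<^sup>2)
          + 108 * K ^ 4 * (h * (norm (slope (err t) i))\<^sup>2) + 108 * K ^ 6 * h\<^sup>2 * h) / ?l) (?I i)"
        by (intro has_integral_add has_integral_neg has_integral_mult_right has_integral_divide a1 a2 a3 k k1)
    qed
    have Nh': "(\<Sum>i=1..N. 108 * K ^ 6 * h\<^sup>2 * h) = 108 * K ^ 6 * h\<^sup>2 * (2 * pi)"
      unfolding Nh[symmetric] by simp
    have m2: "mass_id ?f ?f = (\<Sum>i=1..N. integral (?I i) (\<lambda>x. fe ?f x \<bullet> fe ?f x))"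
      by (rule mass_eq_integral) (rule linear_id[unfolded id_def])
    show ?thesis
      unfolding slope_energy_def m2 mass_eq_integral[of "\<lambda>i. scheme_op \<alpha> (p i)", OF linear_scheme_op] Nh'[symmetric] sum_distrib_left
        sum_divide_distrib sum_negf[symmetric] sum.distrib[symmetric]
      by (rule sum.cong[OF refl]) (simp only: 1)
  qed
  also have "\<dots> \<le> - mass (\<lambda>i. scheme_op \<alpha> (p i)) ?f ?f + ?l / 4 * mass_id ?f ?f
      + (192 * K ^ 4 * (B\<^sup>2 * h\<^sup>2) + 108 * K ^ 4 * slope_energy t + 108 * K ^ 6 * h\<^sup>2 * (2 * pi)) / ?l"
    using rho[OF t'] l by (intro add_left_mono divide_right_mono add_right_mono mult_left_mono) auto
  finally show ?thesis by (simp add: p_def[abs_def])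
qed

text \<open>The slope energy does not see translations, so the L2 norm of the error is added to it,
  with a weight small enough for its time derivative to be absorbed by the velocity term.\<close>

lemma energy:
  assumes \<tau>: "\<tau> \<in> {0..T}" and tb: "\<And>t i. t \<in> {0..\<tau>} \<Longrightarrow> i \<in> {1..N} \<Longrightarrow> norm (slope (err t) i) \<le> c\<^sub>0 / 4"
    and eq: "\<And>t f. t \<in> {0..\<tau>} \<Longrightarrow> mass (\<lambda>i. scheme_op \<alpha> (slope (c t) i)) (c' t) f = - stiff (slope (c t)) f"
  shows "continuous_on {0..\<tau>} dissipation"
    and "slope_energy \<tau> + \<alpha> * a\<^sup>2 / 2 * mass_id (err \<tau>) (err \<tau>) + a\<^sup>2 * integral {0..\<tau>} dissipation \<le> Q * h\<^sup>2"
proof -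
  have sub: "{0..\<tau>} \<subseteq> {0..T}" using \<tau> by auto
  have tT: "t \<in> {0..T}" if "t \<in> {0..\<tau>}" for t using that sub by auto
  let ?l = "\<alpha> * a\<^sup>2"
  have l: "?l > 0" using \<alpha> a_pos by simp
  have cs: "continuous_on {0..\<tau>} (\<lambda>t. slope (c t) i)" for i
    unfolding slope_def by (intro continuous_intros continuous_on_subset[OF cc sub])
  have ce: "continuous_on {0..\<tau>} (\<lambda>t. err' t j)" for j by (intro continuous_on_subset[OF continuous_err(2) sub])
  have nz: "(norm (slope (c t) i))\<^sup>2 \<noteq> 0" if "t \<in> {0..\<tau>}" "i \<in> {1..N}" for t i
    using tube_slope_bounds(1)[OF tT[OF that(1)] that(2) tb[OF that]] a_pos by auto
  show cd: "continuous_on {0..\<tau>} dissipation"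
  proof -
    have np: "continuous_on {0..\<tau>} (\<lambda>t. normal_proj (slope (c t) i) (err' t j))" if i: "i \<in> {1..N}" for i j
      unfolding normal_proj_def by (intro continuous_intros cs ce ballI nz[OF _ i])
    have "continuous_on {0..\<tau>} (\<lambda>t. mass (\<lambda>i. normal_proj (slope (c t) i)) (err' t) (err' t))"
      unfolding mass_def by (intro continuous_intros ce np ballI) auto
    then show ?thesis unfolding dissipation_def[abs_def] by (intro continuous_intros continuous_mass_id ce)
  qed
  have d0: "dissipation t \<ge> 0" for t
    using mass_nonneg[of "err' t"] mass_normal_proj_nonneg[of "slope (c t)" "err' t"] \<alpha> by (simp add: dissipation_def)
  define f where "f t = slope_energy t + ?l / 2 * mass_id (err t) (err t)" for t
  define f' where "f' t = 2 * stiff (slope (err t)) (err' t) + ?l / 2 * (2 * mass_id (err t) (err' t))" for t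
  have e0: "err 0 j = 0" if "j \<in> {1..N}" for j using cinit[OF that] by (simp add: err_def)
  have R0: "R0 \<ge> 0" unfolding R0_eq using K_pos by simp
  have K0: "K0 \<ge> 0" unfolding K0_eq by simp
  have "f \<tau> + integral {0..\<tau>} (\<lambda>t. a\<^sup>2 * dissipation t) \<le> (R0 * h\<^sup>2 / \<alpha>) * \<tau> * exp (K0 / \<alpha> * \<tau>)"
  proof (rule gronwall_energy)
    show "0 \<le> \<tau>" "0 \<le> K0 / \<alpha>" "0 \<le> R0 * h\<^sup>2 / \<alpha>" using \<tau> K0 R0 \<alpha> by auto
    have "mass_id (err 0) (err 0) = mass_id (\<lambda>_. 0) (\<lambda>_. 0)" by (rule mass_cong) (auto simp: e0)
    then have "mass_id (err 0) (err 0) = 0" by (simp add: mass_def)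
    moreover have "slope_energy 0 = 0" unfolding slope_energy_def slope_def using e0 nx_in by (intro sum.neutral) auto
    ultimately show "f 0 = 0" by (simp add: f_def)
    fix t assume t: "t \<in> {0..\<tau>}"
    show "(f has_real_derivative f' t) (at t within {0..\<tau>})"
      unfolding f_def[abs_def] f'_def
      by (intro DERIV_add DERIV_cmult has_field_derivative_subset[OF slope_energy_deriv[OF tT[OF t]] sub]
          has_field_derivative_subset[OF mass_id_deriv[OF err_deriv[OF tT[OF t]]] sub])
    show "0 \<le> a\<^sup>2 * dissipation t" using d0[of t] by simp
  next
    show "continuous_on {0..\<tau>} (\<lambda>t. a\<^sup>2 * dissipation t)" by (intro continuous_intros cd)
    fix t assume t: "0 < t" "t < \<tau>"
    then have t': "t \<in> {0..\<tau>}" and tT': "t < T" using \<tau> by auto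
    let ?m = "mass_id (err' t) (err' t)" and ?n = "mass (\<lambda>i. normal_proj (slope (c t) i)) (err' t) (err' t)"
    let ?mE = "mass_id (err t) (err t)"
    have s: "stiff (slope (err t)) (err' t) \<le> - mass (\<lambda>i. scheme_op \<alpha> (slope (c t) i)) (err' t) (err' t) + ?l / 4 * ?m
      + (192 * K ^ 4 * (B\<^sup>2 * h\<^sup>2) + 108 * K ^ 4 * slope_energy t + 108 * K ^ 6 * h\<^sup>2 * (2 * pi)) / ?l"
      by (rule stiff_err_bound[OF t(1) tT' tb[OF t'] eq[OF t']])
    have w: "?l * ?m + (1 - \<alpha>) * a\<^sup>2 * ?n \<le> mass (\<lambda>i. scheme_op \<alpha> (slope (c t) i)) (err' t) (err' t)"
      by (rule mass_scheme_op_ge[OF \<alpha> a_pos]) (rule tube_slope_bounds(1)[OF tT[OF t'] _ tb[OF t']])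
    have y: "?l / 2 * (2 * mass_id (err t) (err' t)) \<le> ?l / 2 * (?mE + ?m)"
      using l by (intro mult_left_mono mass_id_young) auto
    have n0: "0 \<le> (1 - \<alpha>) * a\<^sup>2 * ?n" using \<alpha> mass_normal_proj_nonneg by simp
    define Z where "Z = (192 * K ^ 4 * (B\<^sup>2 * h\<^sup>2) + 108 * K ^ 4 * slope_energy t + 108 * K ^ 6 * h\<^sup>2 * (2 * pi)) / ?l"
    \<comment> \<open>The balance: coercivity provides \<open>2 * ?l * ?m\<close>, of which
      \<open>?l / 2 * ?m\<close> pays for Young's inequality in the consistency terms,
      \<open>?l / 2 * ?m\<close> for the derivative of the L2 part, and \<open>?l * ?m\<close>
      remains as dissipation.\<close>
    have "f' t + a\<^sup>2 * dissipation t \<le> ?l / 2 * ?mE + 2 * Z"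
    proof -
      have "a\<^sup>2 * dissipation t = ?l * ?m + (1 - \<alpha>) * a\<^sup>2 * ?n" by (simp add: dissipation_def algebra_simps)
      then show ?thesis using s w y n0 unfolding f'_def Z_def[symmetric] by (simp add: distrib_left)
    qed
    also have "2 * Z = R0 * h\<^sup>2 / \<alpha> + 216 * K ^ 4 / a\<^sup>2 / \<alpha> * slope_energy t"
      using \<alpha> a_pos unfolding Z_def R0_eq by (simp add: field_simps)
    also have "?l / 2 * ?mE \<le> K0 / \<alpha> * (?l / 2 * ?mE)"
    proof -
      have "0 \<le> 216 * K ^ 4 / a\<^sup>2" by simp
      then have "\<alpha> \<le> K0" using \<alpha> unfolding K0_eq by linarith
      then have "1 \<le> K0 / \<alpha>" using \<alpha> by (simp add: le_divide_eq)
      then have "1 * (?l / 2 * ?mE) \<le> K0 / \<alpha> * (?l / 2 * ?mE)"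
        using l mass_nonneg[of "err t"] by (intro mult_right_mono) auto
      then show ?thesis by simp
    qed
    also have "216 * K ^ 4 / a\<^sup>2 / \<alpha> * slope_energy t \<le> K0 / \<alpha> * slope_energy t"
      using \<alpha> slope_energy_nonneg by (intro mult_right_mono divide_right_mono) (auto simp: K0_eq)
    finally show "f' t + a\<^sup>2 * dissipation t \<le> K0 / \<alpha> * f t + R0 * h\<^sup>2 / \<alpha>"
      by (simp add: f_def algebra_simps)
  qed
  also have "(R0 * h\<^sup>2 / \<alpha>) * \<tau> * exp (K0 / \<alpha> * \<tau>) \<le> (R0 * h\<^sup>2 / \<alpha>) * T * exp (K0 / \<alpha> * T)"
    using \<tau> R0 K0 \<alpha> by (intro mult_mono) (auto intro!: divide_right_mono mult_left_mono)
  also have "\<dots> = Q * h\<^sup>2" by (simp add: Q_eq)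
  finally show "slope_energy \<tau> + ?l / 2 * mass_id (err \<tau>) (err \<tau>) + a\<^sup>2 * integral {0..\<tau>} dissipation \<le> Q * h\<^sup>2"
    by (simp add: f_def)
qed

end

section \<open>The error norms\<close>

lemma (in fe_mesh) continuous_on_hat_snd: "continuous_on (A \<times> B) (\<lambda>p. hat j (snd p))"
  by (rule continuous_on_compose2[OF continuous_hat[of UNIV]]) (auto intro!: continuous_intros)

lemma (in fe_mesh) continuous_on_fe_product:
  fixes u :: "real \<Rightarrow> nat \<Rightarrow> 'a::real_normed_vector"
  assumes u: "\<And>j. continuous_on A (\<lambda>t. u t j)"
  shows "continuous_on (A \<times> B) (\<lambda>p. fe (u (fst p)) (snd p))"
proof -
  have "continuous_on (A \<times> B) (\<lambda>p. u (fst p) j)" for j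
    by (rule continuous_on_compose2[OF u]) (auto intro!: continuous_intros)
  then show ?thesis unfolding fe_def by (intro continuous_intros continuous_on_hat_snd)
qed

lemma (in fe_mesh) continuous_sum_element_integrals:
  assumes "\<And>i. i \<in> {1..N} \<Longrightarrow> continuous_on (A \<times> {\<theta> i..\<theta> (i + 1)}) (\<lambda>p. G i (fst p) (snd p) :: real)"
  shows "continuous_on A (\<lambda>t. \<Sum>i=1..N. integral {\<theta> i..\<theta> (i + 1)} (G i t))"
proof (rule continuous_on_sum)
  fix i assume i: "i \<in> {1..N}"
  have "continuous_on A (\<lambda>t. integral (cbox (\<theta> i) (\<theta> (i + 1))) (G i t))"
    by (rule integral_continuous_on_param) (use assms[OF i] in \<open>simp add: case_prod_unfold\<close>)
  then show "continuous_on A (\<lambda>t. integral {\<theta> i..\<theta> (i + 1)} (G i t))" by simp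
qed

lemma (in fe_mesh) fe_has_derivative_idx:
  assumes "rep x \<noteq> \<theta> (idx x)"
  shows "(fe c has_vector_derivative slope c (idx x)) (at x)"
proof -
  let ?k = "\<lfloor>(x - \<theta> 1) / (2 * pi)\<rfloor>"
  have "rep x \<in> {\<theta> (idx x)<..<\<theta> (idx x + 1)}" using idx_rep(2)[of x] assms by auto
  from fe_has_derivative[OF idx_rep(1) this, of c]
  have d: "(fe c has_vector_derivative slope c (idx x)) (at (x + 2 * pi * of_int (- ?k)))" by (simp add: rep_def)
  have "((\<lambda>y. y + 2 * pi * of_int (- ?k)) has_vector_derivative 1) (at x)"
    by (auto intro!: derivative_eq_intros simp flip: has_real_derivative_iff_has_vector_derivative)
  from vector_diff_chain_at[OF this d]
  have "((\<lambda>y. fe c (y + 2 * pi * of_int (- ?k))) has_vector_derivative slope c (idx x)) (at x)" by (simp add: o_def)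
  then show ?thesis by (simp only: periodic2pi_int[OF periodic_fe])
qed

lemma norm_add_power2_le: "(norm (x + y :: 'a::real_inner))\<^sup>2 \<le> 2 * (norm x)\<^sup>2 + 2 * (norm y)\<^sup>2"
proof -
  have "0 \<le> (norm (x - y))\<^sup>2" by simp
  then show ?thesis by (simp add: power2_norm_eq_inner inner_add_left inner_add_right inner_diff_left inner_diff_right inner_commute)
qed

text \<open>Parallelogram law for a semidefinite form. For \<open>y\<close>, the interpolation
  error, the full length is used because it is what \<open>rho\<close> controls.\<close>

lemma normal_proj_add_le: "(x + y) \<bullet> normal_proj p (x + y) \<le> 2 * (x \<bullet> normal_proj p x) + 2 * (norm y)\<^sup>2"
proof -
  have "(x + y) \<bullet> normal_proj p (x + y) + (x - y) \<bullet> normal_proj p (x - y) = 2 * (x \<bullet> normal_proj p x) + 2 * (y \<bullet> normal_proj p y)"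
    by (simp add: linear_add[OF linear_normal_proj] linear_diff[OF linear_normal_proj] inner_add_left inner_diff_left inner_add_right inner_diff_right)
  then show ?thesis using normal_proj_nonneg[of "x - y" p] normal_proj_le[of y p] by linarith
qed

context approx
begin

lemma slope_le_of_slope_energy:
  assumes "slope_energy t \<le> h * (c\<^sub>0 / 4)\<^sup>2" "i \<in> {1..N}"
  shows "norm (slope (err t) i) \<le> c\<^sub>0 / 4"
proof -
  have "h * (norm (slope (err t) i))\<^sup>2 \<le> slope_energy t"
    unfolding slope_energy_def using assms(2) h_pos by (intro member_le_sum[of i "{1..N}" "\<lambda>i. h * (norm (slope (err t) i))\<^sup>2"]) auto
  then have "(norm (slope (err t) i))\<^sup>2 \<le> (c\<^sub>0 / 4)\<^sup>2" using assms(1) h_pos mult_le_cancel_left_pos[OF h_pos, of "(norm (slope (err t) i))\<^sup>2" "(c\<^sub>0 / 4)\<^sup>2"] by linarith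
  then show ?thesis by (rule power2_le_imp_le) (use c0 in simp)
qed

text \<open>The energy bound is of order \<open>h\<^sup>2\<close>, one power better than the
  threshold \<open>h * (c\<^sub>0 / 4)\<^sup>2\<close> at which the slopes are still known to lie in
  the tube; this gap closes the bootstrap.\<close>

lemma slope_energy_small:
  assumes Qh: "Q * h < (c\<^sub>0 / 4)\<^sup>2"
    and eq: "\<And>t f. t \<in> {0..T} \<Longrightarrow> (\<And>i. i \<in> {1..N} \<Longrightarrow> norm (slope (err t) i) \<le> c\<^sub>0 / 4) \<Longrightarrow>
      mass (\<lambda>i. scheme_op \<alpha> (slope (c t) i)) (c' t) f = - stiff (slope (c t)) f"
    and t: "t \<in> {0..T}"
  shows "slope_energy t < h * (c\<^sub>0 / 4)\<^sup>2"
proof (rule continuous_bootstrap[OF continuous_slope_energy _ _ t])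
  have e0: "err 0 j = 0" if "j \<in> {1..N}" for j using cinit[OF that] by (simp add: err_def)
  have "slope_energy 0 = 0" unfolding slope_energy_def slope_def using e0 nx_in by (intro sum.neutral) auto
  then show "slope_energy 0 < h * (c\<^sub>0 / 4)\<^sup>2" using h_pos c0 by simp
  fix \<tau> assume \<tau>: "\<tau> \<in> {0..T}" and le: "\<And>t. t \<in> {0..\<tau>} \<Longrightarrow> slope_energy t \<le> h * (c\<^sub>0 / 4)\<^sup>2"
  have tb: "norm (slope (err t) i) \<le> c\<^sub>0 / 4" if "t \<in> {0..\<tau>}" "i \<in> {1..N}" for t i
    using slope_le_of_slope_energy[OF le[OF that(1)] that(2)] .
  have eq': "mass (\<lambda>i. scheme_op \<alpha> (slope (c t) i)) (c' t) f = - stiff (slope (c t)) f" if "t \<in> {0..\<tau>}" for t f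
    by (rule eq) (use that \<tau> tb[OF that] in auto)
  have E: "slope_energy \<tau> + \<alpha> * a\<^sup>2 / 2 * mass_id (err \<tau>) (err \<tau>) + a\<^sup>2 * integral {0..\<tau>} dissipation \<le> Q * h\<^sup>2"
    by (rule energy(2)[OF \<tau> tb eq'])
  have "continuous_on {0..\<tau>} dissipation" by (rule energy(1)[OF \<tau> tb eq'])
  then have "0 \<le> integral {0..\<tau>} dissipation"
    using mass_nonneg mass_normal_proj_nonneg \<alpha> 
    by (intro integral_nonneg integrable_continuous_real) (auto simp: dissipation_def)
  then have "0 \<le> a\<^sup>2 * integral {0..\<tau>} dissipation" by simp
  moreover have "0 \<le> \<alpha> * a\<^sup>2 / 2 * mass_id (err \<tau>) (err \<tau>)" using \<alpha> mass_nonneg[of "err \<tau>"] by simp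
  ultimately have "slope_energy \<tau> \<le> Q * h * h" using E by (simp add: power2_eq_square)
  also have "\<dots> < (c\<^sub>0 / 4)\<^sup>2 * h" using Qh h_pos by (intro mult_strict_right_mono)
  finally show "slope_energy \<tau> < h * (c\<^sub>0 / 4)\<^sup>2" by (simp add: mult.commute)
qed

section \<open>Error norms as sums over the elements\<close>

text \<open>The three squared norms are rewritten as sums of integrals over closed elements. With
  nonzero discrete slopes for the normal part, this makes them continuous in time, which yields
  integrability and an attained maximum.\<close>

definition err_dt_sq where "err_dt_sq t = (\<Sum>i=1..N. integral {\<theta> i..\<theta> (i + 1)} (\<lambda>x. (norm (dt T X t x - fe (c' t) x))\<^sup>2))"

definition err_normal_sq where "err_normal_sq t = (\<Sum>i=1..N. integral {\<theta> i..\<theta> (i + 1)}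
  (\<lambda>x. (dt T X t x - fe (c' t) x) \<bullet> normal_proj (slope (c t) i) (dt T X t x - fe (c' t) x)))"

definition err_H1_sq where "err_H1_sq t = (\<Sum>i=1..N. integral {\<theta> i..\<theta> (i + 1)} (\<lambda>x. (norm (X t x - fe (c t) x))\<^sup>2))
  + (\<Sum>i=1..N. integral {\<theta> i..\<theta> (i + 1)} (\<lambda>x. (norm (dx (X t) x - slope (c t) i))\<^sup>2))"

lemma L2_norm_err_dt:
  assumes t: "t \<in> {0..T}"
  shows "(L2_norm {0<..<2*pi} (\<lambda>x. dt T X t x - fe (c' t) x))\<^sup>2 = err_dt_sq t"
proof -
  have "(LINT x:{0..2*pi}|lebesgue. (norm (dt T X t x - fe (c' t) x))\<^sup>2) = err_dt_sq t"
    unfolding err_dt_sq_def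
    by (rule circle_integral(2))
      (use per(4)[OF t] periodic_fe[of "c' t"] in \<open>auto simp: periodic2pi_def intro!: continuous_intros cont_x[OF t] continuous_fe\<close>)
  moreover have "err_dt_sq t \<ge> 0" unfolding err_dt_sq_def
    by (intro sum_nonneg integral_nonneg integrable_continuous_real continuous_intros cont_x[OF t] continuous_fe) auto
  ultimately show ?thesis by (simp add: L2_norm_def set_integral_open_closed(2))
qed

text \<open>The right-hand side does not involve \<open>\<nu>\<close>. Normals may be chosen
  separately at each time with arbitrary sign, so continuity in time can be expected only after
  their elimination.\<close>

lemma L2_norm_err_normal:
  assumes t: "t \<in> {0..T}" and \<nu>: "unit_normal_fe N \<theta> (fe (c t)) \<nu>" and nz: "\<And>i. i \<in> {1..N} \<Longrightarrow> slope (c t) i \<noteq> 0"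
  shows "(L2_norm {0<..<2*pi} (\<lambda>x. \<nu> x \<bullet> (dt T X t x - fe (c' t) x)))\<^sup>2 = err_normal_sq t"
proof -
  have cont: "continuous_on {\<theta> i..\<theta> (i + 1)} (\<lambda>x. (dt T X t x - fe (c' t) x) \<bullet> normal_proj (slope (c t) i) (dt T X t x - fe (c' t) x))" for i
    by (intro continuous_intros linear_continuous_on_compose[OF _ linear_normal_proj] cont_x[OF t] continuous_fe)
  have "(LINT x:{0..2*pi}|lebesgue. (norm (\<nu> x \<bullet> (dt T X t x - fe (c' t) x)))\<^sup>2) = err_normal_sq t"
    unfolding err_normal_sq_def
  proof (rule circle_integral(2)[OF _ cont])
    show "periodic2pi (\<lambda>x. (norm (\<nu> x \<bullet> (dt T X t x - fe (c' t) x)))\<^sup>2)"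
      using per(4)[OF t] periodic_fe[of "c' t"] \<nu> by (simp add: periodic2pi_def unit_normal_fe_def)
    fix i x assume i: "i \<in> {1..N}" and x: "x \<in> {\<theta> i<..<\<theta> (i + 1)}"
    obtain n where n: "norm n = 1" "n \<bullet> (fe (c t) (\<theta> (i + 1)) - fe (c t) (\<theta> i)) = 0" "\<And>x. x \<in> {\<theta> i..<\<theta> (i + 1)} \<Longrightarrow> \<nu> x = n"
      using \<nu> i unfolding unit_normal_fe_def by blast
    have "n \<bullet> slope (c t) i = 0"
      using n(2) node_nx[OF periodic_fe i, of "c t"] fe_at_node[OF i, of "c t"] fe_at_node[OF nx_in[OF i], of "c t"] by (simp add: slope_def)
    moreover have "\<nu> x = n" using n(3) x by auto
    ultimately show "(norm (\<nu> x \<bullet> (dt T X t x - fe (c' t) x)))\<^sup>2 = (dt T X t x - fe (c' t) x) \<bullet> normal_proj (slope (c t) i) (dt T X t x - fe (c' t) x)"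
      using normal_proj_unit_normal[OF n(1) _ nz[OF i]] by simp
  qed
  moreover have "err_normal_sq t \<ge> 0" unfolding err_normal_sq_def
    by (intro sum_nonneg integral_nonneg integrable_continuous_real cont normal_proj_nonneg)
  ultimately show ?thesis by (simp add: L2_norm_def set_integral_open_closed(2))
qed

lemma sobolev_norm_err:
  assumes t: "t \<in> {0..T}"
  shows "(sobolev_norm 1 (\<lambda>x. X t x - fe (c t) x))\<^sup>2 = err_H1_sq t"
proof -
  define v where "v x = dx (X t) x - slope (c t) (idx x)" for x
  \<comment> \<open>Kinks occur where the representative of \<open>x\<close> is a node; for
    \<open>x\<close> before \<open>\<theta> 1\<close> that representative is
    \<open>x + 2 * pi\<close>, which accounts for the shifted copy.\<close>
  define Z where "Z = \<theta> ` {1..N} \<union> (\<lambda>y. y - 2 * pi) ` \<theta> ` {1..N}"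
  have pv: "periodic2pi v" using per(2)[OF t] by (simp add: v_def periodic2pi_def idx_def rep_periodic)
  have ve: "v x = dx (X t) x - slope (c t) i" if "i \<in> {1..N}" "x \<in> {\<theta> i<..<\<theta> (i + 1)}" for i x
    using idx_unique[OF that(1), of x] that(2) by (simp add: v_def)
  have cv: "continuous_on {\<theta> i..\<theta> (i + 1)} (\<lambda>x. dx (X t) x - slope (c t) i)" for i
    by (intro continuous_intros cont_x[OF t])
  have cu: "continuous_on A (\<lambda>x. X t x - fe (c t) x)" for A
    by (intro continuous_intros cont_x[OF t] continuous_fe)
  have vai: "v absolutely_integrable_on {0..2*pi}" by (rule circle_integral(1)[OF pv cv ve])
  have pv2: "periodic2pi (\<lambda>x. (norm (v x))\<^sup>2)" using pv by (simp add: periodic2pi_def)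
  have cv2: "continuous_on {\<theta> i..\<theta> (i + 1)} (\<lambda>x. (norm (dx (X t) x - slope (c t) i))\<^sup>2)" for i
    by (intro continuous_intros cont_x[OF t])
  have ve2: "(norm (v x))\<^sup>2 = (norm (dx (X t) x - slope (c t) i))\<^sup>2" if "i \<in> {1..N}" "x \<in> {\<theta> i<..<\<theta> (i + 1)}" for i x
    using ve[OF that] by simp
  have wd: "has_weak_deriv {0<..<2*pi} (\<lambda>x. X t x - fe (c t) x) v"
  proof (rule has_weak_deriv_classical[OF cu _ _ vai])
    show "finite Z" by (simp add: Z_def)
    fix x assume x: "x \<in> {0<..<2*pi} - Z"
    have "rep x \<noteq> \<theta> (idx x)"
    proof
      assume r: "rep x = \<theta> (idx x)"
      have i: "idx x \<in> {1..N}" by (rule idx_rep(1))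
      show False
      proof (cases "\<theta> 1 \<le> x")
        case True
        then have "rep x = x" using x theta1 by (intro rep_id) auto
        then have "x \<in> Z" using r i unfolding Z_def by (metis UnI1 imageI)
        with x show False by simp
      next
        case False
        then have "rep (x + 2 * pi) = x + 2 * pi" using x theta1 by (intro rep_id) auto
        then have "x = \<theta> (idx x) - 2 * pi" using r by (simp add: rep_periodic)
        then have "x \<in> Z" using i unfolding Z_def by (metis UnI2 imageI)
        with x show False by simp
      qed
    qed
    then show "((\<lambda>x. X t x - fe (c t) x) has_vector_derivative v x) (at x)"
      unfolding v_def by (intro has_vector_derivative_diff deriv_X(1)[OF t] fe_has_derivative_idx)
  qed simp
  have "(sobolev_norm 1 (\<lambda>x. X t x - fe (c t) x))\<^sup>2 =
    (LINT x:{0..2*pi}|lebesgue. (norm (X t x - fe (c t) x))\<^sup>2) + (LINT x:{0..2*pi}|lebesgue. (norm (v x))\<^sup>2)"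
    by (rule sobolev_norm_1_eq[OF wd cu circle_integral(1)[OF pv2 cv2 ve2]])
  also have "(LINT x:{0..2*pi}|lebesgue. (norm (v x))\<^sup>2) = (\<Sum>i=1..N. integral {\<theta> i..\<theta> (i + 1)} (\<lambda>x. (norm (dx (X t) x - slope (c t) i))\<^sup>2))"
    by (rule circle_integral(2)[OF pv2 cv2 ve2])
  also have "(LINT x:{0..2*pi}|lebesgue. (norm (X t x - fe (c t) x))\<^sup>2) = (\<Sum>i=1..N. integral {\<theta> i..\<theta> (i + 1)} (\<lambda>x. (norm (X t x - fe (c t) x))\<^sup>2))"
    by (rule circle_integral(2))
      (use per(1)[OF t] periodic_fe[of "c t"] in \<open>auto simp: periodic2pi_def intro!: continuous_intros cu\<close>)
  finally show ?thesis by (simp add: err_H1_sq_def)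
qed

lemma continuous_err_dt_sq: "continuous_on {0..T} err_dt_sq"
  unfolding err_dt_sq_def[abs_def]
  by (intro continuous_sum_element_integrals continuous_intros cont2[unfolded case_prod_unfold] continuous_on_fe_product cc')

lemma continuous_slope: "continuous_on {0..T} (\<lambda>t. slope (c t) i)"
  unfolding slope_def by (intro continuous_intros cc)

lemma continuous_slope_fst: "continuous_on ({0..T} \<times> A) (\<lambda>p. slope (c (fst p)) i)"
  by (rule continuous_on_compose2[OF continuous_slope]) (auto intro!: continuous_intros)

lemma continuous_err_normal_sq:
  assumes nz: "\<And>t i. t \<in> {0..T} \<Longrightarrow> i \<in> {1..N} \<Longrightarrow> slope (c t) i \<noteq> 0"
  shows "continuous_on {0..T} err_normal_sq"
  unfolding err_normal_sq_def[abs_def]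
proof (rule continuous_sum_element_integrals)
  fix i assume i: "i \<in> {1..N}"
  have w: "continuous_on ({0..T} \<times> {\<theta> i..\<theta> (i + 1)}) (\<lambda>p. dt T X (fst p) (snd p) - fe (c' (fst p)) (snd p))"
    by (intro continuous_intros cont2[unfolded case_prod_unfold] continuous_on_fe_product cc')
  show "continuous_on ({0..T} \<times> {\<theta> i..\<theta> (i + 1)}) (\<lambda>p. (dt T X (fst p) (snd p) - fe (c' (fst p)) (snd p)) \<bullet>
      normal_proj (slope (c (fst p)) i) (dt T X (fst p) (snd p) - fe (c' (fst p)) (snd p)))"
    unfolding normal_proj_def using nz[OF _ i] by (intro continuous_intros w continuous_slope_fst ballI) auto
qed

lemma continuous_err_H1_sq: "continuous_on {0..T} err_H1_sq"
  unfolding err_H1_sq_def[abs_def]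
  by (intro continuous_on_add continuous_sum_element_integrals continuous_on_power continuous_on_norm continuous_on_diff
      cont2[unfolded case_prod_unfold] continuous_on_fe_product cc continuous_slope_fst)

lemma integral_element_const: "i \<in> {1..N} \<Longrightarrow> integral {\<theta> i..\<theta> (i + 1)} (\<lambda>x. k :: real) = h * k"
  using mesh_step[of i] h_pos by simp

lemma split_dt: "dt T X t x - fe (c' t) x = fe (err' t) x + (dt T X t x - fe (nodal_dt t) x)"
proof -
  have "fe (err' t) x = fe (nodal_dt t) x - fe (c' t) x" unfolding fe_diff by (simp add: err'_def[abs_def])
  then show ?thesis by simp
qed

lemma mass_id_integral: "mass_id u u = (\<Sum>i=1..N. integral {\<theta> i..\<theta> (i + 1)} (\<lambda>x. (norm (fe u x))\<^sup>2))"
  using mass_eq_integral[of "\<lambda>_ x. x" u u] linear_id[unfolded id_def] by (simp add: power2_norm_eq_inner)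

lemma sum_element_le:
  assumes "\<And>i. i \<in> {1..N} \<Longrightarrow> continuous_on {\<theta> i..\<theta> (i + 1)} (F i)" "\<And>i. i \<in> {1..N} \<Longrightarrow> continuous_on {\<theta> i..\<theta> (i + 1)} (G i)"
    and "\<And>i. i \<in> {1..N} \<Longrightarrow> continuous_on {\<theta> i..\<theta> (i + 1)} (H i)"
    and le: "\<And>i x. i \<in> {1..N} \<Longrightarrow> x \<in> {\<theta> i..\<theta> (i + 1)} \<Longrightarrow> F i x \<le> 2 * G i x + 2 * (H i x :: real)"
  shows "(\<Sum>i=1..N. integral {\<theta> i..\<theta> (i + 1)} (F i)) \<le> 2 * (\<Sum>i=1..N. integral {\<theta> i..\<theta> (i + 1)} (G i)) + 2 * (\<Sum>i=1..N. integral {\<theta> i..\<theta> (i + 1)} (H i))"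
  unfolding sum_distrib_left sum.distrib[symmetric]
proof (rule sum_mono)
  fix i assume i: "i \<in> {1..N}"
  have g: "G i integrable_on {\<theta> i..\<theta> (i + 1)}" "H i integrable_on {\<theta> i..\<theta> (i + 1)}" "F i integrable_on {\<theta> i..\<theta> (i + 1)}"
    using assms(1-3)[OF i] by (auto intro: integrable_continuous_real)
  have "integral {\<theta> i..\<theta> (i + 1)} (F i) \<le> integral {\<theta> i..\<theta> (i + 1)} (\<lambda>x. 2 * G i x + 2 * H i x)"
    by (rule integral_le) (use g le[OF i] in \<open>auto intro!: integrable_add integrable_on_mult_right\<close>)
  also have "\<dots> = 2 * integral {\<theta> i..\<theta> (i + 1)} (G i) + 2 * integral {\<theta> i..\<theta> (i + 1)} (H i)"
    using g by (subst Henstock_Kurzweil_Integration.integral_add) (auto intro!: integrable_on_mult_right)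
  finally show "integral {\<theta> i..\<theta> (i + 1)} (F i) \<le> 2 * integral {\<theta> i..\<theta> (i + 1)} (G i) + 2 * integral {\<theta> i..\<theta> (i + 1)} (H i)" .
qed

lemma err_dt_sq_le:
  assumes t: "t \<in> {0..T}"
  shows "err_dt_sq t \<le> 2 * mass_id (err' t) (err' t) + 2 * (B\<^sup>2 * h\<^sup>2)"
proof -
  have "err_dt_sq t \<le> 2 * (\<Sum>i=1..N. integral {\<theta> i..\<theta> (i + 1)} (\<lambda>x. (norm (fe (err' t) x))\<^sup>2))
     + 2 * (\<Sum>i=1..N. integral {\<theta> i..\<theta> (i + 1)} (\<lambda>x. (norm (dt T X t x - fe (nodal_dt t) x))\<^sup>2))"
    unfolding err_dt_sq_def
    by (intro sum_element_le continuous_intros continuous_fe cont_x[OF t]) (subst split_dt, rule norm_add_power2_le)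
  then show ?thesis using rho[OF t] unfolding mass_id_integral by linarith
qed

lemma err_normal_sq_le:
  assumes t: "t \<in> {0..T}"
  shows "err_normal_sq t \<le> 2 * mass (\<lambda>i. normal_proj (slope (c t) i)) (err' t) (err' t) + 2 * (B\<^sup>2 * h\<^sup>2)"
proof -
  have "err_normal_sq t \<le> 2 * (\<Sum>i=1..N. integral {\<theta> i..\<theta> (i + 1)} (\<lambda>x. fe (err' t) x \<bullet> normal_proj (slope (c t) i) (fe (err' t) x)))
     + 2 * (\<Sum>i=1..N. integral {\<theta> i..\<theta> (i + 1)} (\<lambda>x. (norm (dt T X t x - fe (nodal_dt t) x))\<^sup>2))"
    unfolding err_normal_sq_def
    by (intro sum_element_le continuous_intros continuous_fe cont_x[OF t] linear_continuous_on_compose[OF _ linear_normal_proj])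
      (simp only: split_dt normal_proj_add_le)
  then show ?thesis
    using rho[OF t] mass_eq_integral[of "\<lambda>i. normal_proj (slope (c t) i)" "err' t" "err' t", OF linear_normal_proj] by linarith
qed

text \<open>Values and slopes of the interpolant each contribute
  \<open>2 * (2 * pi) * (K * h)\<^sup>2\<close>.\<close>

lemma err_H1_sq_le:
  assumes t: "t \<in> {0..T}"
  shows "err_H1_sq t \<le> 2 * mass_id (err t) (err t) + 2 * slope_energy t + 8 * pi * K\<^sup>2 * h\<^sup>2"
proof -
  have Kh2: "(\<Sum>i=1..N. integral {\<theta> i..\<theta> (i + 1)} (\<lambda>x. (K * h)\<^sup>2)) = 2 * pi * (K\<^sup>2 * h\<^sup>2)"
  proof -
    have "(\<Sum>i=1..N. integral {\<theta> i..\<theta> (i + 1)} (\<lambda>x. (K * h)\<^sup>2)) = (\<Sum>i=1..N. h * (K * h)\<^sup>2)"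
      by (rule sum.cong[OF refl]) (rule integral_element_const)
    also have "\<dots> = (real N * h) * (K\<^sup>2 * h\<^sup>2)" by (simp add: power_mult_distrib)
    finally show ?thesis unfolding Nh .
  qed
  have b: "(norm y)\<^sup>2 \<le> (K * h)\<^sup>2" if "norm y \<le> K * h" for y :: "real ^ 2" using that by (intro power_mono) auto
  have "(\<Sum>i=1..N. integral {\<theta> i..\<theta> (i + 1)} (\<lambda>x. (norm (X t x - fe (c t) x))\<^sup>2)) \<le>
      2 * (\<Sum>i=1..N. integral {\<theta> i..\<theta> (i + 1)} (\<lambda>x. (norm (fe (err t) x))\<^sup>2)) + 2 * (\<Sum>i=1..N. integral {\<theta> i..\<theta> (i + 1)} (\<lambda>x. (K * h)\<^sup>2))"
  proof (intro sum_element_le continuous_intros continuous_fe cont_x[OF t])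
    fix i x assume i: "i \<in> {1..N}" and x: "x \<in> {\<theta> i..\<theta> (i + 1)}"
    have "fe (err t) x = fe (nodal t) x - fe (c t) x" unfolding fe_diff by (simp add: err_def[abs_def])
    then have e: "X t x - fe (c t) x = fe (err t) x + (X t x - fe (nodal t) x)" by simp
    show "(norm (X t x - fe (c t) x))\<^sup>2 \<le> 2 * (norm (fe (err t) x))\<^sup>2 + 2 * (K * h)\<^sup>2"
      unfolding e using norm_add_power2_le[of "fe (err t) x" "X t x - fe (nodal t) x"] b[OF nodal_fe[OF t i x]] by linarith
  qed
  moreover have "(\<Sum>i=1..N. integral {\<theta> i..\<theta> (i + 1)} (\<lambda>x. (norm (dx (X t) x - slope (c t) i))\<^sup>2)) \<le>
      2 * (\<Sum>i=1..N. integral {\<theta> i..\<theta> (i + 1)} (\<lambda>x. (norm (slope (err t) i))\<^sup>2)) + 2 * (\<Sum>i=1..N. integral {\<theta> i..\<theta> (i + 1)} (\<lambda>x. (K * h)\<^sup>2))"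
  proof (intro sum_element_le continuous_intros cont_x[OF t])
    fix i x assume i: "i \<in> {1..N}" and x: "x \<in> {\<theta> i..\<theta> (i + 1)}"
    have e: "dx (X t) x - slope (c t) i = slope (err t) i + (dx (X t) x - slope (nodal t) i)" by (simp add: slope_err)
    show "(norm (dx (X t) x - slope (c t) i))\<^sup>2 \<le> 2 * (norm (slope (err t) i))\<^sup>2 + 2 * (K * h)\<^sup>2"
      unfolding e using norm_add_power2_le[of "slope (err t) i" "dx (X t) x - slope (nodal t) i"]
        b[OF nodal_slope[OF t i x]] by (simp add: norm_minus_commute)
  qed
  moreover have "(\<Sum>i=1..N. integral {\<theta> i..\<theta> (i + 1)} (\<lambda>x. (norm (slope (err t) i))\<^sup>2)) = slope_energy t"
    unfolding slope_energy_def by (rule sum.cong[OF refl]) (rule integral_element_const)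
  ultimately show ?thesis unfolding err_H1_sq_def Kh2 mass_id_integral by (simp add: algebra_simps)
qed

text \<open>In the coefficient of \<open>Q\<close>, \<open>2 / a\<^sup>2\<close> comes from the
  dissipation, 2 from the slope energy, and \<open>4 / (\<alpha> * a\<^sup>2)\<close> from the L2
  part, whose weight in the energy is \<open>\<alpha> * a\<^sup>2 / 2\<close>. The interpolation
  error of the velocity is weighted by \<open>\<alpha> + (1 - \<alpha>) = 1\<close> and contributes
  \<open>2 * T * B\<^sup>2\<close>.\<close>

lemma total_error:
  assumes tb: "\<And>t i. t \<in> {0..T} \<Longrightarrow> i \<in> {1..N} \<Longrightarrow> norm (slope (err t) i) \<le> c\<^sub>0 / 4"
    and eq: "\<And>t f. t \<in> {0..T} \<Longrightarrow> mass (\<lambda>i. scheme_op \<alpha> (slope (c t) i)) (c' t) f = - stiff (slope (c t)) f"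
    and t: "t \<in> {0..T}"
  shows "\<alpha> * integral {0..T} err_dt_sq + (1 - \<alpha>) * integral {0..T} err_normal_sq + err_H1_sq t
    \<le> (Q * (2 / a\<^sup>2 + 2 + 4 / (\<alpha> * a\<^sup>2)) + 2 * T * B\<^sup>2 + 8 * pi * K\<^sup>2) * h\<^sup>2"
proof -
  have T': "T \<in> {0..T}" using T by simp
  have nz: "slope (c t) i \<noteq> 0" if "t \<in> {0..T}" "i \<in> {1..N}" for t i
    using tube_slope_bounds(1)[OF that tb[OF that]] a_pos by auto
  have cont_normal: "continuous_on {0..T} err_normal_sq" by (rule continuous_err_normal_sq[OF nz])
  have cd: "continuous_on {0..T} dissipation" by (rule energy(1)[OF T' tb eq])
  have d0: "0 \<le> integral {0..\<tau>} dissipation" if "\<tau> \<in> {0..T}" for \<tau>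
  proof (rule integral_nonneg)
    show "dissipation integrable_on {0..\<tau>}" by (rule integrable_continuous_real, rule continuous_on_subset[OF cd]) (use that in auto)
  qed (use mass_nonneg mass_normal_proj_nonneg \<alpha> in \<open>auto simp: dissipation_def\<close>)
  have E: "slope_energy \<tau> + \<alpha> * a\<^sup>2 / 2 * mass_id (err \<tau>) (err \<tau>) + a\<^sup>2 * integral {0..\<tau>} dissipation \<le> Q * h\<^sup>2" if "\<tau> \<in> {0..T}" for \<tau>
    using that by (intro energy(2) tb eq) auto
  have la: "a\<^sup>2 > 0" "\<alpha> * a\<^sup>2 > 0" using a_pos \<alpha> by auto
  have "0 \<le> \<alpha> * a\<^sup>2 / 2 * mass_id (err \<tau>) (err \<tau>)" for \<tau> using la mass_nonneg[of "err \<tau>"] by simp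
  moreover have "0 \<le> a\<^sup>2 * integral {0..\<tau>} dissipation" if "\<tau> \<in> {0..T}" for \<tau> using d0[OF that] by simp
  ultimately have b: "slope_energy t \<le> Q * h\<^sup>2" "\<alpha> * a\<^sup>2 / 2 * mass_id (err t) (err t) \<le> Q * h\<^sup>2" "a\<^sup>2 * integral {0..T} dissipation \<le> Q * h\<^sup>2"
    using E[OF t] E[OF T'] slope_energy_nonneg[of t] slope_energy_nonneg[of T] t T' by (smt (verit, best))+
  have "\<alpha> * integral {0..T} err_dt_sq + (1 - \<alpha>) * integral {0..T} err_normal_sq = integral {0..T} (\<lambda>t. \<alpha> * err_dt_sq t + (1 - \<alpha>) * err_normal_sq t)"
    by (subst Henstock_Kurzweil_Integration.integral_add)
      (auto intro!: integrable_continuous_real continuous_intros continuous_err_dt_sq cont_normal)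
  also have "\<dots> \<le> integral {0..T} (\<lambda>t. 2 * dissipation t + 2 * (B\<^sup>2 * h\<^sup>2))"
  proof (rule integral_le)
    fix t assume t: "t \<in> {0..T}"
    have "\<alpha> * err_dt_sq t + (1 - \<alpha>) * err_normal_sq t \<le> \<alpha> * (2 * mass_id (err' t) (err' t) + 2 * (B\<^sup>2 * h\<^sup>2))
        + (1 - \<alpha>) * (2 * mass (\<lambda>i. normal_proj (slope (c t) i)) (err' t) (err' t) + 2 * (B\<^sup>2 * h\<^sup>2))"
      using \<alpha> err_dt_sq_le[OF t] err_normal_sq_le[OF t] by (intro add_mono mult_left_mono) auto
    also have "\<dots> = 2 * dissipation t + 2 * (B\<^sup>2 * h\<^sup>2)" by (simp add: dissipation_def algebra_simps)
    finally show "\<alpha> * err_dt_sq t + (1 - \<alpha>) * err_normal_sq t \<le> 2 * dissipation t + 2 * (B\<^sup>2 * h\<^sup>2)" .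
  qed (intro integrable_continuous_real continuous_intros continuous_err_dt_sq cont_normal cd)+
  also have "\<dots> = 2 * integral {0..T} dissipation + 2 * (B\<^sup>2 * h\<^sup>2) * T"
    using T by (subst Henstock_Kurzweil_Integration.integral_add) (auto intro!: integrable_continuous_real continuous_intros cd)
  finally have I: "\<alpha> * integral {0..T} err_dt_sq + (1 - \<alpha>) * integral {0..T} err_normal_sq \<le> 2 * integral {0..T} dissipation + 2 * (B\<^sup>2 * h\<^sup>2) * T" .
  have b2: "mass_id (err t) (err t) \<le> 2 / (\<alpha> * a\<^sup>2) * (Q * h\<^sup>2)"
    using b(2) la by (simp add: field_simps)
  have b3: "integral {0..T} dissipation \<le> 1 / a\<^sup>2 * (Q * h\<^sup>2)"
    using b(3) la by (simp add: field_simps)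
  have "\<alpha> * integral {0..T} err_dt_sq + (1 - \<alpha>) * integral {0..T} err_normal_sq + err_H1_sq t \<le>
    2 * (1 / a\<^sup>2 * (Q * h\<^sup>2)) + 2 * (B\<^sup>2 * h\<^sup>2) * T + 2 * (2 / (\<alpha> * a\<^sup>2) * (Q * h\<^sup>2)) + 2 * (Q * h\<^sup>2) + 8 * pi * K\<^sup>2 * h\<^sup>2"
    using I b(1) b2 b3 err_H1_sq_le[OF t] by linarith
  also have "\<dots> = (Q * (2 / a\<^sup>2 + 2 + 4 / (\<alpha> * a\<^sup>2)) + 2 * T * B\<^sup>2 + 8 * pi * K\<^sup>2) * h\<^sup>2"
    by (simp add: algebra_simps)
  finally show ?thesis .
qed

end

section \<open>Existence, uniqueness and error on one mesh\<close>

context exact_mesh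
begin

text \<open>The Sobolev bound holds for almost every time. The L2 interpolation error is continuous
  in time, so its bound extends to all times, including the end points.\<close>

lemma interpolation_dt_bound:
  assumes ae: "AE t in lebesgue_on {0<..<T}. dt T X t \<in> sobolev_circle 1"
    "AE t in lebesgue_on {0<..<T}. sobolev_norm 1 (dt T X t) \<le> B" and t: "t \<in> {0..T}"
  shows "(\<Sum>i=1..N. integral {\<theta> i..\<theta> (i + 1)} (\<lambda>x. (norm (dt T X t x - fe (nodal_dt t) x))\<^sup>2)) \<le> B\<^sup>2 * h\<^sup>2"
proof (rule AE_le_imp_le_continuous[OF T _ _ t])
  show "continuous_on {0..T} (\<lambda>t. \<Sum>i=1..N. integral {\<theta> i..\<theta> (i + 1)} (\<lambda>x. (norm (dt T X t x - fe (nodal_dt t) x))\<^sup>2))"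
    by (intro continuous_sum_element_integrals continuous_intros cont2[unfolded case_prod_unfold] continuous_on_fe_product continuous_nodal)
  have "AE t in lebesgue. t \<in> {0<..<T} \<longrightarrow> dt T X t \<in> sobolev_circle 1" "AE t in lebesgue. t \<in> {0<..<T} \<longrightarrow> sobolev_norm 1 (dt T X t) \<le> B"
    using ae by (simp_all add: AE_lebesgue_on_iff)
  then have "AE t in lebesgue. t \<in> {0<..<T} \<longrightarrow>
    (\<Sum>i=1..N. integral {\<theta> i..\<theta> (i + 1)} (\<lambda>x. (norm (dt T X t x - fe (nodal_dt t) x))\<^sup>2)) \<le> B\<^sup>2 * h\<^sup>2"
  proof eventually_elim
    case (elim t)
    show ?case
    proof
      assume t: "t \<in> {0<..<T}"
      then have "t \<in> {0..T}" by auto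
      then show "(\<Sum>i=1..N. integral {\<theta> i..\<theta> (i + 1)} (\<lambda>x. (norm (dt T X t x - fe (nodal_dt t) x))\<^sup>2)) \<le> B\<^sup>2 * h\<^sup>2"
        using interpolation_L2_bound[of "dt T X t" B] elim t cont_x(4) by (simp add: nodal_dt_def[abs_def])
    qed
  qed
  then show "AE t in lebesgue_on {0<..<T}.
    (\<Sum>i=1..N. integral {\<theta> i..\<theta> (i + 1)} (\<lambda>x. (norm (dt T X t x - fe (nodal_dt t) x))\<^sup>2)) \<le> B\<^sup>2 * h\<^sup>2"
    by (simp add: AE_lebesgue_on_iff)
qed

text \<open>The truncated flow supplies the nodal curve of \<open>approx\<close>; tube radius and
  slope bounds are those of \<open>nodal_slope_bounds\<close>. Since the flow satisfies the scheme
  as long as it is in the tube, the premise of \<open>slope_energy_small\<close> is available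
  without knowing this beforehand for all times.\<close>

lemma semi_discrete_error:
  assumes \<alpha>: "0 < \<alpha>" "\<alpha> \<le> 1" and Kh: "K * h \<le> c\<^sub>0 / 4"
    and pde: "\<And>t x. 0 < t \<Longrightarrow> t < T \<Longrightarrow> scheme_op \<alpha> (dx (X t) x) (dt T X t x) = dx (dx (X t)) x"
    and rho: "\<And>t. t \<in> {0..T} \<Longrightarrow>
      (\<Sum>i=1..N. integral {\<theta> i..\<theta> (i + 1)} (\<lambda>x. (norm (dt T X t x - fe (nodal_dt t) x))\<^sup>2)) \<le> B\<^sup>2 * h\<^sup>2"
    and Qh: "energy_const T c\<^sub>0 K B \<alpha> * h < (c\<^sub>0 / 4)\<^sup>2"
    and C: "energy_const T c\<^sub>0 K B \<alpha> * (2 / (c\<^sub>0 / 2)\<^sup>2 + 2 + 4 / (\<alpha> * (c\<^sub>0 / 2)\<^sup>2)) + 2 * T * B\<^sup>2 + 8 * pi * K\<^sup>2 \<le> C"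
  shows "\<exists>X\<^sub>h. (\<exists>X\<^sub>h\<^sub>t \<nu>\<^sub>h. semi_discrete_solution \<alpha> T N \<theta> (X 0) X\<^sub>h X\<^sub>h\<^sub>t \<nu>\<^sub>h) \<and>
        (\<forall>Y Y\<^sub>t \<mu>. semi_discrete_solution \<alpha> T N \<theta> (X 0) Y Y\<^sub>t \<mu> \<longrightarrow> (\<forall>t\<in>{0..T}. Y t = X\<^sub>h t)) \<and>
        (\<forall>X\<^sub>h\<^sub>t \<nu>\<^sub>h. semi_discrete_solution \<alpha> T N \<theta> (X 0) X\<^sub>h X\<^sub>h\<^sub>t \<nu>\<^sub>h \<longrightarrow>
          set_integrable lebesgue {0..T}
            (\<lambda>t. (L2_norm {0<..<2*pi} (\<lambda>x. dt T X t x - X\<^sub>h\<^sub>t t x))\<^sup>2) \<and>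
          set_integrable lebesgue {0..T}
            (\<lambda>t. (L2_norm {0<..<2*pi} (\<lambda>x. \<nu>\<^sub>h t x \<bullet> (dt T X t x - X\<^sub>h\<^sub>t t x)))\<^sup>2) \<and>
          (\<exists>t\<^sub>m\<in>{0..T}.
            (\<forall>t\<in>{0..T}. (sobolev_norm 1 (\<lambda>x. X t x - X\<^sub>h t x))\<^sup>2
               \<le> (sobolev_norm 1 (\<lambda>x. X t\<^sub>m x - X\<^sub>h t\<^sub>m x))\<^sup>2) \<and>
            \<alpha> * (LINT t:{0..T}|lebesgue.
                  (L2_norm {0<..<2*pi} (\<lambda>x. dt T X t x - X\<^sub>h\<^sub>t t x))\<^sup>2)
            + (1 - \<alpha>) * (LINT t:{0..T}|lebesgue.
                  (L2_norm {0<..<2*pi} (\<lambda>x. \<nu>\<^sub>h t x \<bullet> (dt T X t x - X\<^sub>h\<^sub>t t x)))\<^sup>2)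
            + (sobolev_norm 1 (\<lambda>x. X t\<^sub>m x - X\<^sub>h t\<^sub>m x))\<^sup>2
            \<le> C * h\<^sup>2))"
proof -
  interpret F: fe_flow N \<theta> h \<alpha> "c\<^sub>0 / 2" "2 * K" "c\<^sub>0 / 4" T "\<lambda>t. slope (nodal t)"
  proof unfold_locales
    show "continuous_on {0..T} (\<lambda>t. slope (nodal t) i)" for i
      unfolding slope_def by (intro continuous_intros continuous_nodal)
    show "c\<^sub>0 / 2 + c\<^sub>0 / 4 \<le> norm (slope (nodal t) i) \<and> norm (slope (nodal t) i) + c\<^sub>0 / 4 \<le> 2 * K"
      if "t \<in> {0..T}" "i \<in> {1..N}" for t i
      using nodal_slope_bounds[OF that Kh] by simp
  qed (use \<alpha> c0 T in auto)
  obtain c :: "real \<Rightarrow> nat \<Rightarrow> real ^ 2" where c0': "\<And>j. j \<in> {1..N} \<Longrightarrow> c 0 j = nodal 0 j"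
    and dc: "\<And>t j. t \<in> {0..T} \<Longrightarrow> ((\<lambda>t. c t j) has_vector_derivative apply_bcontfun (F.field t (c t)) j) (at t within {0..T})"
    using F.truncated_flow[of "nodal 0"] by blast
  define c' where "c' t = apply_bcontfun (F.field t (c t))" for t
  have cc: "continuous_on {0..T} (\<lambda>t. c t j)" for j
    using dc by (meson continuous_on_eq_continuous_within has_vector_derivative_continuous)
  interpret A: approx T c\<^sub>0 K X N \<theta> h \<alpha> B c c'
  proof unfold_locales
    show "((\<lambda>t. c t j) has_vector_derivative c' t j) (at t within {0..T})" if "t \<in> {0..T}" for t j
      unfolding c'_def by (rule dc[OF that])
    show "continuous_on {0..T} (\<lambda>t. c' t j)" for j
      unfolding c'_def by (intro bounded_linear.continuous_on[OF bounded_linear_apply_bcontfun] F.continuous_field cc)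
  qed (use \<alpha> Kh pde rho c0' in auto)
  have tube_err: "F.tube t (c t) \<longleftrightarrow> (\<forall>i\<in>{1..N}. norm (slope (A.err t) i) \<le> c\<^sub>0 / 4)" for t
    by (simp add: F.tube_def A.slope_err norm_minus_commute)
  have eq: "mass (\<lambda>i. scheme_op \<alpha> (slope (c t) i)) (c' t) f = - stiff (slope (c t)) f" if t: "t \<in> {0..T}" and tb: "F.tube t (c t)" for t f
    unfolding c'_def F.field_tube[OF tb]
    by (rule velocity_eq[OF \<alpha> F.a]) (use F.tube_bounds[OF t tb] in blast)
  have small: "A.slope_energy t < h * (c\<^sub>0 / 4)\<^sup>2" if "t \<in> {0..T}" for t
    by (rule A.slope_energy_small[OF Qh _ that], rule eq) (auto simp: tube_err)
  have tb: "norm (slope (A.err t) i) \<le> c\<^sub>0 / 4" if "t \<in> {0..T}" "i \<in> {1..N}" for t i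
    by (rule A.slope_le_of_slope_energy[OF less_imp_le[OF small[OF that(1)]] that(2)])
  have tube: "F.tube t (c t)" if "t \<in> {0..T}" for t using tb[OF that] by (simp add: tube_err)
  have init: "c 0 j = X 0 (\<theta> j)" if "j \<in> {1..N}" for j using c0'[OF that] by (simp add: nodal_def)
  have ex: "semi_discrete_solution \<alpha> T N \<theta> (X 0) (\<lambda>t. fe (c t)) (\<lambda>t. fe (c' t)) (\<lambda>t x. normal_vec (slope (c t) (idx x)))"
    unfolding c'_def by (rule F.tube_semi_discrete_solution[OF init dc tube])
  \<comment> \<open>A second bootstrap, for an arbitrary solution: as long as its slopes are in the
    tube it coincides with the truncated flow, from which it inherits the strict bound. No separate
    energy estimate for \<open>Y\<close> is made.\<close>
  have uniq: "Y t = fe (c t)" if Y: "semi_discrete_solution \<alpha> T N \<theta> (X 0) Y Y\<^sub>t \<mu>" and t: "t \<in> {0..T}" for Y Y\<^sub>t \<mu> t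
  proof -
    define y where "y t j = Y t (\<theta> j)" for t j
    define SY where "SY t = (\<Sum>i=1..N. h * (norm (slope (y t) i - slope (nodal t) i))\<^sup>2)" for t
    have cy: "continuous_on {0..T} (\<lambda>t. y t j)" for j using Y by (simp add: semi_discrete_solution_def fe_H1_def y_def)
    have tubeY: "F.tube t (y t)" if "SY t \<le> h * (c\<^sub>0 / 4)\<^sup>2" for t
      unfolding F.tube_def
    proof
      fix i assume i: "i \<in> {1..N}"
      have "h * (norm (slope (y t) i - slope (nodal t) i))\<^sup>2 \<le> SY t"
        unfolding SY_def using i h_pos
        by (intro member_le_sum[of i "{1..N}" "\<lambda>i. h * (norm (slope (y t) i - slope (nodal t) i))\<^sup>2"]) auto
      then have "(norm (slope (y t) i - slope (nodal t) i))\<^sup>2 \<le> (c\<^sub>0 / 4)\<^sup>2"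
        using that mult_le_cancel_left_pos[OF h_pos, of "(norm (slope (y t) i - slope (nodal t) i))\<^sup>2" "(c\<^sub>0 / 4)\<^sup>2"] by linarith
      then show "norm (slope (y t) i - slope (nodal t) i) \<le> c\<^sub>0 / 4" by (rule power2_le_imp_le) (use c0 in simp)
    qed
    have Yc: "Y \<tau> = fe (c \<tau>)" if \<tau>: "\<tau> \<in> {0..T}" and le: "\<And>t. t \<in> {0..\<tau>} \<Longrightarrow> SY t \<le> h * (c\<^sub>0 / 4)\<^sup>2" for \<tau>
      by (rule F.semi_discrete_unique[OF Y \<tau> _ init dc]) (use tubeY[OF le] in \<open>simp add: y_def[abs_def]\<close>)
    have "SY t < h * (c\<^sub>0 / 4)\<^sup>2" if "t \<in> {0..T}" for t
    proof (rule continuous_bootstrap[OF _ _ _ that])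
      show "continuous_on {0..T} SY"
        unfolding SY_def slope_def by (intro continuous_intros continuous_nodal cy)
      have "y 0 j = nodal 0 j" if "j \<in> {1..N}" for j
        using Y fe_at_node[OF that] by (simp add: semi_discrete_solution_def y_def interpolation_eq_fe nodal_def)
      then have "SY 0 = 0" unfolding SY_def slope_def using nx_in by (intro sum.neutral) auto
      then show "SY 0 < h * (c\<^sub>0 / 4)\<^sup>2" using h_pos c0 by simp
      fix \<tau> assume \<tau>: "\<tau> \<in> {0..T}" and le: "\<And>t. t \<in> {0..\<tau>} \<Longrightarrow> SY t \<le> h * (c\<^sub>0 / 4)\<^sup>2"
      have "Y \<tau> = fe (c \<tau>)" by (rule Yc[OF \<tau> le])
      then have "y \<tau> j = c \<tau> j" if "j \<in> {1..N}" for j using fe_at_node[OF that] by (simp add: y_def)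
      then have "SY \<tau> = A.slope_energy \<tau>"
        unfolding SY_def A.slope_energy_def A.slope_err using nx_in
        by (intro sum.cong refl) (simp add: slope_def norm_minus_commute)
      then show "SY \<tau> < h * (c\<^sub>0 / 4)\<^sup>2" using small[OF \<tau>] by simp
    qed
    then have "\<And>s. s \<in> {0..t} \<Longrightarrow> SY s \<le> h * (c\<^sub>0 / 4)\<^sup>2" using t by (simp add: less_imp_le)
    then show ?thesis by (rule Yc[OF t])
  qed
  have nz: "slope (c t) i \<noteq> 0" if "t \<in> {0..T}" "i \<in> {1..N}" for t i
    using F.tube_bounds[OF that(1) tube[OF that(1)] that(2)] c0 by auto
  have err: "set_integrable lebesgue {0..T} (\<lambda>t. (L2_norm {0<..<2*pi} (\<lambda>x. dt T X t x - X\<^sub>h\<^sub>t t x))\<^sup>2) \<and>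
          set_integrable lebesgue {0..T} (\<lambda>t. (L2_norm {0<..<2*pi} (\<lambda>x. \<nu>\<^sub>h t x \<bullet> (dt T X t x - X\<^sub>h\<^sub>t t x)))\<^sup>2) \<and>
          (\<exists>t\<^sub>m\<in>{0..T}.
            (\<forall>t\<in>{0..T}. (sobolev_norm 1 (\<lambda>x. X t x - fe (c t) x))\<^sup>2
               \<le> (sobolev_norm 1 (\<lambda>x. X t\<^sub>m x - fe (c t\<^sub>m) x))\<^sup>2) \<and>
            \<alpha> * (LINT t:{0..T}|lebesgue. (L2_norm {0<..<2*pi} (\<lambda>x. dt T X t x - X\<^sub>h\<^sub>t t x))\<^sup>2)
            + (1 - \<alpha>) * (LINT t:{0..T}|lebesgue. (L2_norm {0<..<2*pi} (\<lambda>x. \<nu>\<^sub>h t x \<bullet> (dt T X t x - X\<^sub>h\<^sub>t t x)))\<^sup>2)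
            + (sobolev_norm 1 (\<lambda>x. X t\<^sub>m x - fe (c t\<^sub>m) x))\<^sup>2
            \<le> C * h\<^sup>2)"
    if sol: "semi_discrete_solution \<alpha> T N \<theta> (X 0) (\<lambda>t. fe (c t)) X\<^sub>h\<^sub>t \<nu>\<^sub>h" for X\<^sub>h\<^sub>t \<nu>\<^sub>h
  proof -
    have fc: "F.field t (\<lambda>j. fe (c t) (\<theta> j)) = F.field t (c t)" for t
      unfolding F.field_def
      by (rule velocity_cong) (simp add: F.trunc_def slope_def fe_at_node fe_at_node[OF nx_in])
    have tubec: "F.tube t (\<lambda>j. fe (c t) (\<theta> j))" if "t \<in> {0..T}" for t
      using tube[OF that] by (simp add: F.tube_def slope_def fe_at_node fe_at_node[OF nx_in])
    \<comment> \<open>Any weak time derivative agrees almost everywhere with the nodal velocity, so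
      time integrals of the error do not depend on its choice.\<close>
    have "AE t in lebesgue. t \<in> {0<..<T} \<longrightarrow> t \<le> T \<longrightarrow> X\<^sub>h\<^sub>t t = fe (c' t)"
      using F.semi_discrete_velocity[OF sol order_refl tubec] by (simp add: fc c'_def)
    then obtain Z where Z: "negligible Z" "\<And>t. t \<in> {0<..<T} \<Longrightarrow> t \<notin> Z \<Longrightarrow> X\<^sub>h\<^sub>t t = fe (c' t)"
      unfolding eventually_ae_filter negligible_iff_null_sets by force
    \<comment> \<open>The end points join the null set because the preceding statement concerns the
      open time interval and the integrals the closed one.\<close>
    define Z' where "Z' = insert 0 (insert T Z)"
    have Z': "negligible Z'" using Z(1) by (simp add: Z'_def)
    have un: "unit_normal_fe N \<theta> (fe (c t)) (\<nu>\<^sub>h t)" if "t \<in> {0..T}" for t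
      using sol that by (simp add: semi_discrete_solution_def)
    have Xt: "X\<^sub>h\<^sub>t t = fe (c' t)" if "t \<in> {0..T} - Z'" for t using that by (intro Z(2)) (auto simp: Z'_def)
    have e1: "(L2_norm {0<..<2*pi} (\<lambda>x. dt T X t x - X\<^sub>h\<^sub>t t x))\<^sup>2 = A.err_dt_sq t" if "t \<in> {0..T} - Z'" for t
      unfolding Xt[OF that] by (rule A.L2_norm_err_dt) (use that in simp)
    have e2: "(L2_norm {0<..<2*pi} (\<lambda>x. \<nu>\<^sub>h t x \<bullet> (dt T X t x - X\<^sub>h\<^sub>t t x)))\<^sup>2 = A.err_normal_sq t" if "t \<in> {0..T} - Z'" for t
      unfolding Xt[OF that] by (rule A.L2_norm_err_normal) (use that un nz in auto)
    have ai: "A.err_dt_sq absolutely_integrable_on {0..T}" "A.err_normal_sq absolutely_integrable_on {0..T}"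
      by (intro absolutely_integrable_continuous_real A.continuous_err_dt_sq A.continuous_err_normal_sq nz; assumption)+
    have i1: "set_integrable lebesgue {0..T} (\<lambda>t. (L2_norm {0<..<2*pi} (\<lambda>x. dt T X t x - X\<^sub>h\<^sub>t t x))\<^sup>2)"
      by (rule absolutely_integrable_spike[OF ai(1) Z' e1])
    have i2: "set_integrable lebesgue {0..T} (\<lambda>t. (L2_norm {0<..<2*pi} (\<lambda>x. \<nu>\<^sub>h t x \<bullet> (dt T X t x - X\<^sub>h\<^sub>t t x)))\<^sup>2)"
      by (rule absolutely_integrable_spike[OF ai(2) Z' e2])
    have l1: "(LINT t:{0..T}|lebesgue. (L2_norm {0<..<2*pi} (\<lambda>x. dt T X t x - X\<^sub>h\<^sub>t t x))\<^sup>2) = integral {0..T} A.err_dt_sq"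
      unfolding set_lebesgue_integral_eq_integral(2)[OF i1] by (rule integral_spike[OF Z' e1[symmetric]])
    have l2: "(LINT t:{0..T}|lebesgue. (L2_norm {0<..<2*pi} (\<lambda>x. \<nu>\<^sub>h t x \<bullet> (dt T X t x - X\<^sub>h\<^sub>t t x)))\<^sup>2) = integral {0..T} A.err_normal_sq"
      unfolding set_lebesgue_integral_eq_integral(2)[OF i2] by (rule integral_spike[OF Z' e2[symmetric]])
    obtain tm where tm: "tm \<in> {0..T}" "\<And>t. t \<in> {0..T} \<Longrightarrow> A.err_H1_sq t \<le> A.err_H1_sq tm"
      using continuous_attains_sup[OF _ _ A.continuous_err_H1_sq] T by auto
    have "\<alpha> * integral {0..T} A.err_dt_sq + (1 - \<alpha>) * integral {0..T} A.err_normal_sq + A.err_H1_sq tm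
      \<le> (A.Q * (2 / A.a\<^sup>2 + 2 + 4 / (\<alpha> * A.a\<^sup>2)) + 2 * T * B\<^sup>2 + 8 * pi * K\<^sup>2) * h\<^sup>2"
      by (rule A.total_error[OF tb eq[OF _ tube] tm(1)])
    also have "\<dots> \<le> C * h\<^sup>2" using C unfolding A.a_def by (intro mult_right_mono) auto
    finally show ?thesis
      using i1 i2 tm A.sobolev_norm_err unfolding l1 l2 by (intro conjI bexI[of _ tm]) auto
  qed
  show ?thesis
    using ex uniq err by (intro exI[of _ "\<lambda>t. fe (c t)"]) blast
qed

end

section \<open>Choice of the constants\<close>

lemma periodic_mesh_N_ge_3:
  assumes m: "periodic_mesh N \<theta> h" and h: "h \<le> 1"
  shows "N \<ge> 3"
proof -
  have "\<theta> (Suc j) = \<theta> 1 + real j * h" if "j \<le> N" for j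
    using that
  proof (induction j)
    case (Suc j)
    then have "Suc j \<in> {1..N}" by simp
    then have "\<theta> (Suc j) < \<theta> (Suc j + 1)" "\<bar>\<theta> (Suc j + 1) - \<theta> (Suc j)\<bar> = h"
      using m unfolding periodic_mesh_def by blast+
    then have "\<theta> (Suc (Suc j)) = \<theta> (Suc j) + h" by simp
    then show ?case using Suc by (simp add: algebra_simps)
  qed simp
  from this[of N] have "real N * h = 2 * pi" using m by (simp add: periodic_mesh_def)
  moreover have "real N * h \<le> real N" using h by (simp add: mult_left_le)
  ultimately have "real N > 2" using pi_gt3 by linarith
  then show ?thesis by simp
qed

text \<open>Two factors \<open>1 / \<alpha>\<close> are estimated by
  \<open>exp (2 / \<alpha>)\<close>, and \<open>2 / \<alpha> = (2 / T) / \<alpha> * T\<close> has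
  the required form of the exponent.\<close>

lemma error_const_le:
  fixes R D E K0 T \<alpha> :: real
  assumes \<alpha>: "0 < \<alpha>" "\<alpha> \<le> 1" and T: "T > 0" and R: "R \<ge> 0" and D: "D \<ge> 0" and E: "E \<ge> 0" and K0: "K0 \<ge> 0" and F: "F \<ge> 0"
  shows "R / \<alpha> * T * exp (K0 / \<alpha> * T) * (D + E / \<alpha>) + F \<le> (R * T * (D + E) + F) * exp ((K0 + 2 / T) / \<alpha> * T)"
proof -
  have e: "1 / \<alpha> \<le> exp (1 / \<alpha>)" using exp_ge_add_one_self[of "1 / \<alpha>"] by linarith
  have "D + E / \<alpha> \<le> (D + E) * (1 / \<alpha>)"
    using \<alpha> D by (simp add: distrib_right add_divide_distrib le_divide_eq mult_left_le)
  then have "R / \<alpha> * T * exp (K0 / \<alpha> * T) * (D + E / \<alpha>) \<le> R / \<alpha> * T * exp (K0 / \<alpha> * T) * ((D + E) * (1 / \<alpha>))"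
    using R \<alpha> T by (intro mult_left_mono) auto
  also have "\<dots> = R * T * (D + E) * exp (K0 / \<alpha> * T) * ((1 / \<alpha>) * (1 / \<alpha>))" by simp
  also have "\<dots> \<le> R * T * (D + E) * exp (K0 / \<alpha> * T) * (exp (1 / \<alpha>) * exp (1 / \<alpha>))"
    using R T D E \<alpha> e by (intro mult_left_mono mult_mono) auto
  also have "\<dots> = R * T * (D + E) * exp ((K0 + 2 / T) / \<alpha> * T)"
  proof -
    have "(K0 + 2 / T) / \<alpha> * T = K0 / \<alpha> * T + (1 / \<alpha> + 1 / \<alpha>)" using T \<alpha> by (simp add: field_simps)
    then show ?thesis by (simp only: exp_add mult.assoc)
  qed
  finally have 1: "R / \<alpha> * T * exp (K0 / \<alpha> * T) * (D + E / \<alpha>) \<le> R * T * (D + E) * exp ((K0 + 2 / T) / \<alpha> * T)" .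
  have "1 \<le> exp ((K0 + 2 / T) / \<alpha> * T)" using K0 T \<alpha> by simp
  then have "F * 1 \<le> F * exp ((K0 + 2 / T) / \<alpha> * T)" using F by (rule mult_left_mono)
  with 1 show ?thesis by (simp add: distrib_right)
qed

text \<open>Only the curve itself is unique: its weak time derivative is determined almost
  everywhere and its normals up to sign. The error bound is therefore claimed for every admissible
  choice of both, and \<open>t\<^sub>m\<close> expresses that the maximum is attained.\<close>

theorem theorem2:
  fixes T c\<^sub>0 :: real
    and X \<nu> :: "real \<Rightarrow> real \<Rightarrow> real ^ 2"
    and X\<^sub>0 :: "real \<Rightarrow> real ^ 2"
  assumes "T > 0"
    and "C21 T X"
    and "\<forall>t\<in>{0..T}. \<forall>x. norm (\<nu> t x) = 1 \<and> \<nu> t x \<bullet> dx (X t) x = 0"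
    and "X 0 = X\<^sub>0"
    and "bochner_Linf T (sobolev_circle 1) (sobolev_norm 1) (dt T X)"
    and "bochner_L2 T (sobolev_circle 2) (sobolev_norm 2) (dt T X)"
    and "c\<^sub>0 > 0"
    and "\<forall>t\<in>{0..T}. \<forall>x. norm (dx (X t) x) \<ge> c\<^sub>0"
  shows "\<exists>C>0. \<exists>M>0. \<forall>\<alpha>. 0 < \<alpha> \<and> \<alpha> \<le> 1 \<and>
    (\<forall>t\<in>{0<..<T}. \<forall>x. \<alpha> *\<^sub>R dt T X t x + (1 - \<alpha>) *\<^sub>R ((\<nu> t x \<bullet> dt T X t x) *\<^sub>R \<nu> t x)
        = (1 / (norm (dx (X t) x))\<^sup>2) *\<^sub>R dx (dx (X t)) x) \<longrightarrow>
    (\<exists>h\<^sub>0>0. \<forall>N \<theta> h. periodic_mesh N \<theta> h \<and> 0 < h \<and> h \<le> h\<^sub>0 \<longrightarrow>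
      (\<exists>X\<^sub>h. (\<exists>X\<^sub>h\<^sub>t \<nu>\<^sub>h. semi_discrete_solution \<alpha> T N \<theta> X\<^sub>0 X\<^sub>h X\<^sub>h\<^sub>t \<nu>\<^sub>h) \<and>
        (\<forall>Y Y\<^sub>t \<mu>. semi_discrete_solution \<alpha> T N \<theta> X\<^sub>0 Y Y\<^sub>t \<mu> \<longrightarrow> (\<forall>t\<in>{0..T}. Y t = X\<^sub>h t)) \<and>
        (\<forall>X\<^sub>h\<^sub>t \<nu>\<^sub>h. semi_discrete_solution \<alpha> T N \<theta> X\<^sub>0 X\<^sub>h X\<^sub>h\<^sub>t \<nu>\<^sub>h \<longrightarrow>
          set_integrable lebesgue {0..T}
            (\<lambda>t. (L2_norm {0<..<2*pi} (\<lambda>x. dt T X t x - X\<^sub>h\<^sub>t t x))\<^sup>2) \<and>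
          set_integrable lebesgue {0..T}
            (\<lambda>t. (L2_norm {0<..<2*pi} (\<lambda>x. \<nu>\<^sub>h t x \<bullet> (dt T X t x - X\<^sub>h\<^sub>t t x)))\<^sup>2) \<and>
          (\<exists>t\<^sub>m\<in>{0..T}.
            (\<forall>t\<in>{0..T}. (sobolev_norm 1 (\<lambda>x. X t x - X\<^sub>h t x))\<^sup>2
               \<le> (sobolev_norm 1 (\<lambda>x. X t\<^sub>m x - X\<^sub>h t\<^sub>m x))\<^sup>2) \<and>
            \<alpha> * (LINT t:{0..T}|lebesgue.
                  (L2_norm {0<..<2*pi} (\<lambda>x. dt T X t x - X\<^sub>h\<^sub>t t x))\<^sup>2)
            + (1 - \<alpha>) * (LINT t:{0..T}|lebesgue.
                  (L2_norm {0<..<2*pi} (\<lambda>x. \<nu>\<^sub>h t x \<bullet> (dt T X t x - X\<^sub>h\<^sub>t t x)))\<^sup>2)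
            + (sobolev_norm 1 (\<lambda>x. X t\<^sub>m x - X\<^sub>h t\<^sub>m x))\<^sup>2
            \<le> C * exp (M / \<alpha> * T) * h\<^sup>2))))"
proof -
  note T = assms(1) and C21 = assms(2) and \<nu> = assms(3) and X0 = assms(4) and c0 = assms(7)
  obtain K where K: "\<And>t x. t \<in> {0..T} \<Longrightarrow> norm (dx (X t) x) \<le> K" "\<And>t x. t \<in> {0..T} \<Longrightarrow> norm (dx (dx (X t)) x) \<le> K"
    "\<And>t x. t \<in> {0..T} \<Longrightarrow> norm (dt T X t x) \<le> K"
    using C21_bound[OF T C21] by blast
  interpret exact_curve T c\<^sub>0 K X
    by unfold_locales (use assms K in auto)
  obtain B where B: "AE t in lebesgue_on {0<..<T}. dt T X t \<in> sobolev_circle 1"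
    "AE t in lebesgue_on {0<..<T}. sobolev_norm 1 (dt T X t) \<le> B"
    using assms(5) unfolding bochner_Linf_def bochner_measurable_def by blast
  define R where "R = energy_source c\<^sub>0 K B"
  define K0 where "K0 = energy_rate c\<^sub>0 K"
  define D where "D = 2 / (c\<^sub>0 / 2)\<^sup>2 + 2"
  define E where "E = 4 / (c\<^sub>0 / 2)\<^sup>2"
  \<comment> \<open>The summand 1 makes positivity of \<open>F\<close>, and with it that of
    \<open>C\<close>, immediate.\<close>
  define F where "F = 2 * T * B\<^sup>2 + 8 * pi * K\<^sup>2 + 1"
  define C where "C = R * T * (D + E) + F"
  define M where "M = K0 + 2 / T"
  have nn: "R \<ge> 0" "K0 \<ge> 0" "D \<ge> 0" "E \<ge> 0" "F > 0"
    using T K_pos by (auto simp: R_def K0_def D_def E_def F_def energy_source_def energy_rate_def add_nonneg_pos)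
  have C: "C > 0" unfolding C_def using nn T by (intro add_nonneg_pos) auto
  have M: "M > 0" unfolding M_def using nn T by (intro add_nonneg_pos) auto
  show ?thesis
  proof (rule exI[of _ C], rule conjI[OF C], rule exI[of _ M], rule conjI[OF M], intro allI impI, elim conjE)
    fix \<alpha> :: real
    assume \<alpha>: "0 < \<alpha>" "\<alpha> \<le> 1"
      and eq: "\<forall>t\<in>{0<..<T}. \<forall>x. \<alpha> *\<^sub>R dt T X t x + (1 - \<alpha>) *\<^sub>R ((\<nu> t x \<bullet> dt T X t x) *\<^sub>R \<nu> t x)
        = (1 / (norm (dx (X t) x))\<^sup>2) *\<^sub>R dx (dx (X t)) x"
    \<comment> \<open>Testing with every \<open>z\<close> and multiplying by the squared slope
      length removes \<nu> and gives the exact equation the form that the discrete one has.\<close>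
    have pde: "scheme_op \<alpha> (dx (X t) x) (dt T X t x) = dx (dx (X t)) x" if t: "0 < t" "t < T" for t x
    proof (rule vector_eq_ldot[THEN iffD1], intro allI)
      fix z
      have t': "t \<in> {0..T}" "t \<in> {0<..<T}" using t by auto
      have n: "norm (\<nu> t x) = 1" "\<nu> t x \<bullet> dx (X t) x = 0" using \<nu> t' by auto
      have p: "norm (dx (X t) x) > 0" using lower[OF t'(1), of x] c0 by linarith
      have "z \<bullet> scheme_op \<alpha> (dx (X t) x) (dt T X t x)
        = (\<alpha> * (dt T X t x \<bullet> z) + (1 - \<alpha>) * ((dt T X t x \<bullet> \<nu> t x) * (\<nu> t x \<bullet> z))) * (norm (dx (X t) x))\<^sup>2"
        by (rule scheme_op_normal_form[OF n, symmetric])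
      also have "\<alpha> * (dt T X t x \<bullet> z) + (1 - \<alpha>) * ((dt T X t x \<bullet> \<nu> t x) * (\<nu> t x \<bullet> z))
        = z \<bullet> (\<alpha> *\<^sub>R dt T X t x + (1 - \<alpha>) *\<^sub>R ((\<nu> t x \<bullet> dt T X t x) *\<^sub>R \<nu> t x))"
        by (simp add: inner_add_right inner_commute)
      also have "\<dots> = z \<bullet> ((1 / (norm (dx (X t) x))\<^sup>2) *\<^sub>R dx (dx (X t)) x)" using eq t'(2) by simp
      also have "\<dots> * (norm (dx (X t) x))\<^sup>2 = z \<bullet> dx (dx (X t)) x" using p by simp
      finally show "z \<bullet> scheme_op \<alpha> (dx (X t) x) (dt T X t x) = z \<bullet> dx (dx (X t)) x" .
    qed
    define Q where "Q = energy_const T c\<^sub>0 K B \<alpha>"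
    have Q: "Q = R / \<alpha> * T * exp (K0 / \<alpha> * T)" by (simp only: Q_def R_def K0_def energy_const_def)
    have Q0: "Q \<ge> 0" unfolding Q using nn T \<alpha> by simp
    \<comment> \<open>The bound 1 gives at least three nodes, \<open>c\<^sub>0 / (4 * K)\<close>
      keeps the nodal slopes away from zero, and the last bound gives
      \<open>Q * h < (c\<^sub>0 / 4)\<^sup>2\<close>: the factor 2 makes the inequality strict, and
      \<open>Q + 1\<close> keeps the denominator positive.\<close>
    define h0 where "h0 = min 1 (min (c\<^sub>0 / (4 * K)) ((c\<^sub>0 / 4)\<^sup>2 / (2 * (Q + 1))))"
    have h0: "h0 > 0" using c0 K_pos Q0 by (simp add: h0_def)
    show "\<exists>h\<^sub>0>0. \<forall>N \<theta> h. periodic_mesh N \<theta> h \<and> 0 < h \<and> h \<le> h\<^sub>0 \<longrightarrow>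
      (\<exists>X\<^sub>h. (\<exists>X\<^sub>h\<^sub>t \<nu>\<^sub>h. semi_discrete_solution \<alpha> T N \<theta> X\<^sub>0 X\<^sub>h X\<^sub>h\<^sub>t \<nu>\<^sub>h) \<and>
        (\<forall>Y Y\<^sub>t \<mu>. semi_discrete_solution \<alpha> T N \<theta> X\<^sub>0 Y Y\<^sub>t \<mu> \<longrightarrow> (\<forall>t\<in>{0..T}. Y t = X\<^sub>h t)) \<and>
        (\<forall>X\<^sub>h\<^sub>t \<nu>\<^sub>h. semi_discrete_solution \<alpha> T N \<theta> X\<^sub>0 X\<^sub>h X\<^sub>h\<^sub>t \<nu>\<^sub>h \<longrightarrow>
          set_integrable lebesgue {0..T}
            (\<lambda>t. (L2_norm {0<..<2*pi} (\<lambda>x. dt T X t x - X\<^sub>h\<^sub>t t x))\<^sup>2) \<and>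
          set_integrable lebesgue {0..T}
            (\<lambda>t. (L2_norm {0<..<2*pi} (\<lambda>x. \<nu>\<^sub>h t x \<bullet> (dt T X t x - X\<^sub>h\<^sub>t t x)))\<^sup>2) \<and>
          (\<exists>t\<^sub>m\<in>{0..T}.
            (\<forall>t\<in>{0..T}. (sobolev_norm 1 (\<lambda>x. X t x - X\<^sub>h t x))\<^sup>2
               \<le> (sobolev_norm 1 (\<lambda>x. X t\<^sub>m x - X\<^sub>h t\<^sub>m x))\<^sup>2) \<and>
            \<alpha> * (LINT t:{0..T}|lebesgue.
                  (L2_norm {0<..<2*pi} (\<lambda>x. dt T X t x - X\<^sub>h\<^sub>t t x))\<^sup>2)
            + (1 - \<alpha>) * (LINT t:{0..T}|lebesgue.
                  (L2_norm {0<..<2*pi} (\<lambda>x. \<nu>\<^sub>h t x \<bullet> (dt T X t x - X\<^sub>h\<^sub>t t x)))\<^sup>2)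
            + (sobolev_norm 1 (\<lambda>x. X t\<^sub>m x - X\<^sub>h t\<^sub>m x))\<^sup>2
            \<le> C * exp (M / \<alpha> * T) * h\<^sup>2)))"
    proof (rule exI[of _ h0], rule conjI[OF h0], intro allI impI, elim conjE)
      fix N \<theta> h assume m: "periodic_mesh N \<theta> h" and h: "0 < h" "h \<le> h0"
      have h1: "h \<le> 1" "h \<le> c\<^sub>0 / (4 * K)" "h \<le> (c\<^sub>0 / 4)\<^sup>2 / (2 * (Q + 1))" using h(2) by (auto simp: h0_def)
      interpret exact_mesh T c\<^sub>0 K X N \<theta> h
        by unfold_locales (use m periodic_mesh_N_ge_3[OF m h1(1)] in auto)
      have Kh: "K * h \<le> c\<^sub>0 / 4" using h1(2) K_pos by (simp add: field_simps)
      have "2 * (Q * h) \<le> 2 * (Q + 1) * h" using h by (simp add: algebra_simps)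
      also have "\<dots> \<le> (c\<^sub>0 / 4)\<^sup>2" using h1(3) Q0 by (simp add: pos_le_divide_eq mult.commute)
      finally have "2 * (Q * h) \<le> (c\<^sub>0 / 4)\<^sup>2" .
      moreover have "(c\<^sub>0 / 4)\<^sup>2 > 0" using c0 by simp
      ultimately have Qh: "Q * h < (c\<^sub>0 / 4)\<^sup>2" by linarith
      have "R / \<alpha> * T * exp (K0 / \<alpha> * T) * (D + E / \<alpha>) + F \<le> C * exp (M / \<alpha> * T)"
        unfolding C_def M_def by (rule error_const_le[OF \<alpha> T]) (use nn in auto)
      moreover have e: "4 / (\<alpha> * (c\<^sub>0 / 2)\<^sup>2) = E / \<alpha>" by (simp add: E_def)
      ultimately have CC: "Q * (2 / (c\<^sub>0 / 2)\<^sup>2 + 2 + 4 / (\<alpha> * (c\<^sub>0 / 2)\<^sup>2)) + 2 * T * B\<^sup>2 + 8 * pi * K\<^sup>2 \<le> C * exp (M / \<alpha> * T)"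
        unfolding Q e unfolding D_def F_def by linarith
      show "\<exists>X\<^sub>h. (\<exists>X\<^sub>h\<^sub>t \<nu>\<^sub>h. semi_discrete_solution \<alpha> T N \<theta> X\<^sub>0 X\<^sub>h X\<^sub>h\<^sub>t \<nu>\<^sub>h) \<and>
        (\<forall>Y Y\<^sub>t \<mu>. semi_discrete_solution \<alpha> T N \<theta> X\<^sub>0 Y Y\<^sub>t \<mu> \<longrightarrow> (\<forall>t\<in>{0..T}. Y t = X\<^sub>h t)) \<and>
        (\<forall>X\<^sub>h\<^sub>t \<nu>\<^sub>h. semi_discrete_solution \<alpha> T N \<theta> X\<^sub>0 X\<^sub>h X\<^sub>h\<^sub>t \<nu>\<^sub>h \<longrightarrow>
          set_integrable lebesgue {0..T}
            (\<lambda>t. (L2_norm {0<..<2*pi} (\<lambda>x. dt T X t x - X\<^sub>h\<^sub>t t x))\<^sup>2) \<and>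
          set_integrable lebesgue {0..T}
            (\<lambda>t. (L2_norm {0<..<2*pi} (\<lambda>x. \<nu>\<^sub>h t x \<bullet> (dt T X t x - X\<^sub>h\<^sub>t t x)))\<^sup>2) \<and>
          (\<exists>t\<^sub>m\<in>{0..T}.
            (\<forall>t\<in>{0..T}. (sobolev_norm 1 (\<lambda>x. X t x - X\<^sub>h t x))\<^sup>2
               \<le> (sobolev_norm 1 (\<lambda>x. X t\<^sub>m x - X\<^sub>h t\<^sub>m x))\<^sup>2) \<and>
            \<alpha> * (LINT t:{0..T}|lebesgue.
                  (L2_norm {0<..<2*pi} (\<lambda>x. dt T X t x - X\<^sub>h\<^sub>t t x))\<^sup>2)
            + (1 - \<alpha>) * (LINT t:{0..T}|lebesgue.
                  (L2_norm {0<..<2*pi} (\<lambda>x. \<nu>\<^sub>h t x \<bullet> (dt T X t x - X\<^sub>h\<^sub>t t x)))\<^sup>2)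
            + (sobolev_norm 1 (\<lambda>x. X t\<^sub>m x - X\<^sub>h t\<^sub>m x))\<^sup>2
            \<le> C * exp (M / \<alpha> * T) * h\<^sup>2))"
        unfolding X0[symmetric]
        by (rule semi_discrete_error[OF \<alpha> Kh pde interpolation_dt_bound[OF B] Qh[unfolded Q_def] CC[unfolded Q_def]])
    qed
  qed
qed

end
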